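(* (Existence and uniqueness of positive ground states.) Let $\lambda>0$ and suppose that the frequency $\omega\in\mathbb R$ satisfies $$0<\omega<\frac{\lambda}{2\sqrt e}.$$ Then the equation $$-\tfrac12\Delta\phi+\lambda\,\phi|\phi|^2\ln|\phi|^2+\omega\phi=0,\quad x\in\mathbb R^2,$$ admits a unique positive solution $\phi_\omega\in C^2(\mathbb R^2)$ which is radially symmetric and exponentially decaying as $|x|\to\infty$. Moreover, for all $x\in\mathbb R^2$, it holds $$0<\phi_\omega(x)<\sqrt{z_\omega},$$ for some uniquely defined parameter $z_\omega\in(\tfrac1e,1)$, which satisfies $z_\omega\to1$ as $\omega\to0_+$.
   Context: The nonlinearity $\phi|\phi|^2\ln|\phi|^2$ is understood to be $0$ where $\phi=0$. A ground state is a solution $\phi$ of the equation that minimizes, among all possible (nontrivial) solutions, the action $S(\phi)=E(\phi)+\omega M(\phi)$, where $E(\phi)=\frac12\|\nabla\phi\|_{L^2(\mathbb R^2)}^2+\frac{\lambda}{2}\int_{\mathbb R^2}|\phi|^4\ln\big(|\phi|^2/\sqrt e\big)\,dx$ and $M(\phi)=\int_{\mathbb R^2}|\phi|^2\,dx$. *)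

theory Defs
  imports "HOL-Analysis.Analysis"
begin

definition partial_deriv ::
    "'n \<Rightarrow> (real ^ 'n::finite \<Rightarrow> 'a::real_normed_vector) \<Rightarrow> real ^ 'n \<Rightarrow> 'a" where
  "partial_deriv i f x = vector_derivative (\<lambda>t. f (x + t *\<^sub>R axis i 1)) (at 0)"

definition C1 :: "(real ^ 'n::finite \<Rightarrow> 'a::real_normed_vector) \<Rightarrow> bool" where
  "C1 f \<longleftrightarrow> continuous_on UNIV f \<and>
     (\<forall>i. (\<forall>x. (\<lambda>t. f (x + t *\<^sub>R axis i 1)) differentiable (at 0)) \<and>
          continuous_on UNIV (partial_deriv i f))"

definition C2 :: "(real ^ 'n::finite \<Rightarrow> 'a::real_normed_vector) \<Rightarrow> bool" where
  "C2 f \<longleftrightarrow> C1 f \<and> (\<forall>i. C1 (partial_deriv i f))"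

definition laplacian ::
    "(real ^ 'n::finite \<Rightarrow> 'a::real_normed_vector) \<Rightarrow> real ^ 'n \<Rightarrow> 'a" where
  "laplacian f x = (\<Sum>i\<in>UNIV. partial_deriv i (partial_deriv i f) x)"

definition grad_norm_sq ::
    "(real ^ 'n::finite \<Rightarrow> 'a::real_normed_vector) \<Rightarrow> real ^ 'n \<Rightarrow> real" where
  "grad_norm_sq f x = (\<Sum>i\<in>UNIV. (norm (partial_deriv i f x))\<^sup>2)"

text \<open>
  The definitions below are polymorphic in the codomain, so that they apply both to real-valued
  and to complex-valued functions. At zeros of \<open>\<phi>\<close> the logarithmic terms vanish because of the
  other factors, whatever value \<open>ln 0\<close> has.
\<close>

definition stationary_solution ::
    "real \<Rightarrow> real \<Rightarrow> (real ^ 2 \<Rightarrow> 'a::real_normed_vector) \<Rightarrow> bool" where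
  "stationary_solution lam \<omega> \<phi> \<longleftrightarrow> C2 \<phi> \<and>
     (\<forall>x. - (1 / 2) *\<^sub>R laplacian \<phi> x
          + (lam * (norm (\<phi> x))\<^sup>2 * ln ((norm (\<phi> x))\<^sup>2)) *\<^sub>R \<phi> x
          + \<omega> *\<^sub>R \<phi> x = 0)"

definition mass :: "(real ^ 2 \<Rightarrow> 'a::real_normed_vector) \<Rightarrow> real" where
  "mass \<phi> = (LINT x|lborel. (norm (\<phi> x))\<^sup>2)"

definition energy :: "real \<Rightarrow> (real ^ 2 \<Rightarrow> 'a::real_normed_vector) \<Rightarrow> real" where
  "energy lam \<phi> = 1 / 2 * (LINT x|lborel. grad_norm_sq \<phi> x)
     + lam / 2 * (LINT x|lborel. (norm (\<phi> x)) ^ 4 * ln ((norm (\<phi> x))\<^sup>2 / sqrt (exp 1)))"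

definition action :: "real \<Rightarrow> real \<Rightarrow> (real ^ 2 \<Rightarrow> 'a::real_normed_vector) \<Rightarrow> real" where
  "action lam \<omega> \<phi> = energy lam \<phi> + \<omega> * mass \<phi>"

text \<open>
  Finite mass and finite kinetic energy, i.e. membership in the Sobolev space \<open>H\<^sup>1\<close> (for
  continuously differentiable functions). In two dimensions this makes the quartic-logarithmic
  term of the energy integrable as well. The requirement is needed because the integral of a
  non-integrable function is \<open>0\<close> by convention, so the action is meaningless without it.
\<close>

definition finite_H1 :: "(real ^ 2 \<Rightarrow> 'a::real_normed_vector) \<Rightarrow> bool" where
  "finite_H1 \<phi> \<longleftrightarrow>
     integrable lborel (\<lambda>x. (norm (\<phi> x))\<^sup>2) \<and> integrable lborel (grad_norm_sq \<phi>)"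

definition nontrivial_solution :: "real \<Rightarrow> real \<Rightarrow> (real ^ 2 \<Rightarrow> complex) \<Rightarrow> bool" where
  "nontrivial_solution lam \<omega> \<phi> \<longleftrightarrow>
     stationary_solution lam \<omega> \<phi> \<and> finite_H1 \<phi> \<and> (\<exists>x. \<phi> x \<noteq> 0)"

text \<open>
  The competitors are all complex-valued classical solutions of finite action; by elliptic
  regularity every weak \<open>H\<^sup>1\<close> solution in two dimensions is of this kind.
\<close>

definition ground_state :: "real \<Rightarrow> real \<Rightarrow> (real ^ 2 \<Rightarrow> complex) \<Rightarrow> bool" where
  "ground_state lam \<omega> \<phi> \<longleftrightarrow> nontrivial_solution lam \<omega> \<phi> \<and>
     (\<forall>\<psi>. nontrivial_solution lam \<omega> \<psi> \<longrightarrow> action lam \<omega> \<phi> \<le> action lam \<omega> \<psi>)"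

definition radially_symmetric :: "(real ^ 'n::finite \<Rightarrow> 'a) \<Rightarrow> bool" where
  "radially_symmetric f \<longleftrightarrow> (\<forall>x y. norm x = norm y \<longrightarrow> f x = f y)"

definition exponentially_decaying ::
    "(real ^ 'n::finite \<Rightarrow> 'a::real_normed_vector) \<Rightarrow> bool" where
  "exponentially_decaying f \<longleftrightarrow>
     (\<exists>C. \<exists>\<delta>>0. \<forall>x. norm (f x) \<le> C * exp (- \<delta> * norm x))"

definition positive_radial_solution ::
    "real \<Rightarrow> real \<Rightarrow> (real ^ 2 \<Rightarrow> real) \<Rightarrow> bool" where
  "positive_radial_solution lam \<omega> \<phi> \<longleftrightarrow>
     stationary_solution lam \<omega> \<phi> \<and> (\<forall>x. 0 < \<phi> x) \<and>
     radially_symmetric \<phi> \<and> exponentially_decaying \<phi>"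

text \<open>
  The parameter \<open>z\<^sub>\<omega>\<close>: the root in \<open>(1/e, 1)\<close> of \<open>\<lambda> z ln z + \<omega> = 0\<close>, so that \<open>sqrt z\<^sub>\<omega>\<close> is the
  larger of the two positive constant solutions of the equation.
\<close>

definition is_z_param :: "real \<Rightarrow> real \<Rightarrow> real \<Rightarrow> bool" where
  "is_z_param lam \<omega> z \<longleftrightarrow> z \<in> {1 / exp 1<..<1} \<and> lam * z * ln z + \<omega> = 0"

end

theory Submission
  imports Defs "HOL-Real_Asymp.Real_Asymp" "HOL-Complex_Analysis.Great_Picard"
begin

text \<open>
  Write \<open>f s = - 4 * lam * s ^ 3 * ln s - 2 * om * s\<close>, so that a real solution satisfies \<open>\<Delta>\<phi> + f \<phi> = 0\<close>, and
  let \<open>G\<close> be the primitive of \<open>f\<close> that vanishes at \<open>0\<close>. The action is half the Dirichlet integral minus the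
  integral of \<open>G (norm \<phi>)\<close>. On \<open>(0, \<infinity>)\<close> the function \<open>f\<close> is negative, positive, negative, with zeros
  \<open>al < ze\<close> where \<open>ze\<^sup>2\<close> is the parameter \<open>z\<^sub>\<omega>\<close>; the bound on the frequency makes \<open>G\<close> positive somewhere, with a
  first zero \<open>be\<close> between \<open>al\<close> and \<open>ze\<close>. With \<open>t = ln r\<close> a radial solution becomes a function \<open>w\<close> of one variable
  with \<open>w'' = - exp (2 * t) * f w\<close>; the positive decaying ones that are regular at \<open>t = -\<infinity>\<close> are called profiles.
  
  Uniqueness (\<open>profile_unique\<close>). A profile is strictly decreasing and stays below \<open>ze\<close>. Two profiles are compared
  as functions of the height \<open>s\<close>, through the time \<open>T s\<close> at which the height is reached and the speed \<open>q s\<close> there.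
  Below \<open>be\<close>, where \<open>G < 0\<close>, the comparison uses the Pohozaev function \<open>q\<^sup>2 / 2 + exp (2 * T) * G\<close>; above \<open>be\<close> it
  uses this function minus \<open>2 * (G / f) * q\<close>, which is monotone because \<open>G / f\<close> is increasing there (\<open>f_sq_gt\<close>).
  Together they exclude two different profiles (\<open>level_unique\<close>).
  
  Existence (\<open>profile_exists\<close>). Among functions \<open>w\<close> on the line that tend to \<open>0\<close> at \<open>\<infinity>\<close>, exceed a small height
  and satisfy \<open>0 \<le> \<integral> exp (2 * t) * G (w t)\<close>, one minimises the Dirichlet integral. Both the energy and the sign of
  the constraint are invariant under translation in \<open>t\<close>, which is the scale invariance of the two-dimensional
  problem; hence minimising sequences can be centred, and the Lagrange multiplier can be scaled to \<open>1\<close>. Convexity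
  arguments outside \<open>[0, ze]\<close> and an explicit barrier show that the minimiser is a profile.
  
  Minimality of the action. Every competitor \<open>\<psi>\<close> satisfies the Pohozaev identity \<open>\<integral> G (norm \<psi>) = 0\<close>
  (\<open>pohozaev\<close>), so its action is half its Dirichlet integral. The decreasing rearrangement \<open>v\<close> of \<open>norm \<psi>\<close>, again
  as a function of \<open>t = ln r\<close>, is admissible in the minimisation problem because it is equimeasurable with
  \<open>norm \<psi>\<close>, and its energy is at most that of \<open>\<psi>\<close> up to the factor \<open>2 * pi\<close> (\<open>fin_en_v\<close>). This is the inequality of
  Polya and Szego; it rests on the sharp isoperimetric inequality \<open>sharp_sobolev_level\<close>, which is obtained by writing a
  function as the convolution of its gradient with the dipole field \<open>z / norm z ^ 2\<close> and by maximising the integral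
  of a component of this field over sets of given area. Comparing with the minimum \<open>m\<close> gives the result.
\<close>

section \<open>The nonlinearity and its sign structure\<close>

text \<open>
  The real logarithm satisfies \<open>ln (- x) = ln x\<close>. Therefore \<open>s ^ n * ln s\<close> with \<open>n \<ge> 2\<close> is continuously
  differentiable on the whole line, and so are the nonlinearity \<open>f\<close> and its primitive \<open>G\<close> below.
\<close>
lemma DERIV_ln_nonzero: "x \<noteq> 0 \<Longrightarrow> (ln has_real_derivative 1 / x) (at x)" for x :: real
proof (cases "x > 0")
  case False
  assume "x \<noteq> 0"
  with False have "-x > 0" by simp
  have "((\<lambda>y. ln (- y)) has_real_derivative 1 / (-x) * (-1)) (at x)"
    by (rule DERIV_chain2[of ln]) (use \<open>-x > 0\<close> in \<open>auto intro!: DERIV_ln_divide derivative_eq_intros\<close>)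
  then show ?thesis by (simp add: ln_minus)
qed (auto intro: DERIV_ln_divide)

lemma tendsto_x_ln_x: "((\<lambda>x::real. x * ln x) \<longlongrightarrow> 0) (at 0)"
proof -
  have r: "((\<lambda>x::real. x * ln x) \<longlongrightarrow> 0) (at_right 0)" by real_asymp
  have "((\<lambda>x::real. (- x) * ln (- x)) \<longlongrightarrow> 0) (at_right 0)"
    using tendsto_minus[OF r] by (simp add: ln_minus)
  then have l: "((\<lambda>x::real. x * ln x) \<longlongrightarrow> 0) (at_left 0)"
    by (simp add: filterlim_at_left_to_right)
  show ?thesis by (rule filterlim_split_at[OF l r])
qed

lemma DERIV_power_ln:
  fixes s :: real
  shows "((\<lambda>s. s ^ Suc (Suc n) * ln s) has_real_derivative
     (real (n + 2) * s ^ Suc n * ln s + s ^ Suc n)) (at s)"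
proof (cases "s = 0")
  case True
  have lim: "((\<lambda>x::real. x ^ n * (x * ln x)) \<longlongrightarrow> 0 ^ n * 0) (at 0)"
    by (intro tendsto_intros tendsto_x_ln_x)
  have eq: "\<forall>\<^sub>F h in at 0. h ^ n * (h * ln h) = (h ^ Suc (Suc n) * ln h) / (h::real)"
    by (auto simp: eventually_at_filter)
  have "((\<lambda>h. (h ^ Suc (Suc n) * ln h) / h) \<longlongrightarrow> (0::real)) (at 0)"
    using iffD1[OF tendsto_cong[OF eq] lim] by (simp only: mult_zero_right)
  then show ?thesis using True by (simp add: DERIV_def)
next
  case False
  have "((\<lambda>s. s ^ Suc (Suc n) * ln s) has_real_derivative
     real (Suc (Suc n)) * s ^ (Suc (Suc n) - Suc 0) * ln s + 1 / s * s ^ Suc (Suc n)) (at s)"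
    by (intro DERIV_mult DERIV_pow DERIV_ln_nonzero False)
  then show ?thesis using False by simp
qed

locale nls =
  fixes lam om :: real
  assumes lam_pos: "0 < lam" and om_pos: "0 < om" and om_less: "om < lam / (2 * sqrt (exp 1))"
begin

definition f :: "real \<Rightarrow> real" where "f s = - 4 * lam * s ^ 3 * ln s - 2 * om * s"
definition f' :: "real \<Rightarrow> real" where "f' s = - 12 * lam * s\<^sup>2 * ln s - 4 * lam * s\<^sup>2 - 2 * om"
definition G :: "real \<Rightarrow> real" where "G s = - lam * s ^ 4 * ln s + lam / 4 * s ^ 4 - om * s\<^sup>2"

lemma DERIV_f: "(f has_real_derivative f' s) (at s)"
proof -
  have "((\<lambda>s. s ^ 3 * ln s) has_real_derivative 3 * s\<^sup>2 * ln s + s\<^sup>2) (at s)"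
    using DERIV_power_ln[of 1 s] by (simp add: eval_nat_numeral)
  then have "((\<lambda>s. - 4 * lam * (s ^ 3 * ln s) - 2 * om * s) has_real_derivative
      - 4 * lam * (3 * s\<^sup>2 * ln s + s\<^sup>2) - 2 * om * 1) (at s)"
    by (intro DERIV_diff DERIV_cmult DERIV_ident)
  moreover have "(\<lambda>s. - 4 * lam * (s ^ 3 * ln s) - 2 * om * s) = f"
    by (simp add: f_def[abs_def] mult.assoc)
  moreover have "- 4 * lam * (3 * s\<^sup>2 * ln s + s\<^sup>2) - 2 * om * 1 = f' s"
    by (simp add: f'_def algebra_simps)
  ultimately show ?thesis by simp
qed

lemma DERIV_G: "(G has_real_derivative f s) (at s)"
proof -
  have "((\<lambda>s. s ^ 4 * ln s) has_real_derivative 4 * s ^ 3 * ln s + s ^ 3) (at s)"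
    using DERIV_power_ln[of 2 s] by (simp add: eval_nat_numeral)
  then have "((\<lambda>s. - lam * (s ^ 4 * ln s) + lam / 4 * s ^ 4 - om * s\<^sup>2) has_real_derivative
      - lam * (4 * s ^ 3 * ln s + s ^ 3) + lam / 4 * (4 * s ^ 3) - om * (2 * s)) (at s)"
    by (intro DERIV_diff DERIV_add DERIV_cmult) (auto intro!: derivative_eq_intros simp: eval_nat_numeral)
  moreover have "(\<lambda>s. - lam * (s ^ 4 * ln s) + lam / 4 * s ^ 4 - om * s\<^sup>2) = G"
    by (simp add: G_def[abs_def] mult.assoc)
  moreover have "- lam * (4 * s ^ 3 * ln s + s ^ 3) + lam / 4 * (4 * s ^ 3) - om * (2 * s) = f s"
    by (simp add: f_def algebra_simps)
  ultimately show ?thesis by simp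
qed

lemma isCont_f': "isCont f' s"
proof -
  have "isCont (\<lambda>s::real. s ^ Suc (Suc 0) * ln s) s"
    by (rule DERIV_isCont[OF DERIV_power_ln])
  moreover have "isCont (\<lambda>s. 4 * lam * s\<^sup>2 + 2 * om) s" by (intro continuous_intros)
  ultimately have "isCont (\<lambda>s. -12 * lam * (s ^ Suc (Suc 0) * ln s) - (4 * lam * s\<^sup>2 + 2 * om)) s"
    by (intro isCont_diff isCont_mult[of s "\<lambda>_. -12 * lam"] continuous_const)
  then show ?thesis unfolding f'_def[abs_def] by (simp add: mult.assoc power2_eq_square diff_diff_eq)
qed

lemma continuous_on_f: "continuous_on A f"
  using DERIV_f by (meson DERIV_isCont continuous_at_imp_continuous_on)
lemma continuous_on_G: "continuous_on A G"
  using DERIV_G by (meson DERIV_isCont continuous_at_imp_continuous_on)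

lemma f_0: "f 0 = 0" and G_0: "G 0 = 0" by (simp_all add: f_def G_def)

lemma G_eq_ln_sqrt: "G s = - (lam / 2) * (s ^ 4 * ln (s\<^sup>2 / sqrt (exp 1))) - om * s\<^sup>2"
proof (cases "s = 0")
  case False
  have "ln (sqrt (exp 1)) = (1/2::real)" by (simp add: ln_sqrt)
  then have "ln (s\<^sup>2 / sqrt (exp 1)) = 2 * ln s - 1/2" using False
    by (simp add: ln_div ln_realpow power2_eq_square ln_mult)
  then show ?thesis unfolding G_def by (simp add: right_diff_distrib)
qed (simp add: G_def)

lemma f_Lipschitz: "\<exists>L>0. \<forall>x\<in>{a..b}. \<forall>y\<in>{a..b}. \<bar>f x - f y\<bar> \<le> L * \<bar>x - y\<bar>"
proof -
  have "compact (f' ` {a..b})"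
    by (intro compact_continuous_image continuous_at_imp_continuous_on ballI isCont_f') simp
  then obtain B where B: "B > 0" "\<forall>y\<in>f' ` {a..b}. \<bar>y\<bar> \<le> B"
    using bounded_pos compact_imp_bounded by (metis real_norm_def)
  have "norm (f x - f y) \<le> B * norm (x - y)" if "x \<in> {a..b}" "y \<in> {a..b}" for x y
    by (rule field_differentiable_bound[of "{a..b}" f f'])
      (use that B DERIV_f in \<open>auto intro: has_field_derivative_at_within\<close>)
  then show ?thesis using B(1) by auto
qed

text \<open>
  The derivative of \<open>G / f\<close> is \<open>((f s)\<^sup>2 - G s * f' s) / (f s)\<^sup>2\<close>, so this says that \<open>G / f\<close> increases where both
  are positive. In the variables \<open>p = om / (lam * s\<^sup>2)\<close> and \<open>m = - 2 * ln s - p\<close> it is a polynomial inequality, in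
  which \<open>0 < f s\<close> means \<open>0 < m\<close> and \<open>0 < G s\<close> means \<open>p - 1/2 < m\<close>.
\<close>
lemma f_sq_gt:
  assumes "0 < s" "0 < f s" "0 < G s"
  shows "G s * f' s < (f s)\<^sup>2"
proof -
  define z where "z = s\<^sup>2"
  define p where "p = om / (lam * z)"
  define L where "L = 2 * ln s"
  define m where "m = - L - p"
  have z: "z > 0" using assms by (simp add: z_def)
  have om: "om = lam * z * p" using z lam_pos by (simp add: p_def)
  have fs: "f s = 2 * lam * z * s * m"
    unfolding f_def by (subst om) (simp add: m_def L_def z_def power2_eq_square power3_eq_cube algebra_simps)
  have Gs: "G s = lam * z\<^sup>2 / 2 * (m + 1/2 - p)"
    unfolding G_def by (subst om) (simp add: m_def L_def z_def power2_eq_square power4_eq_xxxx algebra_simps)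
  have f's: "f' s = 2 * lam * z * (3 * m + 2 * p - 2)"
    unfolding f'_def by (subst om) (simp add: m_def L_def z_def power2_eq_square algebra_simps)
  have "0 < 2 * lam * z * s" using z lam_pos assms(1) by simp
  then have m: "m > 0" using assms(2) unfolding fs by (rule zero_less_mult_pos[rotated])
  have "0 < lam * z\<^sup>2 / 2" using z lam_pos by simp
  then have mp: "m > p - 1/2" using zero_less_mult_pos[of "lam * z\<^sup>2 / 2" "m + 1/2 - p"] assms(3) unfolding Gs by simp
  have p: "p > 0" using z lam_pos om_pos by (simp add: p_def)
  have "(m + 1/2 - p) * (3 * m + 2 * p - 2) < 4 * m\<^sup>2"
  proof -
    have *: "4 * m\<^sup>2 - (m + 1/2 - p) * (3 * m + 2 * p - 2) = (2*p-1)*(p-1) + m*(p + m + 1/2)"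
      by (simp add: power2_eq_square algebra_simps)
    \<comment> \<open>For \<open>p \<le> 1/2\<close> both terms are nonnegative; otherwise insert \<open>m > p - 1/2\<close>, which bounds the sum below by \<open>(2*p-1)\<^sup>2\<close>.\<close>
    have "(2*p-1)*(p-1) + m*(p + m + 1/2) > 0"
    proof (cases "p \<le> 1/2")
      case True
      then have "(2*p-1)*(p-1) \<ge> 0" by (intro mult_nonpos_nonpos) auto
      moreover have "m*(p + m + 1/2) > 0" using m p by simp
      ultimately show ?thesis by linarith
    next
      case False
      have "m*(p + m + 1/2) > (p - 1/2) * (p + (p - 1/2) + 1/2)"
        using False mp p by (intro mult_strict_mono) auto
      then have "(2*p-1)*(p-1) + m*(p + m + 1/2) > (2*p-1)\<^sup>2"
        by (simp add: power2_eq_square algebra_simps)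
      then show ?thesis using zero_le_power2[of "2*p-1"] by linarith
    qed
    then show ?thesis using * by linarith
  qed
  then have "lam\<^sup>2 * z^3 * ((m + 1/2 - p) * (3 * m + 2 * p - 2)) < lam\<^sup>2 * z^3 * (4 * m\<^sup>2)"
    using z lam_pos by (intro mult_strict_left_mono) auto
  moreover have "(f s)\<^sup>2 = lam\<^sup>2 * z^3 * (4 * m\<^sup>2)"
    unfolding fs by (simp add: z_def power2_eq_square power3_eq_cube algebra_simps)
  moreover have "G s * f' s = lam\<^sup>2 * z^3 * ((m + 1/2 - p) * (3 * m + 2 * p - 2))"
  proof -
    have "(lam * z\<^sup>2 / 2 * A) * (2 * lam * z * B) = lam\<^sup>2 * z^3 * (A * B)" for A B
      by (simp add: power2_eq_square power3_eq_cube)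
    then show ?thesis unfolding Gs f's .
  qed
  ultimately show ?thesis by simp
qed

end

lemma x_ln_x_strict_antimono:
  assumes "0 < x" "x < y" "y \<le> 1 / exp 1" shows "y * ln y < x * ln (x::real)"
proof (rule DERIV_neg_imp_decreasing_open[OF assms(2)])
  fix u assume u: "x < u" "u < y"
  have "u < exp (-1)" using u assms by (simp add: exp_minus inverse_eq_divide)
  then have "ln u < -1" using u assms by (metis exp_less_cancel_iff exp_ln less_trans)
  then show "\<exists>d. ((\<lambda>x. x * ln x) has_real_derivative d) (at u) \<and> d < 0"
    using u assms by (intro exI[of _ "ln u + 1"]) (auto intro!: derivative_eq_intros)
next
  show "continuous_on {x..y} (\<lambda>x. x * ln x)"
    using assms by (auto intro!: continuous_intros)
qed

lemma x_ln_x_strict_mono: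
  assumes "1 / exp 1 \<le> x" "x < y" shows "x * ln x < y * ln (y::real)"
proof (rule DERIV_pos_imp_increasing_open[OF assms(2)])
  have x0: "x > 0" using assms(1) by (meson exp_gt_zero less_le_trans zero_less_divide_1_iff)
  { fix u assume u: "x < u" "u < y"
  have "u > exp (-1)" using u assms by (simp add: exp_minus inverse_eq_divide)
  then have "ln u > -1" using u x0 by (metis exp_less_cancel_iff exp_ln less_trans)
  then show "\<exists>d. ((\<lambda>x. x * ln x) has_real_derivative d) (at u) \<and> d > 0"
    using u x0 by (intro exI[of _ "ln u + 1"]) (auto intro!: derivative_eq_intros) }
  show "continuous_on {x..y} (\<lambda>x. x * ln x)"
    using x0 by (auto intro!: continuous_intros)
qed

lemma z_param_exists:
  assumes "0 < lam" "0 < om" "om < lam / (2 * sqrt (exp 1))"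
  shows "\<exists>z. is_z_param lam om z"
proof -
  define e where "e = exp (1::real)"
  have e: "e > 1" "ln e = 1" by (simp_all add: e_def)
  have "e < 2\<^sup>2" using exp_le by (simp add: e_def)
  then have "sqrt e < 2" using real_sqrt_less_mono[of e "2\<^sup>2"] by simp
  then have "sqrt e * sqrt e < 2 * sqrt e" using e by (intro mult_strict_right_mono) auto
  then have "e < 2 * sqrt e" using e by simp
  then have "lam / (2 * sqrt e) < lam / e" using assms e by (intro divide_strict_left_mono) auto
  then have "om < lam / e" using assms by (simp add: e_def)
  then have 1: "lam * (1/e) * ln (1/e) + om < 0" using e by (simp add: ln_div)
  have "\<exists>x\<ge>1/e. x \<le> 1 \<and> lam * x * ln x + om = 0"
    by (rule IVT') (use 1 assms e in \<open>auto intro!: continuous_intros simp: field_simps\<close>)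
  then obtain x where x: "1/e \<le> x" "x \<le> 1" "lam * x * ln x + om = 0" by blast
  have "x \<noteq> 1/e" using x 1 by auto
  moreover have "x \<noteq> 1" using x assms by auto
  ultimately show ?thesis using x unfolding is_z_param_def e_def by (intro exI[of _ x]) auto
qed

lemma z_param_unique:
  assumes "0 < lam" "is_z_param lam om x" "is_z_param lam om y"
  shows "x = y"
proof -
  have "lam * (x * ln x) = lam * (y * ln y)" using assms by (simp add: is_z_param_def mult.assoc add_eq_0_iff)
  then have "x * ln x = y * ln y" using assms(1) by (metis mult_cancel_left less_irrefl)
  then show ?thesis using x_ln_x_strict_mono[of x y] x_ln_x_strict_mono[of y x] assms
    by (cases x y rule: linorder_cases) (auto simp: is_z_param_def)
qed

lemma z_param_tendsto_1:
  assumes "0 < lam" "\<And>om. 0 < om \<Longrightarrow> om < lam / (2 * sqrt (exp 1)) \<Longrightarrow> is_z_param lam om (z om)"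
  shows "(z \<longlongrightarrow> 1) (at_right 0)"
proof (rule order_tendstoI)
  have ev: "eventually (\<lambda>om. 0 < om \<and> om < lam / (2 * sqrt (exp 1))) (at_right 0)"
    using assms(1) by (auto simp: eventually_at_right_field intro!: exI[of _ "lam / (2 * sqrt (exp 1))"])
  fix a :: real
  { assume "1 < a"
    show "eventually (\<lambda>om. z om < a) (at_right 0)"
      using ev by eventually_elim (use assms(2) \<open>1 < a\<close> in \<open>fastforce simp: is_z_param_def\<close>) }
  assume a: "a < 1"
  define b where "b = max a (1 / exp 1)"
  have b: "b < 1" "b \<ge> 1 / exp 1" "b \<ge> a" using a by (auto simp: b_def)
  have b0: "b > 0" using b(2) by (meson exp_gt_zero less_le_trans zero_less_divide_1_iff)
  define d where "d = - lam * (b * ln b)"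
  have d: "d > 0" using b b0 assms(1) by (simp add: d_def mult_less_0_iff)
  have "eventually (\<lambda>om. om < d) (at_right 0)" using d by (auto simp: eventually_at_right_field)
  then show "eventually (\<lambda>om. a < z om) (at_right 0)" using ev
  proof eventually_elim
    case (elim om)
    then have z: "is_z_param lam om (z om)" using assms(2) by auto
    have "b < z om"
    proof (rule ccontr)
      assume "\<not> b < z om"
      then have "z om * ln (z om) \<le> b * ln b"
        using x_ln_x_strict_mono[of "z om" b] z by (cases "z om = b") (auto simp: is_z_param_def)
      then have "lam * (z om * ln (z om)) \<le> lam * (b * ln b)" using assms(1) by simp
      then show False using z elim by (simp add: is_z_param_def d_def algebra_simps)
    qed
    then show ?case using b by simp
  qed
qed


context nls
begin

lemma f_factor: "f s = - 2 * s * (lam * (s\<^sup>2 * ln (s\<^sup>2)) + om)"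
  by (simp add: f_def ln_mult power2_eq_square power3_eq_cube algebra_simps)

lemma f_neg_of:
  assumes "0 < s" "lam * (s\<^sup>2 * ln (s\<^sup>2)) + om > 0" shows "f s < 0"
  using assms mult_pos_pos[of "2 * s"] unfolding f_factor by simp
lemma f_pos_of:
  assumes "0 < s" "lam * (s\<^sup>2 * ln (s\<^sup>2)) + om < 0" shows "f s > 0"
  unfolding f_factor using assms by (intro mult_neg_neg) auto

text \<open>
  The function \<open>x * ln x\<close> decreases on \<open>(0, 1 / e]\<close> and increases afterwards, so \<open>lam * (z * ln z) + om\<close> has one
  zero on each side of \<open>1 / e\<close>.
\<close>
lemma z_signs:
  obtains za zb where "0 < za" "za < zb" "is_z_param lam om zb"
    "\<And>z. 0 < z \<Longrightarrow> z < za \<Longrightarrow> lam * (z * ln z) + om > 0" "lam * (za * ln za) + om = 0"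
    "\<And>z. za < z \<Longrightarrow> z < zb \<Longrightarrow> lam * (z * ln z) + om < 0"
    "\<And>z. zb < z \<Longrightarrow> lam * (z * ln z) + om > 0"
proof -
  obtain zb where zb: "is_z_param lam om zb" using z_param_exists[OF lam_pos om_pos om_less] by blast
  have zb1: "1 / exp 1 < zb" "zb < 1" and zb2: "lam * (zb * ln zb) + om = 0"
    using zb by (auto simp: is_z_param_def)
  define m :: real where "m = 1 / exp 1"
  have m: "m > 0" by (simp add: m_def)
  have m_neg: "lam * (m * ln m) + om < 0"
    using x_ln_x_strict_mono[of m zb] zb1 zb2 lam_pos mult_strict_left_mono[of "m * ln m" "zb * ln zb" lam]
    by (simp add: m_def)
  have "((\<lambda>x::real. lam * (x * ln x) + om) \<longlongrightarrow> lam * 0 + om) (at_right 0)"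
    by (intro tendsto_intros tendsto_mono[OF _ tendsto_x_ln_x] at_le) auto
  then have "eventually (\<lambda>x. lam * (x * ln x) + om > 0) (at_right 0)"
    using om_pos by (intro order_tendstoD(1)) auto
  moreover have "eventually (\<lambda>x. 0 < x \<and> x < m) (at_right 0)"
    using m by (auto simp: eventually_at_right_field)
  ultimately have "eventually (\<lambda>x. lam * (x * ln x) + om > 0 \<and> 0 < x \<and> x < m) (at_right 0)"
    by eventually_elim auto
  then obtain zl where zl: "lam * (zl * ln zl) + om > 0" "0 < zl" "zl < m"
    using eventually_happens'[of "at_right (0::real)"] by auto
  have "\<exists>x\<ge>zl. x \<le> m \<and> lam * (x * ln x) + om = 0"
    by (rule IVT2') (use zl m_neg in \<open>auto intro!: continuous_intros\<close>)
  then obtain za where za: "zl \<le> za" "za \<le> m" "lam * (za * ln za) + om = 0" by blast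
  have za0: "za > 0" using za zl by linarith
  have za_m: "za < m" using za m_neg by (cases "za = m") auto
  show ?thesis
  proof (rule that[of za zb])
    show "0 < za" "is_z_param lam om zb" "lam * (za * ln za) + om = 0" by fact+
    show "za < zb" using za_m zb1 by (simp add: m_def)
    fix z :: real
    { assume "0 < z" "z < za"
      then have "za * ln za < z * ln z" using za_m by (intro x_ln_x_strict_antimono) (auto simp: m_def)
      then show "lam * (z * ln z) + om > 0"
        using za(3) lam_pos mult_strict_left_mono[of "za * ln za" "z * ln z" lam] by linarith }
    { assume z: "za < z" "z < zb"
      have "z * ln z < za * ln za \<or> z * ln z < zb * ln zb"
        using x_ln_x_strict_antimono[of za z] x_ln_x_strict_mono[of z zb] z za0 unfolding m_def by linarith
      then show "lam * (z * ln z) + om < 0"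
        using za(3) zb2 lam_pos mult_strict_left_mono[of "z * ln z" "za * ln za" lam]
         mult_strict_left_mono[of "z * ln z" "zb * ln zb" lam] by linarith }
    { assume "zb < z"
      then have "zb * ln zb < z * ln z" using zb1 by (intro x_ln_x_strict_mono) auto
      then show "lam * (z * ln z) + om > 0"
        using zb2 lam_pos mult_strict_left_mono[of "zb * ln zb" "z * ln z" lam] by linarith }
  qed
qed

text \<open>
  The ratio \<open>G s / s\<^sup>2\<close> is largest at \<open>s = exp (- 1 / 4)\<close>, with value \<open>lam / (2 * sqrt e) - om\<close>. This is where the
  bound on the frequency comes from: without it \<open>G\<close> would never be positive.
\<close>
lemma G_pos_somewhere: "G (exp (- 1 / 4)) > 0"
proof -
  define s :: real where "s = exp (- 1 / 4)"
  have "s ^ 4 = exp (-1)" "s\<^sup>2 = exp (- (1 / 2))" by (simp_all add: s_def flip: exp_of_nat_mult)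
  then have "G s = (lam / 2) * exp (-1) - om * exp (- (1/2))"
    unfolding G_def by (simp add: s_def algebra_simps)
  also have "\<dots> = exp (- (1/2)) * (lam / 2 * exp (- (1/2)) - om)"
    by (simp add: algebra_simps flip: exp_add)
  also have "exp (- (1/2)) = 1 / sqrt (exp (1::real))"
  proof -
    have "sqrt (exp 1) = exp (1/2 :: real)"
      by (rule real_sqrt_unique) (simp_all add: power2_eq_square flip: exp_add)
    then show ?thesis by (simp add: exp_minus inverse_eq_divide)
  qed
  finally show ?thesis using om_less by (simp add: s_def)
qed

text \<open>
  By \<open>f_factor\<close> the signs of \<open>f\<close> are those of the preceding lemma at \<open>s\<^sup>2\<close>. Hence \<open>G\<close> decreases from \<open>0\<close> on
  \<open>[0, al]\<close>, increases on \<open>[al, ze]\<close> and decreases again; as it is positive somewhere, it has a single zero \<open>be\<close> in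
  \<open>(al, ze)\<close>.
\<close>
lemma sign_structure:
  obtains al be ze where "0 < al" "al < be" "be < ze" "is_z_param lam om (ze\<^sup>2)"
    "\<And>s. 0 < s \<Longrightarrow> s < al \<Longrightarrow> f s < 0" "f al = 0"
    "\<And>s. al < s \<Longrightarrow> s < ze \<Longrightarrow> 0 < f s" "f ze = 0"
    "\<And>s. ze < s \<Longrightarrow> f s < 0"
    "\<And>s. 0 < s \<Longrightarrow> s < be \<Longrightarrow> G s < 0" "G be = 0"
    "\<And>s. be < s \<Longrightarrow> s \<le> ze \<Longrightarrow> 0 < G s"
proof -
  obtain za zb where z: "0 < za" "za < zb" "is_z_param lam om zb"
    "\<And>z. 0 < z \<Longrightarrow> z < za \<Longrightarrow> lam * (z * ln z) + om > 0" "lam * (za * ln za) + om = 0"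
    "\<And>z. za < z \<Longrightarrow> z < zb \<Longrightarrow> lam * (z * ln z) + om < 0"
    "\<And>z. zb < z \<Longrightarrow> lam * (z * ln z) + om > 0" by (rule z_signs) blast
  define al where "al = sqrt za"
  define ze where "ze = sqrt zb"
  have sq: "al\<^sup>2 = za" "ze\<^sup>2 = zb" using z by (simp_all add: al_def ze_def)
  have pos: "0 < al" "al < ze" using z by (simp_all add: al_def ze_def)
  have lt: "x\<^sup>2 < y\<^sup>2" if "0 < x" "x < y" for x y :: real using that by (simp add: power_strict_mono)
  have f1: "f s < 0" if "0 < s" "s < al" for s
    by (rule f_neg_of) (use that z(4)[of "s\<^sup>2"] lt[of s al] sq in auto)
  have f2: "0 < f s" if "al < s" "s < ze" for s
    by (rule f_pos_of) (use that z(6)[of "s\<^sup>2"] lt[of s ze] lt[of al s] sq pos in auto)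
  have f3: "f s < 0" if "ze < s" for s
    by (rule f_neg_of) (use that z(7)[of "s\<^sup>2"] lt[of ze s] sq pos in auto)
  have f4: "f al = 0" "f ze = 0" using z(3,5) by (simp_all add: f_factor sq is_z_param_def mult.assoc)
  have dec: "G y < G x" if "x < y" "\<And>u. x < u \<Longrightarrow> u < y \<Longrightarrow> f u < 0" for x y
    by (rule DERIV_neg_imp_decreasing_open[OF that(1)]) (use that DERIV_G continuous_on_G in blast)+
  have inc: "G x < G y" if "x < y" "\<And>u. x < u \<Longrightarrow> u < y \<Longrightarrow> f u > 0" for x y
    by (rule DERIV_pos_imp_increasing_open[OF that(1)]) (use that DERIV_G continuous_on_G in blast)+
  have G1: "G s < 0" if "0 < s" "s \<le> al" for s using dec[of 0 s] f1 that G_0 by auto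
  define m :: real where "m = exp (- 1 / 4)"
  have m: "m > 0" "G m > 0" using G_pos_somewhere by (simp_all add: m_def)
  have Gz: "G ze > 0"
  proof (cases m ze rule: linorder_cases)
    case less
    have "al < m" using G1[of m] m by (cases "al < m") auto
    then have "G m < G ze" using less by (intro inc f2) auto
    then show ?thesis using m by simp
  next
    case greater
    then have "G m < G ze" by (intro dec f3) auto
    then show ?thesis using m by simp
  qed (use m in auto)
  have "\<exists>x\<ge>al. x \<le> ze \<and> G x = 0"
    by (rule IVT') (use G1[of al] Gz pos continuous_on_G in auto)
  then obtain be where be: "al \<le> be" "be \<le> ze" "G be = 0" by blast
  have "al \<noteq> be" "be \<noteq> ze" using be G1[of al] pos Gz by auto
  then have be': "al < be" "be < ze" using be by auto
  have G2: "G s < 0" if "0 < s" "s < be" for s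
  proof (cases "s \<le> al")
    case False
    then have "G s < G be" using that be' by (intro inc f2) auto
    then show ?thesis using be by simp
  qed (use G1 that in auto)
  have G3: "G s > 0" if "be < s" "s \<le> ze" for s
  proof -
    have "G be < G s" using that be' by (intro inc f2) auto
    then show ?thesis using be by simp
  qed
  show ?thesis
    by (rule that[of al be ze]) (use pos be be' f1 f2 f3 f4 G2 G3 sq z(3) in auto)
qed

end

section \<open>Pairs of decreasing profiles as functions of the height\<close>

text \<open>
  A function that crosses \<open>0\<close> only upwards cannot be nonnegative to the left of a nonpositive value.
\<close>
lemma neg_left_of_zero:
  fixes d :: "real \<Rightarrow> real"
  assumes "a < b" "d b \<le> 0" and cont: "\<And>x. a \<le> x \<Longrightarrow> x \<le> b \<Longrightarrow> isCont d x"
    and up: "\<And>x. a \<le> x \<Longrightarrow> x \<le> b \<Longrightarrow> d x = 0 \<Longrightarrow> \<exists>D>0. (d has_real_derivative D) (at x)"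
  shows "d a < 0"
proof (rule ccontr)
  assume "\<not> d a < 0"
  then have "d a \<ge> 0" by simp
  obtain c where c: "a \<le> c" "c < b" "d c > 0"
  proof (cases "d a = 0")
    case True
    then obtain D where "D > 0" "(d has_real_derivative D) (at a)" using up[of a] assms(1) by auto
    from DERIV_pos_inc_right[OF this(2,1)] obtain e where e: "e > 0" "\<And>h. h > 0 \<Longrightarrow> h < e \<Longrightarrow> d a < d (a + h)"
      by blast
    show ?thesis
      by (rule that[of "a + min (e/2) ((b - a)/2)"])
        (use e(1) e(2)[of "min (e/2) ((b - a)/2)"] True assms(1) in \<open>auto simp: min_def field_simps\<close>)
  qed (use that[of a] \<open>d a \<ge> 0\<close> assms(1) in auto)
  have cc: "continuous_on {c..b} d" using cont c by (intro continuous_at_imp_continuous_on) auto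
  have "closed ({x \<in> {c..b}. d x \<in> {..0}})"
    by (intro continuous_closed_preimage cc[unfolded continuous_on_eq_continuous_within] | 
        rule continuous_closed_preimage[OF cc, unfolded vimage_def Int_def mem_Collect_eq] | simp)+
  then have "compact {x \<in> {c..b}. d x \<le> 0}"
    by (auto simp: compact_eq_bounded_closed intro: bounded_subset[OF bounded_closed_interval[of c b]])
  moreover have "b \<in> {x \<in> {c..b}. d x \<le> 0}" using c assms by auto
  ultimately obtain x0 where x0: "x0 \<in> {x \<in> {c..b}. d x \<le> 0}" "\<And>x. x \<in> {x \<in> {c..b}. d x \<le> 0} \<Longrightarrow> x0 \<le> x"
    using compact_attains_inf[of "{x \<in> {c..b}. d x \<le> 0}"] by blast
  have "\<exists>z\<ge>c. z \<le> x0 \<and> d z = 0"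
    by (rule IVT2') (use x0 c cc in \<open>auto intro: continuous_on_subset\<close>)
  then obtain z where z: "z \<ge> c" "z \<le> x0" "d z = 0" by blast
  then have "z = x0" using x0(2)[of z] x0(1) by force
  with z have "d x0 = 0" by simp
  then obtain D where "D > 0" "(d has_real_derivative D) (at x0)" using up[of x0] x0(1) c by auto
  from DERIV_pos_inc_left[OF this(2,1)] obtain e where e: "e > 0" "\<And>h. h > 0 \<Longrightarrow> h < e \<Longrightarrow> d (x0 - h) < d x0"
    by blast
  have "c < x0" using x0(1) c(3) by (cases "c = x0") auto
  define h where "h = min (e/2) ((x0 - c)/2)"
  have h: "h > 0" "h < e" "h \<le> x0 - c" using e(1) \<open>c < x0\<close> by (auto simp: h_def min_def field_simps)
  then have "d (x0 - h) < 0" using e(2)[of h] \<open>d x0 = 0\<close> by simp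
  then have "x0 \<le> x0 - h" using h x0(1) by (intro x0(2)) auto
  then show False using h by simp
qed

text \<open>
  Here convexity is known only where \<open>y\<close> is positive. Starting from a positive value with nonnegative slope, \<open>y\<close>
  stays positive, so that it stays convex and above its tangent.
\<close>
lemma convex_barrier_forward:
  fixes y y' y'' :: "real \<Rightarrow> real"
  assumes d: "\<And>t. (y has_real_derivative y' t) (at t)" "\<And>t. (y' has_real_derivative y'' t) (at t)"
    and conv: "\<And>t. t \<ge> t0 \<Longrightarrow> y t > 0 \<Longrightarrow> y'' t \<ge> 0" and t0: "y t0 > 0" "y' t0 \<ge> 0" and t: "t0 \<le> t"
  shows "y t \<ge> y t0 + y' t0 * (t - t0)"
proof -
  have c1: "continuous_on A y" "continuous_on A y'" for A
    using d DERIV_isCont by (blast intro: continuous_at_imp_continuous_on)+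
  have tangent: "y t0 + y' t0 * (c - t0) \<le> y c" if c: "t0 \<le> c" "\<And>x. t0 \<le> x \<Longrightarrow> x < c \<Longrightarrow> y x > 0" for c
  proof -
    have slope: "y' t0 \<le> y' x" if "t0 \<le> x" "x \<le> c" for x
      by (rule DERIV_nonneg_imp_increasing_open[OF that(1) _ c1(2)]) (use d(2) conv c(2) that in \<open>meson less_imp_le less_le_trans\<close>)
    have "y t0 - y' t0 * t0 \<le> y c - y' t0 * c"
    proof (rule DERIV_nonneg_imp_nondecreasing[OF c(1)])
      fix x assume "t0 \<le> x" "x \<le> c"
      then have "y' x - y' t0 * 1 \<ge> 0" using slope by auto
      moreover have "((\<lambda>x. y x - y' t0 * x) has_real_derivative y' x - y' t0 * 1) (at x)"
        by (intro DERIV_diff d DERIV_cmult DERIV_ident)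
      ultimately show "\<exists>D. ((\<lambda>x. y x - y' t0 * x) has_real_derivative D) (at x) \<and> D \<ge> 0" by blast
    qed
    then show ?thesis by (simp add: algebra_simps)
  qed
  have "y x > 0" if x: "t0 \<le> x" "x \<le> t" for x
  proof (rule ccontr)
    assume "\<not> y x > 0"
    have "closed {u \<in> {t0..x}. y u \<in> {..0}}"
      using continuous_closed_preimage[OF c1(1), of "{t0..x}" "{..0}"] by (simp add: vimage_def Int_def)
    then have "compact {u \<in> {t0..x}. y u \<le> 0}"
      by (auto simp: compact_eq_bounded_closed intro: bounded_subset[OF bounded_closed_interval[of t0 x]])
    moreover have "x \<in> {u \<in> {t0..x}. y u \<le> 0}" using x \<open>\<not> y x > 0\<close> by auto
    ultimately obtain c where c: "c \<in> {u \<in> {t0..x}. y u \<le> 0}" "\<And>u. u \<in> {u \<in> {t0..x}. y u \<le> 0} \<Longrightarrow> c \<le> u"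
      using compact_attains_inf[of "{u \<in> {t0..x}. y u \<le> 0}"] by blast
    have "y t0 + y' t0 * (c - t0) \<le> y c"
      by (rule tangent) (use c in force)+
    moreover have "y' t0 * (c - t0) \<ge> 0" using c t0 by (intro mult_nonneg_nonneg) auto
    ultimately show False using c t0 by auto
  qed
  then show ?thesis using tangent[OF t] by auto
qed

lemma convex_barrier_backward:
  fixes y y' y'' :: "real \<Rightarrow> real"
  assumes d: "\<And>t. (y has_real_derivative y' t) (at t)" "\<And>t. (y' has_real_derivative y'' t) (at t)"
    and conv: "\<And>t. t \<le> t0 \<Longrightarrow> y t > 0 \<Longrightarrow> y'' t \<ge> 0" and t0: "y t0 > 0" "y' t0 \<le> 0" and t: "t \<le> t0"
  shows "y t \<ge> y t0 - y' t0 * (t0 - t)"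
proof -
  have "y (- (- t)) \<ge> y (- (- t0)) + - y' (- (- t0)) * (- t - - t0)"
  proof (rule convex_barrier_forward[where y = "\<lambda>t. y (- t)" and y' = "\<lambda>t. - y' (- t)" and y'' = "\<lambda>t. y'' (- t)"])
    show "((\<lambda>t. y (- t)) has_real_derivative - y' (- t)) (at t)" for t
      using DERIV_chain2[OF d(1) DERIV_minus[OF DERIV_ident], of t] by simp
    show "((\<lambda>t. - y' (- t)) has_real_derivative y'' (- t)) (at t)" for t
      using DERIV_minus[OF DERIV_chain2[OF d(2) DERIV_minus[OF DERIV_ident], of t]] by simp
  qed (use conv t0 t in auto)
  then show ?thesis by (simp add: algebra_simps)
qed

locale nls_signs = nls +
  fixes al be ze :: real
  assumes al_pos: "0 < al" and al_be: "al < be" and be_ze: "be < ze"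
    and f_neg1: "\<And>s. 0 < s \<Longrightarrow> s < al \<Longrightarrow> f s < 0" and f_al: "f al = 0"
    and f_pos: "\<And>s. al < s \<Longrightarrow> s < ze \<Longrightarrow> 0 < f s" and f_ze: "f ze = 0"
    and f_neg2: "\<And>s. ze < s \<Longrightarrow> f s < 0"
    and G_neg: "\<And>s. 0 < s \<Longrightarrow> s < be \<Longrightarrow> G s < 0" and G_be: "G be = 0"
    and G_pos: "\<And>s. be < s \<Longrightarrow> s \<le> ze \<Longrightarrow> 0 < G s"
begin

text \<open>
  The system satisfied by a decreasing solution \<open>w\<close> of \<open>w'' = - exp (2 * t) * f w\<close> when it is described by its
  inverse \<open>T\<close> and the speed \<open>q s = - w' (T s)\<close> at height \<open>s\<close>. The number \<open>a\<close> is the limit of \<open>w\<close> at \<open>-\<infinity>\<close>, that is,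
  the value of the radial solution at the origin; \<open>s \<rightarrow> 0\<close> corresponds to \<open>r \<rightarrow> \<infinity>\<close> and \<open>s \<rightarrow> a\<close> to \<open>r \<rightarrow> 0\<close>.
  As \<open>exp (T s)\<close> is the radius, \<open>q s * exp (- T s)\<close> is minus the radial derivative.
\<close>
definition level :: "real \<Rightarrow> (real \<Rightarrow> real) \<Rightarrow> (real \<Rightarrow> real) \<Rightarrow> bool" where
  "level a T q \<longleftrightarrow> be < a \<and> a < ze \<and>
     (\<forall>s. 0 < s \<and> s < a \<longrightarrow> 0 < q s \<and> (T has_real_derivative - 1 / q s) (at s)
        \<and> (q has_real_derivative - exp (2 * T s) * f s / q s) (at s)) \<and>
     (q \<longlongrightarrow> 0) (at_right 0) \<and> ((\<lambda>s. q s * exp (- T s)) \<longlongrightarrow> 0) (at_right 0) \<and>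
     ((\<lambda>s. exp (2 * T s) * G s) \<longlongrightarrow> 0) (at_right 0) \<and>
     (q \<longlongrightarrow> 0) (at_left a) \<and> ((\<lambda>s. q s * exp (- T s)) \<longlongrightarrow> 0) (at_left a) \<and>
     ((\<lambda>s. exp (2 * T s)) \<longlongrightarrow> 0) (at_left a)"

context
  fixes a T q assumes lev: "level a T q"
begin

lemma level_q_pos: "0 < s \<Longrightarrow> s < a \<Longrightarrow> 0 < q s"
  and level_DERIV_T: "0 < s \<Longrightarrow> s < a \<Longrightarrow> (T has_real_derivative - 1 / q s) (at s)"
  and level_DERIV_q: "0 < s \<Longrightarrow> s < a \<Longrightarrow> (q has_real_derivative - exp (2 * T s) * f s / q s) (at s)"
  and level_bounds: "be < a" "a < ze"
  using lev unfolding level_def by blast+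

lemma level_DERIV_q2:
  "0 < s \<Longrightarrow> s < a \<Longrightarrow> ((\<lambda>s. (q s)\<^sup>2) has_real_derivative - 2 * exp (2 * T s) * f s) (at s)"
  by (rule DERIV_cong[OF DERIV_power[OF level_DERIV_q]]) (use level_q_pos[of s] in \<open>auto simp: field_simps\<close>)

lemma level_DERIV_rho:
  assumes "0 < s" "s < a"
  shows "((\<lambda>s. q s * exp (- T s)) has_real_derivative - f s / (q s * exp (- T s)) + exp (- T s)) (at s)"
proof -
  have "((\<lambda>s. q s * exp (- T s)) has_real_derivative
      (- exp (2 * T s) * f s / q s) * exp (- T s) + (exp (- T s) * (- (- 1 / q s))) * q s) (at s)"
    by (intro DERIV_mult level_DERIV_q assms DERIV_fun_exp DERIV_minus level_DERIV_T)
  moreover have "(- exp (2 * T s) * f s / q s) * exp (- T s) = - f s / (q s * exp (- T s))"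
    using level_q_pos[OF assms] by (simp add: field_simps flip: exp_add)
  ultimately show ?thesis using level_q_pos[OF assms] by simp
qed

lemma level_DERIV_pohozaev:
  assumes "0 < s" "s < a"
  shows "((\<lambda>s. (q s)\<^sup>2 / 2 + exp (2 * T s) * G s) has_real_derivative - 2 * G s * (exp (2 * T s) / q s)) (at s)"
proof -
  have "((\<lambda>s. (q s)\<^sup>2 / 2 + exp (2 * T s) * G s) has_real_derivative
      (- 2 * exp (2 * T s) * f s) / 2 + ((exp (2 * T s) * (2 * (- 1 / q s))) * G s + f s * exp (2 * T s))) (at s)"
    by (intro DERIV_add DERIV_cdivide level_DERIV_q2 assms DERIV_mult DERIV_fun_exp DERIV_cmult level_DERIV_T DERIV_G)
  then show ?thesis by (rule DERIV_cong) (simp add: algebra_simps)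
qed

text \<open>
  Subtracting \<open>2 * (G / f) * q\<close> from the Pohozaev function is the device of Erbe and Tang: the term
  \<open>exp (2 * T) * G / q\<close> of the derivative cancels, and what remains has the sign of \<open>- (G / f)'\<close>.
\<close>
lemma level_DERIV_erbe_tang:
  assumes "be < s" "s < a"
  shows "((\<lambda>s. (q s)\<^sup>2 / 2 + exp (2 * T s) * G s - 2 * (G s / f s) * q s) has_real_derivative
     - 2 * (((f s)\<^sup>2 - G s * f' s) / (f s)\<^sup>2) * q s) (at s)"
proof -
  have s: "0 < s" "al < s" "s < ze" "f s > 0" using assms al_pos al_be level_bounds f_pos[of s] by auto
  have "((\<lambda>s. (q s)\<^sup>2 / 2 + exp (2 * T s) * G s - 2 * (G s / f s) * q s) has_real_derivative
     - 2 * G s * (exp (2 * T s) / q s) - ((2 * ((f s * f s - G s * f' s) / (f s * f s))) * q s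
        + (- exp (2 * T s) * f s / q s) * (2 * (G s / f s)))) (at s)"
    by (intro DERIV_diff level_DERIV_pohozaev DERIV_mult DERIV_cmult DERIV_divide DERIV_G DERIV_f level_DERIV_q)
      (use s assms in auto)
  then show ?thesis
    by (rule DERIV_cong) (use s level_q_pos[of s] assms in \<open>simp add: field_simps power2_eq_square\<close>)
qed

lemma ratio_deriv_pos:
  assumes "be < s" "s < ze"
  shows "((f s)\<^sup>2 - G s * f' s) / (f s)\<^sup>2 > 0"
  using f_sq_gt[of s] f_pos[of s] G_pos[of s] assms al_pos al_be by (intro divide_pos_pos) auto

text \<open>
  The function decreases on \<open>(be, a)\<close> and tends to \<open>0\<close> at \<open>a\<close>.
\<close>
lemma level_erbe_tang_pos:
  assumes "be < s" "s < a"
  shows "(q s)\<^sup>2 / 2 + exp (2 * T s) * G s - 2 * (G s / f s) * q s > 0"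
proof -
  let ?P = "\<lambda>s. (q s)\<^sup>2 / 2 + exp (2 * T s) * G s - 2 * (G s / f s) * q s"
  have fa: "f a > 0" using level_bounds al_be by (intro f_pos) auto
  have lim: "(?P \<longlongrightarrow> 0\<^sup>2 / 2 + 0 * G a - 2 * (G a / f a) * 0) (at_left a)"
    using lev fa DERIV_isCont[OF DERIV_G, of a] DERIV_isCont[OF DERIV_f, of a] unfolding level_def
    by (intro tendsto_intros) (auto simp: isCont_def intro: tendsto_mono[OF at_le])
  have dec: "?P y < ?P x" if "s \<le> x" "x < y" "y < a" for x y
  proof (rule DERIV_neg_imp_decreasing[OF that(2)])
    fix u assume "x \<le> u" "u \<le> y"
    then have u: "be < u" "u < a" using that assms by auto
    then have "- 2 * (((f u)\<^sup>2 - G u * f' u) / (f u)\<^sup>2) * q u < 0"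
      using ratio_deriv_pos[of u] level_q_pos[of u] al_pos al_be level_bounds
      by (intro mult_neg_pos) auto
    then show "\<exists>D. (?P has_real_derivative D) (at u) \<and> D < 0"
      using level_DERIV_erbe_tang[OF u] by blast
  qed
  define m where "m = (s + a) / 2"
  have m: "s < m" "m < a" using assms by (auto simp: m_def)
  have "eventually (\<lambda>x. ?P x \<le> ?P m) (at_left a)"
  proof (rule eventually_at_leftI[OF _ m(2)])
    fix x assume "x \<in> {m<..<a}"
    then show "?P x \<le> ?P m" using dec[of m x] m by simp
  qed
  then have "0\<^sup>2 / 2 + 0 * G a - 2 * (G a / f a) * 0 \<le> ?P m"
    by (intro tendsto_upperbound[OF lim]) auto
  then show ?thesis using dec[of s m] m by simp
qed

end

text \<open>
  Comparison of two solutions of the level system. The hypothesis \<open>distinct\<close> excludes a common point of the two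
  curves \<open>s \<mapsto> (T s, q s)\<close>, at which both would coincide by the uniqueness theorem for the equation. The comparison
  follows the signs of the differences \<open>T1 - T2\<close>, \<open>q1\<^sup>2 - q2\<^sup>2\<close> and \<open>q1 * exp (- T1) - q2 * exp (- T2)\<close>.
\<close>
context
  fixes a1 T1 q1 a2 T2 q2
  assumes lev1: "level a1 T1 q1" and lev2: "level a2 T2 q2"
    and distinct: "\<And>s. 0 < s \<Longrightarrow> s < a1 \<Longrightarrow> s < a2 \<Longrightarrow> \<not> (T1 s = T2 s \<and> q1 s = q2 s)"
begin

lemma below: "0 < s \<Longrightarrow> s \<le> be \<Longrightarrow> s < a1 \<and> s < a2"
  using level_bounds[OF lev1] level_bounds[OF lev2] by auto

lemma DERIV_y:
  assumes "0 < s" "s < a1" "s < a2"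
  shows "((\<lambda>s. T1 s - T2 s) has_real_derivative 1 / q2 s - 1 / q1 s) (at s)"
  by (rule DERIV_cong[OF DERIV_diff[OF level_DERIV_T[OF lev1] level_DERIV_T[OF lev2]]]) (use assms in auto)

lemma DERIV_h:
  assumes "0 < s" "s < a1" "s < a2"
  shows "((\<lambda>s. (q1 s)\<^sup>2 - (q2 s)\<^sup>2) has_real_derivative - 2 * f s * (exp (2 * T1 s) - exp (2 * T2 s))) (at s)"
  by (rule DERIV_cong[OF DERIV_diff[OF level_DERIV_q2[OF lev1] level_DERIV_q2[OF lev2]]])
    (use assms in \<open>auto simp: algebra_simps\<close>)

lemma h_sign: "0 < s \<Longrightarrow> s < a1 \<Longrightarrow> s < a2 \<Longrightarrow> (q1 s)\<^sup>2 - (q2 s)\<^sup>2 > 0 \<longleftrightarrow> q1 s > q2 s"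
proof -
  assume "0 < s" "s < a1" "s < a2"
  then have "q1 s + q2 s > 0" using level_q_pos[OF lev1, of s] level_q_pos[OF lev2, of s] by simp
  moreover have "(q1 s)\<^sup>2 - (q2 s)\<^sup>2 = (q1 s + q2 s) * (q1 s - q2 s)"
    by (simp add: power2_eq_square algebra_simps)
  ultimately show ?thesis by (simp add: zero_less_mult_iff)
qed

lemma cont_y: "0 < s \<Longrightarrow> s < a1 \<Longrightarrow> s < a2 \<Longrightarrow> isCont (\<lambda>s. T1 s - T2 s) s"
  using DERIV_y DERIV_isCont by blast

text \<open>
  For \<open>s \<le> al\<close>, where \<open>f < 0\<close>, the product of \<open>y = T1 - T2\<close> and \<open>h = q1\<^sup>2 - q2\<^sup>2\<close> increases. If it were not
  positive at \<open>s\<close>, then it would be negative before \<open>s\<close>, and this makes \<open>h\<^sup>2\<close> decrease there although \<open>h\<close> tends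
  to \<open>0\<close> at \<open>0\<close>. In particular the two solutions do not cross at heights up to \<open>al\<close>.
\<close>
lemma y_h_pos:
  assumes "0 < s" "s \<le> al"
  shows "(T1 s - T2 s) * ((q1 s)\<^sup>2 - (q2 s)\<^sup>2) > 0"
proof (rule ccontr)
  let ?y = "\<lambda>s. T1 s - T2 s" let ?h = "\<lambda>s. (q1 s)\<^sup>2 - (q2 s)\<^sup>2"
  assume not: "\<not> ?y s * ?h s > 0"
  have le: "u < a1" "u < a2" if "u \<le> s" for u using that assms al_be level_bounds[OF lev1] level_bounds[OF lev2] by auto
  have M: "\<exists>D>0. ((\<lambda>s. ?y s * ?h s) has_real_derivative D) (at u)" if u: "0 < u" "u < s" for u
  proof -
    have l: "u < a1" "u < a2" using le u by auto
    have q: "q1 u > 0" "q2 u > 0" using level_q_pos[OF lev1] level_q_pos[OF lev2] u l by auto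
    have fu: "f u < 0" using f_neg1 u assms by auto
    have 1: "(1 / q2 u - 1 / q1 u) * ?h u = (q1 u - q2 u)\<^sup>2 * ((q1 u + q2 u) / (q1 u * q2 u))"
      using q by (simp add: field_simps power2_eq_square)
    have 3: "?y u * (exp (2 * T1 u) - exp (2 * T2 u)) > 0" if "T1 u \<noteq> T2 u"
      using that by (cases "T1 u" "T2 u" rule: linorder_cases) (auto intro: mult_neg_neg)
    have 2: "?y u * (exp (2 * T1 u) - exp (2 * T2 u)) \<ge> 0"
      using 3 by (cases "T1 u = T2 u") (auto intro: less_imp_le)
    have 4: "(1 / q2 u - 1 / q1 u) * ?h u \<ge> 0" unfolding 1 using q by (intro mult_nonneg_nonneg) auto
    have 5: "(1 / q2 u - 1 / q1 u) * ?h u > 0" if "q1 u \<noteq> q2 u" unfolding 1 using q that by (intro mult_pos_pos) auto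
    have eq: "(- 2 * f u * (exp (2 * T1 u) - exp (2 * T2 u))) * ?y u = (- 2 * f u) * (?y u * (exp (2 * T1 u) - exp (2 * T2 u)))"
      by simp
    have fu': "- 2 * f u \<ge> 0" "- 2 * f u > 0" using fu by auto
    have 6: "(- 2 * f u) * (?y u * (exp (2 * T1 u) - exp (2 * T2 u))) \<ge> 0" by (rule mult_nonneg_nonneg[OF fu'(1) 2])
    have 7: "(- 2 * f u) * (?y u * (exp (2 * T1 u) - exp (2 * T2 u))) > 0" if "T1 u \<noteq> T2 u"
      by (rule mult_pos_pos[OF fu'(2) 3[OF that]])
    have "(1 / q2 u - 1 / q1 u) * ?h u + (- 2 * f u * (exp (2 * T1 u) - exp (2 * T2 u))) * ?y u > 0"
      unfolding eq using distinct[OF u(1) l] 4 5 6 7 by (cases "q1 u = q2 u") (auto intro: add_pos_nonneg add_nonneg_pos)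
    moreover have "((\<lambda>s. ?y s * ?h s) has_real_derivative
        (1 / q2 u - 1 / q1 u) * ?h u + (- 2 * f u * (exp (2 * T1 u) - exp (2 * T2 u))) * ?y u) (at u)"
      by (intro DERIV_mult DERIV_y DERIV_h u l)
    ultimately show ?thesis by blast
  qed
  have neg: "?y u * ?h u < 0" if "0 < u" "u < s" for u
  proof -
    have "?y u * ?h u < ?y s * ?h s"
    proof (rule DERIV_pos_imp_increasing_open[OF that(2)])
      have "isCont (\<lambda>s. ?y s * ?h s) v" if "0 < v" "v \<le> s" for v
        using DERIV_isCont[OF DERIV_mult[OF DERIV_y DERIV_h]] le that by blast
      then show "continuous_on {u..s} (\<lambda>s. ?y s * ?h s)" using \<open>0 < u\<close>
        by (intro continuous_at_imp_continuous_on) auto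
      fix x assume "u < x" "x < s"
      then show "\<exists>D. ((\<lambda>s. ?y s * ?h s) has_real_derivative D) (at x) \<and> D > 0"
        using M[of x] \<open>0 < u\<close> by auto
    qed
    then show ?thesis using not by simp
  qed
  define c where "c = s / 2"
  have c: "0 < c" "c < s" using assms by (auto simp: c_def)
  have "(?h c)\<^sup>2 \<le> (?h u)\<^sup>2" if "0 < u" "u < c" for u
  proof (rule DERIV_nonpos_imp_nonincreasing[where f = "\<lambda>v. (?h v)\<^sup>2" and a = u and b = c])
    fix v assume v: "u \<le> v" "v \<le> c"
    then have v': "0 < v" "v < a1" "v < a2" "v < s" using that c le[of v] by auto
    have D: "((\<lambda>v. (?h v)\<^sup>2) has_real_derivative 
       real 2 * (- 2 * f v * (exp (2 * T1 v) - exp (2 * T2 v))) * ?h v ^ (2 - Suc 0)) (at v)"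
      using DERIV_power[OF DERIV_h[OF v'(1-3)], of 2] by (simp add: algebra_simps)
    have "(exp (2 * T1 v) - exp (2 * T2 v)) * ?h v \<le> 0"
    proof (cases "T1 v" "T2 v" rule: linorder_cases)
      case less
      then have "?h v > 0" using neg[OF v'(1,4)] by (auto simp: mult_less_0_iff)
      then show ?thesis using less by (intro mult_nonpos_nonneg) auto
    next
      case greater
      then have "?h v < 0" using neg[OF v'(1,4)] by (auto simp: mult_less_0_iff)
      then show ?thesis using greater by (intro mult_nonneg_nonpos) auto
    qed simp
    moreover have "-4 * f v \<ge> 0" using f_neg1[of v] v' assms by auto
    ultimately have "(-4 * f v) * ((exp (2 * T1 v) - exp (2 * T2 v)) * ?h v) \<le> 0"
      by (rule mult_nonneg_nonpos[rotated])
    then have "real 2 * (- 2 * f v * (exp (2 * T1 v) - exp (2 * T2 v))) * ?h v ^ (2 - Suc 0) \<le> 0"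
      by (simp add: algebra_simps)
    with D show "\<exists>D. ((\<lambda>v. (?h v)\<^sup>2) has_real_derivative D) (at v) \<and> D \<le> 0" by blast
  qed (use that in simp)
  then have "eventually (\<lambda>u. (?h c)\<^sup>2 \<le> (?h u)\<^sup>2) (at_right 0)"
    by (intro eventually_at_rightI[of 0 c]) (use c in auto)
  moreover have "((\<lambda>u. (?h u)\<^sup>2) \<longlongrightarrow> (0\<^sup>2 - 0\<^sup>2)\<^sup>2) (at_right 0)"
    using lev1 lev2 unfolding level_def by (intro tendsto_intros) auto
  ultimately have "(?h c)\<^sup>2 \<le> (0\<^sup>2 - 0\<^sup>2)\<^sup>2" by (intro tendsto_lowerbound) auto
  then have "?h c = 0" by simp
  then show False using neg[OF c] by simp
qed

lemma y_nz_const: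
  assumes nz: "\<And>s. 0 < s \<Longrightarrow> s < c \<Longrightarrow> T1 s \<noteq> T2 s" and c: "c \<le> a1" "c \<le> a2" 
    and s: "0 < s" "s < c" and u: "0 < u" "u < c" "T1 u < T2 u"
  shows "T1 s < T2 s"
proof (rule ccontr)
  assume "\<not> T1 s < T2 s"
  then have gt: "T1 s - T2 s > 0" using nz s by force
  have co: "isCont (\<lambda>s. T1 s - T2 s) x" if "0 < x" "x < c" for x using cont_y that c by auto
  have "\<exists>x. min s u \<le> x \<and> x \<le> max s u \<and> T1 x - T2 x = 0"
  proof (cases "s \<le> u")
    case True
    then show ?thesis using IVT2[of "\<lambda>s. T1 s - T2 s" u 0 s] gt u(3) co s u by auto
  next
    case False
    then show ?thesis using IVT[of "\<lambda>s. T1 s - T2 s" u 0 s] gt u(3) co s u by auto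
  qed
  then obtain x where "min s u \<le> x" "x \<le> max s u" "T1 x = T2 x" by auto
  then show False using nz[of x] s u by (auto simp: min_def max_def split: if_splits)
qed

lemma DERIV_delta:
  assumes "0 < s" "s < a1" "s < a2"
  shows "((\<lambda>s. q1 s * exp (- T1 s) - q2 s * exp (- T2 s)) has_real_derivative
     - f s * (1 / (q1 s * exp (- T1 s)) - 1 / (q2 s * exp (- T2 s))) + (exp (- T1 s) - exp (- T2 s))) (at s)"
  by (rule DERIV_cong[OF DERIV_diff[OF level_DERIV_rho[OF lev1] level_DERIV_rho[OF lev2]]])
    (use assms in \<open>auto simp: algebra_simps\<close>)

text \<open>
  At a zero of \<open>q1 * exp (- T1) - q2 * exp (- T2)\<close> its derivative is \<open>exp (- T1) - exp (- T2)\<close>, which is positive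
  where \<open>T1 < T2\<close>.
\<close>
lemma delta_neg_left:
  assumes "0 < u" "u < s" "s < a1" "s < a2" "\<And>v. u \<le> v \<Longrightarrow> v \<le> s \<Longrightarrow> T1 v < T2 v"
    "q1 s * exp (- T1 s) - q2 s * exp (- T2 s) \<le> 0"
  shows "q1 u * exp (- T1 u) - q2 u * exp (- T2 u) < 0"
proof (rule neg_left_of_zero[where d = "\<lambda>s. q1 s * exp (- T1 s) - q2 s * exp (- T2 s)", OF assms(2,6)])
  fix x assume x: "u \<le> x" "x \<le> s"
  then have x': "0 < x" "x < a1" "x < a2" using assms by auto
  show "isCont (\<lambda>x. q1 x * exp (- T1 x) - q2 x * exp (- T2 x)) x"
    by (rule DERIV_isCont[OF DERIV_delta[OF x']])
  assume "q1 x * exp (- T1 x) - q2 x * exp (- T2 x) = 0"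
  then show "\<exists>D>0. ((\<lambda>x. q1 x * exp (- T1 x) - q2 x * exp (- T2 x)) has_real_derivative D) (at x)"
    using DERIV_delta[OF x'] assms(5)[OF x] by (intro exI[of _ "exp (- T1 x) - exp (- T2 x)"]) auto
qed

text \<open>
  Otherwise the difference of the radial slopes would be negative and nondecreasing on \<open>(0, s)\<close>, and could not tend
  to \<open>0\<close> at \<open>0\<close>.
\<close>
lemma delta_pos_low:
  assumes s: "0 < s" "s \<le> al" "T1 s < T2 s"
  shows "q1 s * exp (- T1 s) - q2 s * exp (- T2 s) > 0"
proof (rule ccontr)
  let ?d = "\<lambda>s. q1 s * exp (- T1 s) - q2 s * exp (- T2 s)"
  assume "\<not> ?d s > 0"
  then have le: "?d s \<le> 0" by simp
  have ab: "al < a1" "al < a2" using below[of al] al_pos al_be by auto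
  have nz: "T1 u \<noteq> T2 u" if "0 < u" "u \<le> al" for u using y_h_pos[OF that] by auto
  have y: "T1 u < T2 u" if "0 < u" "u \<le> s" for u
  proof (rule ccontr)
    assume n: "\<not> T1 u < T2 u"
    then have us: "u < s" using that s by (cases "u = s") auto
    have "\<exists>x. u \<le> x \<and> x \<le> s \<and> T1 x - T2 x = 0"
      by (rule IVT2) (use n s us that cont_y ab in auto)
    then show False using nz that s by fastforce
  qed
  have dneg: "?d u < 0" if "0 < u" "u < s" for u
    by (rule delta_neg_left[OF that _ _ _ le]) (use s ab that y in auto)
  have mono: "?d u \<le> ?d v" if "0 < u" "u \<le> v" "v < s" for u v
  proof (rule DERIV_nonneg_imp_nondecreasing[OF that(2)])
    fix x assume "u \<le> x" "x \<le> v"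
    then have x: "0 < x" "x < s" "x < a1" "x < a2" using that s ab by auto
    have rho: "q1 x * exp (- T1 x) > 0" "q2 x * exp (- T2 x) > 0"
      using level_q_pos[OF lev1] level_q_pos[OF lev2] x by auto
    have "1 / (q2 x * exp (- T2 x)) \<le> 1 / (q1 x * exp (- T1 x))"
      using dneg[OF x(1,2)] rho by (intro divide_left_mono) auto
    moreover have "- f x \<ge> 0" using f_neg1[of x] x s by auto
    ultimately have "- f x * (1 / (q1 x * exp (- T1 x)) - 1 / (q2 x * exp (- T2 x))) \<ge> 0"
      by (intro mult_nonneg_nonneg) auto
    moreover have "exp (- T1 x) - exp (- T2 x) \<ge> 0" using y[of x] x by auto
    ultimately show "\<exists>D. (?d has_real_derivative D) (at x) \<and> D \<ge> 0"
      using DERIV_delta[OF x(1,3,4)] by (meson add_nonneg_nonneg)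
  qed
  define c where "c = s / 2"
  have c: "0 < c" "c < s" using s by (auto simp: c_def)
  have "eventually (\<lambda>u. ?d u \<le> ?d c) (at_right 0)"
    by (rule eventually_at_rightI[of 0 c]) (use c in \<open>auto intro!: mono\<close>)
  moreover have "(?d \<longlongrightarrow> 0 - 0) (at_right 0)"
    using lev1 lev2 unfolding level_def by (intro tendsto_intros) auto
  ultimately have "0 - 0 \<le> ?d c" by (intro tendsto_upperbound) auto
  then show False using dneg[OF c] by simp
qed

text \<open>
  Suppose that the first solution reaches all heights below \<open>sL \<le> be\<close> earlier and is faster at \<open>sL\<close>. Then it is steeper
  as a function of the radius on all of \<open>(0, sL)\<close>, which makes the difference of the Pohozaev functions decrease from
  \<open>0\<close>. On the other hand \<open>q1 < q2\<close> at \<open>al\<close>, so the speeds agree at some height \<open>s1\<close>; there the difference is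
  \<open>(exp (2 * T1) - exp (2 * T2)) * G\<close>, which is positive because \<open>G < 0\<close>.
\<close>
lemma no_descent:
  assumes sL: "al < sL" "sL \<le> be" and y: "\<And>s. 0 < s \<Longrightarrow> s < sL \<Longrightarrow> T1 s < T2 s"
    and yL: "T1 sL \<le> T2 sL" and qL: "q2 sL < q1 sL"
  shows False
proof -
  have ab: "sL < a1" "sL < a2" using below[of sL] al_pos sL by auto
  have q: "q1 s > 0" "q2 s > 0" if "0 < s" "s \<le> sL" for s
    using level_q_pos[OF lev1, of s] level_q_pos[OF lev2, of s] that ab by auto
  have "q2 sL * exp (- T2 sL) < q1 sL * exp (- T1 sL)"
    using yL qL q[of sL] al_pos sL by (intro mult_less_le_imp_less) auto
  then have dL: "q1 sL * exp (- T1 sL) - q2 sL * exp (- T2 sL) > 0" by simp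
  have d: "q1 s * exp (- T1 s) - q2 s * exp (- T2 s) > 0" if s: "0 < s" "s < sL" for s
  proof (cases "s \<le> al")
    case False
    show ?thesis
    proof (rule ccontr)
      assume "\<not> ?thesis"
      then have "q1 al * exp (- T1 al) - q2 al * exp (- T2 al) < 0"
        using False s ab al_pos by (intro delta_neg_left[of al s] y) auto
      then show False using delta_pos_low[of al] y[of al] al_pos sL by auto
    qed
  qed (use delta_pos_low y s in auto)
  let ?h = "\<lambda>s. (q1 s)\<^sup>2 - (q2 s)\<^sup>2"
  have hal: "?h al < 0" using y_h_pos[of al] y[of al] al_pos sL by (auto simp: zero_less_mult_iff)
  have hL: "?h sL > 0" using h_sign[of sL] qL al_pos sL ab by auto
  have hc: "isCont ?h s" if "0 < s" "s \<le> sL" for s by (rule DERIV_isCont[OF DERIV_h]) (use that ab in auto)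
  have "\<exists>x. al \<le> x \<and> x \<le> sL \<and> ?h x = 0"
    by (rule IVT) (use hal hL hc sL al_pos in auto)
  then obtain s1 where s1: "al \<le> s1" "s1 \<le> sL" "?h s1 = 0" by blast
  then have s1': "0 < s1" "s1 < sL" using hL al_pos by (cases "s1 = sL"; force)+
  let ?F = "\<lambda>s. ((q1 s)\<^sup>2 / 2 + exp (2 * T1 s) * G s) - ((q2 s)\<^sup>2 / 2 + exp (2 * T2 s) * G s)"
  have F: "((?F has_real_derivative - 2 * G s * (exp (2 * T1 s) / q1 s) - (- 2 * G s * (exp (2 * T2 s) / q2 s))) (at s)) 
     \<and> - 2 * G s * (exp (2 * T1 s) / q1 s) - (- 2 * G s * (exp (2 * T2 s) / q2 s)) < 0" if s: "0 < s" "s < sL" for s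
  proof
    show "(?F has_real_derivative - 2 * G s * (exp (2 * T1 s) / q1 s) - (- 2 * G s * (exp (2 * T2 s) / q2 s))) (at s)"
      by (intro DERIV_diff level_DERIV_pohozaev[OF lev1] level_DERIV_pohozaev[OF lev2]) (use s ab in auto)
    have e: "exp (2 * t) / x = exp t / (x * exp (- t))" if "x > 0" for t x :: real
      using that by (simp add: field_simps flip: exp_add)
    have "exp (T1 s) / (q1 s * exp (- T1 s)) < exp (T2 s) / (q2 s * exp (- T2 s))"
      using d[OF s] y[OF s] q[of s] s by (intro frac_less) auto
    then have "exp (2 * T1 s) / q1 s - exp (2 * T2 s) / q2 s < 0" using e q[of s] s by auto
    moreover have "- 2 * G s > 0" using G_neg[of s] s sL by auto
    ultimately have "(- 2 * G s) * (exp (2 * T1 s) / q1 s - exp (2 * T2 s) / q2 s) < 0" by (intro mult_pos_neg)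
    then show "- 2 * G s * (exp (2 * T1 s) / q1 s) - (- 2 * G s * (exp (2 * T2 s) / q2 s)) < 0"
      by (simp add: algebra_simps)
  qed
  have dec: "?F v \<le> ?F u" if "0 < u" "u \<le> v" "v < sL" for u v
    by (rule DERIV_nonpos_imp_nonincreasing[OF that(2)]) (use F that in \<open>meson less_imp_le less_le_trans le_less_trans\<close>)
  have "eventually (\<lambda>u. ?F s1 \<le> ?F u) (at_right 0)"
    by (rule eventually_at_rightI[of 0 s1]) (use s1' in \<open>auto intro!: dec\<close>)
  moreover have "(?F \<longlongrightarrow> (0\<^sup>2 / 2 + 0) - (0\<^sup>2 / 2 + 0)) (at_right 0)"
    using lev1 lev2 unfolding level_def by (intro tendsto_intros) auto
  ultimately have "?F s1 \<le> (0\<^sup>2 / 2 + 0) - (0\<^sup>2 / 2 + 0)" by (intro tendsto_lowerbound) auto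
  then have "?F s1 \<le> 0" by simp
  moreover have "?F s1 = (exp (2 * T1 s1) - exp (2 * T2 s1)) * G s1" using s1(3) by (simp add: algebra_simps)
  moreover have "(exp (2 * T1 s1) - exp (2 * T2 s1)) * G s1 > 0"
    using y[OF s1'] G_neg[of s1] s1' sL by (intro mult_neg_neg) auto
  ultimately show False by simp
qed

lemma first_crossing:
  assumes s: "0 < s" "s \<le> be" "T1 s = T2 s"
  obtains sL where "al < sL" "sL \<le> be" "T1 sL = T2 sL" "\<And>u. 0 < u \<Longrightarrow> u < sL \<Longrightarrow> T1 u \<noteq> T2 u"
proof -
  have nz: "T1 u \<noteq> T2 u" if "0 < u" "u \<le> al" for u using y_h_pos[OF that] by auto
  have "al < s" using nz s by force
  have cc: "continuous_on {al..be} (\<lambda>s. T1 s - T2 s)"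
    using cont_y below al_pos by (intro continuous_at_imp_continuous_on) auto
  have "closed {x \<in> {al..be}. T1 x - T2 x \<in> {0}}"
    using continuous_closed_preimage[OF cc, of "{0}"] by (simp add: vimage_def Int_def)
  then have "compact {x \<in> {al..be}. T1 x = T2 x}"
    by (auto simp: compact_eq_bounded_closed intro: bounded_subset[OF bounded_closed_interval[of al be]])
  moreover have "s \<in> {x \<in> {al..be}. T1 x = T2 x}" using s \<open>al < s\<close> by auto
  ultimately obtain x0 where x0: "x0 \<in> {x \<in> {al..be}. T1 x = T2 x}" "\<And>x. x \<in> {x \<in> {al..be}. T1 x = T2 x} \<Longrightarrow> x0 \<le> x"
    using compact_attains_inf[of "{x \<in> {al..be}. T1 x = T2 x}"] by blast
  show ?thesis
  proof (rule that[of x0])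
    show "al < x0" "x0 \<le> be" "T1 x0 = T2 x0" using x0(1) nz[of x0] al_pos by force+
    fix u assume "0 < u" "u < x0"
    then show "T1 u \<noteq> T2 u" using nz[of u] x0(2)[of u] x0(1) by force
  qed
qed

lemma crossing_above:
  assumes s: "al < s" "s \<le> be" "T1 s = T2 s" and y: "\<And>u. 0 < u \<Longrightarrow> u < s \<Longrightarrow> T1 u < T2 u"
  shows "q2 s < q1 s"
proof (rule ccontr)
  assume "\<not> q2 s < q1 s"
  have s': "0 < s" "s < a1" "s < a2" using below[of s] s al_pos by auto
  then have "q1 s < q2 s" using distinct[of s] s \<open>\<not> q2 s < q1 s\<close> by auto
  then have "1 / q2 s - 1 / q1 s < 0"
    using level_q_pos[OF lev1, of s] s' by (auto simp: field_simps)
  from DERIV_neg_dec_left[OF DERIV_y[OF s'] this] obtain e where e: "e > 0"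
    "\<And>h. h > 0 \<Longrightarrow> h < e \<Longrightarrow> T1 s - T2 s < T1 (s - h) - T2 (s - h)" by blast
  define h where "h = min (e/2) (s/2)"
  have "0 < h" "h < e" "h < s" using e(1) s' by (auto simp: h_def)
  then show False using e(2)[of h] y[of "s - h"] s by auto
qed

text \<open>
  The solution that starts higher is faster at every height in \<open>[be, a2)\<close>. Near \<open>a2\<close> this holds because \<open>q2\<close> tends
  to \<open>0\<close>. At the last height \<open>s1\<close> where it fails the speeds agree, and \<open>T1 < T2\<close> by monotonicity of \<open>q1\<^sup>2 - q2\<^sup>2\<close>.
  The difference of the Erbe-Tang functions decreases on \<open>(s1, a2)\<close> to a positive limit, but it is nonpositive at
  \<open>s1\<close>.
\<close>
lemma top_dominates:
  assumes a: "a2 < a1" and s: "be \<le> s" "s < a2"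
  shows "q2 s < q1 s"
proof (rule ccontr)
  assume not: "\<not> q2 s < q1 s"
  have b: "be < a2" "a2 < ze" "be < a1" "a1 < ze" using level_bounds[OF lev1] level_bounds[OF lev2] by auto
  have pos: "0 < u" if "be \<le> u" for u using that al_pos al_be by auto
  let ?k = "\<lambda>s. q1 s - q2 s"
  have kc: "isCont ?k u" if "be \<le> u" "u < a2" for u
    using that a pos level_DERIV_q[OF lev1, of u] level_DERIV_q[OF lev2, of u]
    by (intro continuous_diff) (auto intro: DERIV_isCont)
  have q1a2: "q1 a2 > 0" using level_q_pos[OF lev1, of a2] pos b a by auto
  have q1c: "(q1 \<longlongrightarrow> q1 a2) (at_left a2)"
    using DERIV_isCont[OF level_DERIV_q[OF lev1, of a2]] pos b a
    by (auto simp: isCont_def intro: tendsto_mono[OF at_le])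
  have "(?k \<longlongrightarrow> q1 a2 - 0) (at_left a2)"
    using lev2 q1c unfolding level_def by (intro tendsto_intros) auto
  then have "eventually (\<lambda>u. ?k u > 0) (at_left a2)" using q1a2 by (intro order_tendstoD(1)) auto
  then obtain c0 where c0: "c0 < a2" "\<And>u. c0 < u \<Longrightarrow> u < a2 \<Longrightarrow> ?k u > 0"
    by (auto simp: eventually_at_left_field)
  define c where "c = max s ((c0 + a2) / 2)"
  have c: "s \<le> c" "c < a2" "c > c0" using c0(1) s by (auto simp: c_def less_max_iff_disj)
  have cc: "continuous_on {s..c} ?k" using kc s c by (intro continuous_at_imp_continuous_on) auto
  have "closed {x \<in> {s..c}. ?k x \<in> {..0}}"
    using continuous_closed_preimage[OF cc, of "{..0}"] by (simp add: vimage_def Int_def)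
  then have "compact {x \<in> {s..c}. ?k x \<le> 0}"
    by (auto simp: compact_eq_bounded_closed intro: bounded_subset[OF bounded_closed_interval[of s c]])
  moreover have "s \<in> {x \<in> {s..c}. ?k x \<le> 0}" using not c by auto
  ultimately obtain s1 where s1: "s1 \<in> {x \<in> {s..c}. ?k x \<le> 0}" "\<And>x. x \<in> {x \<in> {s..c}. ?k x \<le> 0} \<Longrightarrow> x \<le> s1"
    using compact_attains_sup[of "{x \<in> {s..c}. ?k x \<le> 0}"] by blast
  have kpos: "?k u > 0" if "s1 < u" "u < a2" for u
  proof (cases "u \<le> c")
    case True
    then show ?thesis using s1(2)[of u] s1(1) that by force
  qed (use c0 c that in auto)
  have s1b: "be \<le> s1" "s1 < a2" "?k s1 \<le> 0" using s1(1) s c by auto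
  have "(?k \<longlongrightarrow> ?k s1) (at_right s1)" using kc[OF s1b(1,2)] by (auto simp: isCont_def intro: tendsto_mono[OF at_le])
  moreover have "eventually (\<lambda>u. 0 \<le> ?k u) (at_right s1)"
  proof (rule eventually_at_rightI[OF _ s1b(2)])
    fix x assume "x \<in> {s1<..<a2}"
    then show "0 \<le> ?k x" using kpos[of x] by simp
  qed
  ultimately have "0 \<le> ?k s1" by (intro tendsto_lowerbound) auto
  then have keq: "q1 s1 = q2 s1" using s1b by auto
  have in1: "0 < u" "u < a1" "u < a2" if "s1 \<le> u" "u < a2" for u using that a pos[of u] s1b by auto
  have y: "T1 s1 < T2 s1"
  proof (rule ccontr)
    assume ge: "\<not> T1 s1 < T2 s1"
    have ypos: "T1 u - T2 u > 0" if u: "s1 < u" "u < a2" for u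
    proof -
      have "T1 s1 - T2 s1 < T1 u - T2 u"
      proof (rule DERIV_pos_imp_increasing_open[OF u(1)])
        show "continuous_on {s1..u} (\<lambda>u. T1 u - T2 u)"
          using in1 u cont_y by (intro continuous_at_imp_continuous_on) auto
        fix x assume x: "s1 < x" "x < u"
        then have "1 / q2 x - 1 / q1 x > 0"
          using kpos[of x] level_q_pos[OF lev2, of x] in1[of x] u by (auto simp: field_simps)
        then show "\<exists>D. ((\<lambda>u. T1 u - T2 u) has_real_derivative D) (at x) \<and> D > 0"
          using DERIV_y[of x] in1[of x] x u by auto
      qed
      then show ?thesis using ge by simp
    qed
    define m where "m = (s1 + a2) / 2"
    have m: "s1 < m" "m < a2" using s1b by (auto simp: m_def)
    have "(q1 m)\<^sup>2 - (q2 m)\<^sup>2 < (q1 s1)\<^sup>2 - (q2 s1)\<^sup>2"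
    proof (rule DERIV_neg_imp_decreasing_open[OF m(1)])
      show "continuous_on {s1..m} (\<lambda>u. (q1 u)\<^sup>2 - (q2 u)\<^sup>2)"
        using in1 m DERIV_isCont[OF DERIV_h] by (intro continuous_at_imp_continuous_on) auto
      fix x assume x: "s1 < x" "x < m"
      then have "f x > 0" using f_pos[of x] b s1b m al_be by auto
      then have "- 2 * f x * (exp (2 * T1 x) - exp (2 * T2 x)) < 0"
        using ypos[of x] x m by (intro mult_neg_pos) auto
      then show "\<exists>D. ((\<lambda>u. (q1 u)\<^sup>2 - (q2 u)\<^sup>2) has_real_derivative D) (at x) \<and> D < 0"
        using DERIV_h[of x] in1[of x] x m by auto
    qed
    moreover have "(q1 m)\<^sup>2 - (q2 m)\<^sup>2 > 0" using h_sign[of m] in1[of m] kpos[of m] m by auto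
    ultimately show False using keq by simp
  qed
  let ?P = "\<lambda>q T s. (q s)\<^sup>2 / 2 + exp (2 * T s) * G s - 2 * (G s / f s) * q s"
  let ?D = "\<lambda>s. ?P q1 T1 s - ?P q2 T2 s"
  have fz: "f u > 0" if "be \<le> u" "u < ze" for u using f_pos[of u] that al_be by auto
  have P1: "?P q1 T1 a2 > 0" using level_erbe_tang_pos[OF lev1, of a2] b a by auto
  have contP: "isCont (?P q T) u" if "level aa T q" "be \<le> u" "u < aa" for q T aa u
    using that pos[of u] fz[of u] level_bounds[OF that(1)]
    by (intro continuous_intros DERIV_isCont[OF DERIV_G] DERIV_isCont[OF DERIV_f]
      DERIV_isCont[OF level_DERIV_q[OF that(1)]] DERIV_isCont[OF level_DERIV_T[OF that(1)]]) auto
  have "(?P q1 T1 \<longlongrightarrow> ?P q1 T1 a2) (at_left a2)"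
    using contP[OF lev1, of a2] b a by (auto simp: isCont_def intro: tendsto_mono[OF at_le])
  moreover have "(?P q2 T2 \<longlongrightarrow> 0\<^sup>2 / 2 + 0 * G a2 - 2 * (G a2 / f a2) * 0) (at_left a2)"
    using lev2 fz[of a2] b DERIV_isCont[OF DERIV_G, of a2] DERIV_isCont[OF DERIV_f, of a2] unfolding level_def
    by (intro tendsto_intros) (auto simp: isCont_def intro: tendsto_mono[OF at_le])
  ultimately have lim: "(?D \<longlongrightarrow> ?P q1 T1 a2 - (0\<^sup>2 / 2 + 0 * G a2 - 2 * (G a2 / f a2) * 0)) (at_left a2)"
    by (rule tendsto_diff)
  have dec: "?D u \<le> ?D s1" if u: "s1 < u" "u < a2" for u
  proof -
    have "?D u < ?D s1"
    proof (rule DERIV_neg_imp_decreasing_open[OF u(1)])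
      show "continuous_on {s1..u} ?D"
        using contP[OF lev1] contP[OF lev2] u s1b a
        by (intro continuous_at_imp_continuous_on ballI isCont_diff[OF contP[OF lev1] contP[OF lev2]]) auto
      fix x assume x: "s1 < x" "x < u"
      then have x': "be < x" "x < a1" "x < a2" "x < ze" using s1b u a b by auto
      let ?r = "((f x)\<^sup>2 - G x * f' x) / (f x)\<^sup>2"
      have D: "(?D has_real_derivative - 2 * ?r * q1 x - - 2 * ?r * q2 x) (at x)"
        by (intro DERIV_diff level_DERIV_erbe_tang[OF lev1] level_DERIV_erbe_tang[OF lev2] x')
      have "?r > 0" by (rule ratio_deriv_pos[OF lev1 x'(1,4)])
      then have "?r * ?k x > 0" using kpos[of x] x u by (intro mult_pos_pos) auto
      moreover have factor: "- 2 * r * A - - 2 * r * B = - 2 * (r * (A - B))" for r A B :: real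
        by (simp add: algebra_simps)
      ultimately have "- 2 * ?r * q1 x - - 2 * ?r * q2 x < 0"
        using factor[of ?r "q1 x" "q2 x"] by linarith
      then show "\<exists>D. (?D has_real_derivative D) (at x) \<and> D < 0" using D by blast
    qed
    then show ?thesis by simp
  qed
  have "eventually (\<lambda>u. ?D u \<le> ?D s1) (at_left a2)"
  proof (rule eventually_at_leftI[OF _ s1b(2)])
    fix x assume "x \<in> {s1<..<a2}"
    then show "?D x \<le> ?D s1" by (intro dec) auto
  qed
  then have "?P q1 T1 a2 - (0\<^sup>2 / 2 + 0 * G a2 - 2 * (G a2 / f a2) * 0) \<le> ?D s1"
    by (intro tendsto_upperbound[OF lim]) auto
  then have "?D s1 > 0" using P1 by simp
  moreover have "?D s1 = (exp (2 * T1 s1) - exp (2 * T2 s1)) * G s1" using keq by (simp add: algebra_simps)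
  moreover have "G s1 \<ge> 0" using G_pos[of s1] G_be s1b b by (cases "s1 = be") auto
  moreover have "exp (2 * T1 s1) - exp (2 * T2 s1) \<le> 0" using y by auto
  ultimately show False by (metis mult_nonpos_nonneg not_less)
qed

end

text \<open>
  At the lowest crossing the solution that is earlier below must be the faster one, contrary to \<open>no_descent\<close>.
\<close>
lemma no_crossing:
  assumes lev1: "level a1 T1 q1" and lev2: "level a2 T2 q2"
    and distinct: "\<And>s. 0 < s \<Longrightarrow> s < a1 \<Longrightarrow> s < a2 \<Longrightarrow> \<not> (T1 s = T2 s \<and> q1 s = q2 s)"
    and s: "0 < s" "s \<le> be"
  shows "T1 s \<noteq> T2 s"
proof
  assume "T1 s = T2 s"
  then obtain sL where sL: "al < sL" "sL \<le> be" "T1 sL = T2 sL" "\<And>u. 0 < u \<Longrightarrow> u < sL \<Longrightarrow> T1 u \<noteq> T2 u"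
    using first_crossing[OF lev1 lev2 distinct s] by blast
  have d': "\<And>s. 0 < s \<Longrightarrow> s < a2 \<Longrightarrow> s < a1 \<Longrightarrow> \<not> (T2 s = T1 s \<and> q2 s = q1 s)" using distinct by metis
  have ab: "sL \<le> a1" "sL \<le> a2" using level_bounds[OF lev1] level_bounds[OF lev2] sL by auto
  consider "T1 al < T2 al" | "T2 al < T1 al" using sL(4)[of al] al_pos sL(1) by force
  then show False
  proof cases
    case 1
    then have "\<And>u. 0 < u \<Longrightarrow> u < sL \<Longrightarrow> T1 u < T2 u"
      using y_nz_const[OF lev1 lev2 distinct sL(4) ab] al_pos sL(1) by blast
    then show False
      using no_descent[OF lev1 lev2 distinct sL(1,2)] crossing_above[OF lev1 lev2 distinct sL(1,2,3)] sL(3) by simp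
  next
    case 2
    have nz: "\<And>u. 0 < u \<Longrightarrow> u < sL \<Longrightarrow> T2 u \<noteq> T1 u" using sL(4) by metis
    have "\<And>u. 0 < u \<Longrightarrow> u < sL \<Longrightarrow> T2 u < T1 u"
      using y_nz_const[OF lev2 lev1 d' nz ab(2,1)] al_pos sL(1) 2 by blast
    then show False
      using no_descent[OF lev2 lev1 d' sL(1,2)] crossing_above[OF lev2 lev1 d' sL(1,2) sL(3)[symmetric]] sL(3) by simp
  qed
qed

text \<open>
  There is no crossing up to \<open>be\<close>, and \<open>q2 < q1\<close> at \<open>be\<close>. If \<open>T1 < T2\<close> at \<open>be\<close>, then \<open>no_descent\<close> applies at \<open>be\<close>
  itself. If \<open>T2 < T1\<close>, the order persists up to \<open>a2\<close>; there the second radial slope vanishes, so that it is the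
  smaller one down to \<open>al\<close> by \<open>delta_neg_left\<close>, contrary to \<open>delta_pos_low\<close>.
\<close>
lemma level_unique:
  assumes lev1: "level a1 T1 q1" and lev2: "level a2 T2 q2" and a: "a2 < a1"
    and distinct: "\<And>s. 0 < s \<Longrightarrow> s < a1 \<Longrightarrow> s < a2 \<Longrightarrow> \<not> (T1 s = T2 s \<and> q1 s = q2 s)"
  shows False
proof -
  have d': "\<And>s. 0 < s \<Longrightarrow> s < a2 \<Longrightarrow> s < a1 \<Longrightarrow> \<not> (T2 s = T1 s \<and> q2 s = q1 s)" using distinct by metis
  have b: "be < a2" "a2 < ze" "be < a1" "a1 < ze" "0 < be" 
    using level_bounds[OF lev1] level_bounds[OF lev2] al_pos al_be by auto
  have nz: "T1 s \<noteq> T2 s" if "0 < s" "s \<le> be" for s using no_crossing[OF lev1 lev2 distinct that] .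
  have q: "q2 s < q1 s" if "be \<le> s" "s < a2" for s using top_dominates[OF lev1 lev2 distinct a that] .
  consider "T1 be < T2 be" | "T2 be < T1 be" using nz[of be] b by force
  then show False
  proof cases
    case 1
    have "T1 u < T2 u" if u: "0 < u" "u < be" for u
    proof (rule ccontr)
      assume n: "\<not> T1 u < T2 u"
      have "\<exists>x. u \<le> x \<and> x \<le> be \<and> T1 x - T2 x = 0"
        by (rule IVT2) (use n 1 u b cont_y[OF lev1 lev2] distinct in auto)
      then show False using nz u by fastforce
    qed
    then show False
      using no_descent[OF lev1 lev2 distinct al_be order_refl] 1 q[of be] b by auto
  next
    case 2
    have y1: "T2 u < T1 u" if u: "0 < u" "u \<le> be" for u
    proof (rule ccontr)
      assume n: "\<not> T2 u < T1 u"
      have "\<exists>x. u \<le> x \<and> x \<le> be \<and> T1 x - T2 x = 0"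
        by (rule IVT) (use n 2 u b cont_y[OF lev1 lev2] distinct in auto)
      then show False using nz u by fastforce
    qed
    have y2: "T2 u < T1 u" if u: "be < u" "u < a2" for u
    proof -
      have "T1 be - T2 be < T1 u - T2 u"
      proof (rule DERIV_pos_imp_increasing[OF u(1)])
        fix x assume x: "be \<le> x" "x \<le> u"
        then have "1 / q2 x - 1 / q1 x > 0"
          using q[of x] level_q_pos[OF lev2, of x] u b by (auto simp: field_simps)
        then show "\<exists>D. ((\<lambda>u. T1 u - T2 u) has_real_derivative D) (at x) \<and> D > 0"
          using DERIV_y[OF lev1 lev2, of x] distinct x u b a by auto
      qed
      then show ?thesis using 2 by simp
    qed
    let ?r1 = "\<lambda>s. q1 s * exp (- T1 s)" let ?r2 = "\<lambda>s. q2 s * exp (- T2 s)"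
    have "?r1 a2 > 0" using level_q_pos[OF lev1, of a2] b a by auto
    have "(?r1 \<longlongrightarrow> ?r1 a2) (at_left a2)"
      using DERIV_isCont[OF level_DERIV_rho[OF lev1, of a2]] b a
      by (auto simp: isCont_def intro: tendsto_mono[OF at_le])
    then have "((\<lambda>s. ?r2 s - ?r1 s) \<longlongrightarrow> 0 - ?r1 a2) (at_left a2)"
      using lev2 unfolding level_def by (intro tendsto_diff) auto
    then have "eventually (\<lambda>u. ?r2 u - ?r1 u < 0) (at_left a2)" 
      using \<open>?r1 a2 > 0\<close> by (intro order_tendstoD(2)) auto
    then obtain c0 where c0: "c0 < a2" "\<And>u. c0 < u \<Longrightarrow> u < a2 \<Longrightarrow> ?r2 u - ?r1 u < 0"
      by (auto simp: eventually_at_left_field)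
    define c where "c = max be ((c0 + a2) / 2)"
    have c: "be \<le> c" "c < a2" "c > c0" using c0(1) b by (auto simp: c_def less_max_iff_disj)
    \<comment> \<open>The comparison of radial slopes is carried from \<open>c\<close> near \<open>a2\<close> down to \<open>al\<close>.\<close>
    have "?r2 al - ?r1 al < 0"
    proof (rule delta_neg_left[OF lev2 lev1 d', of al c])
      show "T2 v < T1 v" if "al \<le> v" "v \<le> c" for v
        using y1[of v] y2[of v] that c al_pos by (cases "v \<le> be") auto
      show "?r2 c - ?r1 c \<le> 0" using c0(2)[of c] c by simp
    qed (use c al_pos al_be a in auto)
    moreover have "?r2 al - ?r1 al > 0"
      by (rule delta_pos_low[OF lev2 lev1 d']) (use y1[of al] al_pos al_be in auto)
    ultimately show False by simp
  qed
qed

end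

section \<open>The radial equation and the uniqueness of profiles\<close>

lemma exp_minus_sq: "(x * exp (- t))\<^sup>2 = exp (- 2 * t) * x\<^sup>2" for x t :: real
  by (simp add: power2_eq_square) (simp flip: exp_add)

context nls_signs
begin

text \<open>
  The radial equation in the variable \<open>t = ln r\<close>, which removes the first-order term.
\<close>
definition radial_ode :: "(real \<Rightarrow> real) \<Rightarrow> (real \<Rightarrow> real) \<Rightarrow> bool" where
  "radial_ode w p \<longleftrightarrow> (\<forall>t. (w has_real_derivative p t) (at t) \<and>
     (p has_real_derivative - exp (2 * t) * f (w t)) (at t))"

lemma radial_ode_const: "f c = 0 \<Longrightarrow> radial_ode (\<lambda>t. c) (\<lambda>t. 0)"
  unfolding radial_ode_def by auto

context
  fixes w1 p1 w2 p2 B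
  assumes ode1: "radial_ode w1 p1" and ode2: "radial_ode w2 p2"
    and bd: "\<And>t. \<bar>w1 t\<bar> \<le> B" "\<And>t. \<bar>w2 t\<bar> \<le> B"
begin

text \<open>
  The weight \<open>exp (- 2 * t)\<close> turns \<open>p\<close> into the radial derivative. With it the Gronwall estimate forward in time has
  the factor \<open>exp t\<close>, which is integrable at \<open>-\<infinity>\<close>, so that solutions are unique also from initial values at the
  origin.
\<close>
definition gap :: "real \<Rightarrow> real" where
  "gap t = exp (- 2 * t) * (p1 t - p2 t)\<^sup>2 + (w1 t - w2 t)\<^sup>2"

lemma gap_zero: "gap t = 0 \<Longrightarrow> w1 t = w2 t"
  unfolding gap_def using zero_le_power2[of "w1 t - w2 t"] mult_nonneg_nonneg[of "exp (- 2 * t)" "(p1 t - p2 t)\<^sup>2"]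
  by (smt (verit) exp_ge_zero power_zero_numeral zero_eq_power2 zero_le_power2)

lemma gap_nonneg: "gap t \<ge> 0" unfolding gap_def by simp

lemma gap_deriv:
  obtains K D where "K \<ge> 0" "\<And>t. (gap has_real_derivative D t) (at t)"
    "\<And>t. D t \<le> K * exp t * gap t" "\<And>t. D t \<ge> - 2 * gap t - K * exp t * gap t"
proof -
  obtain L where L: "L > 0" "\<And>x y. x \<in> {-B..B} \<Longrightarrow> y \<in> {-B..B} \<Longrightarrow> \<bar>f x - f y\<bar> \<le> L * \<bar>x - y\<bar>"
    using f_Lipschitz[of "-B" B] by blast
  define D where "D t = exp (- 2 * t) * (- 2) * (p1 t - p2 t)\<^sup>2
     + exp (- 2 * t) * (2 * (p1 t - p2 t) * (- exp (2 * t) * f (w1 t) - - exp (2 * t) * f (w2 t)))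
     + 2 * (w1 t - w2 t) * (p1 t - p2 t)" for t
  have d: "(w1 has_real_derivative p1 t) (at t)" "(w2 has_real_derivative p2 t) (at t)"
    "(p1 has_real_derivative - exp (2 * t) * f (w1 t)) (at t)" "(p2 has_real_derivative - exp (2 * t) * f (w2 t)) (at t)" for t
    using ode1 ode2 unfolding radial_ode_def by auto
  have D: "(gap has_real_derivative D t) (at t)" for t
    unfolding gap_def[abs_def] D_def
    by (auto intro!: derivative_eq_intros d simp: algebra_simps power2_eq_square)
  define E where "E t = 2 * (p1 t - p2 t) * (w1 t - w2 t) - 2 * (p1 t - p2 t) * (f (w1 t) - f (w2 t))" for t
  have De: "D t = - 2 * (exp (- 2 * t) * (p1 t - p2 t)\<^sup>2) + E t" for t
  proof -
    have "exp (- 2 * t) * exp (2 * t) = 1" by (simp flip: exp_add)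
    moreover have "E1 * E2 = 1 \<Longrightarrow> E1 * (- 2) * x\<^sup>2 + E1 * (2 * x * (- E2 * a - - E2 * b)) + 2 * y * x
        = - 2 * (E1 * x\<^sup>2) + (2 * x * y - 2 * x * (a - b))" for E1 E2 x y a b :: real
      by algebra
    ultimately show ?thesis unfolding D_def E_def by blast
  qed
  have E: "\<bar>E t\<bar> \<le> (L + 1) * exp t * gap t" for t
  proof -
    define P where "P = exp (- t) * \<bar>p1 t - p2 t\<bar>"
    define W where "W = \<bar>w1 t - w2 t\<bar>"
    have g: "gap t = P\<^sup>2 + W\<^sup>2" unfolding gap_def P_def W_def by (simp add: power_mult_distrib flip: exp_of_nat_mult)
    have pe: "\<bar>p1 t - p2 t\<bar> = exp t * P" unfolding P_def by (simp flip: exp_add mult.assoc)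
    have PW: "P \<ge> 0" "W \<ge> 0" by (auto simp: P_def W_def)
    have "\<bar>f (w1 t) - f (w2 t)\<bar> \<le> L * W" using L(2)[of "w1 t" "w2 t"] bd[of t] unfolding W_def by (auto simp: abs_le_iff)
    then have "\<bar>(w1 t - w2 t) - (f (w1 t) - f (w2 t))\<bar> \<le> (L + 1) * W" unfolding W_def by (simp add: algebra_simps)
    moreover have "\<bar>E t\<bar> = 2 * \<bar>p1 t - p2 t\<bar> * \<bar>(w1 t - w2 t) - (f (w1 t) - f (w2 t))\<bar>"
    proof -
      have "E t = 2 * (p1 t - p2 t) * ((w1 t - w2 t) - (f (w1 t) - f (w2 t)))"
        unfolding E_def by (simp add: algebra_simps)
      then show ?thesis by (simp only: abs_mult abs_numeral)
    qed
    ultimately have "\<bar>E t\<bar> \<le> 2 * (exp t * P) * ((L + 1) * W)"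
      unfolding pe using PW by (simp add: mult_left_mono)
    also have "\<dots> = (L + 1) * exp t * (2 * P * W)" by simp
    also have "\<dots> \<le> (L + 1) * exp t * (P\<^sup>2 + W\<^sup>2)"
      using L(1) sum_squares_bound[of P W] by (intro mult_left_mono) auto
    finally show ?thesis unfolding g .
  qed
  show ?thesis
  proof (rule that[of "L + 1" D])
    fix t
    have 1: "0 \<le> exp (- 2 * t) * (p1 t - p2 t)\<^sup>2" "exp (- 2 * t) * (p1 t - p2 t)\<^sup>2 \<le> gap t" unfolding gap_def by auto
    show "D t \<le> (L + 1) * exp t * gap t" unfolding De using E[of t] 1 by linarith
    show "D t \<ge> - 2 * gap t - (L + 1) * exp t * gap t" unfolding De using E[of t] 1 by linarith
  qed (use L D in auto)
qed

lemma gap_mono: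
  obtains K where "\<And>t u. t \<le> u \<Longrightarrow> gap u * exp (- K * exp u) \<le> gap t * exp (- K * exp t)"
    "\<And>t u. t \<le> u \<Longrightarrow> gap t * exp (2 * t + K * exp t) \<le> gap u * exp (2 * u + K * exp u)"
proof -
  obtain K D where K: "K \<ge> 0" and D: "\<And>t. (gap has_real_derivative D t) (at t)"
    "\<And>t. D t \<le> K * exp t * gap t" "\<And>t. D t \<ge> - 2 * gap t - K * exp t * gap t"
    using gap_deriv by blast
  show ?thesis
  proof (rule that[of K])
    fix t u :: real assume tu: "t \<le> u"
    show "gap u * exp (- K * exp u) \<le> gap t * exp (- K * exp t)"
    proof (rule DERIV_nonpos_imp_nonincreasing[OF tu])
      fix x
      have "((\<lambda>t. gap t * exp (- K * exp t)) has_real_derivative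
         D x * exp (- K * exp x) + (exp (- K * exp x) * (- K * exp x)) * gap x) (at x)"
        by (intro DERIV_mult D DERIV_fun_exp DERIV_cmult DERIV_exp)
      moreover have "(D x - K * exp x * gap x) * exp (- K * exp x) \<le> 0"
        using D(2)[of x] by (intro mult_nonpos_nonneg) auto
      then have "D x * exp (- K * exp x) + (exp (- K * exp x) * (- K * exp x)) * gap x \<le> 0"
        by (simp add: algebra_simps)
      ultimately show "\<exists>D. ((\<lambda>t. gap t * exp (- K * exp t)) has_real_derivative D) (at x) \<and> D \<le> 0"
        by blast
    qed
    show "gap t * exp (2 * t + K * exp t) \<le> gap u * exp (2 * u + K * exp u)"
    proof (rule DERIV_nonneg_imp_nondecreasing[OF tu])
      fix x
      have "((\<lambda>t. gap t * exp (2 * t + K * exp t)) has_real_derivative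
         D x * exp (2 * x + K * exp x) + (exp (2 * x + K * exp x) * (2 * 1 + K * exp x)) * gap x) (at x)"
        by (intro DERIV_mult D DERIV_fun_exp DERIV_cmult DERIV_exp DERIV_add DERIV_ident)
      moreover have "(D x + 2 * gap x + K * exp x * gap x) * exp (2 * x + K * exp x) \<ge> 0"
        using D(3)[of x] by (intro mult_nonneg_nonneg) auto
      then have "D x * exp (2 * x + K * exp x) + (exp (2 * x + K * exp x) * (2 * 1 + K * exp x)) * gap x \<ge> 0"
        by (simp add: algebra_simps)
      ultimately show "\<exists>D. ((\<lambda>t. gap t * exp (2 * t + K * exp t)) has_real_derivative D) (at x) \<and> D \<ge> 0"
        by blast
    qed
  qed
qed

lemma ode_unique_point:
  assumes "w1 t0 = w2 t0" "p1 t0 = p2 t0"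
  shows "w1 t = w2 t"
proof -
  obtain K where K: "\<And>t u. t \<le> u \<Longrightarrow> gap u * exp (- K * exp u) \<le> gap t * exp (- K * exp t)"
    "\<And>t u. t \<le> u \<Longrightarrow> gap t * exp (2 * t + K * exp t) \<le> gap u * exp (2 * u + K * exp u)"
    using gap_mono by blast
  have "gap t0 = 0" using assms by (simp add: gap_def)
  then have "gap t \<le> 0"
    using K(1)[of t0 t] K(2)[of t t0] by (cases "t0 \<le> t") (auto simp: mult_le_0_iff not_less)
  then show ?thesis using gap_zero gap_nonneg[of t] by (simp add: order_antisym)
qed

lemma ode_unique_limit:
  assumes "(gap \<longlongrightarrow> 0) at_bot"
  shows "w1 t = w2 t"
proof -
  obtain K where K: "\<And>t u. t \<le> u \<Longrightarrow> gap u * exp (- K * exp u) \<le> gap t * exp (- K * exp t)"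
    "\<And>t u. t \<le> u \<Longrightarrow> gap t * exp (2 * t + K * exp t) \<le> gap u * exp (2 * u + K * exp u)"
    using gap_mono by blast
  have "((\<lambda>t. exp t) \<longlongrightarrow> (0::real)) at_bot" by (rule exp_at_bot)
  then have "((\<lambda>u. gap u * exp (- K * exp u)) \<longlongrightarrow> 0 * exp (- K * 0)) at_bot"
    using assms by (intro tendsto_intros)
  moreover have "eventually (\<lambda>u. gap t * exp (- K * exp t) \<le> gap u * exp (- K * exp u)) at_bot"
    using eventually_le_at_bot[of t] by eventually_elim (rule K(1))
  ultimately have "gap t * exp (- K * exp t) \<le> 0 * exp (- K * 0)"
    by (intro tendsto_lowerbound) auto
  then have "gap t \<le> 0" by (simp add: mult_le_0_iff not_less)
  then show ?thesis using gap_zero gap_nonneg[of t] by (simp add: order_antisym)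
qed

end

text \<open>
  Positive solutions that decay exponentially in \<open>r = exp t\<close> and come from a function differentiable at the origin:
  \<open>p t\<close> is \<open>r\<close> times the radial derivative, so it tends to \<open>0\<close> with \<open>r\<close>.
\<close>
definition profile :: "(real \<Rightarrow> real) \<Rightarrow> (real \<Rightarrow> real) \<Rightarrow> bool" where
  "profile w p \<longleftrightarrow> radial_ode w p \<and> (\<forall>t. 0 < w t) \<and> (\<exists>a. (w \<longlongrightarrow> a) at_bot) \<and> (p \<longlongrightarrow> 0) at_bot \<and>
     (\<exists>C \<delta>. 0 < \<delta> \<and> (\<forall>t. w t \<le> C * exp (- \<delta> * exp t)))"

context
  fixes w p assumes prof: "profile w p"
begin

lemma profile_ode: "radial_ode w p" and profile_pos: "0 < w t"
  and DERIV_w: "(w has_real_derivative p t) (at t)"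
  and DERIV_p: "(p has_real_derivative - exp (2 * t) * f (w t)) (at t)"
  using prof unfolding profile_def radial_ode_def by auto

lemma profile_bounded: obtains B where "\<And>t. \<bar>w t\<bar> \<le> B"
proof -
  obtain C \<delta> where C: "0 < \<delta>" "\<And>t. w t \<le> C * exp (- \<delta> * exp t)" using prof unfolding profile_def by blast
  have "\<bar>w t\<bar> \<le> \<bar>C\<bar>" for t
  proof -
    have "C * exp (- \<delta> * exp t) \<le> \<bar>C\<bar> * 1" using C(1) by (intro mult_mono) auto
    then show ?thesis using C(2)[of t] profile_pos[of t] by simp
  qed
  then show ?thesis using that by blast
qed

lemma profile_decay: "(w \<longlongrightarrow> 0) at_top" "((\<lambda>t. exp (2 * t) * (w t)\<^sup>2) \<longlongrightarrow> 0) at_top"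
proof -
  obtain C \<delta> where C: "0 < \<delta>" "\<And>t. w t \<le> C * exp (- \<delta> * exp t)" using prof unfolding profile_def by blast
  have "((\<lambda>t. C * exp (- \<delta> * exp t)) \<longlongrightarrow> 0) at_top" using C(1) by real_asymp
  then show "(w \<longlongrightarrow> 0) at_top"
    by (rule tendsto_sandwich[OF _ _ tendsto_const, rotated 2]) (use C profile_pos in \<open>auto intro!: always_eventually less_imp_le\<close>)
  have "((\<lambda>t. exp (2 * t) * (exp (- \<delta> * exp t))\<^sup>2) \<longlongrightarrow> 0) at_top" using C(1) by real_asymp
  from tendsto_mult_left[OF this, of "C\<^sup>2"]
  have l: "((\<lambda>t. exp (2 * t) * (C * exp (- \<delta> * exp t))\<^sup>2) \<longlongrightarrow> 0) at_top"
    by (simp add: power_mult_distrib mult_ac)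
  have "(w t)\<^sup>2 \<le> (C * exp (- \<delta> * exp t))\<^sup>2" for t
    using C(2)[of t] profile_pos[of t] by (intro power_mono) auto
  then show "((\<lambda>t. exp (2 * t) * (w t)\<^sup>2) \<longlongrightarrow> 0) at_top"
    by (intro tendsto_sandwich[OF _ _ tendsto_const l]) (auto intro!: always_eventually)
qed

lemma profile_G_decay: "((\<lambda>t. exp (2 * t) * G (w t)) \<longlongrightarrow> 0) at_top"
proof -
  have "((\<lambda>s::real. s * ln s) \<longlongrightarrow> 0 * ln 0) (at 0)" using tendsto_x_ln_x by simp
  then have c: "isCont (\<lambda>s::real. s * ln s) 0" by (simp add: isCont_def)
  have "isCont (\<lambda>s. - lam * s * (s * ln s) + lam / 4 * s\<^sup>2 - om) 0" by (intro continuous_intros c)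
  from isCont_tendsto_compose[OF this profile_decay(1)]
  have "((\<lambda>t. - lam * w t * (w t * ln (w t)) + lam / 4 * (w t)\<^sup>2 - om) \<longlongrightarrow> - om) at_top" by simp
  from tendsto_mult[OF profile_decay(2) this]
  have "((\<lambda>t. exp (2 * t) * (w t)\<^sup>2 * (- lam * w t * (w t * ln (w t)) + lam / 4 * (w t)\<^sup>2 - om)) \<longlongrightarrow> 0) at_top" by simp
  moreover have "exp (2 * t) * (w t)\<^sup>2 * (- lam * w t * (w t * ln (w t)) + lam / 4 * (w t)\<^sup>2 - om) = exp (2 * t) * G (w t)" for t
    by (simp add: G_def power2_eq_square power4_eq_xxxx algebra_simps)
  ultimately show ?thesis by (simp only:)
qed

text \<open>
  Once \<open>w < al\<close> the function \<open>w\<close> is convex in \<open>t\<close>, and a bounded convex function has slope tending to \<open>0\<close>.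
\<close>
lemma profile_p_top: "(p \<longlongrightarrow> 0) at_top"
proof -
  have "eventually (\<lambda>t. w t < al) at_top" using profile_decay(1) al_pos by (intro order_tendstoD(2)) auto
  then obtain T where T: "\<And>t. t \<ge> T \<Longrightarrow> w t < al" by (auto simp: eventually_at_top_linorder)
  have mono: "p t \<le> p u" if "T \<le> t" "t \<le> u" for t u
  proof (rule DERIV_nonneg_imp_nondecreasing[OF that(2)])
    fix x assume "t \<le> x" "x \<le> u"
    then have "f (w x) < 0" using f_neg1[of "w x"] T[of x] profile_pos that by auto
    then have "- exp (2 * x) * f (w x) \<ge> 0" by (simp add: mult_nonneg_nonpos)
    then show "\<exists>D. (p has_real_derivative D) (at x) \<and> D \<ge> 0" using DERIV_p[of x] by blast
  qed
  have le0: "p t \<le> 0" if t: "t \<ge> T" for t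
  proof (rule ccontr)
    assume "\<not> p t \<le> 0"
    have "w t \<le> w u" if "t \<le> u" for u
      by (rule DERIV_nonneg_imp_nondecreasing[OF that]) (use DERIV_w mono t \<open>\<not> p t \<le> 0\<close> in \<open>meson le_cases order_trans\<close>)
    then have "eventually (\<lambda>u. w t \<le> w u) at_top" by (auto simp: eventually_at_top_linorder)
    then have "w t \<le> 0" by (intro tendsto_lowerbound[OF profile_decay(1)]) auto
    then show False using profile_pos[of t] by simp
  qed
  show ?thesis
  proof (rule order_tendstoI)
    fix e :: real assume e: "e < 0"
    have "\<exists>t\<ge>T. p t > e"
    proof (rule ccontr)
      assume "\<not> (\<exists>t\<ge>T. p t > e)"
      then have pe: "p t \<le> e" if "t \<ge> T" for t using that by force
      define u where "u = T + w T / (- e)"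
      have u: "T \<le> u" "e * (u - T) = - w T" using e profile_pos[of T] by (auto simp: u_def divide_nonneg_neg divide_le_0_iff)
      have "w u - e * u \<le> w T - e * T"
      proof (rule DERIV_nonpos_imp_nonincreasing[OF u(1)])
        fix x assume "T \<le> x"
        then show "\<exists>D. ((\<lambda>u. w u - e * u) has_real_derivative D) (at x) \<and> D \<le> 0"
          using pe[of x] by (intro exI[of _ "p x - e * 1"] conjI DERIV_diff DERIV_w DERIV_cmult DERIV_ident) auto
      qed
      then have "w u \<le> 0" using u(2) by (simp add: algebra_simps)
      then show False using profile_pos[of u] by simp
    qed
    then obtain t where t: "t \<ge> T" "p t > e" by blast
    show "eventually (\<lambda>u. e < p u) at_top"
      using less_le_trans[OF t(2) mono[OF t(1)]] by (auto simp: eventually_at_top_linorder)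
  next
    fix e :: real assume "0 < e"
    then show "eventually (\<lambda>u. p u < e) at_top"
      using le_less_trans[OF le0 \<open>0 < e\<close>] by (auto simp: eventually_at_top_linorder)
  qed
qed

text \<open>
  The mechanical energy \<open>\<phi>'\<^sup>2 / 2 + G \<phi>\<close> of the radial solution. It decreases to \<open>0\<close> and is therefore positive; in
  the limit \<open>r \<rightarrow> 0\<close> this shows that the value at the origin exceeds \<open>be\<close>.
\<close>
definition en :: "real \<Rightarrow> real" where "en t = exp (- 2 * t) * (p t)\<^sup>2 / 2 + G (w t)"

lemma DERIV_en: "(en has_real_derivative - exp (- 2 * t) * (p t)\<^sup>2) (at t)"
proof -
  have sq: "((\<lambda>t. (p t)\<^sup>2) has_real_derivative real 2 * (- exp (2 * t) * f (w t)) * p t ^ (2 - Suc 0)) (at t)"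
    by (rule DERIV_cong[OF DERIV_power[OF DERIV_p]]) simp
  have "(en has_real_derivative ((exp (- 2 * t) * (- 2 * 1)) * (p t)\<^sup>2 + 
      (real 2 * (- exp (2 * t) * f (w t)) * p t ^ (2 - Suc 0)) * exp (- 2 * t)) / 2 + f (w t) * p t) (at t)"
    unfolding en_def[abs_def]
    by (intro DERIV_add DERIV_cdivide DERIV_mult DERIV_fun_exp DERIV_cmult DERIV_ident DERIV_chain2[OF DERIV_G DERIV_w]
        sq)
  moreover have "exp (2 * t) * exp (- 2 * t) = 1" by (simp flip: exp_add)
  then have "(real 2 * (- exp (2 * t) * f (w t)) * p t ^ (2 - Suc 0)) * exp (- 2 * t) = - 2 * f (w t) * p t"
    by simp
  ultimately show ?thesis by (auto elim!: DERIV_cong simp: field_simps)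
qed

lemma en_antimono: "t \<le> u \<Longrightarrow> en u \<le> en t"
  by (rule DERIV_nonpos_imp_nonincreasing) (use DERIV_en in \<open>fastforce intro!: exI\<close>)+

lemma en_top: "(en \<longlongrightarrow> 0) at_top"
proof -
  have "((\<lambda>t::real. exp (- 2 * t)) \<longlongrightarrow> 0) at_top" by real_asymp
  moreover have "((\<lambda>t. G (w t)) \<longlongrightarrow> G 0) at_top"
    using isCont_tendsto_compose[OF DERIV_isCont[OF DERIV_G] profile_decay(1)] .
  ultimately have "(en \<longlongrightarrow> 0 * 0\<^sup>2 / 2 + G 0) at_top"
    unfolding en_def[abs_def] using profile_p_top by (intro tendsto_intros) auto
  then show ?thesis by (simp add: G_0)
qed

lemma en_nonneg: "en t \<ge> 0"
proof -
  have "eventually (\<lambda>u. en u \<le> en t) at_top" using en_antimono by (auto simp: eventually_at_top_linorder)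
  then show ?thesis by (intro tendsto_upperbound[OF en_top]) auto
qed

lemma en_pos: "en t > 0"
proof (rule ccontr)
  assume "\<not> en t > 0"
  then have z: "en u = 0" if "u \<ge> t" for u using en_nonneg[of u] en_nonneg[of t] en_antimono[OF that] by auto
  have p0: "p u = 0" if "u > t" for u
  proof -
    have "(en has_real_derivative 0) (at u)"
      by (rule has_field_derivative_transform_within_open[of "\<lambda>_. 0" _ _ "{t<..}"]) (use that z in auto)
    from DERIV_unique[OF this DERIV_en] show ?thesis by auto
  qed
  have D0: "(w has_real_derivative 0) (at u)" if "u > t" for u using DERIV_w[of u] p0[OF that] by simp
  have "w u = w (t + 1)" if "u > t + 1" for u
    by (rule DERIV_isconst_end[OF that])
      (use D0 DERIV_isCont[OF DERIV_w] in \<open>auto intro!: continuous_at_imp_continuous_on\<close>)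
  then have "eventually (\<lambda>u. w u = w (t + 1)) at_top"
    by (auto simp: eventually_at_top_dense intro!: exI[of _ "t + 1"])
  then have "(w \<longlongrightarrow> w (t + 1)) at_top" by (rule tendsto_eventually)
  from tendsto_unique[OF _ this profile_decay(1)] have "w (t + 1) = 0" by simp
  then show False using profile_pos[of "t + 1"] by simp
qed

lemma profile_p_bot: obtains K where "\<And>t. \<bar>p t\<bar> \<le> K * exp (2 * t)"
proof -
  obtain B where B: "\<And>t. \<bar>w t\<bar> \<le> B" using profile_bounded by blast
  have "compact (f ` {-B..B})" by (intro compact_continuous_image continuous_on_f) simp
  then obtain M where M: "\<forall>y\<in>f ` {-B..B}. \<bar>y\<bar> \<le> M"
    using bounded_pos compact_imp_bounded by (metis real_norm_def)
  have fM: "\<bar>f (w t)\<bar> \<le> M" for t using M B[of t] by (auto simp: abs_le_iff)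
  have p0: "(p \<longlongrightarrow> 0) at_bot" using prof unfolding profile_def by blast
  have e0: "((\<lambda>t. M / 2 * exp (2 * t)) \<longlongrightarrow> M / 2 * 0) at_bot"
    by (intro tendsto_mult_left) real_asymp
  have d: "((\<lambda>t. M / 2 * exp (2 * t)) has_real_derivative M * exp (2 * t)) (at t)" for t
    by (auto intro!: derivative_eq_intros)
  have key: "- exp (2 * t) * f (w t) - M * exp (2 * t) \<le> 0" "- exp (2 * t) * f (w t) + M * exp (2 * t) \<ge> 0" for t
  proof -
    have "exp (2 * t) * (- f (w t) - M) \<le> 0" using fM[of t] by (intro mult_nonneg_nonpos) auto
    then show "- exp (2 * t) * f (w t) - M * exp (2 * t) \<le> 0" by (simp add: algebra_simps)
    have "exp (2 * t) * (- f (w t) + M) \<ge> 0" using fM[of t] by (intro mult_nonneg_nonneg) auto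
    then show "- exp (2 * t) * f (w t) + M * exp (2 * t) \<ge> 0" by (simp add: algebra_simps)
  qed
  have "p t - M / 2 * exp (2 * t) \<le> p s - M / 2 * exp (2 * s)" if "s \<le> t" for s t
    by (rule DERIV_nonpos_imp_nonincreasing[OF that, where f = "\<lambda>t. p t - M / 2 * exp (2 * t)"])
      (use DERIV_diff[OF DERIV_p d] key in blast)
  then have "eventually (\<lambda>s. p t - M / 2 * exp (2 * t) \<le> p s - M / 2 * exp (2 * s)) at_bot" for t
    by (auto simp: eventually_at_bot_linorder)
  then have 1: "p t - M / 2 * exp (2 * t) \<le> 0 - M / 2 * 0" for t
    using tendsto_diff[OF p0 e0] by (intro tendsto_lowerbound) auto
  have "p t + M / 2 * exp (2 * t) \<ge> p s + M / 2 * exp (2 * s)" if "s \<le> t" for s t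
    by (rule DERIV_nonneg_imp_nondecreasing[OF that, where f = "\<lambda>t. p t + M / 2 * exp (2 * t)"])
      (use DERIV_add[OF DERIV_p d] key in blast)
  then have "eventually (\<lambda>s. p s + M / 2 * exp (2 * s) \<le> p t + M / 2 * exp (2 * t)) at_bot" for t
    by (auto simp: eventually_at_bot_linorder)
  then have 2: "p t + M / 2 * exp (2 * t) \<ge> 0 + M / 2 * 0" for t
    using tendsto_add[OF p0 e0] by (intro tendsto_upperbound) auto
  have "\<bar>p t\<bar> \<le> M / 2 * exp (2 * t)" for t using 1[of t] 2[of t] by (simp add: abs_le_iff)
  then show ?thesis by (rule that)
qed

lemma profile_rho_bot: "((\<lambda>t. exp (- 2 * t) * (p t)\<^sup>2) \<longlongrightarrow> 0) at_bot" "((\<lambda>t. p t * exp (- t)) \<longlongrightarrow> 0) at_bot"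
proof -
  obtain K where K: "\<And>t. \<bar>p t\<bar> \<le> K * exp (2 * t)" using profile_p_bot by blast
  have e: "\<bar>p t * exp (- t)\<bar> \<le> K * exp t" for t
  proof -
    have "\<bar>p t * exp (- t)\<bar> \<le> (K * exp (2 * t)) * exp (- t)" using K[of t] by (simp add: abs_mult)
    also have "\<dots> = K * (exp (2 * t) * exp (- t))" by simp
    also have "exp (2 * t) * exp (- t) = exp t" unfolding exp_add[symmetric] by simp
    finally show ?thesis .
  qed
  have "((\<lambda>t. K * exp t) \<longlongrightarrow> K * 0) at_bot" by (intro tendsto_mult_left exp_at_bot)
  then have K0: "((\<lambda>t. K * exp t) \<longlongrightarrow> 0) at_bot" by simp
  have "eventually (\<lambda>t. norm (p t * exp (- t)) \<le> K * exp t) at_bot"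
    unfolding real_norm_def by (intro always_eventually allI e)
  from Lim_null_comparison[OF this K0] show l: "((\<lambda>t. p t * exp (- t)) \<longlongrightarrow> 0) at_bot" .
  have "(\<lambda>t. (p t * exp (- t))\<^sup>2) = (\<lambda>t. exp (- 2 * t) * (p t)\<^sup>2)"
    by (rule ext) (rule exp_minus_sq)
  with tendsto_power[OF l, of 2] show "((\<lambda>t. exp (- 2 * t) * (p t)\<^sup>2) \<longlongrightarrow> 0) at_bot"
    by (simp only: power_zero_numeral)
qed

text \<open>
  Above \<open>ze\<close> the solution is convex in \<open>t\<close>; extended along its tangent to one of the two sides it would stay above \<open>ze\<close>
  or become unbounded.
\<close>
lemma profile_le_ze: "w t \<le> ze"
proof (rule ccontr)
  assume n: "\<not> w t \<le> ze"
  obtain B where B: "\<And>t. \<bar>w t\<bar> \<le> B" using profile_bounded by blast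
  have d: "((\<lambda>t. w t - ze) has_real_derivative p t) (at t)" for t
    using DERIV_diff[OF DERIV_w DERIV_const] by simp
  have conv: "- exp (2 * u) * f (w u) \<ge> 0" if "w u - ze > 0" for u
    using f_neg2[of "w u"] that by (simp add: mult_nonneg_nonpos)
  show False
  proof (cases "p t \<ge> 0")
    case True
    have "w t - ze + p t * (u - t) \<le> w u - ze" if "t \<le> u" for u
      by (rule convex_barrier_forward[OF d DERIV_p conv _ True that]) (use n in auto)
    then have "w t \<le> w u" if "t \<le> u" for u using that True by (smt (verit) mult_nonneg_nonneg)
    then have "eventually (\<lambda>u. w t \<le> w u) at_top" by (auto simp: eventually_at_top_linorder)
    then have "w t \<le> 0" by (intro tendsto_lowerbound[OF profile_decay(1)]) auto
    then show False using profile_pos[of t] by simp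
  next
    case False
    define u where "u = t - (B + 1) / (- p t)"
    have "B \<ge> 0" using B[of t] by auto
    then have u: "u \<le> t" "p t * (t - u) = - (B + 1)" using False by (auto simp: u_def field_simps)
    have "w t - ze - p t * (t - u) \<le> w u - ze"
      by (rule convex_barrier_backward[OF d DERIV_p conv _ _ u(1)]) (use n False in auto)
    then show False using u(2) B[of u] profile_pos[of t] by auto
  qed
qed

lemma const_not_profile: "\<not> (\<forall>t. w t = c)"
proof
  assume c: "\<forall>t. w t = c"
  then have "(w \<longlongrightarrow> c) at_top" by (intro tendsto_eventually) auto
  from tendsto_unique[OF _ this profile_decay(1)] have "c = 0" by simp
  then show False using profile_pos c by (metis less_irrefl)
qed

lemma profile_lt_ze: "w t < ze"
proof (rule ccontr)
  assume "\<not> w t < ze"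
  then have eq: "w t = ze" using profile_le_ze[of t] by simp
  obtain B where B: "\<And>t. \<bar>w t\<bar> \<le> B" using profile_bounded by blast
  have "p t = 0" by (rule DERIV_local_max[OF DERIV_w, of 1]) (use eq profile_le_ze in auto)
  moreover have "\<bar>w u\<bar> \<le> max B \<bar>ze\<bar>" "\<bar>ze\<bar> \<le> max B \<bar>ze\<bar>" for u using B[of u] by auto
  ultimately have "w u = ze" for u
    using ode_unique_point[OF profile_ode radial_ode_const[OF f_ze], of "max B \<bar>ze\<bar>" t u] eq by auto
  then show False using const_not_profile by blast
qed

lemma profile_G_lim_pos:
  assumes a: "(w \<longlongrightarrow> a) at_bot" shows "G a > 0"
proof -
  have "((\<lambda>t. G (w t)) \<longlongrightarrow> G a) at_bot"
    using isCont_tendsto_compose[OF DERIV_isCont[OF DERIV_G] a] .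
  then have "(en \<longlongrightarrow> 0 / 2 + G a) at_bot"
    unfolding en_def[abs_def] by (intro tendsto_add tendsto_divide profile_rho_bot tendsto_const) auto
  moreover have "eventually (\<lambda>u. en 0 \<le> en u) at_bot" using en_antimono by (auto simp: eventually_at_bot_linorder)
  ultimately have "en 0 \<le> 0 / 2 + G a" by (intro tendsto_lowerbound) auto
  then show ?thesis using en_pos[of 0] by simp
qed

lemma profile_lim_bounds:
  assumes a: "(w \<longlongrightarrow> a) at_bot" shows "be < a" "a < ze"
proof -
  obtain B where B: "\<And>t. \<bar>w t\<bar> \<le> B" using profile_bounded by blast
  have "a \<le> ze" by (rule tendsto_upperbound[OF a]) (use profile_le_ze in auto)
  moreover have "0 \<le> a" by (rule tendsto_lowerbound[OF a]) (use profile_pos in \<open>auto intro!: always_eventually less_imp_le\<close>)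
  moreover have "a \<noteq> ze"
  proof
    assume "a = ze"
    have "((\<lambda>t. exp (- 2 * t) * (p t - 0)\<^sup>2 + (w t - ze)\<^sup>2) \<longlongrightarrow> 0 + (ze - ze)\<^sup>2) at_bot"
      using profile_rho_bot(1) a \<open>a = ze\<close> by (intro tendsto_intros) auto
    moreover have bd: "\<bar>w u\<bar> \<le> max B \<bar>ze\<bar>" "\<bar>ze\<bar> \<le> max B \<bar>ze\<bar>" for u using B[of u] by auto
    ultimately have "(gap w p (\<lambda>t. ze) (\<lambda>t. 0) \<longlongrightarrow> 0) at_bot"
      by (simp add: gap_def[OF profile_ode radial_ode_const[OF f_ze] bd, abs_def])
    from ode_unique_limit[OF profile_ode radial_ode_const[OF f_ze] bd this] have "w u = ze" for u .
    then show False using const_not_profile by blast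
  qed
  ultimately show "a < ze" "be < a"
    using profile_G_lim_pos[OF a] G_neg[of a] G_be G_0 by (cases "a = 0"; cases "a = be"; force)+
qed

text \<open>
  At a critical point the energy is \<open>G (w x)\<close>, so \<open>be < w x\<close> and the point is a strict local maximum. If the slope were
  nonnegative somewhere, it would hence be positive at all earlier times, whereas near \<open>-\<infinity>\<close> it decreases from \<open>0\<close>.
\<close>
lemma profile_p_neg: "p t < 0"
proof (rule ccontr)
  assume "\<not> p t < 0"
  obtain a where a: "(w \<longlongrightarrow> a) at_bot" using prof unfolding profile_def by blast
  have pos: "p u > 0" if "u < t" for u
  proof -
    have "- p u < 0"
    proof (rule neg_left_of_zero[OF that, where d = "\<lambda>t. - p t"])
      show "isCont (\<lambda>t. - p t) x" for x using DERIV_isCont[OF DERIV_p] by (intro continuous_minus)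
      fix x assume "- p x = 0"
      then have "G (w x) > 0" using en_pos[of x] unfolding en_def by simp
      then have "be < w x" using G_neg[of "w x"] G_be profile_pos[of x] by (cases "w x" be rule: linorder_cases) auto
      then have "f (w x) > 0" using f_pos[of "w x"] profile_lt_ze[of x] al_be by auto
      then show "\<exists>D>0. ((\<lambda>t. - p t) has_real_derivative D) (at x)"
        using DERIV_minus[OF DERIV_p[of x]] by (intro exI[of _ "exp (2 * x) * f (w x)"]) auto
    qed (use \<open>\<not> p t < 0\<close> in auto)
    then show ?thesis by simp
  qed
  have "eventually (\<lambda>u. be < w u) at_bot" using a profile_lim_bounds[OF a] by (intro order_tendstoD(1)) auto
  then obtain T where T: "\<And>u. u \<le> T \<Longrightarrow> be < w u" by (auto simp: eventually_at_bot_linorder)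
  define c where "c = min T (t - 1)"
  have "p c \<le> p u" if "u \<le> c" for u
  proof (rule DERIV_nonpos_imp_nonincreasing[OF that])
    fix x assume "u \<le> x" "x \<le> c"
    then have "f (w x) > 0" using f_pos[of "w x"] T[of x] profile_lt_ze[of x] al_be by (auto simp: c_def)
    then have "- exp (2 * x) * f (w x) \<le> 0" by simp
    then show "\<exists>D. (p has_real_derivative D) (at x) \<and> D \<le> 0" using DERIV_p by blast
  qed
  then have "eventually (\<lambda>u. p c \<le> p u) at_bot" by (auto simp: eventually_at_bot_linorder)
  moreover have "(p \<longlongrightarrow> 0) at_bot" using prof unfolding profile_def by blast
  ultimately have "p c \<le> 0" by (intro tendsto_lowerbound) auto
  moreover have "c < t" by (auto simp: c_def)
  ultimately show False using pos[of c] by simp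
qed

lemma profile_strict: "s < t \<Longrightarrow> w t < w s"
  by (rule DERIV_neg_imp_decreasing) (use DERIV_w profile_p_neg in blast)+

lemma profile_less_iff: "w t < w s \<longleftrightarrow> s < t"
  using profile_strict[of s t] profile_strict[of t s] by (cases s t rule: linorder_cases) auto

lemma profile_inj: "inj w"
  by (rule injI) (metis profile_less_iff linorder_neqE_linordered_idom less_irrefl)

lemma profile_surj:
  assumes a: "(w \<longlongrightarrow> a) at_bot" and s: "0 < s" "s < a"
  shows "w (inv w s) = s"
proof -
  have "eventually (\<lambda>t. w t < s) at_top" using profile_decay(1) s by (intro order_tendstoD(2)) auto
  then obtain v where v: "w v < s" by (auto simp: eventually_at_top_linorder)
  have "eventually (\<lambda>t. s < w t) at_bot" using a s by (intro order_tendstoD(1)) auto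
  then obtain u where u: "s < w u" by (auto simp: eventually_at_bot_linorder)
  have "u < v" using u v profile_less_iff by (meson less_trans)
  have "\<exists>x\<ge>u. x \<le> v \<and> w x = s"
    by (rule IVT2) (use u v \<open>u < v\<close> DERIV_isCont[OF DERIV_w] in auto)
  then show ?thesis by (metis f_inv_into_f rangeI)
qed

lemma profile_level:
  assumes a: "(w \<longlongrightarrow> a) at_bot"
  shows "level a (inv w) (\<lambda>s. - p (inv w s))"
proof -
  let ?T = "inv w"
  note b = profile_lim_bounds[OF a]
  have inv: "?T (w t) = t" for t by (simp add: profile_inj)
  have wT: "w (?T s) = s" if "0 < s" "s < a" for s using profile_surj[OF a that] .
  have wa: "w t < a" for t
  proof -
    have "eventually (\<lambda>u. w (t - 1) \<le> w u) at_bot"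
      using profile_strict by (auto simp: eventually_at_bot_dense intro!: exI[of _ "t - 1"] less_imp_le)
    then have "w (t - 1) \<le> a" by (intro tendsto_lowerbound[OF a]) auto
    then show ?thesis using profile_strict[of "t - 1" t] by simp
  qed
  have DT: "(?T has_real_derivative - 1 / - p (?T s)) (at s)" if s: "0 < s" "s < a" for s
  proof -
    have "isCont ?T (w (?T s))"
      by (rule isCont_inverse_function[of 1]) (use inv DERIV_isCont[OF DERIV_w] in auto)
    then have c: "isCont ?T s" using wT[OF s] by simp
    have "(?T has_real_derivative inverse (p (?T s))) (at s)"
      by (rule DERIV_inverse_function[where f = w and a = 0 and b = a])
        (use DERIV_w profile_p_neg[of "?T s"] s wT c in auto)
    then show ?thesis by (simp add: inverse_eq_divide)
  qed
  have Dq: "((\<lambda>s. - p (?T s)) has_real_derivative - exp (2 * ?T s) * f s / - p (?T s)) (at s)" if s: "0 < s" "s < a" for s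
    using DERIV_minus[OF DERIV_chain2[OF DERIV_p DT[OF s]]] wT[OF s] by simp
  have T_top: "filterlim ?T at_top (at_right 0)"
    unfolding filterlim_at_top
  proof
    fix M
    show "eventually (\<lambda>s. M \<le> ?T s) (at_right 0)"
    proof (rule eventually_at_rightI[of 0 "w M"])
      fix s assume "s \<in> {0<..<w M}"
      then have "w (?T s) < w M" using wT[of s] wa[of M] by auto
      then show "M \<le> ?T s" using profile_less_iff by simp
    qed (rule profile_pos)
  qed
  have T_bot: "filterlim ?T at_bot (at_left a)"
    unfolding filterlim_at_bot
  proof
    fix M
    show "eventually (\<lambda>s. ?T s \<le> M) (at_left a)"
    proof (rule eventually_at_leftI[of "w M"])
      fix s assume "s \<in> {w M<..<a}"
      then have "w M < w (?T s)" using wT[of s] profile_pos[of M] by auto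
      then show "?T s \<le> M" using profile_less_iff by simp
    qed (rule wa)
  qed
  have e0: "((\<lambda>t::real. exp (- t)) \<longlongrightarrow> 0) at_top" "((\<lambda>t::real. exp (2 * t)) \<longlongrightarrow> 0) at_bot" by real_asymp+
  have p0: "(p \<longlongrightarrow> 0) at_bot" using prof unfolding profile_def by blast
  have l1: "((\<lambda>t. - p t) \<longlongrightarrow> 0) at_top" "((\<lambda>t. - p t) \<longlongrightarrow> 0) at_bot"
    using tendsto_minus[OF profile_p_top] tendsto_minus[OF p0] by simp_all
  have l2: "((\<lambda>t. - p t * exp (- t)) \<longlongrightarrow> 0) at_top" "((\<lambda>t. - p t * exp (- t)) \<longlongrightarrow> 0) at_bot"
    using tendsto_mult[OF l1(1) e0(1)] tendsto_minus[OF profile_rho_bot(2)] by simp_all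
  have "((\<lambda>s. exp (2 * ?T s) * G (w (?T s))) \<longlongrightarrow> 0) (at_right 0)"
    by (rule filterlim_compose[OF profile_G_decay T_top])
  moreover have "eventually (\<lambda>s. exp (2 * ?T s) * G (w (?T s)) = exp (2 * ?T s) * G s) (at_right 0)"
    by (rule eventually_at_rightI[of 0 a]) (use wT b al_pos al_be in auto)
  ultimately have l3: "((\<lambda>s. exp (2 * ?T s) * G s) \<longlongrightarrow> 0) (at_right 0)" by (rule Lim_transform_eventually)
  show ?thesis unfolding level_def
    using b DT Dq profile_p_neg l3 filterlim_compose[OF l1(1) T_top] filterlim_compose[OF l1(2) T_bot]
      filterlim_compose[OF l2(1) T_top] filterlim_compose[OF l2(2) T_bot] filterlim_compose[OF e0(2) T_bot]
    by auto
qed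

end

text \<open>
  Profiles with different limits at \<open>-\<infinity>\<close> are excluded by \<open>level_unique\<close>, profiles with the same limit by uniqueness
  from initial values at the origin.
\<close>
theorem profile_unique:
  assumes prof1: "profile w1 p1" and prof2: "profile w2 p2"
  shows "w1 = w2"
proof (rule ccontr)
  assume "w1 \<noteq> w2"
  then obtain t0 where t0: "w1 t0 \<noteq> w2 t0" by auto
  obtain a1 where a1: "(w1 \<longlongrightarrow> a1) at_bot" using prof1 unfolding profile_def by blast
  obtain a2 where a2: "(w2 \<longlongrightarrow> a2) at_bot" using prof2 unfolding profile_def by blast
  obtain B1 where B1: "\<And>t. \<bar>w1 t\<bar> \<le> B1" using profile_bounded[OF prof1] by blast
  obtain B2 where B2: "\<And>t. \<bar>w2 t\<bar> \<le> B2" using profile_bounded[OF prof2] by blast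
  define B where "B = max B1 B2"
  have B: "\<bar>w1 t\<bar> \<le> B" "\<bar>w2 t\<bar> \<le> B" for t using B1[of t] B2[of t] by (auto simp: B_def)
  note ode = profile_ode[OF prof1] profile_ode[OF prof2]
  have distinct: "\<not> (inv w1 s = inv w2 s \<and> - p1 (inv w1 s) = - p2 (inv w2 s))" if s: "0 < s" "s < a1" "s < a2" for s
  proof
    assume eq: "inv w1 s = inv w2 s \<and> - p1 (inv w1 s) = - p2 (inv w2 s)"
    have "w1 (inv w1 s) = w2 (inv w1 s)" "p1 (inv w1 s) = p2 (inv w1 s)"
      using profile_surj[OF prof1 a1 s(1,2)] profile_surj[OF prof2 a2 s(1,3)] eq by auto
    from ode_unique_point[OF ode B this] t0 show False by blast
  qed
  have lev: "level a1 (inv w1) (\<lambda>s. - p1 (inv w1 s))" "level a2 (inv w2) (\<lambda>s. - p2 (inv w2 s))"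
    using profile_level[OF prof1 a1] profile_level[OF prof2 a2] by auto
  show False
  proof (cases a1 a2 rule: linorder_cases)
    case greater
    show False by (rule level_unique[OF lev greater]) (use distinct in blast)
  next
    case less
    show False by (rule level_unique[OF lev(2,1) less]) (use distinct in metis)
  next
    case equal
    have r: "((\<lambda>t. p1 t * exp (- t) - p2 t * exp (- t)) \<longlongrightarrow> 0 - 0) at_bot"
      by (intro tendsto_diff profile_rho_bot(2)[OF prof1] profile_rho_bot(2)[OF prof2])
    have eq: "gap w1 p1 w2 p2 t = (p1 t * exp (- t) - p2 t * exp (- t))\<^sup>2 + (w1 t - w2 t)\<^sup>2" for t
      unfolding gap_def[OF ode B] by (simp add: exp_minus_sq flip: left_diff_distrib)
    have "((\<lambda>t. (p1 t * exp (- t) - p2 t * exp (- t))\<^sup>2 + (w1 t - w2 t)\<^sup>2) \<longlongrightarrow> (0 - 0)\<^sup>2 + (a1 - a2)\<^sup>2) at_bot"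
      by (intro tendsto_intros r a1 a2)
    then have "((\<lambda>t. gap w1 p1 w2 p2 t) \<longlongrightarrow> 0) at_bot" using equal by (simp add: eq)
    from ode_unique_limit[OF ode B this] t0 show False by blast
  qed
qed

end

section \<open>Functions of finite Dirichlet energy on the line\<close>

text \<open>
  This expresses that the integral of \<open>w'\<^sup>2\<close> is at most \<open>M\<close> without mentioning a derivative: \<open>A t\<close> plays the role of the
  integral up to \<open>t\<close>, and the inequality is the Cauchy-Schwarz inequality on \<open>[s, t]\<close>. The notion passes to pointwise
  limits, and rearrangements satisfy it without being differentiable.
\<close>
definition fin_en :: "(real \<Rightarrow> real) \<Rightarrow> real \<Rightarrow> bool" where
  "fin_en w M \<longleftrightarrow> (\<exists>A. (\<forall>t. 0 \<le> A t \<and> A t \<le> M) \<and>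
     (\<forall>s t. s \<le> t \<longrightarrow> (w t - w s)\<^sup>2 \<le> (t - s) * (A t - A s)))"

lemma energy_density_mono:
  fixes A :: "real \<Rightarrow> real"
  assumes "\<And>s t. s \<le> t \<Longrightarrow> (w t - w s)\<^sup>2 \<le> (t - s) * (A t - A s)" "s \<le> t"
  shows "A s \<le> (A t :: real)"
proof (cases "s = t")
  case False
  then have "0 \<le> (t - s) * (A t - A s)" "t - s > 0" using assms order_trans[OF zero_le_power2] by auto
  then show ?thesis by (simp add: zero_le_mult_iff)
qed simp

lemma fin_en_holder:
  assumes "fin_en w M" shows "(w t - w s)\<^sup>2 \<le> M * \<bar>t - s\<bar>"
proof -
  obtain A where A: "\<And>t. 0 \<le> A t \<and> A t \<le> M" "\<And>s t. s \<le> t \<Longrightarrow> (w t - w s)\<^sup>2 \<le> (t - s) * (A t - A s)"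
    using assms unfolding fin_en_def by blast
  have key: "(w t - w s)\<^sup>2 \<le> M * \<bar>t - s\<bar>" if "s \<le> t" for s t
  proof -
    have "(t - s) * (A t - A s) \<le> (t - s) * M" using A(1)[of t] A(1)[of s] that by (intro mult_left_mono) auto
    then show ?thesis using A(2)[OF that] that by (simp add: mult.commute)
  qed
  show ?thesis using key[of s t] key[of t s] by (cases "s \<le> t") (auto simp: power2_commute abs_minus_commute)
qed

lemma fin_en_nonneg: "fin_en w M \<Longrightarrow> 0 \<le> M"
  unfolding fin_en_def by (meson order_trans)

lemma isCont_of_holder:
  assumes "\<And>s t. (w t - w s)\<^sup>2 \<le> M * \<bar>t - s :: real\<bar>" shows "isCont w (t::real)"
proof -
  have "((\<lambda>s. sqrt (M * \<bar>s - t\<bar>)) \<longlongrightarrow> sqrt (M * \<bar>t - t\<bar>)) (at t)" by (intro tendsto_intros)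
  then have "((\<lambda>s. sqrt (M * \<bar>s - t\<bar>)) \<longlongrightarrow> 0) (at t)" by simp
  moreover have "norm (w s - w t) \<le> sqrt (M * \<bar>s - t\<bar>)" for s
    unfolding real_norm_def by (rule real_le_rsqrt) (use assms[of s t] in simp)
  then have "eventually (\<lambda>s. norm (w s - w t) \<le> sqrt (M * \<bar>s - t\<bar>)) (at t)"
    by (intro always_eventually allI)
  ultimately have "((\<lambda>s. w s - w t) \<longlongrightarrow> 0) (at t)" by (rule Lim_null_comparison[rotated])
  then show ?thesis by (simp add: isCont_def LIM_zero_iff)
qed

lemma fin_en_isCont: "fin_en w M \<Longrightarrow> isCont w t"
  by (rule isCont_of_holder[OF fin_en_holder])

lemma fin_en_measurable [measurable_dest]: "fin_en w M \<Longrightarrow> w \<in> borel_measurable borel"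
  by (intro borel_measurable_continuous_onI continuous_at_imp_continuous_on) (auto intro: fin_en_isCont)

lemma fin_en_shift:
  assumes "fin_en w M" shows "fin_en (\<lambda>t. w (t + T)) M"
proof -
  obtain A where A: "\<And>t. 0 \<le> A t \<and> A t \<le> M" "\<And>s t. s \<le> t \<Longrightarrow> (w t - w s)\<^sup>2 \<le> (t - s) * (A t - A s)"
    using assms unfolding fin_en_def by blast
  have "(w (t + T) - w (s + T))\<^sup>2 \<le> (t - s) * (A (t + T) - A (s + T))" if "s \<le> t" for s t
    using A(2)[of "s + T" "t + T"] that by simp
  then show ?thesis unfolding fin_en_def using A(1) by (intro exI[of _ "\<lambda>t. A (t + T)"]) blast
qed

lemma sq_add_le:
  fixes a b x y A B :: real
  assumes "a\<^sup>2 \<le> x * A" "b\<^sup>2 \<le> y * B" "0 \<le> x" "0 \<le> y" "0 \<le> A" "0 \<le> B"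
  shows "(a + b)\<^sup>2 \<le> (x + y) * (A + B)"
proof -
  have "(a * b)\<^sup>2 \<le> (x * A) * (y * B)"
    unfolding power_mult_distrib using assms by (intro mult_mono) auto
  also have "\<dots> = (x * B) * (y * A)" by simp
  also have "4 * \<dots> \<le> (x * B + y * A)\<^sup>2"
    using sum_squares_ge_zero[of "x * B - y * A" 0] by (simp add: power2_eq_square algebra_simps)
  finally have "(2 * (a * b))\<^sup>2 \<le> (x * B + y * A)\<^sup>2" by (simp add: power_mult_distrib)
  moreover have "0 \<le> x * B + y * A" using assms(3-6) by simp
  ultimately have "2 * (a * b) \<le> x * B + y * A" by (rule power2_le_imp_le)
  moreover have "(a + b)\<^sup>2 = a\<^sup>2 + b\<^sup>2 + 2 * (a * b)" "(x + y) * (A + B) = x * A + y * B + (x * B + y * A)"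
    by (simp_all add: power2_eq_square algebra_simps)
  ultimately show ?thesis using assms(1,2) by linarith
qed

definition clamp_on :: "real \<Rightarrow> real \<Rightarrow> real \<Rightarrow> real" where "clamp_on a b t = max a (min t b)"

text \<open>
  Adding a piece of slope \<open>d\<close> on \<open>[a, b]\<close> changes \<open>w'\<^sup>2\<close> to \<open>w'\<^sup>2 + 2 * d * w' + d\<^sup>2\<close> there.
\<close>
lemma fin_en_ramp:
  assumes en: "fin_en w M" and ab: "a \<le> b"
  shows "fin_en (\<lambda>t. w t + d * clamp_on a b t) (M + 2 * d * (w b - w a) + d\<^sup>2 * (b - a))"
proof -
  obtain A where A: "\<And>t. 0 \<le> A t \<and> A t \<le> M" "\<And>s t. s \<le> t \<Longrightarrow> (w t - w s)\<^sup>2 \<le> (t - s) * (A t - A s)"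
    using en unfolding fin_en_def by blast
  have mono: "A s \<le> A t" if "s \<le> t" for s t
    by (rule energy_density_mono[of w A]) (use A(2) that in auto)
  let ?k = "clamp_on a b"
  define A' where "A' t = A t + 2 * d * (w (?k t) - w a) + d\<^sup>2 * (?k t - a)" for t
  have inside: "((w t + d * t) - (w s + d * s))\<^sup>2 \<le> (t - s) * ((A t + 2 * d * w t + d\<^sup>2 * t) - (A s + 2 * d * w s + d\<^sup>2 * s))"
    if "s \<le> t" for s t
  proof -
    have "((w t + d * t) - (w s + d * s))\<^sup>2 = (w t - w s)\<^sup>2 + (t - s) * (2 * d * (w t - w s) + d\<^sup>2 * (t - s))"
      by algebra
    moreover have "(t - s) * ((A t + 2 * d * w t + d\<^sup>2 * t) - (A s + 2 * d * w s + d\<^sup>2 * s))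
      = (t - s) * (A t - A s) + (t - s) * (2 * d * (w t - w s) + d\<^sup>2 * (t - s))"
      by algebra
    ultimately show ?thesis using A(2)[OF that] by linarith
  qed
  have ineq: "((w t + d * ?k t) - (w s + d * ?k s))\<^sup>2 \<le> (t - s) * (A' t - A' s)" if st: "s \<le> t" for s t
  proof (cases "t \<le> a \<or> b \<le> s")
    case True
    then have "?k t = ?k s" using st ab by (auto simp: clamp_on_def)
    then show ?thesis using A(2)[OF st] by (simp add: A'_def)
  next
    case False
    define s' where "s' = ?k s"
    define t' where "t' = ?k t"
    have le: "s \<le> s'" "s' \<le> t'" "t' \<le> t" using False st ab by (auto simp: s'_def t'_def clamp_on_def)
    define I where "I = (A t' + 2 * d * w t' + d\<^sup>2 * t') - (A s' + 2 * d * w s' + d\<^sup>2 * s')"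
    have i1: "((w t' + d * t') - (w s' + d * s'))\<^sup>2 \<le> (t' - s') * I" unfolding I_def by (rule inside[OF le(2)])
    have I0: "0 \<le> I"
    proof (cases "s' = t'")
      case False
      have "0 \<le> (t' - s') * I" by (rule order_trans[OF zero_le_power2 i1])
      then show ?thesis using False le(2) by (simp add: zero_le_mult_iff)
    qed (simp add: I_def)
    have "((w s' - w s) + ((w t' + d * t') - (w s' + d * s')))\<^sup>2 \<le> ((s' - s) + (t' - s')) * ((A s' - A s) + I)"
      by (rule sq_add_le[OF A(2)[OF le(1)] i1]) (use le mono[OF le(1)] I0 in auto)
    moreover have "0 \<le> (A s' - A s) + I" using mono[OF le(1)] I0 by simp
    ultimately have "(((w s' - w s) + ((w t' + d * t') - (w s' + d * s'))) + (w t - w t'))\<^sup>2 \<le>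
        (((s' - s) + (t' - s')) + (t - t')) * (((A s' - A s) + I) + (A t - A t'))"
      by (intro sq_add_le[OF _ A(2)[OF le(3)]]) (use le mono[OF le(3)] in auto)
    moreover have "((s' - s) + (t' - s')) + (t - t') = t - s" by simp
    moreover have "((A s' - A s) + I) + (A t - A t') = A' t - A' s"
      unfolding I_def A'_def s'_def[symmetric] t'_def[symmetric] by (simp add: algebra_simps)
    moreover have "((w s' - w s) + ((w t' + d * t') - (w s' + d * s'))) + (w t - w t') = (w t + d * ?k t) - (w s + d * ?k s)"
      unfolding s'_def[symmetric] t'_def[symmetric] by simp
    ultimately show ?thesis by (simp only:)
  qed
  have mono': "A' s \<le> A' t" if "s \<le> t" for s t 
    by (rule energy_density_mono[of "\<lambda>t. w t + d * ?k t" A']) (use ineq that in auto)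
  have "0 \<le> A' t" for t
  proof -
    have "A' (min t (a - 1)) = A (min t (a - 1))" using ab by (simp add: A'_def clamp_on_def)
    then have "0 \<le> A' (min t (a - 1))" using A(1) by simp
    then show ?thesis using mono'[of "min t (a - 1)" t] by simp
  qed
  moreover have "A' t \<le> M + 2 * d * (w b - w a) + d\<^sup>2 * (b - a)" for t
  proof -
    have "A' (max t (b + 1)) = A (max t (b + 1)) + 2 * d * (w b - w a) + d\<^sup>2 * (b - a)"
      using ab by (simp add: A'_def clamp_on_def)
    then show ?thesis using A(1)[of "max t (b + 1)"] mono'[of t "max t (b + 1)"] by simp
  qed
  ultimately show ?thesis unfolding fin_en_def using ineq by (intro exI[of _ A']) auto
qed

lemma fin_en_add_const: "fin_en w M \<Longrightarrow> fin_en (\<lambda>t. w t + c) M"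
  unfolding fin_en_def by simp

definition hat :: "real \<Rightarrow> real \<Rightarrow> real \<Rightarrow> real" where "hat c h t = max 0 (1 - \<bar>t - c\<bar> / h)"

lemma hat_clamp:
  assumes "h > 0"
  shows "hat c h t = (1 / h) * clamp_on (c - h) c t + (- 1 / h) * clamp_on c (c + h) t + 1"
proof -
  have "hat c h t * h = clamp_on (c - h) c t - clamp_on c (c + h) t + h"
    using assms by (auto simp: hat_def clamp_on_def max_def min_def field_simps abs_if)
  then show ?thesis using assms by (simp add: field_simps)
qed

text \<open>
  The first-order change of the energy in the direction of a hat function is a second difference of \<open>w\<close>.
\<close>
lemma fin_en_hat:
  assumes en: "fin_en w M" and h: "h > 0"
  shows "fin_en (\<lambda>t. w t + e * hat c h t) (M + e * (2 * (2 * w c - w (c - h) - w (c + h)) / h) + e\<^sup>2 * (2 / h))"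
proof -
  let ?w1 = "\<lambda>t. w t + (e / h) * clamp_on (c - h) c t"
  have 1: "fin_en ?w1 (M + 2 * (e / h) * (w c - w (c - h)) + (e / h)\<^sup>2 * (c - (c - h)))"
    by (rule fin_en_ramp[OF en]) (use h in simp)
  have "fin_en (\<lambda>t. ?w1 t + (- e / h) * clamp_on c (c + h) t)
     (M + 2 * (e / h) * (w c - w (c - h)) + (e / h)\<^sup>2 * (c - (c - h)) + 2 * (- e / h) * (?w1 (c + h) - ?w1 c) + (- e / h)\<^sup>2 * (c + h - c))"
    by (rule fin_en_ramp[OF 1]) (use h in simp)
  from fin_en_add_const[OF this, of e]
  have 2: "fin_en (\<lambda>t. w t + (e / h) * clamp_on (c - h) c t + (- e / h) * clamp_on c (c + h) t + e)
     (M + 2 * (e / h) * (w c - w (c - h)) + (e / h)\<^sup>2 * (c - (c - h)) + 2 * (- e / h) * (?w1 (c + h) - ?w1 c) + (- e / h)\<^sup>2 * (c + h - c))" .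
  have eq1: "w t + (e / h) * clamp_on (c - h) c t + (- e / h) * clamp_on c (c + h) t + e = w t + e * hat c h t" for t
    unfolding hat_clamp[OF h] by (simp add: algebra_simps)
  have w1: "?w1 (c + h) - ?w1 c = w (c + h) - w c" using h by (simp add: clamp_on_def)
  have eq2: "M + 2 * (e / h) * (w c - w (c - h)) + (e / h)\<^sup>2 * (c - (c - h)) + 2 * (- e / h) * (w (c + h) - w c) + (- e / h)\<^sup>2 * (c + h - c)
       = M + e * (2 * (2 * w c - w (c - h) - w (c + h)) / h) + e\<^sup>2 * (2 / h)"
    using h by (simp add: power2_eq_square field_simps)
  show ?thesis using 2 unfolding eq1 w1 eq2 .
qed

text \<open>
  A diagonal argument makes the functions and their energy functions \<open>A\<close> converge at all rational points. By
  equicontinuity the former then converge everywhere; the limits of the latter are extended from the rationals by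
  suprema, which preserves the inequality because the limit function is continuous.
\<close>
lemma fin_en_limit:
  fixes w :: "nat \<Rightarrow> real \<Rightarrow> real"
  assumes en: "\<And>n. fin_en (w n) (M n)" and M: "M \<longlonglongrightarrow> m" and w0: "\<And>n. w n 0 = b"
  obtains k v where "strict_mono k" "\<And>t. (\<lambda>n. w (k n) t) \<longlonglongrightarrow> v t" "fin_en v m"
proof -
  obtain A where A: "\<And>n t. 0 \<le> A n t \<and> A n t \<le> M n" "\<And>n s t. s \<le> t \<Longrightarrow> (w n t - w n s)\<^sup>2 \<le> (t - s) * (A n t - A n s)"
    using en unfolding fin_en_def by metis
  obtain B0 where B0: "\<And>n. norm (M n) \<le> B0" using convergent_imp_Bseq[of M] M convergent_def unfolding Bseq_def by blast
  define B where "B = max 1 B0"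
  have MB: "M n \<le> B" for n using B0[of n] by (auto simp: B_def)
  have B1: "B \<ge> 1" by (simp add: B_def)
  have hold: "(w n t - w n s)\<^sup>2 \<le> B * \<bar>t - s\<bar>" for n s t
    using fin_en_holder[OF en, of n t s] MB[of n] by (smt (verit) abs_ge_zero mult_right_mono)
  \<comment> \<open>A common bound for all the functions at \<open>t\<close>; dividing by it makes the sequence uniformly bounded.\<close>
  define D where "D t = \<bar>b\<bar> + B + \<bar>t\<bar>" for t :: real
  have D: "D t > 0" for t using B1 by (simp add: D_def)
  have wD: "\<bar>w n t\<bar> \<le> D t" for n t
  proof -
    have "\<bar>w n t - b\<bar>\<^sup>2 \<le> B * \<bar>t\<bar>" using hold[of n t 0] w0 by simp
    also have "\<dots> \<le> B * \<bar>t\<bar> + (B\<^sup>2 + B * \<bar>t\<bar> + \<bar>t\<bar>\<^sup>2)" using B1 by simp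
    also have "\<dots> = (B + \<bar>t\<bar>)\<^sup>2" by (simp add: power2_sum)
    finally have sq: "\<bar>w n t - b\<bar>\<^sup>2 \<le> (B + \<bar>t\<bar>)\<^sup>2" .
    have "0 \<le> B + \<bar>t\<bar>" using B1 by simp
    with sq have "\<bar>w n t - b\<bar> \<le> B + \<bar>t\<bar>" by (rule power2_le_imp_le)
    then show ?thesis unfolding D_def by linarith
  qed
  define F where "F n t = (w n t / D t, A n t / B)" for n t
  have Fb: "norm (F n t) \<le> 1 + 1" for n t
  proof -
    have "norm (F n t) \<le> norm (w n t / D t) + norm (A n t / B)" unfolding F_def by (rule norm_Pair_le)
    moreover have "norm (w n t / D t) \<le> 1" using wD[of n t] D[of t] by simp
    moreover have "norm (A n t / B) \<le> 1" using A(1)[of n t] MB[of n] B1 by simp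
    ultimately show ?thesis by linarith
  qed
  obtain k where k: "strict_mono k" "\<And>q. q \<in> \<rat> \<Longrightarrow> \<exists>l. (\<lambda>n. F (k n) q) \<longlonglongrightarrow> l"
    by (rule function_convergent_subsequence[OF countable_rat, of F "1 + 1"]) (use Fb in auto)
  have wq: "convergent (\<lambda>n. w (k n) q)" and Aq: "convergent (\<lambda>n. A (k n) q)" if q: "q \<in> \<rat>" for q
  proof -
    obtain l where l: "(\<lambda>n. F (k n) q) \<longlonglongrightarrow> l" using k(2)[OF q] by blast
    have "(\<lambda>n. D q * fst (F (k n) q)) \<longlonglongrightarrow> D q * fst l" using l by (intro tendsto_intros)
    then show "convergent (\<lambda>n. w (k n) q)" using D[of q] by (auto simp: F_def convergent_def)
    have "(\<lambda>n. B * snd (F (k n) q)) \<longlonglongrightarrow> B * snd l" using l by (intro tendsto_intros)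
    then show "convergent (\<lambda>n. A (k n) q)" using B1 by (auto simp: F_def convergent_def)
  qed
  have rat_between: "\<exists>q\<in>\<rat>. x < q \<and> q < y" if "x < y" for x y :: real using Rats_dense_in_real[OF that] by auto
  have conv: "convergent (\<lambda>n. w (k n) t)" for t
  proof (rule Cauchy_convergent, rule CauchyI')
    fix e :: real assume e: "e > 0"
    obtain q where q: "q \<in> \<rat>" "t < q" "q < t + (e / 4)\<^sup>2 / B" using rat_between[of t "t + (e / 4)\<^sup>2 / B"] e B1 by auto
    have near: "\<bar>w n t - w n q\<bar> \<le> e / 4" for n
    proof -
      have "\<bar>w n t - w n q\<bar>\<^sup>2 \<le> B * (q - t)" using hold[of n t q] q by simp
      also have "\<dots> \<le> B * ((e / 4)\<^sup>2 / B)" using q B1 by (intro mult_left_mono) auto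
      finally have "\<bar>w n t - w n q\<bar>\<^sup>2 \<le> (e / 4)\<^sup>2" using B1 by simp
      then show ?thesis by (rule power2_le_imp_le) (use e in simp)
    qed
    obtain N where N: "\<And>m n. m \<ge> N \<Longrightarrow> n \<ge> N \<Longrightarrow> dist (w (k m) q) (w (k n) q) < e / 4"
      using convergent_Cauchy[OF wq[OF q(1)]] e unfolding Cauchy_def by (meson divide_pos_pos zero_less_numeral)
    show "\<exists>M. \<forall>m\<ge>M. \<forall>n>m. dist (w (k m) t) (w (k n) t) < e"
    proof (intro exI[of _ N] allI impI)
      fix m n assume "m \<ge> N" "n > m"
      then have "\<bar>w (k m) q - w (k n) q\<bar> < e / 4" using N[of m n] by (simp add: dist_real_def)
      then show "dist (w (k m) t) (w (k n) t) < e"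
        using near[of "k m"] near[of "k n"] e unfolding dist_real_def by linarith
    qed
  qed
  define v where "v t = lim (\<lambda>n. w (k n) t)" for t
  have v: "(\<lambda>n. w (k n) t) \<longlonglongrightarrow> v t" for t using conv[of t] by (simp add: v_def convergent_LIMSEQ_iff)
  define a where "a q = lim (\<lambda>n. A (k n) q)" for q
  have a: "(\<lambda>n. A (k n) q) \<longlonglongrightarrow> a q" if "q \<in> \<rat>" for q using Aq[OF that] by (simp add: a_def convergent_LIMSEQ_iff)
  have Mk: "(\<lambda>n. M (k n)) \<longlonglongrightarrow> m" using LIMSEQ_subseq_LIMSEQ[OF M k(1)] by (simp add: o_def)
  have a01: "0 \<le> a q" "a q \<le> m" if "q \<in> \<rat>" for q
    using LIMSEQ_le_const[OF a[OF that], of 0] LIMSEQ_le[OF a[OF that] Mk] A(1) by auto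
  have ineq_q: "(v t - v s)\<^sup>2 \<le> (t - s) * (a t - a s)" if "s \<in> \<rat>" "t \<in> \<rat>" "s \<le> t" for s t
  proof (rule LIMSEQ_le)
    show "(\<lambda>n. (w (k n) t - w (k n) s)\<^sup>2) \<longlonglongrightarrow> (v t - v s)\<^sup>2" by (intro tendsto_intros v)
    show "(\<lambda>n. (t - s) * (A (k n) t - A (k n) s)) \<longlonglongrightarrow> (t - s) * (a t - a s)" by (intro tendsto_intros a that)
  qed (use A(2)[OF that(3)] in auto)
  have a_mono: "a s \<le> a t" if "s \<in> \<rat>" "t \<in> \<rat>" "s \<le> t" for s t
  proof (cases "s = t")
    case False
    then have "0 \<le> (t - s) * (a t - a s)" "t - s > 0" using ineq_q[OF that] that order_trans[OF zero_le_power2] by auto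
    then show ?thesis by (simp add: zero_le_mult_iff)
  qed simp
  have v_hold: "(v t - v s)\<^sup>2 \<le> B * \<bar>t - s\<bar>" for s t
    by (rule LIMSEQ_le_const2[of "\<lambda>n. (w (k n) t - w (k n) s)\<^sup>2"]) (use hold v in \<open>auto intro!: tendsto_intros\<close>)
  have v_cont: "isCont v t" for t by (rule isCont_of_holder[OF v_hold])
  define A' where "A' t = Sup (a ` {q \<in> \<rat>. q < t})" for t
  have bdd: "bdd_above (a ` {q \<in> \<rat>. q < t})" for t using a01 by (auto simp: bdd_above_def)
  have ne: "{q \<in> \<rat>. q < t} \<noteq> {}" for t :: real using rat_between[of "t - 1" t] by auto
  have A'_ge: "a q \<le> A' t" if "q \<in> \<rat>" "q < t" for q t unfolding A'_def by (rule cSup_upper) (use that bdd in auto)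
  have A'_le: "A' t \<le> a q" if "q \<in> \<rat>" "t \<le> q" for q t
    unfolding A'_def by (rule cSup_least) (use ne that a_mono in auto)
  have bounds: "0 \<le> A' t \<and> A' t \<le> m" for t
  proof
    obtain q where "q \<in> \<rat>" "q < t" using ne[of t] by auto
    then show "0 \<le> A' t" using a01(1)[of q] A'_ge[of q t] by simp
    show "A' t \<le> m" unfolding A'_def by (rule cSup_least) (use ne a01 in auto)
  qed
  have "(v t - v s)\<^sup>2 \<le> (t - s) * (A' t - A' s)" if st: "s \<le> t" for s t
  proof (cases "s = t")
    case False
    with st have st: "s < t" by simp
    define d where "d = (t - s) / 2"
    have d: "d > 0" using st by (simp add: d_def)
    have "\<forall>n. \<exists>q\<in>\<rat>. s < q \<and> q < s + d / real (Suc n)" using rat_between d by auto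
    then obtain x where x: "\<And>n. x n \<in> \<rat>" "\<And>n. s < x n" "\<And>n. x n < s + d / real (Suc n)" by metis
    have "\<forall>n. \<exists>q\<in>\<rat>. t - d / real (Suc n) < q \<and> q < t" using rat_between d by auto
    then obtain y where y: "\<And>n. y n \<in> \<rat>" "\<And>n. t - d / real (Suc n) < y n" "\<And>n. y n < t" by metis
    have dn: "d / real (Suc n) \<le> d" for n using d by (simp add: field_simps)
    have xy: "x n \<le> y n" for n 
    proof -
      have "x n < s + d" by (rule less_le_trans[OF x(3) add_left_mono[OF dn]])
      moreover have "t - d < y n" by (rule le_less_trans[OF diff_left_mono[OF dn] y(2)])
      moreover have "s + d = t - d" by (simp add: d_def field_simps)
      ultimately show ?thesis by simp
    qed
    have d0: "(\<lambda>n. d / real (Suc n)) \<longlonglongrightarrow> 0" by real_asymp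
    have xl: "x \<longlonglongrightarrow> s"
    proof (rule tendsto_sandwich[of "\<lambda>_. s" _ _ "\<lambda>n. s + d / real (Suc n)"])
      show "(\<lambda>n. s + d / real (Suc n)) \<longlonglongrightarrow> s" using tendsto_add[OF tendsto_const d0, of s] by simp
    qed (use x in \<open>auto intro!: always_eventually less_imp_le\<close>)
    have yl: "y \<longlonglongrightarrow> t"
    proof (rule tendsto_sandwich[of "\<lambda>n. t - d / real (Suc n)" _ _ "\<lambda>_. t"])
      show "(\<lambda>n. t - d / real (Suc n)) \<longlonglongrightarrow> t" using tendsto_diff[OF tendsto_const d0, of t] by simp
    qed (use y in \<open>auto intro!: always_eventually less_imp_le\<close>)
    show ?thesis
    proof (rule LIMSEQ_le_const2)
      show "(\<lambda>n. (v (y n) - v (x n))\<^sup>2) \<longlonglongrightarrow> (v t - v s)\<^sup>2"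
        by (intro tendsto_intros isCont_tendsto_compose[OF v_cont] xl yl)
      show "\<exists>N. \<forall>n\<ge>N. (v (y n) - v (x n))\<^sup>2 \<le> (t - s) * (A' t - A' s)"
      proof (intro exI allI impI)
        fix n
        have "(v (y n) - v (x n))\<^sup>2 \<le> (y n - x n) * (a (y n) - a (x n))" by (rule ineq_q[OF x(1) y(1) xy])
        also have "\<dots> \<le> (t - s) * (A' t - A' s)"
          using x(2)[of n] y(3)[of n] xy[of n] a_mono[OF x(1) y(1) xy, of n] A'_ge[OF y(1)[of n] y(3)[of n]] A'_le[OF x(1)[of n], of s]
          by (intro mult_mono) auto
        finally show "(v (y n) - v (x n))\<^sup>2 \<le> (t - s) * (A' t - A' s)" .
      qed
    qed
  qed simp
  then have "fin_en v m" unfolding fin_en_def using bounds by (intro exI[of _ A']) auto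
  then show ?thesis using that k(1) v by blast
qed

text \<open>
  Fatou's lemma for the squared difference quotients, whose integrals are bounded by those of the difference quotients
  of \<open>A\<close>.
\<close>
lemma fin_en_deriv_square_integral:
  assumes en: "fin_en w M" and d: "\<And>t. (w has_real_derivative p t) (at t)" and pc: "\<And>t. isCont p t"
  shows "integrable lborel (\<lambda>t. (p t)\<^sup>2)" "(LINT t|lborel. (p t)\<^sup>2) \<le> M"
proof -
  obtain A where A: "\<And>t. 0 \<le> A t \<and> A t \<le> M" "\<And>s t. s \<le> t \<Longrightarrow> (w t - w s)\<^sup>2 \<le> (t - s) * (A t - A s)"
    using en unfolding fin_en_def by blast
  have M0: "0 \<le> M" by (rule fin_en_nonneg[OF en])
  have A_mono: "A s \<le> A t" if "s \<le> t" for s t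
    by (rule energy_density_mono[of w A]) (use A(2) that in auto)
  then have "mono A" by (intro monoI)
  then have Am [measurable]: "A \<in> borel_measurable borel" by (rule borel_measurable_mono)
  have wm [measurable]: "w \<in> borel_measurable borel" using en by (rule fin_en_measurable)
  have pm [measurable]: "p \<in> borel_measurable borel"
    by (intro borel_measurable_continuous_onI continuous_at_imp_continuous_on) (auto intro: pc)
  define h where "h n = 1 / real (Suc n)" for n
  have h: "h n > 0" for n by (simp add: h_def)
  define F where "F n t = indicator {- real n..real n} t * ((w (t + h n) - w t) / h n)\<^sup>2" for n t
  have Fm [measurable]: "F n \<in> borel_measurable borel" for n unfolding F_def by measurable
  have F_int: "(\<integral>\<^sup>+t. ennreal (F n t) \<partial>lborel) \<le> ennreal M" for n
  proof -
    have i0: "integrable lborel (\<lambda>t. M * indicator {- real n..real n} t)" by simp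
    have ile: "integrable lborel (\<lambda>t. indicator {- real n..real n} t * A (t + c))" for c
    proof (rule Bochner_Integration.integrable_bound[OF i0])
      have "norm (indicator {- real n..real n} t * A (t + c)) \<le> norm (M * indicator {- real n..real n} t)" for t
        using A(1)[of "t + c"] by (auto simp: indicator_def)
      then show "AE t in lborel. norm (indicator {- real n..real n} t * A (t + c)) \<le> norm (M * indicator {- real n..real n} t)"
        by (intro AE_I2)
    qed simp
    have iA: "integrable lborel (\<lambda>t. indicator {- real n..real n} t * A t)" using ile[of 0] by simp
    have shift: "(LINT t|lborel. indicator {- real n..real n} t * A (t + h n)) = (LINT t|lborel. indicator {- real n..real n} (t - h n) * A t)"
      using lborel_integral_real_affine[of 1 "\<lambda>t. indicator {- real n..real n} (t - h n) * A t" "h n"] by (simp add: add.commute)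
    have iS: "integrable lborel (\<lambda>t. indicator {- real n..real n} (t - h n) * A t)"
      using lborel_integrable_real_affine_iff[of 1 "\<lambda>t. indicator {- real n..real n} (t - h n) * A t" "h n"] ile[of "h n"]
      by (simp add: add.commute)
    have "(LINT t|lborel. indicator {- real n..real n} t * (A (t + h n) - A t))
       = (LINT t|lborel. indicator {- real n..real n} t * A (t + h n)) - (LINT t|lborel. indicator {- real n..real n} t * A t)"
      by (subst Bochner_Integration.integral_diff[symmetric, OF ile iA]) (simp add: algebra_simps)
    also have "\<dots> = (LINT t|lborel. indicator {- real n..real n} (t - h n) * A t - indicator {- real n..real n} t * A t)"
      unfolding shift by (rule Bochner_Integration.integral_diff[symmetric, OF iS iA])
    also have "\<dots> \<le> (LINT t|lborel. M * indicator {real n..real n + h n} t)"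
    proof (rule integral_mono)
      show "integrable lborel (\<lambda>t. indicator {- real n..real n} (t - h n) * A t - indicator {- real n..real n} t * A t)"
        using iS iA by simp
      fix t show "indicator {- real n..real n} (t - h n) * A t - indicator {- real n..real n} t * A t \<le> M * indicator {real n..real n + h n} t"
        using A(1)[of t] h[of n] M0 by (auto simp: indicator_def)
      show "integrable lborel (\<lambda>t. M * indicator {real n..real n + h n} t)"
        by (intro integrable_mult_right integrable_real_indicator) (auto simp: emeasure_lborel_Icc_eq)
    qed
    also have "\<dots> = M * h n" using h[of n] by simp
    finally have le: "(LINT t|lborel. indicator {- real n..real n} t * (A (t + h n) - A t)) \<le> M * h n" .
    have int: "integrable lborel (\<lambda>t. indicator {- real n..real n} t * (A (t + h n) - A t) / h n)"
      using Bochner_Integration.integrable_diff[OF ile iA] by (simp add: right_diff_distrib)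
    have "(\<integral>\<^sup>+t. ennreal (F n t) \<partial>lborel) \<le> (\<integral>\<^sup>+t. ennreal (indicator {- real n..real n} t * (A (t + h n) - A t) / h n) \<partial>lborel)"
    proof (intro nn_integral_mono ennreal_leI)
      fix t
      have "(w (t + h n) - w t)\<^sup>2 / (h n)\<^sup>2 \<le> (h n * (A (t + h n) - A t)) / (h n)\<^sup>2"
        using A(2)[of t "t + h n"] h[of n] by (intro divide_right_mono) auto
      then have "((w (t + h n) - w t) / h n)\<^sup>2 \<le> (A (t + h n) - A t) / h n"
        using h[of n] by (simp add: power_divide power2_eq_square)
      then show "F n t \<le> indicator {- real n..real n} t * (A (t + h n) - A t) / h n"
        unfolding F_def by (auto simp: indicator_def)
    qed
    also have "\<dots> = ennreal (LINT t|lborel. indicator {- real n..real n} t * (A (t + h n) - A t) / h n)"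
      by (rule nn_integral_eq_integral[OF int])
        (use h[of n] in \<open>auto simp: indicator_def intro!: divide_nonneg_nonneg AE_I2 A_mono\<close>)
    also have "\<dots> \<le> ennreal M"
      using le h[of n] by (intro ennreal_leI) (simp add: divide_le_eq)
    finally show ?thesis .
  qed
  have lim: "(\<lambda>n. F n t) \<longlonglongrightarrow> (p t)\<^sup>2" for t
  proof -
    have h0: "h \<longlonglongrightarrow> 0" unfolding h_def by real_asymp
    then have "filterlim h (at 0) sequentially" using h by (intro filterlim_atI) (auto intro!: always_eventually less_imp_neq[symmetric])
    moreover have "((\<lambda>e. (w (t + e) - w t) / e) \<longlongrightarrow> p t) (at 0)" using d[of t] by (simp add: DERIV_def)
    ultimately have "(\<lambda>n. (w (t + h n) - w t) / h n) \<longlonglongrightarrow> p t" by (rule filterlim_compose[rotated])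
    then have "(\<lambda>n. ((w (t + h n) - w t) / h n)\<^sup>2) \<longlonglongrightarrow> (p t)\<^sup>2" by (intro tendsto_intros)
    moreover obtain N where N: "\<bar>t\<bar> \<le> real N" using real_arch_simple by blast
    have "eventually (\<lambda>n. ((w (t + h n) - w t) / h n)\<^sup>2 = F n t) sequentially"
      using eventually_ge_at_top[of N] by eventually_elim (use N in \<open>auto simp: F_def indicator_def abs_le_iff\<close>)
    ultimately show ?thesis by (rule Lim_transform_eventually)
  qed
  have "(\<integral>\<^sup>+t. ennreal ((p t)\<^sup>2) \<partial>lborel) = (\<integral>\<^sup>+t. liminf (\<lambda>n. ennreal (F n t)) \<partial>lborel)"
    by (intro nn_integral_cong sym[OF lim_imp_Liminf] tendsto_ennrealI lim) simp
  also have "\<dots> \<le> liminf (\<lambda>n. \<integral>\<^sup>+t. ennreal (F n t) \<partial>lborel)" by (rule nn_integral_liminf) simp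
  also have "\<dots> \<le> ennreal M"
    using Liminf_mono[of "\<lambda>n. \<integral>\<^sup>+t. ennreal (F n t) \<partial>lborel" "\<lambda>_. ennreal M" sequentially] F_int
    by (simp add: Liminf_const)
  finally have fin: "(\<integral>\<^sup>+t. ennreal ((p t)\<^sup>2) \<partial>lborel) \<le> ennreal M" .
  show int: "integrable lborel (\<lambda>t. (p t)\<^sup>2)"
    by (rule integrableI_bounded) (use fin in \<open>auto simp: le_less_trans\<close>)
  have "ennreal (LINT t|lborel. (p t)\<^sup>2) \<le> ennreal M"
    using fin nn_integral_eq_integral[OF int] by simp
  then show "(LINT t|lborel. (p t)\<^sup>2) \<le> M" using M0 by simp
qed

section \<open>A constrained minimisation problem on the line\<close>

lemma hat_bounds: "0 < h \<Longrightarrow> 0 \<le> hat c h t" "0 < h \<Longrightarrow> hat c h t \<le> 1"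
  "0 < h \<Longrightarrow> t \<notin> {c - h..c + h} \<Longrightarrow> hat c h t = 0"
  by (auto simp: hat_def max_def field_simps abs_if split: if_splits)

lemma isCont_hat: "h > 0 \<Longrightarrow> isCont (hat c h) t"
  unfolding hat_def[abs_def] by (intro continuous_intros) auto

lemma has_antiderivative:
  fixes p :: "real \<Rightarrow> real"
  assumes "\<And>t. isCont p t" shows "\<exists>P. \<forall>t. (P has_real_derivative p t) (at t)"
proof (intro exI allI)
  fix t
  have "((\<lambda>u. LBINT y=ereal 0..ereal u. p y) has_vector_derivative p t) (at t within {min t 0 - 1..max t 0 + 1})"
    by (rule interval_integral_FTC2[of "min t 0 - 1" 0 "max t 0 + 1" p t])
      (use assms in \<open>auto intro!: continuous_at_imp_continuous_on\<close>)
  moreover have "at t within {min t 0 - 1..max t 0 + 1} = at t"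
    by (rule at_within_interior) (auto simp: min_def max_def)
  ultimately show "((\<lambda>u. LBINT y=ereal 0..ereal u. p y) has_real_derivative p t) (at t)"
    by (simp add: has_real_derivative_iff_has_vector_derivative)
qed

text \<open>
  Integrating by parts twice, the integral of \<open>p\<close> against a hat function is a second difference of a second primitive.
\<close>
lemma hat_integral:
  fixes p P Q :: "real \<Rightarrow> real"
  assumes p: "\<And>t. isCont p t" and P: "\<And>t. (P has_real_derivative p t) (at t)"
    and Q: "\<And>t. (Q has_real_derivative P t) (at t)" and h: "h > 0"
  shows "integrable lborel (\<lambda>t. p t * hat c h t)"
    "h * (LINT t|lborel. p t * hat c h t) = Q (c + h) + Q (c - h) - 2 * Q c"
proof -
  let ?F1 = "\<lambda>t. (t - (c - h)) / h * P t - Q t / h"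
  let ?F2 = "\<lambda>t. ((c + h) - t) / h * P t + Q t / h"
  have D1: "(?F1 has_real_derivative p t * ((t - (c - h)) / h)) (at t)" for t
    by (rule derivative_eq_intros P Q refl | use h in \<open>simp add: field_simps\<close>)+
  have D2: "(?F2 has_real_derivative p t * (((c + h) - t) / h)) (at t)" for t
    by (rule derivative_eq_intros P Q refl | use h in \<open>simp add: field_simps\<close>)+
  have 1: "has_bochner_integral lborel (\<lambda>t. p t * ((t - (c - h)) / h) * indicator {c - h..c} t) (?F1 c - ?F1 (c - h))"
    by (rule has_bochner_integral_FTC_Icc_real) (use h D1 p in \<open>auto intro!: continuous_intros\<close>)
  have 2: "has_bochner_integral lborel (\<lambda>t. p t * (((c + h) - t) / h) * indicator {c..c + h} t) (?F2 (c + h) - ?F2 c)"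
    by (rule has_bochner_integral_FTC_Icc_real) (use h D2 p in \<open>auto intro!: continuous_intros\<close>)
  have ae: "AE t in lborel. p t * ((t - (c - h)) / h) * indicator {c - h..c} t + p t * (((c + h) - t) / h) * indicator {c..c + h} t
     = p t * hat c h t"
  proof (rule AE_mp[OF AE_lborel_singleton[of c]], rule AE_I2, rule impI)
    fix t assume "t \<noteq> c"
    then show "p t * ((t - (c - h)) / h) * indicator {c - h..c} t + p t * (((c + h) - t) / h) * indicator {c..c + h} t
     = p t * hat c h t" using h by (auto simp: hat_def indicator_def max_def field_simps abs_if)
  qed
  have pm [measurable]: "p \<in> borel_measurable borel"
    by (intro borel_measurable_continuous_onI continuous_at_imp_continuous_on) (auto intro: p)
  have hm [measurable]: "hat c h \<in> borel_measurable borel"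
    by (intro borel_measurable_continuous_onI continuous_at_imp_continuous_on) (auto intro: isCont_hat h)
  have hb: "has_bochner_integral lborel (\<lambda>t. p t * hat c h t) ((?F1 c - ?F1 (c - h)) + (?F2 (c + h) - ?F2 c))"
    by (rule has_bochner_integralI_AE[OF has_bochner_integral_add[OF 1 2] _ ae]) simp
  have "h * ((?F1 c - ?F1 (c - h)) + (?F2 (c + h) - ?F2 c)) = Q (c + h) + Q (c - h) - 2 * Q c"
    using h by (simp add: field_simps)
  then show "integrable lborel (\<lambda>t. p t * hat c h t)"
    "h * (LINT t|lborel. p t * hat c h t) = Q (c + h) + Q (c - h) - 2 * Q c"
    using hb by (simp_all only: has_bochner_integral_iff)
qed

lemma affine_of_second_difference:
  fixes V :: "real \<Rightarrow> real"
  assumes c: "\<And>t. isCont V t" and mid: "\<And>c h. h > 0 \<Longrightarrow> V (c + h) + V (c - h) = 2 * V c"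
  shows "V t = V 0 + (V 1 - V 0) * t"
proof -
  have chord: "U x \<le> 0" if U: "\<And>t. isCont U t" "\<And>c h. h > 0 \<Longrightarrow> U (c + h) + U (c - h) = 2 * U c"
      and ab: "U a = 0" "U b = 0" "a \<le> x" "x \<le> b" for U :: "real \<Rightarrow> real" and a b x
  proof (rule ccontr)
    assume pos: "\<not> U x \<le> 0"
    have cU: "continuous_on {a..b} U" using U(1) by (intro continuous_at_imp_continuous_on) auto
    obtain m where m: "m \<in> {a..b}" "\<And>y. y \<in> {a..b} \<Longrightarrow> U y \<le> U m"
      using continuous_attains_sup[of "{a..b}" U] cU ab by auto
    have "closed {y \<in> {a..b}. U y \<in> {U m..}}"
      using continuous_closed_preimage[OF cU, of "{U m..}"] by (simp add: vimage_def Int_def)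
    then have "compact {y \<in> {a..b}. U m \<le> U y}"
      by (auto simp: compact_eq_bounded_closed intro: bounded_subset[OF bounded_closed_interval[of a b]])
    moreover have "m \<in> {y \<in> {a..b}. U m \<le> U y}" using m by auto
    ultimately obtain l where l: "l \<in> {y \<in> {a..b}. U m \<le> U y}" "\<And>y. y \<in> {y \<in> {a..b}. U m \<le> U y} \<Longrightarrow> l \<le> y"
      using compact_attains_inf[of "{y \<in> {a..b}. U m \<le> U y}"] by blast
    have Ul: "U l = U m" "a \<le> l" "l \<le> b" using l(1) m(2)[of l] by auto
    have "U m > 0" using m(2)[of x] pos ab by auto
    then have lt: "a < l" "l < b" using Ul ab by (cases "a = l"; cases "l = b"; auto)+
    define h where "h = min (l - a) (b - l)"
    have h: "h > 0" "l - h \<in> {a..b}" "l + h \<in> {a..b}" using lt by (auto simp: h_def)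
    have "U (l - h) \<ge> U m" using U(2)[OF h(1), of l] m(2)[OF h(3)] Ul(1) by linarith
    then have "l \<le> l - h" using h(2) by (intro l(2)) auto
    then show False using h by simp
  qed
  have zero: "U x = 0" if U: "\<And>t. isCont U t" "\<And>c h. h > 0 \<Longrightarrow> U (c + h) + U (c - h) = 2 * U c"
      and ab: "U a = 0" "U b = 0" "a \<le> x" "x \<le> b" for U :: "real \<Rightarrow> real" and a b x
  proof (rule order_antisym)
    show "U x \<le> 0" by (rule chord[OF U ab])
    have mid': "- U (c + h) + - U (c - h) = 2 * - U c" if "h > 0" for c h using U(2)[OF that, of c] by linarith
    have "- U x \<le> 0" by (rule chord[of "\<lambda>x. - U x", OF continuous_minus[OF U(1)] mid' _ _ ab(3,4)]) (use ab in auto)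
    then show "0 \<le> U x" by simp
  qed
  define U where "U s = V s - (V 0 + (V 1 - V 0) * s)" for s
  have U: "isCont U s" "h > 0 \<Longrightarrow> U (c + h) + U (c - h) = 2 * U c" for s c h
    unfolding U_def using mid[of h c] by (auto intro!: continuous_intros c simp: algebra_simps)
  have U01: "U 0 = 0" "U 1 = 0" by (auto simp: U_def)
  have "U t = 0"
  proof (cases "t \<in> {0..1}")
    case True
    then show ?thesis using zero[OF U U01] by auto
  next
    case False
    text \<open>Reflecting at 0 doubles the interval.\<close>
    have dbl: "U (2 ^ n) = 0 \<and> U (- (2 ^ n)) = 0" for n :: nat
    proof (induction n)
      case 0
      show ?case using U(2)[of 1 0] U01 by simp
    next
      case (Suc n)
      show ?case
        using U(2)[of "2 ^ n" "2 ^ n"] U(2)[of "2 ^ n" "- (2 ^ n)"] Suc U01 by simp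
    qed
    obtain n where "\<bar>t\<bar> < 2 ^ n" using real_arch_pow[of 2 "\<bar>t\<bar>"] by auto
    then show ?thesis using zero[OF U, of "- (2 ^ n)" "2 ^ n" t] dbl[of n] by auto
  qed
  then show ?thesis by (simp add: U_def)
qed

lemma exp2_half_line:
  "integrable lborel (\<lambda>t. exp (2 * t) * indicator {..0} t :: real)" (is ?I)
  "(LINT t|lborel. exp (2 * t) * indicator {..0} t) = (1/2 :: real)"
proof -
  have 1: "(\<integral>\<^sup>+t. ennreal (exp (- 2 * t)) * indicator {0..} t \<partial>lborel) = ennreal (0 - (- 1/2 * exp (- 2 * 0)))"
  proof (rule nn_integral_FTC_atLeast)
    show "((\<lambda>t::real. - 1/2 * exp (- 2 * t)) has_real_derivative exp (- 2 * t)) (at t)" for t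
      by (auto intro!: derivative_eq_intros)
    show "((\<lambda>t::real. - 1/2 * exp (- 2 * t)) \<longlongrightarrow> 0) at_top" by real_asymp
  qed auto
  have "(\<integral>\<^sup>+t. ennreal (exp (2 * t)) * indicator {..0} t \<partial>lborel)
    = ennreal \<bar>- 1\<bar> * (\<integral>\<^sup>+t. ennreal (exp (2 * (0 + - 1 * t))) * indicator {..0} (0 + - 1 * t) \<partial>lborel)"
    by (rule nn_integral_real_affine) auto
  also have "\<dots> = (\<integral>\<^sup>+t. ennreal (exp (- 2 * t)) * indicator {0..} t \<partial>lborel)"
    by (auto simp: indicator_def intro!: nn_integral_cong)
  finally have "(\<integral>\<^sup>+t. ennreal (exp (2 * t)) * indicator {..0} t \<partial>lborel) = ennreal (1/2)"
    using 1 by simp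
  moreover have "ennreal (exp (2 * t) * indicator {..0} t) = ennreal (exp (2 * t)) * indicator {..0} t" for t :: real
    by (auto simp: indicator_def)
  ultimately have "(\<integral>\<^sup>+t. ennreal (exp (2 * t) * indicator {..0} t) \<partial>lborel) = ennreal (1/2)" by simp
  from nn_integral_eq_integrable[THEN iffD1, OF _ _ _ this]
  show ?I "(LINT t|lborel. exp (2 * t) * indicator {..0} t) = (1/2 :: real)" by auto
qed

text \<open>
  The minimisation is carried out for a potential \<open>\<Gamma>\<close> on the whole line that is negative quadratically up to the
  height \<open>b0\<close>, bounded above and positive at some point \<open>sp\<close>. The condition \<open>g b0 \<noteq> 0\<close> makes the constraint nondegenerate
  at a function that passes through the height \<open>b0\<close>.
\<close>
locale radial_min =
  fixes g \<Gamma> :: "real \<Rightarrow> real" and b0 c Gm sp :: real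
  assumes D\<Gamma>: "\<And>s. (\<Gamma> has_real_derivative g s) (at s)" and g_cont: "\<And>s. isCont g s" and \<Gamma>0: "\<Gamma> 0 = 0"
    and b0: "0 < b0" and c: "0 < c" and low: "\<And>s. s \<le> b0 \<Longrightarrow> \<Gamma> s \<le> - c * s\<^sup>2"
    and Gm: "\<And>s. \<Gamma> s \<le> Gm" and sp: "0 < \<Gamma> sp" and g_b0: "g b0 \<noteq> 0"
begin

lemma \<Gamma>_cont: "isCont \<Gamma> s" using D\<Gamma> DERIV_isCont by blast
lemma \<Gamma>_meas [measurable]: "\<Gamma> \<in> borel_measurable borel"
  by (intro borel_measurable_continuous_onI continuous_at_imp_continuous_on) (auto intro: \<Gamma>_cont)
lemma g_meas [measurable]: "g \<in> borel_measurable borel"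
  by (intro borel_measurable_continuous_onI continuous_at_imp_continuous_on) (auto intro: g_cont)
lemma Gm_pos: "0 < Gm" using sp Gm less_le_trans by blast

definition admissible :: "(real \<Rightarrow> real) \<Rightarrow> bool" where
  "admissible w \<longleftrightarrow> (w \<longlongrightarrow> 0) at_top \<and> (\<exists>t. b0 < w t) \<and>
     integrable lborel (\<lambda>t. exp (2 * t) * \<Gamma> (w t)) \<and> 0 \<le> (LINT t|lborel. exp (2 * t) * \<Gamma> (w t))"

text \<open>
  A translation by \<open>T\<close> multiplies the constraint integral by \<open>exp (- 2 * T)\<close> and leaves the energy unchanged. So the last
  time at which the height \<open>b0\<close> is attained can be moved to \<open>0\<close>, and this restores compactness.
\<close>
definition normalised :: "(real \<Rightarrow> real) \<Rightarrow> bool" where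
  "normalised w \<longleftrightarrow> w 0 = b0 \<and> (\<forall>t\<ge>0. w t \<le> b0) \<and>
     integrable lborel (\<lambda>t. exp (2 * t) * \<Gamma> (w t)) \<and> 0 \<le> (LINT t|lborel. exp (2 * t) * \<Gamma> (w t))"

lemma admissible_normalised:
  assumes adm: "admissible w" and en: "fin_en w M"
  shows "\<exists>v. normalised v \<and> fin_en v M"
proof -
  have c: "isCont w t" for t by (rule fin_en_isCont[OF en])
  obtain t1 where t1: "b0 < w t1" using adm unfolding admissible_def by blast
  have "eventually (\<lambda>t. w t < b0) at_top"
    using adm b0 unfolding admissible_def by (intro order_tendstoD(2)) auto
  then obtain t2 where t2: "\<And>t. t \<ge> t2 \<Longrightarrow> w t < b0" by (auto simp: eventually_at_top_linorder)
  have t12: "t1 < t2" using t1 t2[of t1] by (cases "t1 < t2") auto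
  have cc: "continuous_on {t1..t2} w" using c by (intro continuous_at_imp_continuous_on) auto
  have "closed {x \<in> {t1..t2}. w x \<in> {b0..}}"
    using continuous_closed_preimage[OF cc, of "{b0..}"] by (simp add: vimage_def Int_def)
  then have "compact {x \<in> {t1..t2}. b0 \<le> w x}"
    by (auto simp: compact_eq_bounded_closed intro: bounded_subset[OF bounded_closed_interval[of t1 t2]])
  moreover have "t1 \<in> {x \<in> {t1..t2}. b0 \<le> w x}" using t1 t12 by auto
  ultimately obtain T where T: "T \<in> {x \<in> {t1..t2}. b0 \<le> w x}" "\<And>x. x \<in> {x \<in> {t1..t2}. b0 \<le> w x} \<Longrightarrow> x \<le> T"
    using compact_attains_sup[of "{x \<in> {t1..t2}. b0 \<le> w x}"] by blast
  have after: "w t < b0" if "T < t" for t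
    using T(2)[of t] T(1) t2[of t] that by (cases "t \<le> t2") force+
  have "(w \<longlongrightarrow> w T) (at_right T)" using c[of T] by (auto simp: isCont_def intro: tendsto_mono[OF at_le])
  moreover have "eventually (\<lambda>t. w t \<le> b0) (at_right T)"
    using after by (intro eventually_at_rightI[of T "T + 1"]) (auto intro: less_imp_le)
  ultimately have "w T \<le> b0" by (intro tendsto_upperbound) auto
  then have wT: "w T = b0" using T(1) by simp
  let ?v = "\<lambda>t. w (t + T)"
  have eq: "exp (2 * (T + 1 * t)) * \<Gamma> (w (T + 1 * t)) = exp (2 * T) * (exp (2 * t) * \<Gamma> (?v t))" for t
    by (simp add: exp_add add.commute distrib_left)
  have "integrable lborel (\<lambda>t. exp (2 * (T + 1 * t)) * \<Gamma> (w (T + 1 * t)))"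
    using adm unfolding admissible_def by (intro lborel_integrable_real_affine) auto
  then have i: "integrable lborel (\<lambda>t. exp (2 * t) * \<Gamma> (?v t))" unfolding eq by simp
  have "(LINT t|lborel. exp (2 * t) * \<Gamma> (w t)) = (LINT t|lborel. exp (2 * (T + 1 * t)) * \<Gamma> (w (T + 1 * t)))"
    by (subst lborel_integral_real_affine[of 1 _ T]) auto
  also have "\<dots> = exp (2 * T) * (LINT t|lborel. exp (2 * t) * \<Gamma> (?v t))" unfolding eq by simp
  finally have "0 \<le> (LINT t|lborel. exp (2 * t) * \<Gamma> (?v t))"
    using adm unfolding admissible_def by (simp add: zero_le_mult_iff)
  then have "normalised ?v" using i wT after unfolding normalised_def
    by (auto simp: le_less)
  then show ?thesis using fin_en_shift[OF en] by blast
qed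

text \<open>
  For \<open>t \<ge> 0\<close> the potential is at most \<open>- c * (w t)\<^sup>2\<close>. A value of size \<open>e\<close> at a late time \<open>t\<close> persists for a fixed
  length by Hoelder continuity, and the weight \<open>exp (2 * t)\<close> would make the constraint integral too large.
\<close>
lemma normalised_tendsto_0:
  assumes n: "normalised w" and en: "fin_en w M"
  shows "(w \<longlongrightarrow> 0) at_top"
proof (rule tendstoI)
  fix e :: real assume e: "e > 0"
  define K where "K = max M 1"
  have K: "K \<ge> 1" "M \<le> K" by (auto simp: K_def)
  have hold: "\<bar>w t - w s\<bar>\<^sup>2 \<le> K * \<bar>t - s\<bar>" for s t
    using order_trans[OF fin_en_holder[OF en, of t s] mult_right_mono[OF K(2) abs_ge_zero]] by simp
  define d where "d = (e / 2)\<^sup>2 / K"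
  have d: "d > 0" "K * d = (e / 2)\<^sup>2" using e K by (auto simp: d_def)
  define I where "I = (LINT t|lborel. norm (exp (2 * t) * \<Gamma> (w t)))"
  have int: "integrable lborel (\<lambda>t. exp (2 * t) * \<Gamma> (w t))" using n unfolding normalised_def by blast
  have bound: "exp (2 * t) * (c * (e / 2)\<^sup>2 * d) \<le> I" if t: "t \<ge> 0" "\<bar>w t\<bar> \<ge> e" for t
  proof -
    have "(LINT s|lborel. exp (2 * t) * (c * (e / 2)\<^sup>2) * indicator {t..t + d} s) \<le> I"
      unfolding I_def
    proof (rule integral_mono)
      show "integrable lborel (\<lambda>s. exp (2 * t) * (c * (e / 2)\<^sup>2) * indicator {t..t + d} s)"
        by (intro integrable_mult_right integrable_real_indicator) (auto simp: emeasure_lborel_Icc_eq)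
      show "integrable lborel (\<lambda>s. norm (exp (2 * s) * \<Gamma> (w s)))" using int by (rule integrable_norm)
      fix s
      show "exp (2 * t) * (c * (e / 2)\<^sup>2) * indicator {t..t + d} s \<le> norm (exp (2 * s) * \<Gamma> (w s))"
      proof (cases "s \<in> {t..t + d}")
        case True
        have "\<bar>w t - w s\<bar>\<^sup>2 \<le> K * d" using hold[of t s] True K by (smt (verit) atLeastAtMost_iff mult_left_mono)
        then have "\<bar>w t - w s\<bar> \<le> e / 2" unfolding d(2) by (rule power2_le_imp_le) (use e in simp)
        then have "e / 2 \<le> \<bar>w s\<bar>" using t(2) by linarith
        then have "(e / 2)\<^sup>2 \<le> (w s)\<^sup>2" using e by (metis abs_ge_zero abs_le_square_iff abs_of_nonneg half_gt_zero less_eq_real_def)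
        then have "c * (e / 2)\<^sup>2 \<le> c * (w s)\<^sup>2" using c by simp
        also have "\<dots> \<le> - \<Gamma> (w s)" using low[of "w s"] n True t(1) unfolding normalised_def by auto
        also have "\<dots> \<le> \<bar>\<Gamma> (w s)\<bar>" by simp
        finally have "exp (2 * t) * (c * (e / 2)\<^sup>2) \<le> exp (2 * s) * \<bar>\<Gamma> (w s)\<bar>"
          using True c by (intro mult_mono) auto
        then show ?thesis using True by (simp add: abs_mult)
      qed simp
    qed
    also have "(LINT s|lborel. exp (2 * t) * (c * (e / 2)\<^sup>2) * indicator {t..t + d} s) = exp (2 * t) * (c * (e / 2)\<^sup>2) * d"
      using d(1) by simp
    finally show ?thesis by (simp add: mult.assoc)
  qed
  have pos: "c * (e / 2)\<^sup>2 * d > 0" using c e d by simp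
  have "filterlim (\<lambda>t::real. exp (2 * t)) at_top at_top" by real_asymp
  then have "eventually (\<lambda>t. exp (2 * t) > I / (c * (e / 2)\<^sup>2 * d)) at_top" by (simp add: filterlim_at_top_dense)
  then show "eventually (\<lambda>t. dist (w t) 0 < e) at_top"
    using eventually_ge_at_top[of 0]
  proof eventually_elim
    case (elim t)
    then have "exp (2 * t) * (c * (e / 2)\<^sup>2 * d) > I" using pos by (simp add: divide_less_eq)
    then show ?case using bound[of t] elim by force
  qed
qed

lemma compact_bound:
  fixes h :: "real \<Rightarrow> real"
  assumes "\<And>s. isCont h s" obtains K where "K > 0" "\<And>s. s \<in> {a..b} \<Longrightarrow> \<bar>h s\<bar> \<le> K"
proof -
  have "compact (h ` {a..b})"
    using assms by (intro compact_continuous_image continuous_at_imp_continuous_on) auto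
  then obtain K where "K > 0" "\<forall>y\<in>h ` {a..b}. norm y \<le> K" using bounded_pos compact_imp_bounded by blast
  then show ?thesis using that by auto
qed

lemma sp_gt: "b0 < sp"
  using low[of sp] sp c zero_le_power2[of sp] by (metis mult_minus_left mult_nonneg_nonneg neg_le_0_iff_le not_le order_le_less_trans less_imp_le)

text \<open>
  The plateau of height \<open>sp\<close> on \<open>(-\<infinity>, 0]\<close> followed by a sufficiently short descent to \<open>0\<close> is admissible.
\<close>
lemma normalised_exists: "\<exists>w M. normalised w \<and> fin_en w M"
proof -
  obtain K where K: "K > 0" "\<And>s. s \<in> {0..sp} \<Longrightarrow> \<bar>\<Gamma> s\<bar> \<le> K" using compact_bound[OF \<Gamma>_cont, of 0 sp] by blast
  define d where "d = min 1 (\<Gamma> sp / (2 * exp 2 * K))"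
  have d: "0 < d" "d \<le> 1" "exp 2 * K * d \<le> \<Gamma> sp / 2"
  proof -
    show "0 < d" "d \<le> 1" using sp K by (auto simp: d_def)
    have "exp 2 * K * d \<le> exp 2 * K * (\<Gamma> sp / (2 * exp 2 * K))" using K by (intro mult_left_mono) (auto simp: d_def)
    then show "exp 2 * K * d \<le> \<Gamma> sp / 2" using K by simp
  qed
  define w where "w t = sp + (- sp / d) * clamp_on 0 d t" for t
  have "fin_en (\<lambda>t. sp) 0" unfolding fin_en_def by (intro exI[of _ "\<lambda>_. 0"]) auto
  from fin_en_ramp[OF this, of 0 d "- sp / d"] have en: "fin_en w ((- sp / d)\<^sup>2 * d)"
    using d by (simp add: w_def[abs_def])
  have w1: "w t = sp" if "t \<le> 0" for t using that d by (simp add: w_def clamp_on_def)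
  have w2: "w t = 0" if "t \<ge> d" for t using that d by (simp add: w_def clamp_on_def)
  have w3: "w t \<in> {0..sp}" if "0 \<le> t" "t \<le> d" for t
    using that d sp_gt b0 by (auto simp: w_def clamp_on_def field_simps)
  have wm [measurable]: "w \<in> borel_measurable borel" by (rule fin_en_measurable[OF en])
  let ?f = "\<lambda>t. exp (2 * t) * \<Gamma> (w t)"
  let ?u = "\<lambda>t. K * (exp (2 * t) * indicator {..0} t) + exp 2 * K * indicator {0..d} t"
  let ?l = "\<lambda>t. \<Gamma> sp * (exp (2 * t) * indicator {..0} t) - exp 2 * K * indicator {0..d} t"
  have iu: "integrable lborel ?u" and il: "integrable lborel ?l"
    using exp2_half_line(1) by (auto intro!: integrable_real_indicator simp: emeasure_lborel_Icc_eq)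
  have mid: "\<bar>?f t\<bar> \<le> exp 2 * K" if "0 \<le> t" "t \<le> d" for t
    unfolding abs_mult using K(2)[OF w3[OF that]] that d by (intro mult_mono) auto
  have fu: "norm (?f t) \<le> norm (?u t)" for t
  proof -
    consider "t < 0" | "0 \<le> t" "t \<le> d" | "t > d" by linarith
    then show ?thesis
    proof cases
      case 1
      then show ?thesis using K(2)[of sp] K(1) w1[of t] sp_gt b0 d by (auto simp: abs_mult indicator_def)
    next
      case 2
      have "exp 2 * K \<le> ?u t" using 2 K(1) by (auto simp: indicator_def)
      then show ?thesis using mid[OF 2] K(1) by (auto simp: abs_le_iff)
    next
      case 3
      then show ?thesis using w2[of t] \<Gamma>0 by simp
    qed
  qed
  have if': "integrable lborel ?f"
    by (rule Bochner_Integration.integrable_bound[OF iu]) (use fu in \<open>auto intro!: AE_I2\<close>)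
  have "?l t \<le> ?f t" for t
  proof -
    consider "t < 0" | "0 \<le> t" "t \<le> d" | "t > d" by linarith
    then show ?thesis
    proof cases
      case 2
      show ?thesis
      proof (cases "t = 0")
        case True
        then show ?thesis using w1[of 0] K(1) d by (simp add: indicator_def)
      qed (use mid[OF 2] 2 in \<open>auto simp: abs_le_iff\<close>)
    qed (use w1 w2 \<Gamma>0 d in auto)
  qed
  then have "(LINT t|lborel. ?l t) \<le> (LINT t|lborel. ?f t)" by (intro integral_mono il if')
  moreover have "(LINT t|lborel. ?l t) = \<Gamma> sp * (1/2) - exp 2 * K * d"
    using exp2_half_line d by (subst Bochner_Integration.integral_diff)
      (auto intro!: integrable_real_indicator simp: emeasure_lborel_Icc_eq)
  ultimately have pos: "0 \<le> (LINT t|lborel. ?f t)" using d(3) by linarith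
  have "(w \<longlongrightarrow> 0) at_top"
    using w2 by (intro tendsto_eventually) (auto simp: eventually_at_top_linorder)
  then have "admissible w" unfolding admissible_def using pos if' w1[of 0] sp_gt by (auto intro: exI[of _ 0])
  then show ?thesis using admissible_normalised[OF _ en] by blast
qed

text \<open>
  For a normalised function the integrand \<open>exp (2 * t) * \<Gamma> (w t)\<close> is at most \<open>Gm * exp (2 * t)\<close> for \<open>t \<le> 0\<close> and at most
  \<open>0\<close> for \<open>t \<ge> 0\<close>. Hence Fatou's lemma, applied to the differences, shows that the constraint survives in the limit.
\<close>
lemma minimiser_exists:
  obtains w m where "normalised w" "fin_en w m" "\<And>v M. normalised v \<Longrightarrow> fin_en v M \<Longrightarrow> m \<le> M"
proof -
  define S where "S = {M. \<exists>w. normalised w \<and> fin_en w M}"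
  define m where "m = Inf S"
  have ne: "S \<noteq> {}" using normalised_exists by (auto simp: S_def)
  have bdd: "bdd_below S" using fin_en_nonneg by (auto simp: S_def bdd_below_def)
  have low_m: "m \<le> M" if "M \<in> S" for M unfolding m_def by (rule cInf_lower[OF that bdd])
  have "\<exists>M\<in>S. M < m + 1 / real (Suc n)" for n
    using cInf_less_iff[OF ne bdd, of "m + 1 / real (Suc n)"] unfolding m_def by simp
  then obtain M where M: "\<And>n. M n \<in> S" "\<And>n. M n < m + 1 / real (Suc n)" by metis
  have "\<forall>n. \<exists>w. normalised w \<and> fin_en w (M n)" using M(1) unfolding S_def by blast
  then obtain w where w: "\<And>n. normalised (w n)" "\<And>n. fin_en (w n) (M n)" by metis
  have Mm: "M \<longlonglongrightarrow> m"
  proof (rule tendsto_sandwich[of "\<lambda>_. m" _ _ "\<lambda>n. m + 1 / real (Suc n)"])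
    have "(\<lambda>n. 1 / real (Suc n)) \<longlonglongrightarrow> 0" by real_asymp
    from tendsto_add[OF tendsto_const this] show "(\<lambda>n. m + 1 / real (Suc n)) \<longlonglongrightarrow> m" by simp
  qed (use M low_m in \<open>auto intro!: always_eventually less_imp_le\<close>)
  obtain k v where k: "strict_mono k" and v: "\<And>t. (\<lambda>n. w (k n) t) \<longlonglongrightarrow> v t" and env: "fin_en v m"
    by (rule fin_en_limit[OF w(2) Mm, of b0]) (use w(1) in \<open>auto simp: normalised_def\<close>)
  have v0: "v 0 = b0"
    using LIMSEQ_unique[OF v[of 0], of b0] w(1) unfolding normalised_def by simp
  have vle: "v t \<le> b0" if "t \<ge> 0" for t
    by (rule LIMSEQ_le_const2[OF v[of t]]) (use w(1) that in \<open>auto simp: normalised_def\<close>)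
  have wm [measurable]: "w n \<in> borel_measurable borel" for n by (rule fin_en_measurable[OF w(2)])
  have vm [measurable]: "v \<in> borel_measurable borel" by (rule fin_en_measurable[OF env])
  \<comment> \<open>The nonnegative functions to which Fatou's lemma is applied; the first term has integral \<open>Gm / 2\<close>.\<close>
  define H where "H u t = Gm * (exp (2 * t) * indicator {..0} t) - exp (2 * t) * \<Gamma> (u t)" for u :: "real \<Rightarrow> real" and t
  have Gm0: "integrable lborel (\<lambda>t. Gm * (exp (2 * t) * indicator {..0} t))"
    using exp2_half_line(1) by (rule integrable_mult_right)
  have Gm1: "(LINT t|lborel. Gm * (exp (2 * t) * indicator {..0} t)) = Gm / 2"
    using exp2_half_line(2) by (subst integral_mult_right_zero) simp
  have Hnn: "0 \<le> H u t" if "\<And>t. t \<ge> 0 \<Longrightarrow> u t \<le> b0" for u t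
  proof (cases "t \<le> 0")
    case True
    then show ?thesis using Gm[of "u t"] by (simp add: H_def)
  next
    case False
    have "\<Gamma> (u t) \<le> 0" using low[of "u t"] that[of t] False c by (auto intro: order_trans)
    then show ?thesis using False by (simp add: H_def mult_nonneg_nonpos)
  qed
  have Hw: "(\<integral>\<^sup>+t. ennreal (H (w n) t) \<partial>lborel) \<le> ennreal (Gm / 2)" for n
  proof -
    have i: "integrable lborel (\<lambda>t. exp (2 * t) * \<Gamma> (w n t))" and p: "0 \<le> (LINT t|lborel. exp (2 * t) * \<Gamma> (w n t))"
      using w(1)[of n] unfolding normalised_def by auto
    have "integrable lborel (H (w n))" unfolding H_def[abs_def] using i Gm0 by (intro Bochner_Integration.integrable_diff)
    moreover have "(LINT t|lborel. H (w n) t) \<le> Gm / 2"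
      unfolding H_def Bochner_Integration.integral_diff[OF Gm0 i] Gm1 using p by simp
    moreover have "AE t in lborel. 0 \<le> H (w n) t" using Hnn w(1)[of n] unfolding normalised_def by (intro AE_I2) auto
    ultimately show ?thesis by (simp add: nn_integral_eq_integral ennreal_leI)
  qed
  have Hlim: "(\<lambda>n. H (w (k n)) t) \<longlonglongrightarrow> H v t" for t
    unfolding H_def by (intro tendsto_intros isCont_tendsto_compose[OF \<Gamma>_cont] v)
  have Hm [measurable]: "H (w n) \<in> borel_measurable borel" "H v \<in> borel_measurable borel" for n unfolding H_def[abs_def] by measurable
  have "(\<integral>\<^sup>+t. ennreal (H v t) \<partial>lborel) = (\<integral>\<^sup>+t. liminf (\<lambda>n. ennreal (H (w (k n)) t)) \<partial>lborel)"
    by (intro nn_integral_cong sym[OF lim_imp_Liminf] tendsto_ennrealI Hlim) simp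
  also have "\<dots> \<le> liminf (\<lambda>n. \<integral>\<^sup>+t. ennreal (H (w (k n)) t) \<partial>lborel)" by (rule nn_integral_liminf) simp
  also have "\<dots> \<le> ennreal (Gm / 2)"
    using Liminf_mono[of "\<lambda>n. \<integral>\<^sup>+t. ennreal (H (w (k n)) t) \<partial>lborel" "\<lambda>_. ennreal (Gm / 2)" sequentially] Hw
    by (simp add: Liminf_const)
  finally have fin: "(\<integral>\<^sup>+t. ennreal (H v t) \<partial>lborel) \<le> ennreal (Gm / 2)" .
  have Hv0: "0 \<le> H v t" for t using Hnn vle by blast
  have iH: "integrable lborel (H v)"
    by (rule integrableI_bounded) (use fin Hv0 in \<open>auto intro: le_less_trans\<close>)
  have "ennreal (LINT t|lborel. H v t) \<le> ennreal (Gm / 2)"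
    using fin nn_integral_eq_integral[OF iH] Hv0 by simp
  then have le: "(LINT t|lborel. H v t) \<le> Gm / 2" using Gm_pos by simp
  have eq: "exp (2 * t) * \<Gamma> (v t) = Gm * (exp (2 * t) * indicator {..0} t) - H v t" for t by (simp add: H_def)
  have "integrable lborel (\<lambda>t. exp (2 * t) * \<Gamma> (v t))"
    unfolding eq using iH Gm0 by (intro Bochner_Integration.integrable_diff)
  moreover have "0 \<le> (LINT t|lborel. exp (2 * t) * \<Gamma> (v t))"
    unfolding eq Bochner_Integration.integral_diff[OF Gm0 iH] Gm1 using le by simp
  ultimately have "normalised v" using v0 vle unfolding normalised_def by blast
  then show ?thesis using that env low_m unfolding S_def by blast
qed

context
  fixes w m
  assumes nw: "normalised w" and en: "fin_en w m"
    and least: "\<And>v M. normalised v \<Longrightarrow> fin_en v M \<Longrightarrow> m \<le> M"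
begin

lemma w_cont: "isCont w t" by (rule fin_en_isCont[OF en])
lemma w_meas [measurable]: "w \<in> borel_measurable borel" by (rule fin_en_measurable[OF en])

text \<open>
  A variation that increases the constraint integral to first order gives admissible functions, so it cannot decrease
  the energy to first order. Combinations of two hat functions suffice to produce the Lagrange multiplier.
\<close>
lemma first_variation:
  fixes c0 h0 c1 h1 x y :: real
  defines "L0 \<equiv> (LINT t|lborel. (exp (2 * t) * g (w t)) * hat c0 h0 t)"
  defines "L1 \<equiv> (LINT t|lborel. (exp (2 * t) * g (w t)) * hat c1 h1 t)"
  assumes h: "h0 > 0" "h1 > 0" and pos: "x * L0 + y * L1 > 0"
  shows "0 \<le> x * (2 * (2 * w c0 - w (c0 - h0) - w (c0 + h0)) / h0) + y * (2 * (2 * w c1 - w (c1 - h1) - w (c1 + h1)) / h1)"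
proof -
  define th where "th t = x * hat c0 h0 t + y * hat c1 h1 t" for t
  define Th where "Th = \<bar>x\<bar> + \<bar>y\<bar>"
  define R where "R = \<bar>c0\<bar> + h0 + \<bar>c1\<bar> + h1"
  have R0: "R \<ge> 0" using h by (simp add: R_def)
  have th_le: "\<bar>th t\<bar> \<le> Th" for t
  proof -
    have "\<bar>th t\<bar> \<le> \<bar>x\<bar> * \<bar>hat c0 h0 t\<bar> + \<bar>y\<bar> * \<bar>hat c1 h1 t\<bar>" unfolding th_def by (metis abs_mult abs_triangle_ineq)
    also have "\<dots> \<le> \<bar>x\<bar> * 1 + \<bar>y\<bar> * 1"
      using hat_bounds(1,2)[OF h(1)] hat_bounds(1,2)[OF h(2)] by (intro add_mono mult_left_mono) auto
    finally show ?thesis by (simp add: Th_def)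
  qed
  have th0: "th t = 0" if "t \<notin> {-R..R}" for t
  proof -
    have "t \<notin> {c0 - h0..c0 + h0}" "t \<notin> {c1 - h1..c1 + h1}"
      using that h unfolding R_def by (auto simp: abs_if split: if_splits)
    then show ?thesis using hat_bounds(3)[OF h(1)] hat_bounds(3)[OF h(2)] unfolding th_def by simp
  qed
  have hm [measurable]: "hat c0 h0 \<in> borel_measurable borel" "hat c1 h1 \<in> borel_measurable borel"
    by (auto intro!: borel_measurable_continuous_onI continuous_at_imp_continuous_on isCont_hat h)
  have th_meas [measurable]: "th \<in> borel_measurable borel" unfolding th_def[abs_def] by measurable
  obtain W where W: "W > 0" "\<And>t. t \<in> {-R..R} \<Longrightarrow> \<bar>w t\<bar> \<le> W" using compact_bound[OF w_cont, of "-R" R] by blast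
  obtain K where K: "K > 0" "\<And>s. s \<in> {-(W + Th)..W + Th} \<Longrightarrow> \<bar>g s\<bar> \<le> K" using compact_bound[OF g_cont] by blast
  define e where "e n = 1 / real (Suc n)" for n
  have e: "0 < e n" "e n \<le> 1" for n by (auto simp: e_def)
  have e0: "e \<longlonglongrightarrow> 0" unfolding e_def[abs_def] by real_asymp
  define v where "v n t = w t + e n * th t" for n t
  define D where "D n t = exp (2 * t) * (\<Gamma> (v n t) - \<Gamma> (w t)) / e n" for n t
  have lip: "\<bar>\<Gamma> (v n t) - \<Gamma> (w t)\<bar> \<le> K * (e n * Th)" if t: "t \<in> {-R..R}" for n t
  proof -
    have eth: "\<bar>e n * th t\<bar> \<le> e n * Th" using e[of n] th_le[of t] by (simp add: abs_mult)
    moreover have "e n * Th \<le> 1 * Th" using e[of n] by (intro mult_right_mono) (auto simp: Th_def)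
    ultimately have in_range: "v n t \<in> {-(W + Th)..W + Th}" "w t \<in> {-(W + Th)..W + Th}"
      using W(2)[OF t] unfolding v_def Th_def by (auto simp: abs_le_iff)
    have "norm (\<Gamma> (v n t) - \<Gamma> (w t)) \<le> K * norm (v n t - w t)"
      by (rule field_differentiable_bound[of "{-(W + Th)..W + Th}" \<Gamma> g])
        (use in_range K(2) D\<Gamma> in \<open>auto intro: has_field_derivative_at_within\<close>)
    also have "norm (v n t - w t) = \<bar>e n * th t\<bar>" by (simp add: v_def)
    also have "K * \<dots> \<le> K * (e n * Th)" using eth K by simp
    finally show ?thesis by simp
  qed
  have Dbound: "norm (D n t) \<le> exp (2 * R) * K * Th * indicator {-R..R} t" for n t
  proof (cases "t \<in> {-R..R}")
    case True
    have "norm (D n t) = exp (2 * t) * (\<bar>\<Gamma> (v n t) - \<Gamma> (w t)\<bar> / e n)"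
      using e(1)[of n] by (simp add: D_def abs_mult)
    also have "\<dots> \<le> exp (2 * R) * (K * Th)"
    proof (rule mult_mono)
      show "\<bar>\<Gamma> (v n t) - \<Gamma> (w t)\<bar> / e n \<le> K * Th"
        using lip[OF True, of n] e(1)[of n] by (simp add: divide_le_eq mult_ac)
    qed (use True e(1)[of n] in auto)
    finally show ?thesis using True by simp
  next
    case False
    then have "D n t = 0" using th0 by (simp add: D_def v_def)
    then show ?thesis using False by simp
  qed
  have vm [measurable]: "v n \<in> borel_measurable borel" for n unfolding v_def[abs_def] by measurable
  have Dlim: "(\<lambda>n. D n t) \<longlonglongrightarrow> exp (2 * t) * g (w t) * th t" for t
  proof (cases "th t = 0")
    case False
    have "((\<lambda>h. (\<Gamma> (w t + h) - \<Gamma> (w t)) / h) \<longlongrightarrow> g (w t)) (at 0)" using D\<Gamma>[of "w t"] by (simp add: DERIV_def)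
    moreover have "(\<lambda>n. e n * th t) \<longlonglongrightarrow> 0 * th t" by (intro tendsto_intros e0)
    then have "filterlim (\<lambda>n. e n * th t) (at 0) sequentially"
      using e(1) False by (intro filterlim_atI) (auto intro!: always_eventually simp: less_imp_neq[symmetric])
    ultimately have "(\<lambda>n. (\<Gamma> (w t + e n * th t) - \<Gamma> (w t)) / (e n * th t)) \<longlonglongrightarrow> g (w t)" by (rule filterlim_compose)
    then have "(\<lambda>n. exp (2 * t) * ((\<Gamma> (w t + e n * th t) - \<Gamma> (w t)) / (e n * th t)) * th t) \<longlonglongrightarrow> exp (2 * t) * g (w t) * th t"
      by (intro tendsto_intros)
    then show ?thesis using False by (simp add: D_def v_def)
  qed (simp add: D_def v_def)
  let ?b = "\<lambda>t. exp (2 * R) * K * Th * indicator {-R..R} t"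
  have ib: "integrable lborel ?b"
    by (intro integrable_mult_right integrable_real_indicator) (auto simp: emeasure_lborel_Icc_eq)
  have Dm: "D n \<in> borel_measurable lborel" for n unfolding D_def[abs_def] by measurable
  have gm: "(\<lambda>t. exp (2 * t) * g (w t) * th t) \<in> borel_measurable lborel" by measurable
  have iD: "integrable lborel (D n)" for n
    by (rule integrable_dominated_convergence2[OF gm Dm ib AE_I2[OF Dlim] AE_I2[OF Dbound]])
  have "(\<lambda>n. LINT t|lborel. D n t) \<longlonglongrightarrow> (LINT t|lborel. exp (2 * t) * g (w t) * th t)"
    by (rule integral_dominated_convergence[OF gm Dm ib AE_I2[OF Dlim] AE_I2[OF Dbound]])
  moreover have "(LINT t|lborel. exp (2 * t) * g (w t) * th t) = x * L0 + y * L1"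
  proof -
    let ?p = "\<lambda>t. exp (2 * t) * g (w t)"
    have pc: "isCont ?p t" for t by (intro continuous_intros isCont_o2[OF w_cont g_cont])
    obtain P where P: "\<And>t. (P has_real_derivative ?p t) (at t)" using has_antiderivative[OF pc] by blast
    obtain Q where Q: "\<And>t. (Q has_real_derivative P t) (at t)"
      using has_antiderivative[of P] P DERIV_isCont by blast
    note i = hat_integral(1)[OF pc P Q h(1), of c0] hat_integral(1)[OF pc P Q h(2), of c1]
    have "(LINT t|lborel. exp (2 * t) * g (w t) * th t)
      = (LINT t|lborel. x * (?p t * hat c0 h0 t) + y * (?p t * hat c1 h1 t))"
      by (intro Bochner_Integration.integral_cong) (auto simp: th_def algebra_simps)
    also have "\<dots> = x * L0 + y * L1" unfolding L0_def L1_def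
      using i by (subst Bochner_Integration.integral_add) auto
    finally show ?thesis .
  qed
  ultimately have ev: "eventually (\<lambda>n. (LINT t|lborel. D n t) > 0) sequentially"
    using pos by (intro order_tendstoD(1)) auto
  have int: "integrable lborel (\<lambda>t. exp (2 * t) * \<Gamma> (w t))" and C0: "0 \<le> (LINT t|lborel. exp (2 * t) * \<Gamma> (w t))"
    using nw unfolding normalised_def by auto
  let ?B0 = "2 * (2 * w c0 - w (c0 - h0) - w (c0 + h0)) / h0"
  let ?B1 = "2 * (2 * w c1 - w (c1 - h1) - w (c1 + h1)) / h1"
  define Q where "Q = x\<^sup>2 * (2 / h0) + y * x * (2 * (2 * hat c0 h0 c1 - hat c0 h0 (c1 - h1) - hat c0 h0 (c1 + h1)) / h1) + y\<^sup>2 * (2 / h1)"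
  have env: "fin_en (v n) (m + e n * (x * ?B0 + y * ?B1) + (e n)\<^sup>2 * Q)" for n
  proof -
    let ?w1 = "\<lambda>t. w t + (e n * x) * hat c0 h0 t"
    have "fin_en (\<lambda>t. ?w1 t + (e n * y) * hat c1 h1 t)
      (m + (e n * x) * ?B0 + (e n * x)\<^sup>2 * (2 / h0) + (e n * y) * (2 * (2 * ?w1 c1 - ?w1 (c1 - h1) - ?w1 (c1 + h1)) / h1) + (e n * y)\<^sup>2 * (2 / h1))"
      by (intro fin_en_hat[OF fin_en_hat[OF en h(1)] h(2)])
    moreover have "(\<lambda>t. ?w1 t + (e n * y) * hat c1 h1 t) = v n" by (auto simp: v_def th_def algebra_simps)
    moreover have "m + (e n * x) * ?B0 + (e n * x)\<^sup>2 * (2 / h0) + (e n * y) * (2 * (2 * ?w1 c1 - ?w1 (c1 - h1) - ?w1 (c1 + h1)) / h1) + (e n * y)\<^sup>2 * (2 / h1)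
       = m + e n * (x * ?B0 + y * ?B1) + (e n)\<^sup>2 * Q"
      using h unfolding Q_def by (simp add: power2_eq_square add_divide_distrib diff_divide_distrib algebra_simps)
    ultimately show ?thesis by (simp only:)
  qed
  have step: "0 \<le> (x * ?B0 + y * ?B1) + e n * Q" if D: "(LINT t|lborel. D n t) > 0" for n
  proof -
    have eq: "exp (2 * t) * \<Gamma> (v n t) = exp (2 * t) * \<Gamma> (w t) + e n * D n t" for t
    proof -
      have "e n * D n t = exp (2 * t) * (\<Gamma> (v n t) - \<Gamma> (w t))" using less_imp_neq[OF e(1)[of n]] by (simp add: D_def)
      then show ?thesis by (simp add: right_diff_distrib)
    qed
    have iv: "integrable lborel (\<lambda>t. exp (2 * t) * \<Gamma> (v n t))" unfolding eq using int iD by simp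
    have "(LINT t|lborel. exp (2 * t) * \<Gamma> (v n t)) = (LINT t|lborel. exp (2 * t) * \<Gamma> (w t)) + e n * (LINT t|lborel. D n t)"
      unfolding eq using int iD by simp
    then have Cv: "0 < (LINT t|lborel. exp (2 * t) * \<Gamma> (v n t))" using C0 D e(1)[of n] by (simp add: add_nonneg_pos)
    have "\<exists>t. b0 < v n t"
    proof (rule ccontr)
      assume "\<not> (\<exists>t. b0 < v n t)"
      then have le: "v n t \<le> b0" for t by (meson not_less)
      have neg: "exp (2 * t) * \<Gamma> (v n t) \<le> 0" for t
        using low[OF le[of t]] c by (intro mult_nonneg_nonpos) (auto intro: order_trans)
      have "0 \<le> (LINT t|lborel. - (exp (2 * t) * \<Gamma> (v n t)))"
        by (rule integral_nonneg_AE) (use neg in \<open>auto intro!: AE_I2\<close>)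
      then show False using Cv by simp
    qed
    moreover have "(v n \<longlongrightarrow> 0) at_top"
    proof (rule Lim_transform_eventually[OF normalised_tendsto_0[OF nw en]])
      show "eventually (\<lambda>t. w t = v n t) at_top"
        using eventually_gt_at_top[of R] by eventually_elim (use th0 in \<open>auto simp: v_def\<close>)
    qed
    ultimately have "admissible (v n)" using iv Cv unfolding admissible_def by auto
    then have "m \<le> m + e n * (x * ?B0 + y * ?B1) + (e n)\<^sup>2 * Q"
      using admissible_normalised[OF _ env[of n]] least by blast
    then have "0 \<le> e n * ((x * ?B0 + y * ?B1) + e n * Q)" by (simp add: power2_eq_square algebra_simps)
    then show ?thesis using e(1)[of n] by (simp add: zero_le_mult_iff)
  qed
  have "(\<lambda>n. (x * ?B0 + y * ?B1) + e n * Q) \<longlonglongrightarrow> (x * ?B0 + y * ?B1) + 0 * Q" by (intro tendsto_intros e0)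
  moreover have "eventually (\<lambda>n. 0 \<le> (x * ?B0 + y * ?B1) + e n * Q) sequentially"
    using ev by eventually_elim (rule step)
  ultimately have "0 \<le> (x * ?B0 + y * ?B1) + 0 * Q" by (intro tendsto_lowerbound) auto
  then show ?thesis by simp
qed

text \<open>
  Not all hat functions leave the constraint unchanged, since \<open>g (w 0) \<noteq> 0\<close>. One that does not fixes the multiplier \<open>l\<close>,
  and then \<open>w + l / 2 * Q\<close>, where \<open>Q'' = exp (2 * t) * g (w t)\<close>, has vanishing second differences, so it is affine.
  The multiplier is not \<open>0\<close>, as \<open>w\<close> would be affine, tend to \<open>0\<close> and take the value \<open>b0\<close>.
\<close>
lemma euler_lagrange:
  "\<exists>k p. 0 < k \<and> (\<forall>t. (w has_real_derivative p t) (at t) \<and> (p has_real_derivative - k * exp (2 * t) * g (w t)) (at t))"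
proof -
  let ?q = "\<lambda>t. exp (2 * t) * g (w t)"
  let ?L = "\<lambda>c h. LINT t|lborel. ?q t * hat c h t"
  let ?B = "\<lambda>c h. 2 * (2 * w c - w (c - h) - w (c + h)) / h"
  have qc: "isCont ?q t" for t by (intro continuous_intros isCont_o2[OF w_cont g_cont])
  obtain P where P: "\<And>t. (P has_real_derivative ?q t) (at t)" using has_antiderivative[OF qc] by blast
  obtain Q where Q: "\<And>t. (Q has_real_derivative P t) (at t)"
    using has_antiderivative[of P] P DERIV_isCont by blast
  note hat_int = hat_integral[OF qc P Q]
  have "\<exists>c h. h > 0 \<and> ?L c h \<noteq> 0"
  proof (rule ccontr)
    assume "\<not> (\<exists>c h. h > 0 \<and> ?L c h \<noteq> 0)"
    then have "Q (c + h) + Q (c - h) = 2 * Q c" if "h > 0" for c h using hat_int(2)[OF that, of c] that by auto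
    then have "Q t = Q 0 + (Q 1 - Q 0) * t" for t
      using affine_of_second_difference[of Q] Q DERIV_isCont by blast
    then have "Q = (\<lambda>t. Q 0 + (Q 1 - Q 0) * t)" by blast
    moreover have "((\<lambda>t. Q 0 + (Q 1 - Q 0) * t) has_real_derivative (Q 1 - Q 0)) (at t)" for t
      by (auto intro!: derivative_eq_intros)
    ultimately have "P t = Q 1 - Q 0" for t using DERIV_unique[OF Q[of t]] by metis
    then have "P = (\<lambda>t. Q 1 - Q 0)" by blast
    then have "(P has_real_derivative 0) (at 0)" by simp
    from DERIV_unique[OF P[of 0] this] have "g (w 0) = 0" by simp
    then show False using g_b0 nw unfolding normalised_def by simp
  qed
  then obtain c1 h1 where L1: "h1 > 0" "?L c1 h1 \<noteq> 0" by blast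
  define l where "l = ?B c1 h1 / ?L c1 h1"
  have l0: "l \<ge> 0"
    using first_variation[OF L1(1) L1(1), of 0 c1 "1 / ?L c1 h1" c1] L1(2) by (simp add: l_def field_simps)
  \<comment> \<open>For both signs, the hat at \<open>c\<close> is corrected by a multiple of the hat at \<open>c1\<close> so that the constraint increases by \<open>d > 0\<close>; then \<open>d\<close> tends to \<open>0\<close>.\<close>
  have BL: "?B c h = l * ?L c h" if h: "h > 0" for c h
  proof (rule order_antisym)
    have arith1: "0 \<le> B + (d - L) * l \<Longrightarrow> l * L \<le> B + d * l"
      and arith2: "0 \<le> - 1 * B + (d + L) * l \<Longrightarrow> B \<le> l * L + d * l" for B d L :: real
      by (simp_all add: algebra_simps)
    have scale: "(d / L) * B = d * (B / L)" for d B L :: real by simp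
    have 1: "l * ?L c h \<le> ?B c h + d * l" if "d > 0" for d
    proof -
      have "0 < 1 * ?L c h + (d - ?L c h) / ?L c1 h1 * ?L c1 h1" using that L1(2) by simp
      from first_variation[OF h L1(1) this]
      have "0 \<le> ?B c h + (d - ?L c h) * l" unfolding scale l_def by simp
      then show ?thesis by (rule arith1)
    qed
    have 2: "?B c h \<le> l * ?L c h + d * l" if "d > 0" for d
    proof -
      have "0 < - 1 * ?L c h + (d + ?L c h) / ?L c1 h1 * ?L c1 h1" using that L1(2) by simp
      from first_variation[OF h L1(1) this]
      have "0 \<le> - 1 * ?B c h + (d + ?L c h) * l" unfolding scale l_def .
      then show ?thesis by (rule arith2)
    qed
    have small: "\<exists>d>0. d * l \<le> e" if "e > 0" for e
      using that l0 by (intro exI[of _ "e / (l + 1)"]) (auto simp: field_simps)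
    show "l * ?L c h \<le> ?B c h"
    proof (rule field_le_epsilon)
      fix e :: real assume "e > 0"
      then obtain d where "d > 0" "d * l \<le> e" using small by blast
      then show "l * ?L c h \<le> ?B c h + e" using 1[of d] by linarith
    qed
    show "?B c h \<le> l * ?L c h"
    proof (rule field_le_epsilon)
      fix e :: real assume "e > 0"
      then obtain d where "d > 0" "d * l \<le> e" using small by blast
      then show "?B c h \<le> l * ?L c h + e" using 2[of d] by linarith
    qed
  qed
  define V where "V t = w t + l / 2 * Q t" for t
  have "V (c + h) + V (c - h) = 2 * V c" if "h > 0" for c h
  proof -
    have "h * ?B c h = l * (h * ?L c h)" using BL[OF that, of c] by simp
    moreover have "h * ?B c h = 2 * (2 * w c - w (c - h) - w (c + h))" using that by simp
    ultimately have "2 * (2 * w c - w (c - h) - w (c + h)) = l * (Q (c + h) + Q (c - h) - 2 * Q c)"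
      unfolding hat_int(2)[OF that] by (simp only:)
    then show ?thesis unfolding V_def by (simp add: algebra_simps)
  qed
  moreover have "isCont V t" for t 
    unfolding V_def by (intro continuous_intros w_cont DERIV_isCont[OF Q])
  ultimately have V: "V t = V 0 + (V 1 - V 0) * t" for t by (intro affine_of_second_difference)
  have weq: "w = (\<lambda>t. V 0 + (V 1 - V 0) * t - l / 2 * Q t)" using V by (auto simp: V_def fun_eq_iff algebra_simps)
  define p where "p t = (V 1 - V 0) - l / 2 * P t" for t
  have dw: "(w has_real_derivative p t) (at t)" for t
    unfolding p_def by (subst weq) (auto intro!: derivative_eq_intros Q)
  have dp: "(p has_real_derivative - (l / 2) * exp (2 * t) * g (w t)) (at t)" for t
    unfolding p_def[abs_def] by (auto intro!: derivative_eq_intros P)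
  have "l \<noteq> 0"
  proof
    assume "l = 0"
    then have "w t = w 0 + (w 1 - w 0) * t" for t using V[of t] by (simp add: V_def)
    then have weq: "w = (\<lambda>t. w 0 + (w 1 - w 0) * t)" by blast
    have lim: "(w \<longlongrightarrow> 0) at_top" by (rule normalised_tendsto_0[OF nw en])
    have "((\<lambda>t. w (t + 1) - w t) \<longlongrightarrow> 0 - 0) at_top"
      using filterlim_compose[OF lim filterlim_tendsto_add_at_top[OF tendsto_const[of 1] filterlim_ident]]
      by (intro tendsto_diff lim) (simp add: add.commute)
    moreover have "w (t + 1) - w t = w 1 - w 0" for t by (subst (1 2) weq) (simp add: algebra_simps)
    ultimately have "w 1 - w 0 = 0" by (simp add: tendsto_const_iff)
    then have "w = (\<lambda>t. w 0)" using weq by simp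
    then have "((\<lambda>t::real. w 0) \<longlongrightarrow> 0) at_top" using lim by simp
    then show False using nw b0 unfolding normalised_def by (simp add: tendsto_const_iff)
  qed
  then show ?thesis using l0 dw dp by (intro exI[of _ "l / 2"] exI[of _ p]) auto
qed

end

theorem minimiser:
  obtains w p k m where "0 < k" "normalised w" "fin_en w m" "(w \<longlongrightarrow> 0) at_top"
    "\<And>t. (w has_real_derivative p t) (at t)"
    "\<And>t. (p has_real_derivative - k * exp (2 * t) * g (w t)) (at t)"
    "\<And>v M. admissible v \<Longrightarrow> fin_en v M \<Longrightarrow> m \<le> M"
proof -
  obtain w m where w: "normalised w" "fin_en w m" "\<And>v M. normalised v \<Longrightarrow> fin_en v M \<Longrightarrow> m \<le> M"
    using minimiser_exists by blast
  have "\<exists>k p. 0 < k \<and> (\<forall>t. (w has_real_derivative p t) (at t) \<and> (p has_real_derivative - k * exp (2 * t) * g (w t)) (at t))"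
    by (rule euler_lagrange[of w m]) (use w in auto)
  then obtain k p where "0 < k"
    "\<And>t. (w has_real_derivative p t) (at t) \<and> (p has_real_derivative - k * exp (2 * t) * g (w t)) (at t)" by blast
  then show ?thesis
    using that w normalised_tendsto_0[OF w(1,2)] admissible_normalised by metis
qed

end

section \<open>Existence of a profile\<close>

lemma DERIV_glue_at_0:
  fixes F H :: "real \<Rightarrow> real"
  assumes "(F has_real_derivative d) (at 0)" "(H has_real_derivative d) (at 0)" "F 0 = H 0"
  shows "((\<lambda>s. if 0 \<le> s then F s else H s) has_real_derivative d) (at 0)"
proof -
  have "((\<lambda>h. if 0 \<le> h then (F (0 + h) - F 0) / h else (H (0 + h) - H 0) / h) \<longlongrightarrow> d) (at 0)"
    using assms(1,2) unfolding DERIV_def by (intro filterlim_If) (auto intro: filterlim_mono inf_le1)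
  moreover have "(\<lambda>h. if 0 \<le> h then (F (0 + h) - F 0) / h else (H (0 + h) - H 0) / h)
    = (\<lambda>h. ((if 0 \<le> 0 + h then F (0 + h) else H (0 + h)) - (if 0 \<le> (0::real) then F 0 else H 0)) / h)"
    using assms(3) by auto
  ultimately show ?thesis unfolding DERIV_def by simp
qed

text \<open>
  If \<open>y\<close> is convex where it is positive, then at a positive value it either stays large to the right or grows linearly
  to the left. The first contradicts the behaviour at \<open>\<infinity>\<close>, the second the growth bound by a square root.
\<close>
lemma no_convex_bump:
  fixes y y' y'' :: "real \<Rightarrow> real"
  assumes d: "\<And>t. (y has_real_derivative y' t) (at t)" "\<And>t. (y' has_real_derivative y'' t) (at t)"
    and conv: "\<And>t. y t > 0 \<Longrightarrow> y'' t \<ge> 0"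
    and hold: "\<And>s t. (y t - y s)\<^sup>2 \<le> M * \<bar>t - s\<bar>"
    and top: "\<And>e. e > 0 \<Longrightarrow> eventually (\<lambda>t. y t < e) at_top"
  shows "y t \<le> 0"
proof (rule ccontr)
  assume "\<not> y t \<le> 0"
  then have pos: "y t > 0" by simp
  show False
  proof (cases "y' t \<ge> 0")
    case True
    have ge: "y t \<le> y u" if "t \<le> u" for u
    proof -
      have "y t + y' t * (u - t) \<le> y u" by (rule convex_barrier_forward[OF d conv pos True that])
      moreover have "0 \<le> y' t * (u - t)" using True that by simp
      ultimately show ?thesis by simp
    qed
    obtain N where N: "\<And>u. u \<ge> N \<Longrightarrow> y u < y t" using top[OF pos] by (auto simp: eventually_at_top_linorder)
    show False using N[OF max.cobounded1[of N t]] ge[OF max.cobounded2[of t N]] by simp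
  next
    case False
    define a where "a = - y' t"
    have a: "a > 0" using False by (simp add: a_def)
    have M: "M \<ge> 0" using hold[of 1 0] order_trans[OF zero_le_power2] by fastforce
    define r where "r = M / a\<^sup>2 + 1"
    have r: "r > 0" using M a by (simp add: r_def add_nonneg_pos)
    have "y t - y' t * (t - (t - r)) \<le> y (t - r)"
      by (rule convex_barrier_backward[OF d conv pos]) (use a r in \<open>auto simp: a_def\<close>)
    then have "a * r \<le> y (t - r) - y t" by (simp add: a_def)
    then have "(a * r)\<^sup>2 \<le> (y (t - r) - y t)\<^sup>2" using a r by (intro power_mono) auto
    also have "\<dots> \<le> M * r" using hold[of "t - r" t] r by simp
    finally have "(a\<^sup>2 * r) * r \<le> M * r" by (simp add: power2_eq_square mult_ac)
    then have "a\<^sup>2 * r \<le> M" using r by simp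
    then show False using a by (simp add: r_def distrib_left)
  qed
qed

lemma mono_tendsto_at_bot:
  fixes V :: "real \<Rightarrow> real"
  assumes "mono V" "\<And>t. V t \<ge> b" shows "(V \<longlongrightarrow> Inf (range V)) at_bot"
proof (rule order_tendstoI)
  have bdd: "bdd_below (range V)" using assms(2) by (auto simp: bdd_below_def)
  fix a
  { assume "a < Inf (range V)"
    moreover have "Inf (range V) \<le> V t" for t using bdd by (intro cInf_lower) auto
    ultimately show "eventually (\<lambda>t. a < V t) at_bot" by (intro always_eventually allI) (rule less_le_trans) }
  assume "Inf (range V) < a"
  then obtain t where "V t < a" using cInf_less_iff[OF _ bdd] by auto
  then show "eventually (\<lambda>t. V t < a) at_bot"
    using monoD[OF assms(1)] by (auto simp: eventually_at_bot_linorder intro!: exI[of _ t] elim!: le_less_trans[rotated])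
qed

context nls_signs
begin

text \<open>
  For negative arguments the potential is replaced by \<open>- om * s\<^sup>2\<close>, which forces the minimiser to be nonnegative.
\<close>
definition ft :: "real \<Rightarrow> real" where "ft s = (if 0 \<le> s then f s else - 2 * om * s)"
definition Gt :: "real \<Rightarrow> real" where "Gt s = (if 0 \<le> s then G s else - om * s\<^sup>2)"

lemma DERIV_Gt: "(Gt has_real_derivative ft s) (at s)"
proof (cases s "0 :: real" rule: linorder_cases)
  case less
  have "((\<lambda>s. - om * s\<^sup>2) has_real_derivative - 2 * om * s) (at s)" by (auto intro!: derivative_eq_intros)
  then have "(Gt has_real_derivative - 2 * om * s) (at s)"
    by (rule has_field_derivative_transform_within_open[of _ _ _ "{..<0}"]) (use less in \<open>auto simp: Gt_def\<close>)
  then show ?thesis using less by (simp add: ft_def)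
next
  case greater
  have "(Gt has_real_derivative f s) (at s)"
    by (rule has_field_derivative_transform_within_open[OF DERIV_G, of "{0<..}"]) (use greater in \<open>auto simp: Gt_def\<close>)
  then show ?thesis using greater by (simp add: ft_def)
next
  case equal
  have "((\<lambda>s. - om * s\<^sup>2) has_real_derivative 0) (at 0)" by (auto intro!: derivative_eq_intros)
  moreover have "(G has_real_derivative 0) (at 0)" using DERIV_G[of 0] by (simp add: f_0)
  ultimately have "((\<lambda>s. if 0 \<le> s then G s else - om * s\<^sup>2) has_real_derivative 0) (at 0)"
    by (intro DERIV_glue_at_0) (auto simp: G_0)
  then show ?thesis using equal f_0 by (simp add: Gt_def[abs_def] ft_def)
qed

lemma isCont_ft: "isCont ft s"
proof -
  have "ft = (\<lambda>s. f (max s 0) - 2 * om * min s 0)" by (auto simp: ft_def fun_eq_iff max_def min_def f_0)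
  moreover have "isCont (\<lambda>s. f (max s 0)) s"
    by (rule isCont_o2[of s "\<lambda>s. max s 0" f]) (auto intro!: continuous_intros DERIV_isCont[OF DERIV_f])
  then have "isCont (\<lambda>s. f (max s 0) - 2 * om * min s 0) s" by (intro continuous_intros)
  ultimately show ?thesis by simp
qed

lemma small_amplitude:
  obtains b where "0 < b" "b < al" "\<And>s. 0 \<le> s \<Longrightarrow> s \<le> b \<Longrightarrow> G s \<le> - (om / 2) * s\<^sup>2"
    "\<And>s. 0 \<le> s \<Longrightarrow> s \<le> b \<Longrightarrow> f s \<le> - om * s"
proof -
  have x: "((\<lambda>s::real. s * ln s) \<longlongrightarrow> 0) (at_right 0)" by (rule tendsto_mono[OF at_le tendsto_x_ln_x]) simp
  have i: "((\<lambda>s::real. s) \<longlongrightarrow> 0) (at_right 0)" by (rule tendsto_ident_at)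
  have "((\<lambda>s. lam * s * (s * ln s) - lam / 4 * s\<^sup>2) \<longlongrightarrow> lam * 0 * 0 - lam / 4 * 0\<^sup>2) (at_right 0)"
    by (intro tendsto_intros x i)
  then have e1: "eventually (\<lambda>s. lam * s * (s * ln s) - lam / 4 * s\<^sup>2 > - om / 2) (at_right 0)"
    using om_pos by (intro order_tendstoD(1)) auto
  have "((\<lambda>s. 4 * lam * s * (s * ln s)) \<longlongrightarrow> 4 * lam * 0 * 0) (at_right 0)"
    by (intro tendsto_intros x i)
  then have e2: "eventually (\<lambda>s. 4 * lam * s * (s * ln s) > - om) (at_right 0)"
    using om_pos by (intro order_tendstoD(1)) auto
  have "eventually (\<lambda>s. lam * s * (s * ln s) - lam / 4 * s\<^sup>2 > - om / 2 \<and> 4 * lam * s * (s * ln s) > - om) (at_right 0)"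
    using e1 e2 by eventually_elim auto
  then obtain b where b: "b > 0" "\<And>s. 0 < s \<Longrightarrow> s < b \<Longrightarrow>
      lam * s * (s * ln s) - lam / 4 * s\<^sup>2 > - om / 2 \<and> 4 * lam * s * (s * ln s) > - om"
    by (auto simp: eventually_at_right_field)
  show ?thesis
  proof (rule that[of "min (b / 2) (al / 2)"])
    show "0 < min (b / 2) (al / 2)" "min (b / 2) (al / 2) < al" using b al_pos by auto
    fix s assume s: "0 \<le> s" "s \<le> min (b / 2) (al / 2)"
    show "G s \<le> - (om / 2) * s\<^sup>2"
    proof (cases "s = 0")
      case False
      then have "lam * s * (s * ln s) - lam / 4 * s\<^sup>2 > - om / 2" using b(2)[of s] b(1) s by auto
      then have "s\<^sup>2 * (lam * s * (s * ln s) - lam / 4 * s\<^sup>2) \<ge> s\<^sup>2 * (- om / 2)" by (intro mult_left_mono) auto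
      moreover have "G s = - (s\<^sup>2 * (lam * s * (s * ln s) - lam / 4 * s\<^sup>2)) - om * s\<^sup>2"
        by (simp add: G_def power2_eq_square power4_eq_xxxx algebra_simps)
      moreover have "s\<^sup>2 * (- om / 2) = - (om / 2) * s\<^sup>2" "om * s\<^sup>2 = 2 * ((om / 2) * s\<^sup>2)" by simp_all
      ultimately show ?thesis by linarith
    qed (simp add: G_0)
    show "f s \<le> - om * s"
    proof (cases "s = 0")
      case False
      then have "4 * lam * s * (s * ln s) > - om" using b(2)[of s] b(1) s by auto
      then have "s * (4 * lam * s * (s * ln s)) \<ge> s * (- om)" using s by (intro mult_left_mono) auto
      moreover have "f s = - (s * (4 * lam * s * (s * ln s))) - 2 * om * s"
        by (simp add: f_def power3_eq_cube algebra_simps)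
      ultimately show ?thesis by (simp add: mult.commute)
    qed (simp add: f_0)
  qed
qed

lemma G_le_max: "0 \<le> s \<Longrightarrow> G s \<le> G ze"
proof -
  assume s: "0 \<le> s"
  have Gze: "0 < G ze" using G_pos[of ze] be_ze by simp
  have cG: "continuous_on A G" for A by (rule continuous_on_G)
  consider "s = 0" | "0 < s" "s < be" | "s = be" | "be < s" "s < ze" | "s = ze" | "ze < s" using s by linarith
  then show ?thesis
  proof cases
    case 4
    have "G s < G ze"
      by (rule DERIV_pos_imp_increasing_open[OF 4(2) _ cG]) (use DERIV_G f_pos 4 al_be in \<open>meson less_trans\<close>)
    then show ?thesis by simp
  next
    case 6
    have "G s < G ze"
      by (rule DERIV_neg_imp_decreasing_open[OF 6 _ cG]) (use DERIV_G f_neg2 in blast)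
    then show ?thesis by simp
  qed (use Gze G_0 G_neg[of s] G_be in auto)
qed

text \<open>
  The minimiser, translated in time so that the Lagrange multiplier becomes \<open>1\<close>. It lies between \<open>0\<close> and \<open>ze\<close> by
  \<open>no_convex_bump\<close>, and is positive by uniqueness for the equation. Its slope is \<open>O(exp (2 * t))\<close> at \<open>-\<infinity>\<close> because a
  slope that does not tend to \<open>0\<close> would make the bounded function unbounded. At \<open>\<infinity>\<close> it lies below the barrier
  \<open>C * exp (- sqrt om * exp t)\<close>, as \<open>f s \<le> - om * s\<close> for small \<open>s\<close>. The number \<open>m\<close> is the minimal energy; the last
  conclusion is the form in which minimality is used for rearranged competitors.
\<close>
theorem profile_exists:
  obtains W P m b where "profile W P" "integrable lborel (\<lambda>t. (P t)\<^sup>2)" "(LINT t|lborel. (P t)\<^sup>2) \<le> m"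
    "0 < b" "\<And>s. 0 \<le> s \<Longrightarrow> s \<le> b \<Longrightarrow> G s \<le> - (om / 2) * s\<^sup>2"
    "\<And>v M. (\<And>t. 0 \<le> v t) \<Longrightarrow> (v \<longlongrightarrow> 0) at_top \<Longrightarrow> (\<exists>t. b < v t) \<Longrightarrow>
      integrable lborel (\<lambda>t. exp (2 * t) * G (v t)) \<Longrightarrow> 0 \<le> (LINT t|lborel. exp (2 * t) * G (v t)) \<Longrightarrow>
      fin_en v M \<Longrightarrow> m \<le> M"
proof -
  obtain b where b: "0 < b" "b < al" and Gb: "\<And>s. 0 \<le> s \<Longrightarrow> s \<le> b \<Longrightarrow> G s \<le> - (om / 2) * s\<^sup>2"
    and fb: "\<And>s. 0 \<le> s \<Longrightarrow> s \<le> b \<Longrightarrow> f s \<le> - om * s" using small_amplitude by blast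
  have Gze: "0 < G ze" using G_pos[of ze] be_ze by simp
  interpret radial_min ft Gt b "om / 2" "G ze" ze
  proof
    show "(Gt has_real_derivative ft s) (at s)" "isCont ft s" for s by (rule DERIV_Gt isCont_ft)+
    show "Gt s \<le> - (om / 2) * s\<^sup>2" if "s \<le> b" for s
      using Gb[of s] that om_pos by (auto simp: Gt_def mult_right_mono)
    show "Gt s \<le> G ze" for s
    proof (cases "0 \<le> s")
      case False
      have "- om * s\<^sup>2 \<le> 0" using om_pos by simp
      then show ?thesis using False Gze by (simp add: Gt_def)
    qed (simp add: Gt_def G_le_max)
    show "0 < Gt ze" using Gze be_ze al_be al_pos by (simp add: Gt_def)
    show "ft b \<noteq> 0" using f_neg1[OF b] b by (simp add: ft_def)
  qed (use b om_pos G_0 in \<open>auto simp: Gt_def\<close>)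
  obtain w p k m where w: "0 < k" "normalised w" "fin_en w m" "(w \<longlongrightarrow> 0) at_top"
    "\<And>t. (w has_real_derivative p t) (at t)" "\<And>t. (p has_real_derivative - k * exp (2 * t) * ft (w t)) (at t)"
    and least: "\<And>v M. admissible v \<Longrightarrow> fin_en v M \<Longrightarrow> m \<le> M" by (rule minimiser) blast
  \<comment> \<open>A translation by \<open>T\<close> multiplies \<open>exp (2 * t)\<close> by \<open>1 / k\<close> and so removes the multiplier.\<close>
  define T where "T = - ln k / 2"
  define W where "W t = w (t + T)" for t
  define P where "P t = p (t + T)" for t
  have DW: "(W has_real_derivative P t) (at t)" for t
    using DERIV_shift[of w "p (t + T)" t T] w(5)[of "t + T"] by (simp add: W_def[abs_def] P_def)
  have kT: "k * exp (2 * (t + T)) = exp (2 * t)" for t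
    using w(1) by (simp add: T_def distrib_left exp_diff)
  have DP0: "(P has_real_derivative - exp (2 * t) * ft (W t)) (at t)" for t
  proof -
    have "- k * exp (2 * (t + T)) * ft (w (t + T)) = - exp (2 * t) * ft (W t)" using kT[of t] by (simp add: W_def)
    then show ?thesis using DERIV_shift[of p _ t T] w(6)[of "t + T"] by (simp add: P_def[abs_def])
  qed
  have enW: "fin_en W m" unfolding W_def[abs_def] by (rule fin_en_shift[OF w(3)])
  have hold: "(W t - W s)\<^sup>2 \<le> m * \<bar>t - s\<bar>" for s t by (rule fin_en_holder[OF enW])
  have topW: "(W \<longlongrightarrow> 0) at_top"
    using filterlim_compose[OF w(4) filterlim_tendsto_add_at_top[OF tendsto_const[of T] filterlim_ident]]
    by (simp add: W_def[abs_def] add.commute)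
  have nonneg: "0 \<le> W t" for t
  proof -
    have "- W t \<le> 0"
    proof (rule no_convex_bump[where y = "\<lambda>t. - W t" and y' = "\<lambda>t. - P t" and y'' = "\<lambda>t. exp (2 * t) * ft (W t)" and M = m])
      show "((\<lambda>t. - W t) has_real_derivative - P t) (at t)" for t by (rule DERIV_minus[OF DW])
      show "((\<lambda>t. - P t) has_real_derivative exp (2 * t) * ft (W t)) (at t)" for t
        using DERIV_minus[OF DP0[of t]] by simp
      show "0 \<le> exp (2 * t) * ft (W t)" if "0 < - W t" for t
      proof -
        have "om * W t \<le> 0" using that om_pos by (intro mult_nonneg_nonpos) auto
        then have "0 \<le> ft (W t)" using that by (simp add: ft_def)
        then show ?thesis by simp
      qed
      show "(- W t - - W s)\<^sup>2 \<le> m * \<bar>t - s\<bar>" for s t using hold[of t s] by (simp add: power2_commute)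
      show "eventually (\<lambda>t. - W t < e) at_top" if "e > 0" for e
        using tendsto_minus[OF topW] that by (intro order_tendstoD(2)) auto
    qed
    then show ?thesis by simp
  qed
  have ftf: "ft (W t) = f (W t)" for t using nonneg[of t] by (simp add: ft_def)
  have DP: "(P has_real_derivative - exp (2 * t) * f (W t)) (at t)" for t using DP0[of t] by (simp add: ftf)
  have ode: "radial_ode W P" unfolding radial_ode_def using DW DP by blast
  have zepos: "0 < ze" using al_pos al_be be_ze by simp
  have le_ze: "W t \<le> ze" for t
  proof -
    have "W t - ze \<le> 0"
    proof (rule no_convex_bump[where y = "\<lambda>t. W t - ze" and y' = P and y'' = "\<lambda>t. - exp (2 * t) * f (W t)" and M = m])
      show "((\<lambda>t. W t - ze) has_real_derivative P t) (at t)" for t using DERIV_diff[OF DW DERIV_const] by simp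
      show "0 \<le> - exp (2 * t) * f (W t)" if "0 < W t - ze" for t
        using f_neg2[of "W t"] that by (simp add: mult_nonneg_nonpos)
      show "(W t - ze - (W s - ze))\<^sup>2 \<le> m * \<bar>t - s\<bar>" for s t using hold[of t s] by simp
      show "eventually (\<lambda>t. W t - ze < e) at_top" if "e > 0" for e
        using order_tendstoD(2)[OF topW, of "e + ze"] that zepos by (auto elim: eventually_mono)
    qed (rule DP)
    then show ?thesis by simp
  qed
  have pos: "0 < W t" for t
  proof (rule ccontr)
    assume "\<not> 0 < W t"
    then have z: "W t = 0" using nonneg[of t] by simp
    have "P t = 0" by (rule DERIV_local_min[OF DW, of 1]) (use z nonneg in auto)
    moreover have bd: "\<bar>W u\<bar> \<le> ze" "\<bar>0 :: real\<bar> \<le> ze" for u using nonneg[of u] le_ze[of u] zepos by auto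
    ultimately have "W u = 0" for u
      using ode_unique_point[OF ode radial_ode_const[OF f_0] bd, of t u] z by auto
    then have "W (- T) = 0" by blast
    then show False using w(2) b unfolding normalised_def by (simp add: W_def)
  qed
  obtain K where K: "K > 0" "\<And>s. s \<in> {0..ze} \<Longrightarrow> \<bar>f s\<bar> \<le> K"
    using compact_bound[of f 0 ze] DERIV_isCont[OF DERIV_f] by blast
  have fK: "\<bar>f (W t)\<bar> \<le> K" for t using K(2)[of "W t"] nonneg[of t] le_ze[of t] by simp
  have dK: "((\<lambda>t. K / 2 * exp (2 * t)) has_real_derivative K * exp (2 * t)) (at t)" for t
    by (auto intro!: derivative_eq_intros)
  have key: "- exp (2 * t) * f (W t) - K * exp (2 * t) \<le> 0" "- exp (2 * t) * f (W t) + K * exp (2 * t) \<ge> 0" for t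
  proof -
    have "exp (2 * t) * (- f (W t) - K) \<le> 0" using fK[of t] by (intro mult_nonneg_nonpos) auto
    then show "- exp (2 * t) * f (W t) - K * exp (2 * t) \<le> 0" by (simp add: algebra_simps)
    have "exp (2 * t) * (- f (W t) + K) \<ge> 0" using fK[of t] by (intro mult_nonneg_nonneg) auto
    then show "- exp (2 * t) * f (W t) + K * exp (2 * t) \<ge> 0" by (simp add: algebra_simps)
  qed
  have P1: "P t - K / 2 * exp (2 * t) \<le> P s - K / 2 * exp (2 * s)" if "s \<le> t" for s t
    by (rule DERIV_nonpos_imp_nonincreasing[OF that, where f = "\<lambda>t. P t - K / 2 * exp (2 * t)"])
      (use DERIV_diff[OF DP dK] key in blast)
  have P2: "P t + K / 2 * exp (2 * t) \<ge> P s + K / 2 * exp (2 * s)" if "s \<le> t" for s t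
    by (rule DERIV_nonneg_imp_nondecreasing[OF that, where f = "\<lambda>t. P t + K / 2 * exp (2 * t)"])
      (use DERIV_add[OF DP dK] key in blast)
  \<comment> \<open>A slope bounded away from zero on a left half-line is incompatible with \<open>0 \<le> W \<le> ze\<close>.\<close>
  have slope: False if a: "a > 0" and s: "\<sigma> = 1 \<or> \<sigma> = (- 1 :: real)" and ge: "\<And>u. u \<le> t \<Longrightarrow> a \<le> \<sigma> * P u" for a \<sigma> t
  proof -
    define r where "r = ze / a + 1"
    have r: "r > 0" "a * r > ze" using a zepos by (auto simp: r_def add_pos_pos distrib_left)
    have "\<sigma> * W (t - r) - a * (t - r) \<le> \<sigma> * W t - a * t"
    proof (rule DERIV_nonneg_imp_nondecreasing[where f = "\<lambda>u. \<sigma> * W u - a * u"])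
      fix u assume "t - r \<le> u" "u \<le> t"
      then have "0 \<le> \<sigma> * P u - a * 1" using ge[of u] by simp
      moreover have "((\<lambda>u. \<sigma> * W u - a * u) has_real_derivative \<sigma> * P u - a * 1) (at u)"
        by (intro DERIV_diff DERIV_cmult DW DERIV_ident)
      ultimately show "\<exists>D. ((\<lambda>u. \<sigma> * W u - a * u) has_real_derivative D) (at u) \<and> 0 \<le> D" by blast
    qed (use r in simp)
    then have "a * r \<le> \<sigma> * W t - \<sigma> * W (t - r)" by (simp add: algebra_simps)
    moreover have "\<sigma> * W t - \<sigma> * W (t - r) \<le> ze"
      using s nonneg[of t] nonneg[of "t - r"] le_ze[of t] le_ze[of "t - r"] by auto
    ultimately show False using r by simp
  qed
  have Pbound: "\<bar>P t\<bar> \<le> K / 2 * exp (2 * t)" for t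
  proof (rule ccontr)
    assume n: "\<not> \<bar>P t\<bar> \<le> K / 2 * exp (2 * t)"
    then consider "P t > K / 2 * exp (2 * t)" | "- P t > K / 2 * exp (2 * t)" by linarith
    then show False
    proof cases
      case 1
      have "P t - K / 2 * exp (2 * t) \<le> 1 * P u" if "u \<le> t" for u
      proof -
        have "0 \<le> K / 2 * exp (2 * u)" using K(1) by simp
        then show ?thesis using P1[OF that] by simp
      qed
      then show False using slope[of "P t - K / 2 * exp (2 * t)" 1 t] 1 by simp
    next
      case 2
      have "- P t - K / 2 * exp (2 * t) \<le> - 1 * P u" if "u \<le> t" for u
      proof -
        have "0 \<le> K / 2 * exp (2 * u)" using K(1) by simp
        then show ?thesis using P2[OF that] by simp
      qed
      then show False using slope[of "- P t - K / 2 * exp (2 * t)" "-1" t] 2 by simp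
    qed
  qed
  have e0: "((\<lambda>t::real. exp (2 * t)) \<longlongrightarrow> 0) at_bot" by real_asymp
  have "((\<lambda>t. K / 2 * exp (2 * t)) \<longlongrightarrow> 0) at_bot" using tendsto_mult_left[OF e0, of "K / 2"] by simp
  moreover have "eventually (\<lambda>t. norm (P t) \<le> K / 2 * exp (2 * t)) at_bot"
    unfolding real_norm_def by (intro always_eventually allI Pbound)
  ultimately have Pbot: "(P \<longlongrightarrow> 0) at_bot" by (rule Lim_null_comparison[rotated])
  let ?V = "\<lambda>t. W t + K / 4 * exp (2 * t)"
  have "?V x \<le> ?V y" if "x \<le> y" for x y
  proof (rule DERIV_nonneg_imp_nondecreasing[OF that, where f = "?V"])
    fix t
    have "((\<lambda>t. K / 4 * exp (2 * t)) has_real_derivative K / 2 * exp (2 * t)) (at t)"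
      by (auto intro!: derivative_eq_intros)
    from DERIV_add[OF DW this] have "(?V has_real_derivative P t + K / 2 * exp (2 * t)) (at t)" .
    moreover have "0 \<le> P t + K / 2 * exp (2 * t)" using Pbound[of t] by (simp add: abs_le_iff)
    ultimately show "\<exists>D. (?V has_real_derivative D) (at t) \<and> 0 \<le> D" by blast
  qed
  then have "mono ?V" by (intro monoI)
  moreover have "0 \<le> ?V t" for t using nonneg[of t] K(1) by simp
  ultimately have "(?V \<longlongrightarrow> Inf (range ?V)) at_bot" by (rule mono_tendsto_at_bot)
  moreover have "((\<lambda>t. K / 4 * exp (2 * t)) \<longlongrightarrow> 0) at_bot" using tendsto_mult_left[OF e0, of "K / 4"] by simp
  ultimately have "((\<lambda>t. ?V t - K / 4 * exp (2 * t)) \<longlongrightarrow> Inf (range ?V) - 0) at_bot" by (rule tendsto_diff)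
  then have Wbot: "(W \<longlongrightarrow> Inf (range ?V)) at_bot" by simp
  have "eventually (\<lambda>t. W t < b) at_top" using topW b by (intro order_tendstoD(2)) auto
  then obtain T0 where T0: "\<And>t. t \<ge> T0 \<Longrightarrow> W t < b" by (auto simp: eventually_at_top_linorder)
  define \<delta> where "\<delta> = sqrt om"
  have \<delta>: "\<delta> > 0" "\<delta>\<^sup>2 = om" using om_pos by (auto simp: \<delta>_def)
  define C where "C = (ze + 1) * exp (\<delta> * exp T0)"
  have C: "C > 0" using zepos by (simp add: C_def)
  let ?B = "\<lambda>t. C * exp (- \<delta> * exp t)"
  have CT0: "?B T0 = ze + 1" by (simp add: C_def flip: exp_add)
  have decay: "W t \<le> ?B t" for t
  proof (cases "t \<le> T0")
    case True
    have "W t \<le> ?B T0" using le_ze[of t] CT0 by simp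
    also have "\<dots> \<le> ?B t" using True C \<delta> by (intro mult_left_mono) auto
    finally show ?thesis .
  next
    case False
    let ?y = "\<lambda>t. W t - ?B t"
    let ?y' = "\<lambda>t. P t + \<delta> * exp t * ?B t"
    let ?y'' = "\<lambda>t. - exp (2 * t) * f (W t) + (\<delta> * exp t * ?B t - \<delta>\<^sup>2 * exp (2 * t) * ?B t)"
    have dB: "(?B has_real_derivative - (\<delta> * exp t * ?B t)) (at t)" for t
      by (auto intro!: derivative_eq_intros)
    have dy: "(?y has_real_derivative ?y' t) (at t)" for t
      using DERIV_diff[OF DW dB, of t] by simp
    have dy': "(?y' has_real_derivative ?y'' t) (at t)" for t
    proof -
      have d2: "((\<lambda>t. \<delta> * exp t * ?B t) has_real_derivative (\<delta> * exp t) * ?B t + - (\<delta> * exp t * ?B t) * (\<delta> * exp t)) (at t)"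
        by (intro DERIV_mult DERIV_cmult DERIV_exp dB)
      have e2: "exp t * exp t = exp (2 * t)" by (simp flip: exp_add)
      have "d * E * X + - (d * E * X) * (d * E) = d * E * X - d\<^sup>2 * (E * E) * X" for d E X :: real
        by (simp add: power2_eq_square)
      from this[of \<delta> "exp t" "?B t", unfolded e2] have eq: "(\<delta> * exp t) * ?B t + - (\<delta> * exp t * ?B t) * (\<delta> * exp t)
        = \<delta> * exp t * ?B t - \<delta>\<^sup>2 * exp (2 * t) * ?B t" .
      from DERIV_add[OF DP d2[unfolded eq]] show ?thesis .
    qed
    have conv: "0 \<le> ?y'' u" if u: "T0 \<le> u" "0 < ?y u" for u
    proof -
      have "f (W u) \<le> - om * W u" using fb[of "W u"] T0[OF u(1)] nonneg[of u] by simp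
      also have "\<dots> \<le> - om * ?B u" using u(2) om_pos by (simp add: mult_left_mono)
      finally have "exp (2 * u) * (om * ?B u) \<le> exp (2 * u) * (- f (W u))" by (intro mult_left_mono) auto
      moreover have "0 \<le> \<delta> * exp u * ?B u" using \<delta> C by simp
      ultimately show ?thesis by (simp add: \<delta>(2) algebra_simps)
    qed
    show ?thesis
    proof (rule ccontr)
      assume n: "\<not> W t \<le> ?B t"
      have "continuous_on {T0..t} ?y" using dy DERIV_isCont by (blast intro: continuous_at_imp_continuous_on)
      then obtain t1 where t1: "t1 \<in> {T0..t}" "\<And>u. u \<in> {T0..t} \<Longrightarrow> ?y u \<le> ?y t1"
        using continuous_attains_sup[of "{T0..t}" ?y] False by auto
      have y1: "0 < ?y t1" using t1(2)[of t] n False by auto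
      have "?y T0 < 0" using le_ze[of T0] CT0 by simp
      then have "t1 \<noteq> T0" using y1 by auto
      then have "T0 < t1" using t1(1) by simp
      have "0 \<le> ?y' t1"
      proof (rule ccontr)
        assume "\<not> 0 \<le> ?y' t1"
        then obtain h where h: "h > 0" "\<And>e. e > 0 \<Longrightarrow> e < h \<Longrightarrow> ?y t1 < ?y (t1 - e)"
          using DERIV_neg_dec_left[OF dy] by (metis not_le)
        define e where "e = min (h / 2) (t1 - T0)"
        have "0 < e" "e < h" "t1 - e \<in> {T0..t}" using h(1) \<open>T0 < t1\<close> t1(1) by (auto simp: e_def min_def)
        then show False using h(2)[of e] t1(2)[of "t1 - e"] by simp
      qed
      then have "?y t1 + ?y' t1 * (u - t1) \<le> ?y u" if "t1 \<le> u" for u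
        by (rule convex_barrier_forward[OF dy dy' conv y1 _ that, rotated 2]) (use \<open>T0 < t1\<close> in auto)
      then have ge: "?y t1 \<le> W u" if "t1 \<le> u" for u
        using that \<open>0 \<le> ?y' t1\<close> C by (smt (verit) exp_gt_zero mult_nonneg_nonneg mult_pos_pos)
      obtain N where "\<And>u. u \<ge> N \<Longrightarrow> W u < ?y t1"
        using order_tendstoD(2)[OF topW y1] by (auto simp: eventually_at_top_linorder)
      then show False using ge[of "max N t1"] by (metis max.cobounded1 max.cobounded2 not_le)
    qed
  qed
  have prof: "profile W P"
    unfolding profile_def using ode pos Wbot Pbot \<delta>(1) decay by blast
  have Pcont: "isCont P t" for t by (rule DERIV_isCont[OF DP])
  show ?thesis
  proof (rule that[OF prof fin_en_deriv_square_integral[OF enW DW Pcont] b(1) Gb])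
    fix v M
    assume v: "\<And>t. 0 \<le> v t" "(v \<longlongrightarrow> 0) at_top" "\<exists>t. b < v t"
      "integrable lborel (\<lambda>t. exp (2 * t) * G (v t))" "0 \<le> (LINT t|lborel. exp (2 * t) * G (v t))" "fin_en v M"
    then have "admissible v" unfolding admissible_def by (simp add: Gt_def)
    then show "m \<le> M" using least v(6) by blast
  qed
qed

end

section \<open>Calculus in the plane and the Pohozaev identity\<close>

text \<open>
  A relational form of \<open>partial_deriv\<close>, which combines with the usual differentiation rules.
\<close>
definition has_partial :: "'n \<Rightarrow> (real ^ 'n::finite \<Rightarrow> 'a::real_normed_vector) \<Rightarrow> (real ^ 'n \<Rightarrow> 'a) \<Rightarrow> bool" where
  "has_partial i F D \<longleftrightarrow> (\<forall>x. ((\<lambda>t. F (x + t *\<^sub>R axis i 1)) has_vector_derivative D x) (at 0))"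

lemma has_partialD: "has_partial i F D \<Longrightarrow> ((\<lambda>t. F (x + t *\<^sub>R axis i 1)) has_vector_derivative D x) (at 0)"
  unfolding has_partial_def by blast

lemma has_partial_eq: "has_partial i F D \<Longrightarrow> partial_deriv i F = D"
  unfolding has_partial_def partial_deriv_def by (auto intro: vector_derivative_at)

lemma C1_has_partial: "C1 F \<Longrightarrow> has_partial i F (partial_deriv i F)"
  unfolding C1_def has_partial_def partial_deriv_def by (auto simp: vector_derivative_works[symmetric])

lemma C1_cont: "C1 F \<Longrightarrow> continuous_on UNIV F" "C1 F \<Longrightarrow> continuous_on UNIV (partial_deriv i F)"
  unfolding C1_def by auto

lemma C1I:
  assumes "continuous_on UNIV F" "\<And>i. has_partial i F (D i)" "\<And>i. continuous_on UNIV (D i)"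
  shows "C1 F"
  unfolding C1_def
proof (intro conjI allI)
  fix i x
  show "(\<lambda>t. F (x + t *\<^sub>R axis i 1)) differentiable at 0"
    using has_partialD[OF assms(2)] differentiableI_vector by blast
  show "continuous_on UNIV (partial_deriv i F)" using has_partial_eq[OF assms(2)] assms(3) by simp
qed (rule assms(1))

lemma has_partial_line:
  assumes "has_partial i F D"
  shows "((\<lambda>t. F (x + t *\<^sub>R axis i 1)) has_vector_derivative D (x + t *\<^sub>R axis i 1)) (at t)"
proof -
  have "((\<lambda>s. F ((x + t *\<^sub>R axis i 1) + s *\<^sub>R axis i 1)) has_vector_derivative D (x + t *\<^sub>R axis i 1)) (at (t - t))"
    using has_partialD[OF assms, of "x + t *\<^sub>R axis i 1"] by simp
  moreover have "((\<lambda>u. u - t) has_vector_derivative 1) (at t)" by (auto intro!: derivative_eq_intros)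
  ultimately have "((\<lambda>s. F ((x + t *\<^sub>R axis i 1) + s *\<^sub>R axis i 1)) \<circ> (\<lambda>u. u - t) has_vector_derivative 1 *\<^sub>R D (x + t *\<^sub>R axis i 1)) (at t)"
    by (intro vector_diff_chain_at) 
  moreover have "(x + t *\<^sub>R axis i 1) + (u - t) *\<^sub>R axis i 1 = x + u *\<^sub>R axis i (1::real)" for u
    by (simp add: scaleR_diff_left)
  ultimately show ?thesis by (simp add: o_def)
qed

lemma has_partial_cong: "has_partial i F D \<Longrightarrow> (\<And>x. D x = D' x) \<Longrightarrow> has_partial i F D'"
  unfolding has_partial_def by simp

lemma has_partial_const: "has_partial i (\<lambda>x. c) (\<lambda>x. 0)"
  unfolding has_partial_def by simp

lemma has_partial_add: "has_partial i F D \<Longrightarrow> has_partial i H E \<Longrightarrow> has_partial i (\<lambda>x. F x + H x) (\<lambda>x. D x + E x)"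
  unfolding has_partial_def by (auto intro: has_vector_derivative_add)

lemma has_partial_diff: "has_partial i F D \<Longrightarrow> has_partial i H E \<Longrightarrow> has_partial i (\<lambda>x. F x - H x) (\<lambda>x. D x - E x)"
  unfolding has_partial_def by (auto intro: has_vector_derivative_diff)

lemma has_partial_sum: "(\<And>j. j \<in> I \<Longrightarrow> has_partial i (F j) (D j)) \<Longrightarrow> has_partial i (\<lambda>x. \<Sum>j\<in>I. F j x) (\<lambda>x. \<Sum>j\<in>I. D j x)"
  unfolding has_partial_def by (auto intro: has_vector_derivative_sum)

lemma has_partial_bilinear:
  assumes "bounded_bilinear p" "has_partial i F D" "has_partial i H E"
  shows "has_partial i (\<lambda>x. p (F x) (H x)) (\<lambda>x. p (F x) (E x) + p (D x) (H x))"
  unfolding has_partial_def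
  using bounded_bilinear.has_vector_derivative[OF assms(1) has_partialD[OF assms(2)] has_partialD[OF assms(3)]] by simp

lemmas has_partial_inner = has_partial_bilinear[OF bounded_bilinear_inner]
lemmas has_partial_mult = has_partial_bilinear[OF bounded_bilinear_mult]

lemma has_partial_compose:
  fixes F :: "real ^ 'n::finite \<Rightarrow> real"
  assumes "has_partial i F D" "\<And>x. (h has_real_derivative h' (F x)) (at (F x))"
  shows "has_partial i (\<lambda>x. h (F x)) (\<lambda>x. h' (F x) * D x)"
  unfolding has_partial_def
proof
  fix x
  have "((\<lambda>t. F (x + t *\<^sub>R axis i 1)) has_real_derivative D x) (at 0)"
    using has_partialD[OF assms(1)] by (simp add: has_real_derivative_iff_has_vector_derivative)
  from DERIV_chain2[OF _ this, of h "h' (F x)"] assms(2)[of x]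
  show "((\<lambda>t. h (F (x + t *\<^sub>R axis i 1))) has_vector_derivative h' (F x) * D x) (at 0)"
    by (simp add: has_real_derivative_iff_has_vector_derivative)
qed

lemma has_partial_coord: "has_partial i (\<lambda>x. x $ j) (\<lambda>x. if i = j then 1 else 0)"
  unfolding has_partial_def
  by (auto simp: axis_def intro!: derivative_eq_intros)

lemma lborel_translate:
  fixes h :: "'a::euclidean_space \<Rightarrow> real"
  assumes [measurable]: "h \<in> borel_measurable borel"
  shows "integrable lborel (\<lambda>x. h (c + x)) \<longleftrightarrow> integrable lborel h"
    "(LINT x|lborel. h (c + x)) = (LINT x|lborel. h x)"
proof -
  have d: "distr lborel borel ((+) c) = (lborel :: 'a measure)" by (rule lborel_distr_plus)
  show "integrable lborel (\<lambda>x. h (c + x)) \<longleftrightarrow> integrable lborel h"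
    by (subst (2) d[symmetric]) (simp add: integrable_distr_eq)
  show "(LINT x|lborel. h (c + x)) = (LINT x|lborel. h x)"
    by (subst (2) d[symmetric]) (simp add: integral_distr)
qed

lemma cont_borel: "continuous_on UNIV h \<Longrightarrow> h \<in> borel_measurable borel"
  by (rule borel_measurable_continuous_onI)

text \<open>
  By Fubini's theorem and translation invariance, the integral of \<open>D\<close> equals the integral of \<open>F (e + x) - F x\<close>, where
  \<open>e\<close> is the unit vector of the direction \<open>i\<close>; this is zero by translation invariance again.
\<close>
theorem integral_partial_zero:
  fixes F D :: "real ^ 'n::finite \<Rightarrow> real"
  assumes hp: "has_partial i F D" and cD: "continuous_on UNIV D"
    and iF: "integrable lborel F" and iD: "integrable lborel D"
  shows "(LINT x|lborel. D x) = 0"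
proof -
  let ?e = "axis i 1 :: real ^ 'n"
  have Dm [measurable]: "D \<in> borel_measurable borel" by (rule cont_borel[OF cD])
  have Fm [measurable]: "F \<in> borel_measurable borel" using iF by simp
  let ?g = "\<lambda>(t, x). D (t *\<^sub>R ?e + x) * indicator {0..1::real} t"
  have gm [measurable]: "?g \<in> borel_measurable (lborel \<Otimes>\<^sub>M lborel)"
    by measurable
  have ftc: "(LINT t|lborel. D (t *\<^sub>R ?e + x) * indicator {0..1} t) = F (?e + x) - F x" for x
  proof -
    have "has_bochner_integral lborel (\<lambda>t. D (x + t *\<^sub>R ?e) * indicator {0..1} t) (F (x + 1 *\<^sub>R ?e) - F (x + 0 *\<^sub>R ?e))"
    proof (rule has_bochner_integral_FTC_Icc_real)
      show "((\<lambda>t. F (x + t *\<^sub>R ?e)) has_real_derivative D (x + t *\<^sub>R ?e)) (at t)" for t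
        using has_partial_line[OF hp] by (simp add: has_real_derivative_iff_has_vector_derivative)
      show "isCont (\<lambda>t. D (x + t *\<^sub>R ?e)) t" for t
        by (rule isCont_o2[of t "\<lambda>t. x + t *\<^sub>R ?e" D])
          (use cD in \<open>auto intro!: continuous_intros simp: continuous_on_eq_continuous_at\<close>)
    qed simp
    then show ?thesis by (simp add: has_bochner_integral_iff add.commute)
  qed
  have row: "integrable lborel (\<lambda>x. D (t *\<^sub>R ?e + x) * indicator {0..1} t)"
    "(LINT x|lborel. D (t *\<^sub>R ?e + x) * indicator {0..1} t) = indicator {0..1} t * (LINT x|lborel. D x)"
    "(LINT x|lborel. norm (D (t *\<^sub>R ?e + x) * indicator {0..1} t)) = indicator {0..1} t * (LINT x|lborel. norm (D x))" for t :: real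
  proof -
    show "integrable lborel (\<lambda>x. D (t *\<^sub>R ?e + x) * indicator {0..1} t)"
      using lborel_translate(1)[OF Dm, of "t *\<^sub>R ?e"] iD by simp
    show "(LINT x|lborel. D (t *\<^sub>R ?e + x) * indicator {0..1} t) = indicator {0..1} t * (LINT x|lborel. D x)"
      using lborel_translate(2)[OF Dm, of "t *\<^sub>R ?e"] by simp
    show "(LINT x|lborel. norm (D (t *\<^sub>R ?e + x) * indicator {0..1} t)) = indicator {0..1} t * (LINT x|lborel. norm (D x))"
      using lborel_translate(2)[of "\<lambda>x. norm (D x)" "t *\<^sub>R ?e"] by (simp add: abs_mult)
  qed
  have ind: "integrable lborel (\<lambda>t. indicator {0..1::real} t * c)" for c :: real
    by (intro integrable_mult_left integrable_real_indicator) auto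
  have "integrable (lborel \<Otimes>\<^sub>M lborel) ?g"
  proof (rule lborel_pair.Fubini_integrable[OF gm])
    show "integrable lborel (\<lambda>t. LINT x|lborel. norm (?g (t, x)))"
      unfolding split_conv row(3) by (rule ind)
    show "AE t in lborel. integrable lborel (\<lambda>x. ?g (t, x))" unfolding split_conv by (intro AE_I2 row(1))
  qed
  then have "(LINT x|lborel. (LINT t|lborel. D (t *\<^sub>R ?e + x) * indicator {0..1} t)) = (LINT t|lborel. (LINT x|lborel. D (t *\<^sub>R ?e + x) * indicator {0..1} t))"
    by (intro lborel_pair.Fubini_integral) simp
  also have "\<dots> = (LINT t|lborel. indicator {0..1::real} t * (LINT x|lborel. D x))" unfolding row(2) ..
  also have "\<dots> = (LINT x|lborel. D x)" by simp
  finally have "(LINT x|lborel. D x) = (LINT x|lborel. F (?e + x) - F x)" unfolding ftc by simp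
  also have "\<dots> = (LINT x|lborel. F (?e + x)) - (LINT x|lborel. F x)"
    using iF lborel_translate(1)[OF Fm] by (intro Bochner_Integration.integral_diff) auto
  also have "\<dots> = 0" using lborel_translate(2)[OF Fm, of ?e] by simp
  finally show ?thesis .
qed

lemma integrable_compact_support:
  fixes h :: "real ^ 'n::finite \<Rightarrow> real"
  assumes c: "continuous_on UNIV h" and z: "\<And>x. norm x > R \<Longrightarrow> h x = 0"
  shows "integrable lborel h"
proof -
  have "integrable lborel (\<lambda>x. indicator (cball 0 R) x *\<^sub>R h x)"
    by (rule borel_integrable_compact) (use c in \<open>auto intro: continuous_on_subset\<close>)
  moreover have "(\<lambda>x. indicator (cball 0 R) x *\<^sub>R h x) = h" using z by (auto simp: indicator_def fun_eq_iff)
  ultimately show ?thesis by (simp only:)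
qed

text \<open>
  Both mixed derivatives are limits of the same double difference quotients by two applications of the mean value
  theorem.
\<close>
lemma clairaut:
  fixes F :: "real ^ 'n::finite \<Rightarrow> real"
  assumes i: "has_partial i F Di" and j: "has_partial j F Dj"
    and ij: "has_partial j Di Dji" and ji: "has_partial i Dj Dij"
    and c: "continuous_on UNIV Dji" "continuous_on UNIV Dij"
  shows "Dij x = Dji x"
proof -
  let ?a = "axis i 1 :: real ^ 'n" let ?b = "axis j 1 :: real ^ 'n"
  have step: "\<exists>u v. 0 < u \<and> u < h \<and> 0 < v \<and> v < h \<and>
      F (x + h *\<^sub>R axis k 1 + h *\<^sub>R axis l 1) - F (x + h *\<^sub>R axis k 1) - F (x + h *\<^sub>R axis l 1) + F x = h * (h * E (x + u *\<^sub>R axis k 1 + v *\<^sub>R axis l 1))"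
    if k: "has_partial k F Dk" and l: "has_partial l Dk E" and h: "h > 0" for k l Dk E h
  proof -
    define A where "A s = F (x + h *\<^sub>R axis l 1 + s *\<^sub>R axis k 1) - F (x + s *\<^sub>R axis k 1)" for s
    have dA: "(A has_real_derivative Dk (x + h *\<^sub>R axis l 1 + s *\<^sub>R axis k 1) - Dk (x + s *\<^sub>R axis k 1)) (at s)" for s
      unfolding A_def[abs_def] has_real_derivative_iff_has_vector_derivative
      by (intro has_vector_derivative_diff has_partial_line[OF k])
    obtain u where u: "0 < u" "u < h" "A h - A 0 = (h - 0) * (Dk (x + h *\<^sub>R axis l 1 + u *\<^sub>R axis k 1) - Dk (x + u *\<^sub>R axis k 1))"
      using MVT2[OF h, of A "\<lambda>s. Dk (x + h *\<^sub>R axis l 1 + s *\<^sub>R axis k 1) - Dk (x + s *\<^sub>R axis k 1)"] dA by blast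
    define B where "B s = Dk (x + u *\<^sub>R axis k 1 + s *\<^sub>R axis l 1)" for s
    have dB: "(B has_real_derivative E (x + u *\<^sub>R axis k 1 + s *\<^sub>R axis l 1)) (at s)" for s
      unfolding B_def[abs_def] has_real_derivative_iff_has_vector_derivative by (rule has_partial_line[OF l])
    obtain v where v: "0 < v" "v < h" "B h - B 0 = (h - 0) * E (x + u *\<^sub>R axis k 1 + v *\<^sub>R axis l 1)"
      using MVT2[OF h, of B "\<lambda>s. E (x + u *\<^sub>R axis k 1 + s *\<^sub>R axis l 1)"] dB by blast
    have "A h - A 0 = F (x + h *\<^sub>R axis k 1 + h *\<^sub>R axis l 1) - F (x + h *\<^sub>R axis k 1) - F (x + h *\<^sub>R axis l 1) + F x"
      by (simp add: A_def add.assoc add.commute[of "h *\<^sub>R axis l 1"])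
    moreover have "B h - B 0 = Dk (x + h *\<^sub>R axis l 1 + u *\<^sub>R axis k 1) - Dk (x + u *\<^sub>R axis k 1)"
      by (simp add: B_def add.assoc add.commute[of "h *\<^sub>R axis l 1"])
    ultimately show ?thesis using u v by (intro exI[of _ u] exI[of _ v]) simp
  qed
  define h where "h n = 1 / real (Suc n)" for n
  have h: "h n > 0" for n by (simp add: h_def)
  have h0: "h \<longlonglongrightarrow> 0" unfolding h_def[abs_def] by real_asymp
  have "\<forall>n. \<exists>u v. 0 < u \<and> u < h n \<and> 0 < v \<and> v < h n \<and>
     F (x + h n *\<^sub>R ?a + h n *\<^sub>R ?b) - F (x + h n *\<^sub>R ?a) - F (x + h n *\<^sub>R ?b) + F x = h n * (h n * Dji (x + u *\<^sub>R ?a + v *\<^sub>R ?b))"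
    using step[OF i ij h] by blast
  then obtain u v where uv: "\<And>n. 0 < u n" "\<And>n. u n < h n" "\<And>n. 0 < v n" "\<And>n. v n < h n"
     "\<And>n. F (x + h n *\<^sub>R ?a + h n *\<^sub>R ?b) - F (x + h n *\<^sub>R ?a) - F (x + h n *\<^sub>R ?b) + F x = h n * (h n * Dji (x + u n *\<^sub>R ?a + v n *\<^sub>R ?b))"
    by metis
  have "\<forall>n. \<exists>u v. 0 < u \<and> u < h n \<and> 0 < v \<and> v < h n \<and>
     F (x + h n *\<^sub>R ?b + h n *\<^sub>R ?a) - F (x + h n *\<^sub>R ?b) - F (x + h n *\<^sub>R ?a) + F x = h n * (h n * Dij (x + u *\<^sub>R ?b + v *\<^sub>R ?a))"
    using step[OF j ji h] by blast
  then obtain u' v' where uv': "\<And>n. 0 < u' n" "\<And>n. u' n < h n" "\<And>n. 0 < v' n" "\<And>n. v' n < h n"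
     "\<And>n. F (x + h n *\<^sub>R ?b + h n *\<^sub>R ?a) - F (x + h n *\<^sub>R ?b) - F (x + h n *\<^sub>R ?a) + F x = h n * (h n * Dij (x + u' n *\<^sub>R ?b + v' n *\<^sub>R ?a))"
    by metis
  have to0: "w \<longlonglongrightarrow> 0" if "\<And>n. 0 < w n" "\<And>n. w n < h n" for w :: "nat \<Rightarrow> real"
    by (rule tendsto_sandwich[of "\<lambda>_. 0" w sequentially h]) (use that h0 in \<open>auto intro!: always_eventually less_imp_le\<close>)
  have pt: "(\<lambda>n. x + w n *\<^sub>R a + z n *\<^sub>R b) \<longlonglongrightarrow> x" if "w \<longlonglongrightarrow> 0" "z \<longlonglongrightarrow> 0" for w z :: "nat \<Rightarrow> real" and a b
  proof -
    have "(\<lambda>n. x + w n *\<^sub>R a + z n *\<^sub>R b) \<longlonglongrightarrow> x + 0 *\<^sub>R a + 0 *\<^sub>R b" by (intro tendsto_intros that)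
    then show ?thesis by simp
  qed
  have eq: "Dji (x + u n *\<^sub>R ?a + v n *\<^sub>R ?b) = Dij (x + u' n *\<^sub>R ?b + v' n *\<^sub>R ?a)" for n
  proof -
    have "h n * (h n * Dji (x + u n *\<^sub>R ?a + v n *\<^sub>R ?b)) = h n * (h n * Dij (x + u' n *\<^sub>R ?b + v' n *\<^sub>R ?a))"
      unfolding uv(5)[symmetric] uv'(5)[symmetric] by (simp add: add.assoc add.commute[of "h n *\<^sub>R ?b"])
    then show ?thesis using h[of n] by simp
  qed
  have cont: "isCont Dji x" "isCont Dij x" using c by (simp_all add: continuous_on_eq_continuous_at)
  have l1: "(\<lambda>n. Dji (x + u n *\<^sub>R ?a + v n *\<^sub>R ?b)) \<longlonglongrightarrow> Dji x"
    by (rule isCont_tendsto_compose[OF cont(1) pt[OF to0[OF uv(1,2)] to0[OF uv(3,4)]]])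
  have l2: "(\<lambda>n. Dij (x + u' n *\<^sub>R ?b + v' n *\<^sub>R ?a)) \<longlonglongrightarrow> Dij x"
    by (rule isCont_tendsto_compose[OF cont(2) pt[OF to0[OF uv'(1,2)] to0[OF uv'(3,4)]]])
  show ?thesis using LIMSEQ_unique[OF l2 l1[unfolded eq]] .
qed

text \<open>
  A continuously differentiable function with values in \<open>[0, 1]\<close> that vanishes outside the ball of radius \<open>R\<close>. Its
  gradient times \<open>x\<close> is bounded independently of \<open>R\<close>, as the Pohozaev identity requires.
\<close>
definition cutoff :: "real \<Rightarrow> real ^ 'n::finite \<Rightarrow> real" where
  "cutoff R x = (max 0 (1 - (x \<bullet> x) / R\<^sup>2))\<^sup>2"
definition dcutoff :: "real \<Rightarrow> 'n \<Rightarrow> real ^ 'n::finite \<Rightarrow> real" where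
  "dcutoff R i x = 2 * max 0 (1 - (x \<bullet> x) / R\<^sup>2) * (- (2 * (x $ i)) / R\<^sup>2)"

lemma DERIV_pos_part_sq: "((\<lambda>s::real. (max 0 s)\<^sup>2) has_real_derivative 2 * max 0 s) (at s)"
proof (cases s "0 :: real" rule: linorder_cases)
  case less
  have "((\<lambda>s::real. (max 0 s)\<^sup>2) has_real_derivative 0) (at s)"
    by (rule has_field_derivative_transform_within_open[of "\<lambda>_. 0" _ _ "{..<0}"]) (use less in auto)
  then show ?thesis using less by simp
next
  case greater
  have "((\<lambda>s::real. s\<^sup>2) has_real_derivative 2 * s) (at s)" by (auto intro!: derivative_eq_intros)
  then have "((\<lambda>s::real. (max 0 s)\<^sup>2) has_real_derivative 2 * s) (at s)"
    by (rule has_field_derivative_transform_within_open[of _ _ _ "{0<..}"]) (use greater in auto)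
  then show ?thesis using greater by simp
next
  case equal
  have "((\<lambda>s::real. if 0 \<le> s then s\<^sup>2 else 0) has_real_derivative 0) (at 0)"
    by (intro DERIV_glue_at_0) (auto intro!: derivative_eq_intros)
  moreover have "(\<lambda>s::real. if 0 \<le> s then s\<^sup>2 else 0) = (\<lambda>s. (max 0 s)\<^sup>2)" by (auto simp: max_def)
  ultimately show ?thesis using equal by simp
qed

lemma has_partial_sq_norm:
  fixes i :: "'n::finite"
  shows "has_partial i (\<lambda>x :: real ^ 'n. x \<bullet> x) (\<lambda>x. 2 * (x $ i))"
proof -
  have "has_partial i (\<lambda>x :: real ^ 'n. \<Sum>j\<in>UNIV. x $ j * x $ j) (\<lambda>x. \<Sum>j\<in>UNIV. x $ j * (if i = j then 1 else 0) + (if i = j then 1 else 0) * x $ j)"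
    by (intro has_partial_sum has_partial_mult has_partial_coord)
  moreover have "(\<Sum>j\<in>UNIV. x $ j * (if i = j then 1 else 0) + (if i = j then 1 else 0) * x $ j) = 2 * (x $ i)" for x :: "real ^ 'n"
  proof -
    have "(\<Sum>j\<in>UNIV. x $ j * (if i = j then 1 else 0) + (if i = j then 1 else 0) * x $ j) = (\<Sum>j\<in>UNIV. if i = j then 2 * (x $ j) else 0)"
      by (intro sum.cong) auto
    then show ?thesis by simp
  qed
  ultimately show ?thesis by (simp only: inner_vec_def inner_real_def)
qed

lemma has_partial_cutoff:
  fixes i :: "'n::finite"
  shows "has_partial i (cutoff R) (dcutoff R i :: real ^ 'n \<Rightarrow> real)"
proof -
  have "has_partial i (\<lambda>x :: real ^ 'n. 1 - (x \<bullet> x) * (1 / R\<^sup>2)) (\<lambda>x. 0 - ((x \<bullet> x) * 0 + 2 * (x $ i) * (1 / R\<^sup>2)))"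
    by (intro has_partial_diff has_partial_mult has_partial_const has_partial_sq_norm)
  from has_partial_compose[OF this DERIV_pos_part_sq] show ?thesis
    unfolding cutoff_def[abs_def] dcutoff_def[abs_def] by simp
qed

lemma cont_cutoff: "continuous_on UNIV (cutoff R)" "continuous_on UNIV (dcutoff R i)"
  unfolding cutoff_def[abs_def] dcutoff_def[abs_def] divide_inverse by (intro continuous_intros)+

lemma cutoff_bounds: "0 \<le> cutoff R x" "cutoff R x \<le> 1"
  unfolding cutoff_def by (auto simp: power_le_one_iff max_def)

lemma cutoff_outside:
  assumes "R > 0" "norm x > R" shows "cutoff R x = 0" "dcutoff R i x = 0"
proof -
  have "R\<^sup>2 < x \<bullet> x" using assms by (simp add: power2_norm_eq_inner[symmetric] power_strict_mono)
  then have "max 0 (1 - (x \<bullet> x) / R\<^sup>2) = 0" using assms by (simp add: max_def field_simps)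
  then show "cutoff R x = 0" "dcutoff R i x = 0" by (simp_all add: cutoff_def dcutoff_def)
qed

lemma dcutoff_bound:
  assumes R: "R > 0" shows "\<bar>dcutoff R i x\<bar> \<le> 4 / R" "\<bar>dcutoff R i x * x $ j\<bar> \<le> 4"
proof -
  have *: "\<bar>dcutoff R i x\<bar> \<le> 4 / R \<and> \<bar>dcutoff R i x * x $ j\<bar> \<le> 4"
  proof (cases "norm x > R")
    case True
    then show ?thesis using cutoff_outside(2)[OF R True] R by simp
  next
    case False
    then have n: "norm x \<le> R" by simp
    have k: "\<bar>x $ k\<bar> \<le> R" for k using component_le_norm_cart[of x k] n by simp
    have m: "\<bar>2 * max 0 (1 - (x \<bullet> x) / R\<^sup>2)\<bar> \<le> 2" using R by (simp add: max_def)
    have d: "\<bar>dcutoff R i x\<bar> \<le> 2 * (2 * R / R\<^sup>2)"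
      unfolding dcutoff_def abs_mult using m k[of i] R by (intro mult_mono) (auto simp: divide_right_mono)
    also have "\<dots> = 4 / R" using R by (simp add: power2_eq_square)
    finally have 1: "\<bar>dcutoff R i x\<bar> \<le> 4 / R" .
    have "\<bar>dcutoff R i x * x $ j\<bar> \<le> (4 / R) * R" unfolding abs_mult using 1 k[of j] R by (intro mult_mono) auto
    then show ?thesis using 1 R by simp
  qed
  then show "\<bar>dcutoff R i x\<bar> \<le> 4 / R" "\<bar>dcutoff R i x * x $ j\<bar> \<le> 4" by auto
qed

lemma cutoff_tendsto:
  "(\<lambda>n. cutoff (real (Suc n)) x) \<longlonglongrightarrow> 1" "(\<lambda>n. dcutoff (real (Suc n)) i x) \<longlonglongrightarrow> 0"
proof -
  have r: "(\<lambda>n. c / (real (Suc n))\<^sup>2) \<longlonglongrightarrow> 0" for c :: real by real_asymp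
  have "(\<lambda>n. (max 0 (1 - (x \<bullet> x) / (real (Suc n))\<^sup>2))\<^sup>2) \<longlonglongrightarrow> (max 0 (1 - 0))\<^sup>2"
    by (intro tendsto_intros r)
  then show "(\<lambda>n. cutoff (real (Suc n)) x) \<longlonglongrightarrow> 1" by (simp add: cutoff_def)
  have "(\<lambda>n. 2 * max 0 (1 - (x \<bullet> x) / (real (Suc n))\<^sup>2) * (- (2 * (x $ i)) / (real (Suc n))\<^sup>2)) \<longlonglongrightarrow> 2 * max 0 (1 - 0) * 0"
    by (intro tendsto_intros r)
  then show "(\<lambda>n. dcutoff (real (Suc n)) i x) \<longlonglongrightarrow> 0" by (simp add: dcutoff_def)
qed

lemma rho_ln_ge: "\<rho> \<ge> 0 \<Longrightarrow> \<rho> * ln \<rho> \<ge> -1" for \<rho> :: real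
proof (cases "\<rho> = 0")
  case False
  assume "\<rho> \<ge> 0"
  then have p: "\<rho> > 0" using False by simp
  have "ln (1 / \<rho>) \<le> 1 / \<rho> - 1" using p by (intro ln_le_minus_one) simp
  then have "1 - 1 / \<rho> \<le> ln \<rho>" using p by (simp add: ln_div)
  then have "\<rho> * (1 - 1 / \<rho>) \<le> \<rho> * ln \<rho>" using p by (intro mult_left_mono) auto
  then show ?thesis using p by (simp add: algebra_simps)
qed simp

context nls
begin

text \<open>
  A competitor \<open>\<psi>\<close> is complex-valued, and \<open>complex\<close> enters only as a real inner product space. In terms of
  \<open>rho = norm \<psi> ^ 2\<close> the potential \<open>G (norm \<psi>)\<close> becomes \<open>Gr rho\<close>, which is differentiable also where \<open>\<psi>\<close> vanishes.
\<close>
context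
  fixes \<psi> :: "real ^ 2 \<Rightarrow> complex"
  assumes sol: "stationary_solution lam om \<psi>" and H1: "finite_H1 \<psi>"
begin

abbreviation "d \<equiv> \<lambda>i. partial_deriv i \<psi>"
abbreviation "dd \<equiv> \<lambda>i j. partial_deriv i (partial_deriv j \<psi>)"
definition rho :: "real ^ 2 \<Rightarrow> real" where "rho x = \<psi> x \<bullet> \<psi> x"
definition Gr :: "real \<Rightarrow> real" where "Gr r = - (lam / 2) * (r\<^sup>2 * ln r) + lam / 4 * r\<^sup>2 - om * r"

lemma psi_C2: "C1 \<psi>" "C1 (d i)" using sol unfolding stationary_solution_def C2_def by auto
lemma hp_psi: "has_partial i \<psi> (d i)" and hp_d: "has_partial i (d j) (dd i j)"
  by (rule C1_has_partial psi_C2)+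
lemma cont_psi: "continuous_on UNIV \<psi>" "continuous_on UNIV (d i)" "continuous_on UNIV (dd i j)"
  using C1_cont psi_C2 by auto

lemma rho_norm: "rho x = (norm (\<psi> x))\<^sup>2" by (simp add: rho_def power2_norm_eq_inner)
lemma rho_nonneg: "rho x \<ge> 0" by (simp add: rho_norm)
lemma hp_rho: "has_partial i rho (\<lambda>x. 2 * (\<psi> x \<bullet> d i x))"
  unfolding rho_def[abs_def]
  by (rule has_partial_cong[OF has_partial_inner[OF hp_psi hp_psi]]) (simp add: inner_commute)
lemma cont_rho: "continuous_on UNIV rho" unfolding rho_def[abs_def] by (intro continuous_intros cont_psi)

lemma pde: "dd 1 1 x + dd 2 2 x = (2 * (lam * (rho x * ln (rho x)) + om)) *\<^sub>R \<psi> x"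
proof -
  have "- (1 / 2) *\<^sub>R (dd 1 1 x + dd 2 2 x) + (lam * rho x * ln (rho x)) *\<^sub>R \<psi> x + om *\<^sub>R \<psi> x = 0"
    using sol unfolding stationary_solution_def laplacian_def by (simp add: sum_2 rho_norm)
  then have "2 *\<^sub>R (- (1 / 2) *\<^sub>R (dd 1 1 x + dd 2 2 x) + (lam * rho x * ln (rho x)) *\<^sub>R \<psi> x + om *\<^sub>R \<psi> x) = 2 *\<^sub>R 0" by simp
  then show ?thesis by (simp add: algebra_simps eq_neg_iff_add_eq_0 add_eq_0_iff)
qed

lemma grad2: "grad_norm_sq \<psi> x = d 1 x \<bullet> d 1 x + d 2 x \<bullet> d 2 x"
  unfolding grad_norm_sq_def by (simp add: sum_2 power2_norm_eq_inner)

lemma int_rho: "integrable lborel rho" and int_grad: "integrable lborel (grad_norm_sq \<psi>)"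
  using H1 unfolding finite_H1_def rho_norm[abs_def] by auto

lemma isCont_rho_ln: "continuous_on UNIV (\<lambda>x. (rho x) ^ Suc k * ln (rho x))"
proof -
  have "isCont (\<lambda>s::real. s ^ Suc k * ln s) s" for s
  proof (cases k)
    case 0
    show ?thesis
    proof (cases "s = 0")
      case True
      then show ?thesis using tendsto_x_ln_x 0 by (simp add: isCont_def)
    next
      case False
      then show ?thesis using DERIV_isCont[OF DERIV_ln_nonzero[OF False]] by (intro continuous_intros)
    qed
  next
    case (Suc m)
    then show ?thesis using DERIV_isCont[OF DERIV_power_ln[of m s]] by simp
  qed
  then have "continuous_on UNIV (\<lambda>s::real. s ^ Suc k * ln s)" by (intro continuous_at_imp_continuous_on) auto
  from continuous_on_compose2[OF this cont_rho] show ?thesis by simp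
qed

text \<open>
  Testing the equation with \<open>\<psi>\<close> times a cutoff bounds the integral of \<open>rho\<^sup>2 * ln rho + rho\<close>, which is nonnegative by
  \<open>rho_ln_ge\<close>, against every cutoff by a multiple of the mass and the Dirichlet integral.
\<close>
lemma nehari_integrable: "integrable lborel (\<lambda>x. (rho x)\<^sup>2 * ln (rho x))" "integrable lborel (\<lambda>x. (rho x)\<^sup>2)"
proof -
  define n where "n x = 2 * lam * ((rho x)\<^sup>2 * ln (rho x) + rho x)" for x
  have c2: "continuous_on UNIV (\<lambda>x. (rho x)\<^sup>2 * ln (rho x))" using isCont_rho_ln[of 1] by (simp add: power2_eq_square)
  have [measurable]: "rho \<in> borel_measurable borel" "(\<lambda>x. (rho x)\<^sup>2 * ln (rho x)) \<in> borel_measurable borel"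
    using cont_borel cont_rho c2 by auto
  have nm [measurable]: "n \<in> borel_measurable borel"
    unfolding n_def[abs_def] by measurable
  have n0: "0 \<le> n x" for x
  proof -
    have "0 \<le> rho x * (rho x * ln (rho x) + 1)" using rho_ln_ge[of "rho x"] rho_nonneg[of x] by (intro mult_nonneg_nonneg) auto
    then have "0 \<le> (2 * lam) * (rho x * (rho x * ln (rho x) + 1))" by (rule mult_nonneg_nonneg[rotated]) (use lam_pos in simp)
    then show ?thesis unfolding n_def by (simp add: power2_eq_square algebra_simps)
  qed
  define B where "B = (2 * lam + 4) * (LINT x|lborel. rho x) + 2 * (LINT x|lborel. grad_norm_sq \<psi> x)"
  have bound: "(LINT x|lborel. cutoff R x * n x) \<le> B" "integrable lborel (\<lambda>x. cutoff R x * n x)" if R: "R \<ge> 1" for R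
  proof -
    have R0: "R > 0" using R by simp
    let ?F = "\<lambda>i x. cutoff R x * (\<psi> x \<bullet> d i x)"
    let ?D = "\<lambda>i x. cutoff R x * (\<psi> x \<bullet> dd i i x + d i x \<bullet> d i x) + dcutoff R i x * (\<psi> x \<bullet> d i x)"
    have cD: "continuous_on UNIV (?D i)" and cF: "continuous_on UNIV (?F i)" for i
      by (intro continuous_intros cont_cutoff cont_psi)+
    have iD: "integrable lborel (?D i)" for i by (rule integrable_compact_support[OF cD, of R]) (simp add: cutoff_outside[OF R0])
    have iF: "integrable lborel (?F i)" for i by (rule integrable_compact_support[OF cF, of R]) (simp add: cutoff_outside[OF R0])
    have z: "(LINT x|lborel. ?D i x) = 0" for i
      by (rule integral_partial_zero[OF has_partial_mult[OF has_partial_cutoff has_partial_inner[OF hp_psi hp_d]] cD iF iD])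
    have in': "integrable lborel (\<lambda>x. cutoff R x * n x)"
      by (rule integrable_compact_support[of _ R])
        (auto simp: n_def cutoff_outside[OF R0] intro!: continuous_intros cont_cutoff cont_rho c2)
    have le: "cutoff R x * n x \<le> (?D 1 x + ?D 2 x) + ((2 * lam + 4) * rho x + 2 * grad_norm_sq \<psi> x)" for x
    proof -
      let ?c = "cutoff R x" let ?g = "d 1 x \<bullet> d 1 x + d 2 x \<bullet> d 2 x"
      have lap: "\<psi> x \<bullet> dd 1 1 x + \<psi> x \<bullet> dd 2 2 x = 2 * (lam * (rho x * ln (rho x)) + om) * rho x"
        unfolding inner_add_right[symmetric] pde by (simp add: rho_def)
      have t: "\<bar>dcutoff R i x * (\<psi> x \<bullet> d i x)\<bar> \<le> 2 * rho x + 2 * (d i x \<bullet> d i x)" for i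
      proof -
        have "\<bar>\<psi> x \<bullet> d i x\<bar> \<le> norm (\<psi> x) * norm (d i x)" by (rule Cauchy_Schwarz_ineq2)
        also have "\<dots> \<le> (rho x + d i x \<bullet> d i x) / 2"
          unfolding rho_norm power2_norm_eq_inner[symmetric] using sum_squares_bound[of "norm (\<psi> x)" "norm (d i x)"] by simp
        finally have "\<bar>dcutoff R i x\<bar> * \<bar>\<psi> x \<bullet> d i x\<bar> \<le> 4 * ((rho x + d i x \<bullet> d i x) / 2)"
          using dcutoff_bound(1)[OF R0, of i x] R by (intro mult_mono) (auto intro: order_trans simp: divide_le_eq)
        then show ?thesis by (simp add: abs_mult)
      qed
      have e1: "?D 1 x + ?D 2 x = ?c * (2 * (lam * (rho x * ln (rho x)) + om) * rho x) + ?c * ?g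
          + (dcutoff R 1 x * (\<psi> x \<bullet> d 1 x) + dcutoff R 2 x * (\<psi> x \<bullet> d 2 x))"
        unfolding lap[symmetric] by (simp add: algebra_simps)
      have e2: "?c * n x = ?c * (2 * (lam * (rho x * ln (rho x)) + om) * rho x) - 2 * om * (?c * rho x) + 2 * lam * (?c * rho x)"
        unfolding n_def by (simp add: power2_eq_square algebra_simps)
      have nn: "0 \<le> ?c * ?g" "0 \<le> ?c * rho x" "?c * rho x \<le> rho x"
        using cutoff_bounds[of R x] rho_nonneg[of x] by (auto simp: mult_left_le_one_le)
      have lo: "2 * lam * (?c * rho x) \<le> 2 * lam * rho x" "0 \<le> 2 * om * (?c * rho x)"
        using nn lam_pos om_pos by auto
      have e3: "(2 * lam + 4) * rho x = 2 * lam * rho x + 4 * rho x" by (simp add: algebra_simps)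
      have combine: "N \<le> S + (K + 2 * (g1 + g2))"
        if "S = A + cg + (t1 + t2)" "N = A - u + l" "0 \<le> cg" "l \<le> L" "0 \<le> u" "K = L + 4 * r"
          "\<bar>t1\<bar> \<le> 2 * r + 2 * g1" "\<bar>t2\<bar> \<le> 2 * r + 2 * g2" for N S A cg t1 t2 u l L K r g1 g2 :: real
      proof -
        have "- (2 * r + 2 * g1) \<le> t1" "- (2 * r + 2 * g2) \<le> t2" using that(7,8) by (simp_all add: abs_le_iff)
        then have "A + cg - (4 * r + 2 * (g1 + g2)) \<le> S" using that(1) by simp
        moreover have "N \<le> A + L" using that(2,4,5) by simp
        ultimately show ?thesis using that(3,6) by simp
      qed
      show ?thesis unfolding grad2 by (rule combine[OF e1 e2 nn(1) lo e3 t t])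
    qed
    have iR: "integrable lborel (\<lambda>x. (2 * lam + 4) * rho x + 2 * grad_norm_sq \<psi> x)" using int_rho int_grad by auto
    have "(LINT x|lborel. cutoff R x * n x) \<le> (LINT x|lborel. (?D 1 x + ?D 2 x) + ((2 * lam + 4) * rho x + 2 * grad_norm_sq \<psi> x))"
      by (intro integral_mono in' Bochner_Integration.integrable_add iD iR le)
    also have "\<dots> = ((LINT x|lborel. ?D 1 x) + (LINT x|lborel. ?D 2 x)) + B"
      unfolding B_def
      by (subst Bochner_Integration.integral_add[OF Bochner_Integration.integrable_add[OF iD iD] iR],
          subst Bochner_Integration.integral_add[OF iD iD]) (use int_rho int_grad in simp)
    finally show "(LINT x|lborel. cutoff R x * n x) \<le> B" unfolding z by simp
    show "integrable lborel (\<lambda>x. cutoff R x * n x)" by (rule in')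
  qed
  let ?c = "\<lambda>k x. cutoff (real (Suc k)) x * n x"
  have "(\<lambda>k. ?c k x) \<longlonglongrightarrow> 1 * n x" for x by (intro tendsto_intros cutoff_tendsto)
  then have lim: "(\<lambda>k. ?c k x) \<longlonglongrightarrow> n x" for x by simp
  have cm: "cutoff R \<in> borel_measurable borel" for R by (rule cont_borel[OF cont_cutoff(1)])
  have "(\<integral>\<^sup>+x. ennreal (n x) \<partial>lborel) = (\<integral>\<^sup>+x. liminf (\<lambda>k. ennreal (?c k x)) \<partial>lborel)"
    by (intro nn_integral_cong sym[OF lim_imp_Liminf] tendsto_ennrealI lim) simp
  also have "\<dots> \<le> liminf (\<lambda>k. \<integral>\<^sup>+x. ennreal (?c k x) \<partial>lborel)"
    by (rule nn_integral_liminf) (use cm in measurable)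
  also have "\<dots> \<le> ennreal B"
  proof -
    have "(\<integral>\<^sup>+x. ennreal (?c k x) \<partial>lborel) \<le> ennreal B" for k
    proof -
      have nn: "AE x in lborel. 0 \<le> ?c k x" by (intro AE_I2 mult_nonneg_nonneg[OF cutoff_bounds(1) n0])
      have R: "real (Suc k) \<ge> 1" by simp
      show ?thesis unfolding nn_integral_eq_integral[OF bound(2)[OF R] nn] by (intro ennreal_leI bound(1)[OF R])
    qed
    then show ?thesis
      using Liminf_mono[of "\<lambda>k. \<integral>\<^sup>+x. ennreal (?c k x) \<partial>lborel" "\<lambda>_. ennreal B" sequentially] by (simp add: Liminf_const)
  qed
  finally have "integrable lborel n"
    using n0 by (intro integrableI_bounded) (auto intro: le_less_trans)
  then have "integrable lborel (\<lambda>x. n x / (2 * lam) - rho x)" using int_rho by auto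
  moreover have "n x / (2 * lam) - rho x = (rho x)\<^sup>2 * ln (rho x)" for x using lam_pos by (simp add: n_def)
  ultimately show i1: "integrable lborel (\<lambda>x. (rho x)\<^sup>2 * ln (rho x))" by simp
  have b: "norm ((rho x)\<^sup>2) \<le> norm (exp 1 * rho x + norm ((rho x)\<^sup>2 * ln (rho x)))" for x
  proof (cases "rho x \<le> exp 1")
    case True
    then have "(rho x)\<^sup>2 \<le> exp 1 * rho x" using rho_nonneg[of x] by (simp add: power2_eq_square mult_right_mono)
    then show ?thesis using rho_nonneg[of x] by (simp add: add_nonneg_nonneg add_increasing2)
  next
    case False
    then have "1 \<le> ln (rho x)" by (metis exp_gt_zero less_imp_le less_trans ln_exp ln_le_cancel_iff not_le)
    then have "(rho x)\<^sup>2 * 1 \<le> (rho x)\<^sup>2 * ln (rho x)" by (intro mult_left_mono) auto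
    then show ?thesis using rho_nonneg[of x] by (simp add: add_increasing)
  qed
  have i2: "integrable lborel (\<lambda>x. exp 1 * rho x + norm ((rho x)\<^sup>2 * ln (rho x)))" using int_rho i1 by auto
  show "integrable lborel (\<lambda>x. (rho x)\<^sup>2)"
    by (rule Bochner_Integration.integrable_bound[OF i2 _ AE_I2[OF b]]) measurable
qed

lemma G_rho: "G (norm (\<psi> x)) = Gr (rho x)"
proof (cases "\<psi> x = 0")
  case False
  then have "ln (rho x) = 2 * ln (norm (\<psi> x))" unfolding rho_norm by (simp add: ln_mult power2_eq_square)
  then show ?thesis unfolding Gr_def G_def rho_norm by (simp add: power2_eq_square power4_eq_xxxx)
qed (simp add: G_def Gr_def rho_def)

lemma DERIV_Gr: "(Gr has_real_derivative - (lam * (r * ln r) + om)) (at r)"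
proof -
  have "((\<lambda>s. s ^ Suc (Suc 0) * ln s) has_real_derivative real (0 + 2) * r ^ Suc 0 * ln r + r ^ Suc 0) (at r)"
    by (rule DERIV_power_ln)
  then have "((\<lambda>s. s\<^sup>2 * ln s) has_real_derivative 2 * r * ln r + r) (at r)" by (simp add: power2_eq_square)
  then have "((\<lambda>r. - (lam / 2) * (r\<^sup>2 * ln r) + lam / 4 * r\<^sup>2 - om * r) has_real_derivative
      - (lam / 2) * (2 * r * ln r + r) + lam / 4 * (2 * r) - om * 1) (at r)"
    by (intro DERIV_diff DERIV_add DERIV_cmult DERIV_ident) (auto intro!: derivative_eq_intros)
  moreover have "- (lam / 2) * (2 * r * ln r + r) + lam / 4 * (2 * r) - om * 1 = - (lam * (r * ln r) + om)"
    by (simp add: algebra_simps)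
  ultimately show ?thesis unfolding Gr_def[abs_def] by simp
qed

lemma mixed_partials: "dd i j x = dd j i x"
proof (rule vector_eq_rdot[THEN iffD1], rule allI)
  fix v
  have "has_partial k (\<lambda>x. H x \<bullet> v) (\<lambda>x. E x \<bullet> v)" if "has_partial k H E" for k and H E :: "real ^ 2 \<Rightarrow> complex"
    by (rule has_partial_cong[OF has_partial_inner[OF that has_partial_const]]) simp
  then show "dd i j x \<bullet> v = dd j i x \<bullet> v"
    by (intro clairaut[where F = "\<lambda>x. \<psi> x \<bullet> v" and i = i and j = j and Di = "\<lambda>x. d i x \<bullet> v" and Dj = "\<lambda>x. d j x \<bullet> v"])
      (auto intro!: hp_psi hp_d continuous_intros cont_psi)
qed

lemma int_G: "integrable lborel (\<lambda>x. Gr (rho x))"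
  unfolding Gr_def using nehari_integrable int_rho by auto

text \<open>
  The vector field \<open>X\<close>, the stress tensor applied to \<open>x\<close>, has divergence \<open>2 * G (norm \<psi>)\<close> for every solution in two
  dimensions. Multiplied by cutoffs it integrates to zero, and the term with the gradient of the cutoff is dominated,
  since \<open>\<bar>X\<bar>\<close> is at most \<open>norm x\<close> times an integrable function.
\<close>
theorem pohozaev: "(LINT x|lborel. G (norm (\<psi> x))) = 0"
proof -
  let ?e = "\<lambda>x. (d 1 x \<bullet> d 1 x + d 2 x \<bullet> d 2 x) / 2 - Gr (rho x)"
  let ?h = "\<lambda>x. - (lam * (rho x * ln (rho x)) + om)"
  \<comment> \<open>The \<open>i\<close>-th component of the stress tensor of the Lagrangian \<open>?e\<close>, applied to \<open>x\<close>.\<close>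
  define X where "X i x = (d i x \<bullet> d 1 x) * x $ 1 + (d i x \<bullet> d 2 x) * x $ 2 - x $ i * ?e x" for i x
  define DX where "DX i x = ((d i x \<bullet> d 1 x) * (if i = 1 then 1 else 0) + (d i x \<bullet> dd i 1 x + dd i i x \<bullet> d 1 x) * x $ 1)
     + ((d i x \<bullet> d 2 x) * (if i = 2 then 1 else 0) + (d i x \<bullet> dd i 2 x + dd i i x \<bullet> d 2 x) * x $ 2)
     - (x $ i * ((d 1 x \<bullet> dd i 1 x + d 2 x \<bullet> dd i 2 x) - ?h x * (2 * (\<psi> x \<bullet> d i x))) + 1 * ?e x)" for i x
  have hp_e: "has_partial i ?e (\<lambda>x. (d 1 x \<bullet> dd i 1 x + d 2 x \<bullet> dd i 2 x) - ?h x * (2 * (\<psi> x \<bullet> d i x)))" for i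
  proof (intro has_partial_diff)
    have "has_partial i (\<lambda>x. (d 1 x \<bullet> d 1 x + d 2 x \<bullet> d 2 x) * (1/2))
      (\<lambda>x. (d 1 x \<bullet> d 1 x + d 2 x \<bullet> d 2 x) * 0 + ((d 1 x \<bullet> dd i 1 x + dd i 1 x \<bullet> d 1 x) + (d 2 x \<bullet> dd i 2 x + dd i 2 x \<bullet> d 2 x)) * (1/2))"
      by (intro has_partial_mult has_partial_const has_partial_add has_partial_inner hp_d)
    then have "has_partial i (\<lambda>x. (d 1 x \<bullet> d 1 x + d 2 x \<bullet> d 2 x) / 2)
      (\<lambda>x. (d 1 x \<bullet> d 1 x + d 2 x \<bullet> d 2 x) * 0 + ((d 1 x \<bullet> dd i 1 x + dd i 1 x \<bullet> d 1 x) + (d 2 x \<bullet> dd i 2 x + dd i 2 x \<bullet> d 2 x)) * (1/2))"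
      by simp
    then show "has_partial i (\<lambda>x. (d 1 x \<bullet> d 1 x + d 2 x \<bullet> d 2 x) / 2) (\<lambda>x. d 1 x \<bullet> dd i 1 x + d 2 x \<bullet> dd i 2 x)"
      by (rule has_partial_cong) (simp add: inner_commute add_divide_distrib)
    show "has_partial i (\<lambda>x. Gr (rho x)) (\<lambda>x. ?h x * (2 * (\<psi> x \<bullet> d i x)))"
      by (rule has_partial_compose[OF hp_rho DERIV_Gr])
  qed
  have hp_X: "has_partial i (X i) (DX i)" for i
  proof -
    have 1: "has_partial i (\<lambda>x. (d i x \<bullet> d k x) * x $ k)
        (\<lambda>x. (d i x \<bullet> d k x) * (if i = k then 1 else 0) + (d i x \<bullet> dd i k x + dd i i x \<bullet> d k x) * x $ k)" for k
      by (intro has_partial_mult has_partial_inner has_partial_coord hp_d)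
    have 2: "has_partial i (\<lambda>x. x $ i * ?e x)
        (\<lambda>x. x $ i * ((d 1 x \<bullet> dd i 1 x + d 2 x \<bullet> dd i 2 x) - ?h x * (2 * (\<psi> x \<bullet> d i x))) + (if i = i then 1 else 0) * ?e x)"
      by (intro has_partial_mult has_partial_coord hp_e)
    show ?thesis
      unfolding X_def[abs_def] DX_def[abs_def] using has_partial_diff[OF has_partial_add[OF 1[of 1] 1[of 2]] 2] by simp
  qed
  have c1: "continuous_on UNIV (\<lambda>x. rho x * ln (rho x))" using isCont_rho_ln[of 0] by simp
  have cG: "continuous_on UNIV (\<lambda>x. Gr (rho x))"
    by (rule continuous_on_compose2[OF _ cont_rho, of UNIV Gr]) (auto intro!: continuous_at_imp_continuous_on DERIV_isCont[OF DERIV_Gr])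
  have cX: "continuous_on UNIV (X i)" and cDX: "continuous_on UNIV (DX i)" for i
    unfolding X_def[abs_def] DX_def[abs_def] by (auto intro!: continuous_intros cont_psi cG c1)
  have div: "DX 1 x + DX 2 x = 2 * Gr (rho x)" for x
  proof -
    have p: "dd 1 1 x \<bullet> d k x + dd 2 2 x \<bullet> d k x = - 2 * ?h x * (\<psi> x \<bullet> d k x)" for k
      unfolding inner_add_left[symmetric] pde by simp
    have m: "dd 2 1 x = dd 1 2 x" by (rule mixed_partials)
    have alg: "((A + (P + K) * X) + (0 * B + (Q + L) * Y) - (X * ((P + W) - h * (2 * S)) + E))
      + ((0 * B + (W + M) * X) + (C + (V + N) * Y) - (Y * ((Q + V) - h * (2 * T)) + E)) = 2 * H"
      if "K + M = - 2 * h * S" "L + N = - 2 * h * T" "E = (A + C) / 2 - H"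
      for A B C P K X Q L Y W h S E M V N T H :: real
    proof -
      have "(K + M) * X = (- 2 * h * S) * X" "(L + N) * Y = (- 2 * h * T) * Y" using that by simp_all
      then show ?thesis unfolding that(3) by (simp add: algebra_simps)
    qed
    show ?thesis
      unfolding DX_def using alg[OF p[of 1] p[of 2] refl, where A = "d 1 x \<bullet> d 1 x" and P = "d 1 x \<bullet> dd 1 1 x" and X = "x $ 1"
        and B = "d 1 x \<bullet> d 2 x" and Q = "d 1 x \<bullet> dd 1 2 x" and Y = "x $ 2" and W = "d 2 x \<bullet> dd 1 2 x"
        and C = "d 2 x \<bullet> d 2 x" and V = "d 2 x \<bullet> dd 2 2 x" and H = "Gr (rho x)"]
      by (simp add: m mult_ac)
  qed
  have zero: "(LINT x|lborel. cutoff R x * (2 * Gr (rho x)) + (dcutoff R 1 x * X 1 x + dcutoff R 2 x * X 2 x)) = 0" if R: "R > 0" for R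
  proof -
    let ?D = "\<lambda>i x. cutoff R x * DX i x + dcutoff R i x * X i x"
    have cD: "continuous_on UNIV (?D i)" and cF: "continuous_on UNIV (\<lambda>x. cutoff R x * X i x)" for i
      by (intro continuous_intros cont_cutoff cX cDX)+
    have iD: "integrable lborel (?D i)" for i by (rule integrable_compact_support[OF cD, of R]) (simp add: cutoff_outside[OF R])
    have iF: "integrable lborel (\<lambda>x. cutoff R x * X i x)" for i by (rule integrable_compact_support[OF cF, of R]) (simp add: cutoff_outside[OF R])
    have z: "(LINT x|lborel. ?D i x) = 0" for i
      by (rule integral_partial_zero[OF has_partial_mult[OF has_partial_cutoff hp_X] cD iF iD])
    have "(LINT x|lborel. ?D 1 x + ?D 2 x) = 0" unfolding Bochner_Integration.integral_add[OF iD iD] z by simp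
    moreover have "?D 1 x + ?D 2 x = cutoff R x * (2 * Gr (rho x)) + (dcutoff R 1 x * X 1 x + dcutoff R 2 x * X 2 x)" for x
      unfolding div[symmetric] by (simp add: algebra_simps)
    ultimately show ?thesis by simp
  qed
  let ?u = "\<lambda>x. 2 * norm (Gr (rho x)) + 2 * (12 * grad_norm_sq \<psi> x + 4 * norm (Gr (rho x)))"
  let ?f = "\<lambda>n x. cutoff (real (Suc n)) x * (2 * Gr (rho x)) + (dcutoff (real (Suc n)) 1 x * X 1 x + dcutoff (real (Suc n)) 2 x * X 2 x)"
  have iu: "integrable lborel ?u" using int_G int_grad by auto
  have Xb: "\<bar>dcutoff R i x * X i x\<bar> \<le> 12 * grad_norm_sq \<psi> x + 4 * norm (Gr (rho x))" if R: "R > 0" for R i x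
  proof -
    have ip: "\<bar>d k x \<bullet> d l x\<bar> \<le> grad_norm_sq \<psi> x" for k l :: 2
    proof -
      have "\<bar>d k x \<bullet> d l x\<bar> \<le> norm (d k x) * norm (d l x)" by (rule Cauchy_Schwarz_ineq2)
      also have "\<dots> \<le> ((norm (d k x))\<^sup>2 + (norm (d l x))\<^sup>2) / 2" using sum_squares_bound[of "norm (d k x)" "norm (d l x)"] by simp
      also have "(norm (d k x))\<^sup>2 \<le> grad_norm_sq \<psi> x" "(norm (d l x))\<^sup>2 \<le> grad_norm_sq \<psi> x"
        unfolding grad_norm_sq_def by (intro member_le_sum; simp)+
      then have "((norm (d k x))\<^sup>2 + (norm (d l x))\<^sup>2) / 2 \<le> grad_norm_sq \<psi> x" by simp
      finally show ?thesis .
    qed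
    have m: "\<bar>(dcutoff R i x * x $ k) * a\<bar> \<le> 4 * b" if "\<bar>a\<bar> \<le> b" for k a b
      unfolding abs_mult[of _ a] using dcutoff_bound(2)[OF R, of i x k] that by (intro mult_mono) auto
    have e: "\<bar>?e x\<bar> \<le> grad_norm_sq \<psi> x + norm (Gr (rho x))"
    proof -
      have bnd: "\<bar>g / 2 - r\<bar> \<le> g + \<bar>r\<bar>" if "0 \<le> g" for g r :: real
        using that by (simp add: abs_if)
      show ?thesis unfolding grad2 real_norm_def by (rule bnd) simp
    qed
    have eqX: "dcutoff R i x * X i x = (dcutoff R i x * x $ 1) * (d i x \<bullet> d 1 x) + (dcutoff R i x * x $ 2) * (d i x \<bullet> d 2 x) - (dcutoff R i x * x $ i) * ?e x"
      unfolding X_def by (simp add: algebra_simps)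
    have sum3: "\<bar>P\<bar> \<le> 12 * g + 4 * n" if "P = A + B - C" "\<bar>A\<bar> \<le> 4 * g" "\<bar>B\<bar> \<le> 4 * g" "\<bar>C\<bar> \<le> 4 * (g + n)"
      for P A B C g n :: real
      using that by (simp add: abs_le_iff)
    show ?thesis by (rule sum3[OF eqX m[OF ip] m[OF ip] m[OF e]])
  qed
  have fu: "norm (?f n x) \<le> ?u x" for n x
  proof -
    have "\<bar>cutoff (real (Suc n)) x * (2 * Gr (rho x))\<bar> \<le> 1 * \<bar>2 * Gr (rho x)\<bar>"
      unfolding abs_mult[of "cutoff (real (Suc n)) x"] using cutoff_bounds[of "real (Suc n)" x] by (intro mult_right_mono) auto
    then show ?thesis using Xb[of "real (Suc n)" 1 x] Xb[of "real (Suc n)" 2 x] unfolding real_norm_def by simp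
  qed
  have fl: "(\<lambda>n. ?f n x) \<longlonglongrightarrow> 2 * Gr (rho x)" for x
  proof -
    have "(\<lambda>n. ?f n x) \<longlonglongrightarrow> 1 * (2 * Gr (rho x)) + (0 * X 1 x + 0 * X 2 x)" by (intro tendsto_intros cutoff_tendsto)
    then show ?thesis by simp
  qed
  have fm: "?f n \<in> borel_measurable lborel" for n
  proof -
    have "continuous_on UNIV (?f n)" by (intro continuous_intros cont_cutoff cX cG)
    then show ?thesis by (simp add: cont_borel)
  qed
  have gm: "(\<lambda>x. 2 * Gr (rho x)) \<in> borel_measurable lborel" using cont_borel[OF cG] by simp
  have "(\<lambda>n. LINT x|lborel. ?f n x) \<longlonglongrightarrow> (LINT x|lborel. 2 * Gr (rho x))"
    by (rule integral_dominated_convergence[OF gm fm iu AE_I2[OF fl] AE_I2[OF fu]])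
  then have "(\<lambda>n. 0 :: real) \<longlonglongrightarrow> (LINT x|lborel. 2 * Gr (rho x))" by (simp only: zero[OF of_nat_0_less_iff[THEN iffD2, OF zero_less_Suc]])
  then have "(LINT x|lborel. 2 * Gr (rho x)) = 0" by (simp add: LIMSEQ_const_iff)
  then show ?thesis unfolding G_rho by simp
qed

end

end

section \<open>A sharp isoperimetric inequality for truncations\<close>

lemma emeasure_disc: "0 \<le> r \<Longrightarrow> emeasure lborel (ball (c :: real ^ 2) r) = ennreal (pi * r\<^sup>2)"
  by (simp add: emeasure_ball unit_ball_vol_2)

lemma nn_exp2_half_line: "(\<integral>\<^sup>+t. ennreal (2 * pi * exp (2 * t)) * indicator {..<T} t \<partial>lborel) = ennreal (pi * exp (2 * T))"
proof -
  have "(\<integral>\<^sup>+t. ennreal (2 * pi * exp (2 * t)) * indicator {..<T} t \<partial>lborel)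
     = ennreal \<bar>1\<bar> * (\<integral>\<^sup>+x. ennreal (2 * pi * exp (2 * (T + 1 * x))) * indicator {..<T} (T + 1 * x) \<partial>lborel)"
    by (rule nn_integral_real_affine) auto
  also have "\<dots> = (\<integral>\<^sup>+x. ennreal (2 * pi * exp (2 * T)) * ennreal (exp (2 * x) * indicator {..0} x) \<partial>lborel)"
    using AE_lborel_singleton[of "0 :: real"]
    by (simp, intro nn_integral_cong_AE)
      (auto simp: indicator_def ennreal_mult[symmetric] exp_add algebra_simps elim!: eventually_mono)
  also have "\<dots> = ennreal (2 * pi * exp (2 * T)) * ennreal (1/2)"
    by (subst nn_integral_cmult) (auto simp: nn_integral_eq_integral exp2_half_line)
  also have "\<dots> = ennreal (2 * pi * exp (2 * T) * (1/2))" by (rule ennreal_mult[symmetric]) auto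
  finally show ?thesis by simp
qed

text \<open>
  Polar coordinates with \<open>r = exp t\<close>: under \<open>ln (norm x)\<close> the Lebesgue measure becomes the measure with density
  \<open>2 * pi * exp (2 * t)\<close>, because both give half-lines the area of a disc.
\<close>
theorem nn_integral_radial:
  fixes h :: "real \<Rightarrow> ennreal"
  assumes [measurable]: "h \<in> borel_measurable borel"
  shows "(\<integral>\<^sup>+x. h (norm (x :: real ^ 2)) \<partial>lborel) = (\<integral>\<^sup>+t. h (exp t) * ennreal (2 * pi * exp (2 * t)) \<partial>lborel)"
proof -
  let ?M = "distr lborel borel (\<lambda>x :: real ^ 2. - ln (norm x))"
  let ?N = "distr (density lborel (\<lambda>t. ennreal (2 * pi * exp (2 * t)))) borel (uminus :: real \<Rightarrow> real)"
  have N: "emeasure ?N {s<..} = ennreal (pi * exp (2 * (- s)))" for s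
  proof -
    have v: "uminus -` {s<..} = {..< - s}" by auto
    show ?thesis by (subst emeasure_distr) (auto simp: v emeasure_density nn_exp2_half_line[of "- s", simplified])
  qed
  have M: "emeasure ?M {s<..} = ennreal (pi * exp (2 * (- s)))" for s
  proof -
    have v: "(\<lambda>x :: real ^ 2. - ln (norm x)) -` {s<..} \<inter> space lborel - {0} = ball 0 (exp (- s)) - {0}"
    proof -
      have "(s < - ln (norm x)) = (norm x < exp (- s))" if "x \<noteq> 0" for x :: "real ^ 2"
        using that ln_less_cancel_iff[of "norm x" "exp (- s)"] less_minus_iff[of s "ln (norm x)"] by simp
      then show ?thesis by auto
    qed
    have "emeasure ?M {s<..} = emeasure lborel ((\<lambda>x :: real ^ 2. - ln (norm x)) -` {s<..} \<inter> space lborel)"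
      by (rule emeasure_distr) measurable
    also have "\<dots> = emeasure lborel ((\<lambda>x :: real ^ 2. - ln (norm x)) -` {s<..} \<inter> space lborel - {0})"
    proof -
      have "(\<lambda>x :: real ^ 2. - ln (norm x)) -` {s<..} \<inter> space lborel \<in> sets lborel" by (rule measurable_sets) measurable
      then show ?thesis by (intro emeasure_Diff_null_set[symmetric]) auto
    qed
    also have "\<dots> = emeasure lborel (ball (0 :: real ^ 2) (exp (- s)))"
      unfolding v by (intro emeasure_Diff_null_set) auto
    also have "\<dots> = ennreal (pi * exp (2 * (- s)))"
      by (subst emeasure_disc) (auto simp: power2_eq_square exp_add[symmetric])
    finally show ?thesis .
  qed
  have eq: "?M = ?N" by (rule measure_eqI_lessThan) (simp_all only: M N sets_distr, simp)
  have "(\<integral>\<^sup>+x. h (norm (x :: real ^ 2)) \<partial>lborel) = (\<integral>\<^sup>+x. h (exp (- (- ln (norm (x :: real ^ 2))))) \<partial>lborel)"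
    using AE_lborel_singleton[of "0 :: real ^ 2"] by (intro nn_integral_cong_AE) (auto elim!: eventually_mono)
  also have "\<dots> = (\<integral>\<^sup>+s. h (exp (- s)) \<partial>?M)" by (subst nn_integral_distr) auto
  also have "\<dots> = (\<integral>\<^sup>+t. h (exp (- (- t))) \<partial>density lborel (\<lambda>t. ennreal (2 * pi * exp (2 * t))))"
    unfolding eq by (subst nn_integral_distr) auto
  also have "\<dots> = (\<integral>\<^sup>+t. h (exp t) * ennreal (2 * pi * exp (2 * t)) \<partial>lborel)"
    by (subst nn_integral_density) (auto simp: mult.commute)
  finally show ?thesis .
qed

text \<open>
  The set where the kernel exceeds \<open>\<tau>\<close> is a disc of diameter \<open>norm g / \<tau>\<close> with \<open>y\<close> on its boundary. Integrating over
  levels, those below \<open>c * norm g\<close> contribute at most the area of \<open>A\<close> each and those above at most the area of the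
  disc. For the best \<open>c\<close> the bound is attained when \<open>A\<close> is such a disc, which is what makes the isoperimetric constant
  sharp.
\<close>
lemma bathtub_dipole:
  fixes g y :: "real ^ 2"
  assumes A: "A \<in> sets borel" "emeasure lborel A < \<infinity>" and c: "c > 0"
  shows "(\<integral>\<^sup>+x. ennreal (g \<bullet> (x - y) / (norm (x - y))\<^sup>2) * indicator A x \<partial>lborel)
    \<le> ennreal (norm g * (c * measure lborel A + pi / (4 * c)))"
proof (cases "g = 0")
  case False
  define k where "k x = g \<bullet> (x - y) / (norm (x - y))\<^sup>2" for x
  define C where "C = c * norm g"
  have C: "C > 0" using c False by (simp add: C_def)
  note [measurable] = A(1)
  have km [measurable]: "k \<in> borel_measurable borel" unfolding k_def[abs_def] by measurable
  have area: "emeasure lborel {x. \<tau> < k x} \<le> ennreal (pi * (norm g)\<^sup>2 / 4 * (1 / \<tau>\<^sup>2))" if t: "\<tau> > 0" for \<tau>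
  proof -
    have "{x. \<tau> < k x} \<subseteq> ball (y + (1 / (2 * \<tau>)) *\<^sub>R g) (norm g / (2 * \<tau>))"
    proof
      fix x assume "x \<in> {x. \<tau> < k x}"
      then have kx: "\<tau> < k x" by simp
      then have z: "x - y \<noteq> 0" using t by (auto simp: k_def)
      let ?z = "x - y"
      have "\<tau> * (norm ?z)\<^sup>2 < g \<bullet> ?z" using kx z by (simp add: k_def field_simps)
      then have "(norm ?z)\<^sup>2 < (g \<bullet> ?z) / \<tau>" using t by (simp add: field_simps)
      moreover have "(norm (?z - (1 / (2 * \<tau>)) *\<^sub>R g))\<^sup>2 = (norm ?z)\<^sup>2 - (g \<bullet> ?z) / \<tau> + (norm g / (2 * \<tau>))\<^sup>2"
      proof -
        have "(norm (w - b *\<^sub>R g))\<^sup>2 = (norm w)\<^sup>2 - 2 * b * (g \<bullet> w) + (b * norm g)\<^sup>2" for b and w :: "real ^ 2"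
          unfolding power_mult_distrib power2_norm_eq_inner
          by (simp add: inner_diff_left inner_diff_right inner_commute power2_eq_square)
        from this[of ?z "1 / (2 * \<tau>)"] show ?thesis using t by simp
      qed
      ultimately have "(norm (?z - (1 / (2 * \<tau>)) *\<^sub>R g))\<^sup>2 < (norm g / (2 * \<tau>))\<^sup>2" by simp
      then have "norm (?z - (1 / (2 * \<tau>)) *\<^sub>R g) < norm g / (2 * \<tau>)" by (rule power_less_imp_less_base) (use t in simp)
      then show "x \<in> ball (y + (1 / (2 * \<tau>)) *\<^sub>R g) (norm g / (2 * \<tau>))"
        by (simp add: dist_norm norm_minus_commute algebra_simps)
    qed
    then have "emeasure lborel {x. \<tau> < k x} \<le> emeasure lborel (ball (y + (1 / (2 * \<tau>)) *\<^sub>R g) (norm g / (2 * \<tau>)))"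
      by (intro emeasure_mono) auto
    also have "\<dots> = ennreal (pi * (norm g)\<^sup>2 / 4 * (1 / \<tau>\<^sup>2))" using t by (subst emeasure_disc) (auto simp: power_divide power_mult_distrib)
    finally show ?thesis .
  qed
  have lc: "ennreal (k x) \<le> ennreal C + (\<integral>\<^sup>+\<tau>. indicator {C<..} \<tau> * indicator {x. \<tau> < k x} x \<partial>lborel)" for x
  proof -
    have "(\<integral>\<^sup>+\<tau>. indicator {C<..} \<tau> * indicator {x. \<tau> < k x} x \<partial>lborel) = (\<integral>\<^sup>+\<tau>. indicator {C<..<k x} \<tau> \<partial>lborel)"
      by (intro nn_integral_cong) (auto simp: indicator_def)
    also have "\<dots> = emeasure lborel {C<..<k x}" by simp
    finally have e: "(\<integral>\<^sup>+\<tau>. indicator {C<..} \<tau> * indicator {x. \<tau> < k x} x \<partial>lborel) = emeasure lborel {C<..<k x}" .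
    show ?thesis unfolding e
    proof (cases "C \<le> k x")
      case True
      then show "ennreal (k x) \<le> ennreal C + emeasure lborel {C<..<k x}" using C by (simp add: ennreal_plus[symmetric] del: ennreal_plus)
    next
      case False
      then have "ennreal (k x) \<le> ennreal C + 0" by (simp add: ennreal_leI)
      then show "ennreal (k x) \<le> ennreal C + emeasure lborel {C<..<k x}" by (rule order_trans) (intro add_left_mono zero_le)
    qed
  qed
  have sm: "(\<lambda>(x, \<tau>). indicator {C<..} \<tau> * indicator {x. \<tau> < k x} x :: ennreal) \<in> borel_measurable (lborel \<Otimes>\<^sub>M lborel)"
  proof -
    have "(\<lambda>(x, \<tau>). indicator {C<..} \<tau> * indicator {x. \<tau> < k x} x :: ennreal) = (\<lambda>p. indicator {p. C < snd p \<and> snd p < k (fst p)} p)"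
      by (auto simp: indicator_def fun_eq_iff)
    also have "\<dots> \<in> borel_measurable (lborel \<Otimes>\<^sub>M lborel)" by measurable
    finally show ?thesis .
  qed
  have "(\<integral>\<^sup>+x. ennreal (k x) * indicator A x \<partial>lborel)
     \<le> (\<integral>\<^sup>+x. ennreal C * indicator A x + (\<integral>\<^sup>+\<tau>. indicator {C<..} \<tau> * indicator {x. \<tau> < k x} x \<partial>lborel) \<partial>lborel)"
  proof (intro nn_integral_mono)
    fix x
    show "ennreal (k x) * indicator A x \<le> ennreal C * indicator A x + (\<integral>\<^sup>+\<tau>. indicator {C<..} \<tau> * indicator {x. \<tau> < k x} x \<partial>lborel)"
      by (cases "x \<in> A") (use lc[of x] in auto)
  qed
  also have "\<dots> = (\<integral>\<^sup>+x. ennreal C * indicator A x \<partial>lborel) + (\<integral>\<^sup>+x. (\<integral>\<^sup>+\<tau>. indicator {C<..} \<tau> * indicator {x. \<tau> < k x} x \<partial>lborel) \<partial>lborel)"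
    using lborel.borel_measurable_nn_integral[OF sm] by (intro nn_integral_add) auto
  also have "(\<integral>\<^sup>+x. ennreal C * indicator A x \<partial>lborel) = ennreal (C * measure lborel A)"
    using A C by (subst nn_integral_cmult_indicator) (auto simp: emeasure_eq_ennreal_measure ennreal_mult)
  also have "(\<integral>\<^sup>+x. (\<integral>\<^sup>+\<tau>. indicator {C<..} \<tau> * indicator {x. \<tau> < k x} x \<partial>lborel) \<partial>lborel)
      = (\<integral>\<^sup>+\<tau>. (\<integral>\<^sup>+x. indicator {C<..} \<tau> * indicator {x. \<tau> < k x} x \<partial>lborel) \<partial>lborel)"
    using lborel_pair.Fubini'[OF sm] by simp
  also have "\<dots> = (\<integral>\<^sup>+\<tau>. indicator {C<..} \<tau> * emeasure lborel {x. \<tau> < k x} \<partial>lborel)"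
    by (intro nn_integral_cong) (auto simp: nn_integral_cmult)
  also have "\<dots> \<le> (\<integral>\<^sup>+\<tau>. ennreal (pi * (norm g)\<^sup>2 / 4 * (1 / \<tau>\<^sup>2)) * indicator {C..} \<tau> \<partial>lborel)"
    using area C by (intro nn_integral_mono) (auto simp: indicator_def)
  also have "\<dots> = ennreal (0 - (- (pi * (norm g)\<^sup>2 / 4) / C))"
  proof (rule nn_integral_FTC_atLeast)
    show "((\<lambda>\<tau>. - (pi * (norm g)\<^sup>2 / 4) / \<tau>) has_real_derivative pi * (norm g)\<^sup>2 / 4 * (1 / \<tau>\<^sup>2)) (at \<tau>)" if "C \<le> \<tau>" for \<tau>
      using that C by (auto intro!: derivative_eq_intros simp: power2_eq_square)
    show "((\<lambda>\<tau>. - (pi * (norm g)\<^sup>2 / 4) / \<tau>) \<longlongrightarrow> 0) at_top" by real_asymp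
  qed auto
  also have "ennreal (C * measure lborel A) + ennreal (0 - (- (pi * (norm g)\<^sup>2 / 4) / C)) = ennreal (norm g * (c * measure lborel A + pi / (4 * c)))"
  proof -
    have "C * measure lborel A + (0 - (- (pi * (norm g)\<^sup>2 / 4) / C)) = norm g * (c * measure lborel A + pi / (4 * c))"
      using False c by (simp add: C_def field_simps power2_eq_square)
    then show ?thesis using C by (subst ennreal_plus[symmetric]) auto
  qed
  finally show ?thesis unfolding k_def by (simp add: add_left_mono)
qed simp

lemma nn_mass_kernel: "(\<integral>\<^sup>+z. ennreal (2 / ((norm (z :: real ^ 2))\<^sup>2 + 1)\<^sup>2) \<partial>lborel) = ennreal (2 * pi)"
proof -
  let ?F = "\<lambda>t :: real. 4 * pi * exp (2 * t) / (exp (2 * t) + 1)\<^sup>2"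
  have pos: "0 < exp (2 * t) + 1" for t :: real by (simp add: add_pos_pos)
  have d: "((\<lambda>t. - 2 * pi / (exp (2 * t) + 1)) has_real_derivative ?F t) (at t)" for t :: real
    using pos[of t] by (auto intro!: derivative_eq_intros simp: power2_eq_square field_simps)
  have A: "(((\<lambda>t. - 2 * pi / (exp (2 * t) + 1)) \<circ> real_of_ereal) \<longlongrightarrow> - 2 * pi) (at_right (-\<infinity>))"
  proof -
    have "((\<lambda>t :: real. - 2 * pi / (exp (2 * t) + 1)) \<longlongrightarrow> - 2 * pi) at_bot" by real_asymp
    then show ?thesis by (simp add: ereal_tendsto_simps)
  qed
  have B: "(((\<lambda>t. - 2 * pi / (exp (2 * t) + 1)) \<circ> real_of_ereal) \<longlongrightarrow> 0) (at_left \<infinity>)"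
  proof -
    have "((\<lambda>t :: real. - 2 * pi / (exp (2 * t) + 1)) \<longlongrightarrow> 0) at_top" by real_asymp
    then show ?thesis by (simp add: ereal_tendsto_simps)
  qed
  have c: "isCont ?F t" for t using pos[of t] by (intro continuous_intros) auto
  have n: "AE t in lborel. -\<infinity> < ereal t \<longrightarrow> ereal t < \<infinity> \<longrightarrow> 0 \<le> ?F t" by (intro AE_I2) auto
  note ftc = interval_integral_FTC_nonneg[OF _ d c n A B]
  have i: "integrable lborel ?F" "(LINT t|lborel. ?F t) = 2 * pi"
    using ftc by (simp_all add: set_integrable_def interval_lebesgue_integral_def set_lebesgue_integral_def)
  have "(\<integral>\<^sup>+z. ennreal (2 / ((norm (z :: real ^ 2))\<^sup>2 + 1)\<^sup>2) \<partial>lborel)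
    = (\<integral>\<^sup>+t. ennreal (2 / ((exp t)\<^sup>2 + 1)\<^sup>2) * ennreal (2 * pi * exp (2 * t)) \<partial>lborel)"
    by (rule nn_integral_radial) measurable
  also have "\<dots> = (\<integral>\<^sup>+t. ennreal (?F t) \<partial>lborel)"
    by (intro nn_integral_cong) (simp add: ennreal_mult[symmetric] exp_double)
  also have "\<dots> = ennreal (2 * pi)" using i by (subst nn_integral_eq_integral) auto
  finally show ?thesis .
qed


lemma nn_integral_affine:
  fixes h :: "real ^ 2 \<Rightarrow> ennreal"
  assumes [measurable]: "h \<in> borel_measurable borel" and c: "c > 0"
  shows "(\<integral>\<^sup>+y. h y \<partial>lborel) = ennreal (c\<^sup>2) * (\<integral>\<^sup>+z. h (x + c *\<^sub>R z) \<partial>lborel)"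
proof -
  have "(\<integral>\<^sup>+y. h y \<partial>lborel) = (\<integral>\<^sup>+y. h y \<partial>density (distr lborel borel (\<lambda>z. x + c *\<^sub>R z)) (\<lambda>_. ennreal (\<bar>c\<bar> ^ DIM(real ^ 2))))"
    using lborel_affine[of c x] c by simp
  also have "\<dots> = ennreal (c\<^sup>2) * (\<integral>\<^sup>+z. h (x + c *\<^sub>R z) \<partial>lborel)"
    by (subst nn_integral_density) (auto simp: nn_integral_cmult nn_integral_distr)
  finally show ?thesis .
qed

text \<open>
  The regularised dipole field \<open>z / (norm z ^ 2 + e)\<close> has divergence \<open>2 * e / (norm z ^ 2 + e)\<^sup>2\<close>, an approximate
  identity of total mass \<open>2 * pi\<close> as \<open>e \<rightarrow> 0\<close>.
\<close>
definition mollifier :: "real \<Rightarrow> real ^ 2 \<Rightarrow> real" where "mollifier e z = 2 * e / (z \<bullet> z + e)\<^sup>2"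
definition dipole :: "real \<Rightarrow> real ^ 2 \<Rightarrow> real ^ 2" where "dipole e z = (1 / (z \<bullet> z + e)) *\<^sub>R z"

text \<open>
  After rescaling by \<open>sqrt (e n)\<close> the kernel no longer depends on \<open>n\<close>, and Fatou's lemma applies.
\<close>
lemma mollifier_liminf:
  assumes cV: "continuous_on UNIV V" and V0: "\<And>y. 0 \<le> V y"
    and e: "\<And>n. 0 < e n" "e \<longlonglongrightarrow> 0"
    and ub: "\<And>n. (\<integral>\<^sup>+y. ennreal (V y * mollifier (e n) (x - y)) \<partial>lborel) \<le> B"
  shows "ennreal (2 * pi * V x) \<le> B"
proof -
  have [measurable]: "V \<in> borel_measurable borel" by (rule cont_borel[OF cV])
  have [measurable]: "mollifier r \<in> borel_measurable borel" for r unfolding mollifier_def[abs_def] by measurable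
  let ?h = "\<lambda>z :: real ^ 2. ennreal (2 / ((norm z)\<^sup>2 + 1)\<^sup>2)"
  have sc: "(\<integral>\<^sup>+y. ennreal (V y * mollifier (e n) (x - y)) \<partial>lborel)
      = (\<integral>\<^sup>+z. ennreal (V (x + sqrt (e n) *\<^sub>R z) * (2 / ((norm z)\<^sup>2 + 1)\<^sup>2)) \<partial>lborel)" for n
  proof -
    have s: "sqrt (e n) > 0" using e(1) by simp
    have "(\<integral>\<^sup>+y. ennreal (V y * mollifier (e n) (x - y)) \<partial>lborel)
      = ennreal ((sqrt (e n))\<^sup>2) * (\<integral>\<^sup>+z. ennreal (V (x + sqrt (e n) *\<^sub>R z) * mollifier (e n) (x - (x + sqrt (e n) *\<^sub>R z))) \<partial>lborel)"
      by (rule nn_integral_affine[OF _ s]) measurable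
    also have "\<dots> = (\<integral>\<^sup>+z. ennreal ((sqrt (e n))\<^sup>2) * ennreal (V (x + sqrt (e n) *\<^sub>R z) * mollifier (e n) (x - (x + sqrt (e n) *\<^sub>R z))) \<partial>lborel)"
      by (subst nn_integral_cmult) auto
    also have "\<dots> = (\<integral>\<^sup>+z. ennreal (V (x + sqrt (e n) *\<^sub>R z) * (2 / ((norm z)\<^sup>2 + 1)\<^sup>2)) \<partial>lborel)"
    proof (rule nn_integral_cong)
      fix z :: "real ^ 2"
      have "x - (x + sqrt (e n) *\<^sub>R z) = - (sqrt (e n) *\<^sub>R z)" by simp
      then have zz: "(x - (x + sqrt (e n) *\<^sub>R z)) \<bullet> (x - (x + sqrt (e n) *\<^sub>R z)) = e n * (norm z)\<^sup>2"
        using e(1)[of n] by (simp only: inner_minus_left inner_minus_right inner_scaleR_left inner_scaleR_right) (simp add: power2_norm_eq_inner)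
      have "e n * (norm z)\<^sup>2 + e n = e n * ((norm z)\<^sup>2 + 1)" by (simp add: algebra_simps)
      then have m: "mollifier (e n) (x - (x + sqrt (e n) *\<^sub>R z)) = 2 * e n / (e n * ((norm z)\<^sup>2 + 1))\<^sup>2"
        unfolding mollifier_def zz by simp
      have "e n * (v * (2 * e n / (e n * q)\<^sup>2)) = v * (2 / q\<^sup>2)" for v q :: real
        using e(1)[of n] by (simp add: power2_eq_square)
      then have "(sqrt (e n))\<^sup>2 * (V (x + sqrt (e n) *\<^sub>R z) * mollifier (e n) (x - (x + sqrt (e n) *\<^sub>R z)))
          = V (x + sqrt (e n) *\<^sub>R z) * (2 / ((norm z)\<^sup>2 + 1)\<^sup>2)"
        unfolding m using e(1)[of n] by simp
      then show "ennreal ((sqrt (e n))\<^sup>2) * ennreal (V (x + sqrt (e n) *\<^sub>R z) * mollifier (e n) (x - (x + sqrt (e n) *\<^sub>R z)))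
          = ennreal (V (x + sqrt (e n) *\<^sub>R z) * (2 / ((norm z)\<^sup>2 + 1)\<^sup>2))"
        by (subst ennreal_mult'[symmetric]) auto
    qed
    finally show ?thesis .
  qed
  have lim: "(\<lambda>n. V (x + sqrt (e n) *\<^sub>R z) * (2 / ((norm z)\<^sup>2 + 1)\<^sup>2)) \<longlonglongrightarrow> V x * (2 / ((norm z)\<^sup>2 + 1)\<^sup>2)" for z
  proof (intro tendsto_intros)
    have "(\<lambda>n. x + sqrt (e n) *\<^sub>R z) \<longlonglongrightarrow> x + sqrt 0 *\<^sub>R z" by (intro tendsto_intros e(2))
    then have "(\<lambda>n. x + sqrt (e n) *\<^sub>R z) \<longlonglongrightarrow> x" by simp
    moreover have "isCont V x" using cV by (simp add: continuous_on_eq_continuous_at)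
    ultimately show "(\<lambda>n. V (x + sqrt (e n) *\<^sub>R z)) \<longlonglongrightarrow> V x" by (rule isCont_tendsto_compose[rotated])
  qed
  have "ennreal (2 * pi * V x) = ennreal (V x) * (\<integral>\<^sup>+z. ?h z \<partial>lborel)"
    unfolding nn_mass_kernel using V0 by (subst ennreal_mult[symmetric]) (auto simp: mult.commute)
  also have "\<dots> = (\<integral>\<^sup>+z. ennreal (V x * (2 / ((norm (z :: real ^ 2))\<^sup>2 + 1)\<^sup>2)) \<partial>lborel)"
  proof -
    have m: "ennreal (V x * (2 / ((norm z)\<^sup>2 + 1)\<^sup>2)) = ennreal (V x) * ?h z" for z
      by (rule ennreal_mult) (use V0 in auto)
    show ?thesis unfolding m by (intro nn_integral_cmult[symmetric]) measurable
  qed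
  also have "\<dots> = (\<integral>\<^sup>+z. liminf (\<lambda>n. ennreal (V (x + sqrt (e n) *\<^sub>R z) * (2 / ((norm z)\<^sup>2 + 1)\<^sup>2))) \<partial>lborel)"
    by (intro nn_integral_cong sym[OF lim_imp_Liminf] tendsto_ennrealI lim) simp
  also have "\<dots> \<le> liminf (\<lambda>n. \<integral>\<^sup>+z. ennreal (V (x + sqrt (e n) *\<^sub>R z) * (2 / ((norm z)\<^sup>2 + 1)\<^sup>2)) \<partial>lborel)"
    by (rule nn_integral_liminf) measurable
  also have "\<dots> \<le> liminf (\<lambda>n :: nat. B)"
    using ub unfolding sc by (intro Liminf_mono always_eventually allI)
  also have "\<dots> = B" by (simp add: Liminf_const)
  finally show ?thesis .
qed


lemma integrable_mult_bounded:
  fixes F K :: "'a::euclidean_space \<Rightarrow> real"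
  assumes F: "integrable lborel F" and K: "continuous_on UNIV K" and b: "\<And>x. \<bar>K x\<bar> \<le> C"
  shows "integrable lborel (\<lambda>x. F x * K x)"
proof (rule Bochner_Integration.integrable_bound)
  show "integrable lborel (\<lambda>x. C * F x)" using F by simp
  show "(\<lambda>x. F x * K x) \<in> borel_measurable lborel" using F cont_borel[OF K] by measurable
  show "AE x in lborel. norm (F x * K x) \<le> norm (C * F x)"
  proof (rule AE_I2)
    fix x
    have "\<bar>F x\<bar> * \<bar>K x\<bar> \<le> \<bar>F x\<bar> * \<bar>C\<bar>" using b[of x] by (intro mult_left_mono) auto
    then show "norm (F x * K x) \<le> norm (C * F x)" by (simp add: abs_mult mult.commute)
  qed
qed

lemma ennreal_integral_le:
  assumes "integrable M h" shows "ennreal (LINT x|M. h x) \<le> (\<integral>\<^sup>+x. ennreal (h x) \<partial>M)"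
proof -
  have f: "(\<integral>\<^sup>+x. ennreal (h x) \<partial>M) < top" using integrableD(2)[OF assms] by (simp add: top.not_eq_extremum)
  have "(LINT x|M. h x) \<le> enn2real (\<integral>\<^sup>+x. ennreal (h x) \<partial>M)"
    unfolding real_lebesgue_integral_def[OF assms] by (simp add: enn2real_nonneg)
  then have "ennreal (LINT x|M. h x) \<le> ennreal (enn2real (\<integral>\<^sup>+x. ennreal (h x) \<partial>M))" by (rule ennreal_leI)
  then show ?thesis using f by (simp add: ennreal_enn2real)
qed

context
  fixes V :: "real ^ 2 \<Rightarrow> real" and D :: "2 \<Rightarrow> real ^ 2 \<Rightarrow> real"
  assumes cV: "continuous_on UNIV V" and V0: "\<And>y. 0 \<le> V y" and hp: "\<And>i. has_partial i V (D i)"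
    and cD: "\<And>i. continuous_on UNIV (D i)" and iV: "integrable lborel V" and iD: "\<And>i. integrable lborel (D i)"
begin

text \<open>
  The divergence of \<open>V\<close> times the regularised field centred at \<open>x\<close> integrates to zero. Where the resulting integrand is
  positive, it increases when the regularisation is removed; \<open>ennreal\<close> discards the negative part.
\<close>
lemma mollified_le:
  assumes e: "e > 0"
  shows "(\<integral>\<^sup>+y. ennreal (V y * mollifier e (x - y)) \<partial>lborel)
    \<le> (\<integral>\<^sup>+y. ennreal ((\<chi> i. D i y) \<bullet> (x - y) / (norm (x - y))\<^sup>2) \<partial>lborel)"
proof -
  define a where "a j y = x $ j - y $ j" for j :: 2 and y :: "real ^ 2"
  define q where "q y = a 1 y * a 1 y + a 2 y * a 2 y + e" for y
  define k where "k i y = a i y * inverse (q y)" for i y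
  define k' where "k' i y = a i y * (- (inverse (q y) ^ Suc (Suc 0)) * (- 2 * a i y)) + (- 1) * inverse (q y)" for i y
  have qe: "q y \<ge> e" "q y > 0" "a i y * a i y + e \<le> q y" for y i
    using e exhaust_2[of i] by (auto simp: q_def add_nonneg_pos)
  have q_eq: "q y = (x - y) \<bullet> (x - y) + e" for y by (simp add: q_def a_def inner_vec_def sum_2)
  have ha: "has_partial i (a j) (\<lambda>y. 0 - (if i = j then 1 else 0))" for i j
    unfolding a_def[abs_def] by (intro has_partial_diff has_partial_const has_partial_coord)
  have hq: "has_partial i q (\<lambda>y. - 2 * a i y)" for i
  proof -
    have "has_partial i q (\<lambda>y. ((a 1 y * (0 - (if i = 1 then 1 else 0)) + (0 - (if i = 1 then 1 else 0)) * a 1 y)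
       + (a 2 y * (0 - (if i = 2 then 1 else 0)) + (0 - (if i = 2 then 1 else 0)) * a 2 y)) + 0)"
      unfolding q_def[abs_def] by (intro has_partial_add has_partial_mult has_partial_const ha)
    then show ?thesis by (rule has_partial_cong) (use exhaust_2[of i] in auto)
  qed
  have hk: "has_partial i (k i) (k' i)" for i
  proof -
    have "has_partial i (\<lambda>y. inverse (q y)) (\<lambda>y. - (inverse (q y) ^ Suc (Suc 0)) * (- 2 * a i y))"
      by (rule has_partial_compose[OF hq]) (use qe(2) DERIV_inverse less_imp_neq[OF qe(2), symmetric] in blast)
    from has_partial_mult[OF ha[of i i] this] show ?thesis unfolding k_def[abs_def] k'_def[abs_def] by simp
  qed
  have ca: "continuous_on UNIV (a j)" for j unfolding a_def[abs_def] by (intro continuous_intros)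
  have cq: "continuous_on UNIV q" unfolding q_def[abs_def] by (intro continuous_intros ca)
  have ci: "continuous_on UNIV (\<lambda>y. inverse (q y))"
    by (intro continuous_on_inverse cq) (metis qe(2) less_irrefl)
  have ck: "continuous_on UNIV (k i)" "continuous_on UNIV (k' i)" for i
    unfolding k_def[abs_def] k'_def[abs_def] by (intro continuous_intros ca ci)+
  have bk: "\<bar>k i y\<bar> \<le> 1 + 1 / e" for i y
  proof -
    have "\<bar>a i y\<bar> \<le> (1 + a i y * a i y) + (a i y * a i y / e + e)"
    proof -
      have "\<bar>b\<bar> \<le> 1 + b * b" for b :: real
      proof (cases "\<bar>b\<bar> \<le> 1")
        case False
        then have "\<bar>b\<bar> * 1 \<le> \<bar>b\<bar> * \<bar>b\<bar>" by (intro mult_left_mono) auto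
        then show ?thesis by simp
      qed (simp add: add_increasing2)
      then have "\<bar>a i y\<bar> \<le> 1 + a i y * a i y" .
      moreover have "0 \<le> a i y * a i y / e + e" using e by simp
      ultimately show ?thesis by linarith
    qed
    also have "\<dots> = (1 + 1 / e) * (a i y * a i y + e)" using e by (simp add: field_simps)
    also have "\<dots> \<le> (1 + 1 / e) * q y" using qe(3)[of i y] e by (intro mult_left_mono) auto
    finally show ?thesis using qe(2)[of y] by (simp add: k_def abs_mult field_simps)
  qed
  have bk': "\<bar>k' i y\<bar> \<le> 3 / e" for i y
  proof -
    have iq: "0 \<le> inverse (q y)" "inverse (q y) \<le> 1 / e" using qe(1,2)[of y] e by (auto simp: field_simps)
    have "a i y * a i y * inverse (q y) \<le> 1" using qe(2)[of y] qe(3)[of i y] e by (simp add: field_simps)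
    then have "(a i y * a i y * inverse (q y)) * inverse (q y) \<le> 1 * inverse (q y)" using iq by (intro mult_right_mono) auto
    then have b1: "(a i y * a i y * inverse (q y)) * inverse (q y) \<le> inverse (q y)" by simp
    have b0: "0 \<le> (a i y * a i y * inverse (q y)) * inverse (q y)" using iq by simp
    have b2: "k' i y = 2 * ((a i y * a i y * inverse (q y)) * inverse (q y)) - inverse (q y)" by (simp add: k'_def)
    have ar: "\<bar>K\<bar> \<le> 3 * j" if "K = 2 * b - j" "0 \<le> b" "b \<le> j" for K b j :: real using that by (simp add: abs_le_iff)
    have "\<bar>k' i y\<bar> \<le> 3 * inverse (q y)" by (rule ar[OF b2 b0 b1])
    then show ?thesis using iq by simp
  qed
  let ?E = "\<lambda>i y. V y * k' i y + D i y * k i y"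
  have iE: "integrable lborel (?E i)" for i
    by (intro Bochner_Integration.integrable_add integrable_mult_bounded[OF iV ck(2) bk'] integrable_mult_bounded[OF iD ck(1) bk])
  have z: "(LINT y|lborel. ?E i y) = 0" for i
    by (rule integral_partial_zero[OF has_partial_mult[OF hp hk]])
      (intro continuous_intros cV cD ck integrable_mult_bounded[OF iV ck(1) bk] iE)+
  let ?m = "\<lambda>y. V y * mollifier e (x - y)" let ?g = "\<lambda>y. D 1 y * k 1 y + D 2 y * k 2 y"
  have ig: "integrable lborel ?g"
    by (intro Bochner_Integration.integrable_add integrable_mult_bounded[OF iD ck(1) bk])
  have kk: "k' 1 y + k' 2 y = - mollifier e (x - y)" for y
  proof -
    have "k' 1 y + k' 2 y = 2 * (q y - e) * (inverse (q y) * inverse (q y)) - 2 * inverse (q y)"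
      by (simp add: k'_def q_def algebra_simps)
    also have "\<dots> = - (2 * e / (q y)\<^sup>2)" using qe(2)[of y] by (simp add: field_simps power2_eq_square)
    finally show ?thesis unfolding mollifier_def q_eq .
  qed
  have mg: "?m y = ?g y - (?E 1 y + ?E 2 y)" for y
  proof -
    have "?E 1 y + ?E 2 y = V y * (k' 1 y + k' 2 y) + ?g y" by (simp add: algebra_simps)
    then show ?thesis unfolding kk by simp
  qed
  have im: "integrable lborel ?m" unfolding mg by (intro Bochner_Integration.integrable_diff Bochner_Integration.integrable_add ig iE)
  have Im: "(LINT y|lborel. ?m y) = (LINT y|lborel. ?g y)"
    unfolding mg Bochner_Integration.integral_diff[OF ig Bochner_Integration.integrable_add[OF iE iE]]
      Bochner_Integration.integral_add[OF iE iE] z by simp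
  have m0: "0 \<le> ?m y" for y using V0[of y] e by (simp add: mollifier_def)
  have "(\<integral>\<^sup>+y. ennreal (?m y) \<partial>lborel) = ennreal (LINT y|lborel. ?m y)"
    by (rule nn_integral_eq_integral[OF im AE_I2[OF m0]])
  also have "\<dots> \<le> (\<integral>\<^sup>+y. ennreal (?g y) \<partial>lborel)" unfolding Im by (rule ennreal_integral_le[OF ig])
  also have "\<dots> \<le> (\<integral>\<^sup>+y. ennreal ((\<chi> i. D i y) \<bullet> (x - y) / (norm (x - y))\<^sup>2) \<partial>lborel)"
  proof (rule nn_integral_mono)
    fix y
    let ?s = "(\<chi> i. D i y) \<bullet> (x - y)"
    have gs: "?g y = ?s / ((norm (x - y))\<^sup>2 + e)"
      unfolding power2_norm_eq_inner q_eq[symmetric] by (simp add: k_def a_def inner_vec_def sum_2 divide_inverse algebra_simps)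
    show "ennreal (?g y) \<le> ennreal (?s / (norm (x - y))\<^sup>2)"
    proof (cases "x = y \<or> ?s \<le> 0")
      case True
      then have "?g y \<le> 0" unfolding gs using e by (auto simp: divide_le_0_iff add_nonneg_pos)
      then show ?thesis by (simp add: ennreal_neg)
    next
      case False
      then show ?thesis unfolding gs using e by (intro ennreal_leI divide_left_mono mult_pos_pos) (auto simp: add_pos_pos)
    qed
  qed
  finally show ?thesis .
qed

lemma potential_bound: "ennreal (2 * pi * V x) \<le> (\<integral>\<^sup>+y. ennreal ((\<chi> i. D i y) \<bullet> (x - y) / (norm (x - y))\<^sup>2) \<partial>lborel)"
proof (rule mollifier_liminf[where e = "\<lambda>n. 1 / real (Suc n)"])
  show "(\<lambda>n. 1 / real (Suc n)) \<longlonglongrightarrow> 0" by real_asymp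
qed (auto intro!: mollified_le cV V0 simp del: of_nat_Suc)

text \<open>
  Integrating \<open>potential_bound\<close> over \<open>A\<close> and using \<open>bathtub_dipole\<close> for the inner integral gives a bound with a free
  parameter \<open>c\<close>. With \<open>c = sqrt (pi / \<bar>A\<bar>) / 2\<close> this is the isoperimetric inequality, with equality in the limit of
  indicator functions of discs.
\<close>
theorem sharp_sobolev_level:
  assumes A: "A \<in> sets borel" "emeasure lborel A < \<infinity>" and T: "0 \<le> T" "\<And>x. x \<in> A \<Longrightarrow> T \<le> V x"
  shows "4 * pi * T\<^sup>2 * measure lborel A \<le> (LINT y|lborel. norm (\<chi> i. D i y))\<^sup>2"
proof -
  note [measurable] = A(1)
  let ?g = "\<lambda>y. (\<chi> i. D i y) :: real ^ 2"
  let ?al = "measure lborel A" let ?N = "LINT y|lborel. norm (?g y)"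
  have cg: "continuous_on UNIV ?g" by (intro continuous_intros cD)
  have [measurable]: "?g \<in> borel_measurable borel" by (rule borel_measurable_continuous_onI[OF cg])
  have iN: "integrable lborel (\<lambda>y. norm (?g y))"
  proof (rule Bochner_Integration.integrable_bound)
    show "integrable lborel (\<lambda>y. \<bar>D 1 y\<bar> + \<bar>D 2 y\<bar>)" using iD by auto
    show "AE y in lborel. norm (norm (?g y)) \<le> norm (\<bar>D 1 y\<bar> + \<bar>D 2 y\<bar>)"
      using norm_le_l1_cart[of "?g _"] by (auto simp: sum_2)
  qed measurable
  have key: "2 * pi * T * ?al \<le> ?N * (c * ?al + pi / (4 * c))" if c: "c > 0" for c
  proof -
    have m2: "(\<lambda>(x, y). ennreal (?g y \<bullet> (x - y) / (norm (x - y))\<^sup>2) * indicator A x) \<in> borel_measurable (lborel \<Otimes>\<^sub>M lborel)"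
      by measurable
    have "ennreal (2 * pi * T * ?al) = (\<integral>\<^sup>+x. ennreal (2 * pi * T) * indicator A x \<partial>lborel)"
      using A T(1) by (subst nn_integral_cmult_indicator) (auto simp: emeasure_eq_ennreal_measure ennreal_mult)
    also have "\<dots> \<le> (\<integral>\<^sup>+x. (\<integral>\<^sup>+y. ennreal (?g y \<bullet> (x - y) / (norm (x - y))\<^sup>2) * indicator A x \<partial>lborel) \<partial>lborel)"
    proof (rule nn_integral_mono)
      fix x
      show "ennreal (2 * pi * T) * indicator A x \<le> (\<integral>\<^sup>+y. ennreal (?g y \<bullet> (x - y) / (norm (x - y))\<^sup>2) * indicator A x \<partial>lborel)"
      proof (cases "x \<in> A")
        case True
        then have "ennreal (2 * pi * T) \<le> ennreal (2 * pi * V x)" using T(2) by (intro ennreal_leI) simp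
        also note potential_bound
        finally show ?thesis using True by simp
      qed simp
    qed
    also have "\<dots> = (\<integral>\<^sup>+y. (\<integral>\<^sup>+x. ennreal (?g y \<bullet> (x - y) / (norm (x - y))\<^sup>2) * indicator A x \<partial>lborel) \<partial>lborel)"
      using lborel_pair.Fubini'[OF m2] by simp
    also have "\<dots> \<le> (\<integral>\<^sup>+y. ennreal (norm (?g y) * (c * ?al + pi / (4 * c))) \<partial>lborel)"
      by (intro nn_integral_mono bathtub_dipole A c)
    also have "\<dots> = ennreal (LINT y|lborel. norm (?g y) * (c * ?al + pi / (4 * c)))"
      using c iN by (intro nn_integral_eq_integral) (auto intro!: AE_I2)
    also have "(LINT y|lborel. norm (?g y) * (c * ?al + pi / (4 * c))) = ?N * (c * ?al + pi / (4 * c))" by simp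
    finally show ?thesis using c by (subst (asm) ennreal_le_iff) (auto intro!: mult_nonneg_nonneg)
  qed
  show ?thesis
  proof (cases "?al = 0")
    case False
    then have al: "?al > 0" by (simp add: less_le)
    define r where "r = sqrt (pi * ?al)"
    have r: "r > 0" "r\<^sup>2 = pi * ?al" using al by (simp_all add: r_def)
    \<comment> \<open>The minimiser of \<open>c * ?al + pi / (4 * c)\<close>, with minimum \<open>sqrt (pi * ?al)\<close>.\<close>
    define c where "c = r / (2 * ?al)"
    have c: "c > 0" using r al by (simp add: c_def)
    have "c * ?al + pi / (4 * c) = r"
    proof -
      have "pi / (4 * c) = r\<^sup>2 / (2 * r)" unfolding r(2) using al r(1) by (simp add: c_def)
      then show ?thesis using al r(1) by (simp add: c_def power2_eq_square)
    qed
    then have "2 * pi * T * ?al \<le> ?N * r" using key[OF c] by simp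
    then have "(2 * pi * T * ?al)\<^sup>2 \<le> (?N * r)\<^sup>2" using T(1) by (intro power_mono) auto
    then have "(pi * ?al) * (4 * pi * T\<^sup>2 * ?al) \<le> (pi * ?al) * ?N\<^sup>2"
      unfolding power_mult_distrib r(2) by (simp add: power2_eq_square algebra_simps)
    then show ?thesis using al by simp
  qed simp
qed

end

section \<open>The decreasing rearrangement\<close>

text \<open>
  A continuously differentiable version of \<open>max 0 (min \<sigma> s' - s)\<close>, up to the loss of \<open>\<delta>\<close> in its total height. The
  derivative rises from \<open>0\<close> to \<open>1\<close> and falls back to \<open>0\<close> within \<open>[s, s']\<close>, over intervals of length \<open>\<delta>\<close>.
\<close>
definition ramp :: "real \<Rightarrow> real \<Rightarrow> real \<Rightarrow> real \<Rightarrow> real" where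
  "ramp s s' \<delta> \<sigma> = ((max 0 (\<sigma> - s))\<^sup>2 - (max 0 (\<sigma> - s - \<delta>))\<^sup>2 - (max 0 (\<sigma> - s' + \<delta>))\<^sup>2 + (max 0 (\<sigma> - s'))\<^sup>2) / (2 * \<delta>)"
definition ramp' :: "real \<Rightarrow> real \<Rightarrow> real \<Rightarrow> real \<Rightarrow> real" where
  "ramp' s s' \<delta> \<sigma> = (max 0 (\<sigma> - s) - max 0 (\<sigma> - s - \<delta>) - max 0 (\<sigma> - s' + \<delta>) + max 0 (\<sigma> - s')) / \<delta>"

lemma DERIV_ramp:
  assumes "\<delta> > 0" shows "(ramp s s' \<delta> has_real_derivative ramp' s s' \<delta> \<sigma>) (at \<sigma>)"
proof -
  have 1: "((\<lambda>\<sigma>. (max 0 (\<sigma> - c))\<^sup>2) has_real_derivative 2 * max 0 (\<sigma> - c)) (at \<sigma>)" for c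
  proof -
    have "((\<lambda>\<sigma>. \<sigma> - c) has_real_derivative 1) (at \<sigma>)" by (auto intro!: derivative_eq_intros)
    from DERIV_chain2[OF DERIV_pos_part_sq this] show ?thesis by simp
  qed
  have eq: "ramp s s' \<delta> = (\<lambda>\<sigma>. ((max 0 (\<sigma> - s))\<^sup>2 - (max 0 (\<sigma> - (s + \<delta>)))\<^sup>2 - (max 0 (\<sigma> - (s' - \<delta>)))\<^sup>2 + (max 0 (\<sigma> - s'))\<^sup>2) / (2 * \<delta>))"
    by (auto simp: ramp_def fun_eq_iff algebra_simps)
  have "(ramp s s' \<delta> has_real_derivative (2 * max 0 (\<sigma> - s) - 2 * max 0 (\<sigma> - (s + \<delta>)) - 2 * max 0 (\<sigma> - (s' - \<delta>)) + 2 * max 0 (\<sigma> - s')) / (2 * \<delta>)) (at \<sigma>)"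
    unfolding eq by (intro DERIV_cdivide DERIV_add DERIV_diff 1)
  moreover have "(2 * max 0 (\<sigma> - s) - 2 * max 0 (\<sigma> - (s + \<delta>)) - 2 * max 0 (\<sigma> - (s' - \<delta>)) + 2 * max 0 (\<sigma> - s')) / (2 * \<delta>) = ramp' s s' \<delta> \<sigma>"
    using assms by (simp add: ramp'_def field_simps)
  ultimately show ?thesis by simp
qed

lemma ramp_props:
  assumes d: "\<delta> > 0" "2 * \<delta> \<le> s' - s"
  shows "0 \<le> ramp' s s' \<delta> \<sigma>" "ramp' s s' \<delta> \<sigma> \<le> 1"
    "\<sigma> \<le> s \<Longrightarrow> ramp' s s' \<delta> \<sigma> = 0" "s' \<le> \<sigma> \<Longrightarrow> ramp' s s' \<delta> \<sigma> = 0"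
    "\<sigma> \<le> s \<Longrightarrow> ramp s s' \<delta> \<sigma> = 0" "s' \<le> \<sigma> \<Longrightarrow> ramp s s' \<delta> \<sigma> = s' - s - \<delta>"
    "0 \<le> ramp s s' \<delta> \<sigma>" "ramp s s' \<delta> \<sigma> \<le> s' - s - \<delta>"
proof -
  have n: "0 \<le> max 0 (\<sigma> - s) - max 0 (\<sigma> - s - \<delta>) - max 0 (\<sigma> - s' + \<delta>) + max 0 (\<sigma> - s')"
    "max 0 (\<sigma> - s) - max 0 (\<sigma> - s - \<delta>) - max 0 (\<sigma> - s' + \<delta>) + max 0 (\<sigma> - s') \<le> \<delta>" for \<sigma>
    using d by (auto simp: max_def)
  have k0: "0 \<le> ramp' s s' \<delta> \<sigma>" for \<sigma> using n d unfolding ramp'_def by simp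
  then show "0 \<le> ramp' s s' \<delta> \<sigma>" .
  show "ramp' s s' \<delta> \<sigma> \<le> 1" using n d unfolding ramp'_def by simp
  show "\<sigma> \<le> s \<Longrightarrow> ramp' s s' \<delta> \<sigma> = 0" "s' \<le> \<sigma> \<Longrightarrow> ramp' s s' \<delta> \<sigma> = 0"
    using d by (auto simp: ramp'_def max_def)
  have z: "\<sigma> \<le> s \<Longrightarrow> ramp s s' \<delta> \<sigma> = 0" for \<sigma> using d by (auto simp: ramp_def max_def)
  have t: "s' \<le> \<sigma> \<Longrightarrow> ramp s s' \<delta> \<sigma> = s' - s - \<delta>" for \<sigma>
  proof -
    assume "s' \<le> \<sigma>"
    then have "ramp s s' \<delta> \<sigma> = ((\<sigma> - s)\<^sup>2 - (\<sigma> - s - \<delta>)\<^sup>2 - (\<sigma> - s' + \<delta>)\<^sup>2 + (\<sigma> - s')\<^sup>2) / (2 * \<delta>)"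
      using d by (simp add: ramp_def max_def)
    also have "\<dots> = (2 * \<delta> * (s' - s - \<delta>)) / (2 * \<delta>)" by (simp add: power2_eq_square algebra_simps)
    finally show ?thesis using d by simp
  qed
  show "\<sigma> \<le> s \<Longrightarrow> ramp s s' \<delta> \<sigma> = 0" by (rule z)
  show "s' \<le> \<sigma> \<Longrightarrow> ramp s s' \<delta> \<sigma> = s' - s - \<delta>" by (rule t)
  have mono: "ramp s s' \<delta> x \<le> ramp s s' \<delta> y" if "x \<le> y" for x y
    using DERIV_ramp[OF d(1)] k0 by (intro DERIV_nonneg_imp_nondecreasing[OF that]) blast
  show "0 \<le> ramp s s' \<delta> \<sigma>" using mono[of "min \<sigma> s" \<sigma>] z[of "min \<sigma> s"] by simp
  show "ramp s s' \<delta> \<sigma> \<le> s' - s - \<delta>" using mono[of \<sigma> "max \<sigma> s'"] t[of "max \<sigma> s'"] by simp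
qed

text \<open>
  The assumptions on \<open>rho = u\<^sup>2\<close> hold when \<open>u = norm \<psi>\<close> and \<open>gr\<close> is the squared gradient of \<open>\<psi>\<close>; the last one is then the
  Cauchy-Schwarz inequality. The density \<open>rho\<close> is differentiable even where \<open>u\<close> is not.
\<close>
locale finite_energy_density =
  fixes rho :: "real ^ 2 \<Rightarrow> real" and Dr :: "2 \<Rightarrow> real ^ 2 \<Rightarrow> real" and gr :: "real ^ 2 \<Rightarrow> real"
  assumes cr: "continuous_on UNIV rho" and r0: "\<And>x. 0 \<le> rho x" and hr: "\<And>i. has_partial i rho (Dr i)"
    and cDr: "\<And>i. continuous_on UNIV (Dr i)" and ir: "integrable lborel rho"
    and g0: "\<And>x. 0 \<le> gr x" and ig: "integrable lborel gr"
    and Dr_le: "\<And>x. (Dr 1 x)\<^sup>2 + (Dr 2 x)\<^sup>2 \<le> 4 * (rho x * gr x)"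
begin

definition u :: "real ^ 2 \<Rightarrow> real" where "u x = sqrt (rho x)"

lemma u0: "0 \<le> u x" and u_sq: "(u x)\<^sup>2 = rho x" using r0 by (simp_all add: u_def)
lemma cu: "continuous_on UNIV u" unfolding u_def[abs_def] by (intro continuous_intros cr)
lemma um [measurable]: "u \<in> borel_measurable borel" by (rule cont_borel[OF cu])
lemma grm [measurable]: "gr \<in> borel_measurable borel" using ig by simp

lemma level_integrable:
  assumes s: "s > 0" shows "integrable lborel (indicator {x. s < u x} :: _ \<Rightarrow> real)"
proof (rule Bochner_Integration.integrable_bound)
  show "integrable lborel (\<lambda>x. rho x / s\<^sup>2)" using ir by simp
  have "indicator {x. s < u x} x \<le> rho x / s\<^sup>2" for x
  proof (cases "s < u x")
    case True
    then have "s\<^sup>2 \<le> (u x)\<^sup>2" using s by (intro power_mono) auto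
    then have "s\<^sup>2 \<le> rho x" unfolding u_sq .
    then show ?thesis using s True by simp
  qed (simp add: r0)
  then show "AE x in lborel. norm (indicator {x. s < u x} x :: real) \<le> norm (rho x / s\<^sup>2)"
    using r0 by (intro AE_I2) simp
qed measurable

lemma level_finite: "s > 0 \<Longrightarrow> emeasure lborel {x. s < u x} < \<infinity>"
  using level_integrable[of s] by (simp add: integrable_indicator_iff)

text \<open>
  The isoperimetric inequality for \<open>u\<close> truncated to the heights between \<open>s\<close> and \<open>s'\<close>, followed by the Cauchy-Schwarz
  inequality on the set where the truncation is not constant.
\<close>
lemma level_gap:
  assumes s: "0 < s" and d: "\<delta> > 0" "2 * \<delta> \<le> s' - s" and a: "0 < a" "measure lborel {x. s < u x \<and> u x < s'} \<le> a"
  shows "4 * pi * (s' - s - \<delta>)\<^sup>2 * measure lborel {x. s' \<le> u x} \<le> a * (LINT x|lborel. gr x * indicator {x. s < u x \<and> u x < s'} x)"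
proof -
  let ?S = "{x. s < u x \<and> u x < s'}"
  let ?K = "ramp' s s' \<delta>" let ?F = "ramp s s' \<delta>"
  let ?E = "LINT x|lborel. gr x * indicator ?S x"
  note rp = ramp_props[OF d]
  have iS: "integrable lborel (indicator ?S :: _ \<Rightarrow> real)"
    by (rule Bochner_Integration.integrable_bound[OF level_integrable[OF s]]) (measurable, auto simp: indicator_def)
  have iE: "integrable lborel (\<lambda>x. gr x * indicator ?S x)"
    by (rule Bochner_Integration.integrable_bound[OF ig]) (measurable, auto simp: indicator_def)
  \<comment> \<open>The denominator may be replaced by \<open>max s (sqrt r)\<close>, since \<open>?K\<close> vanishes up to \<open>s\<close>; this keeps the derivative continuous at the zeros of \<open>rho\<close>.\<close>
  have dh: "((\<lambda>r. ?F (sqrt r)) has_real_derivative ?K (sqrt r) / (2 * max s (sqrt r))) (at r)" for r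
  proof (cases "r > 0")
    case True
    then have "((\<lambda>r. ?F (sqrt r)) has_real_derivative ?K (sqrt r) * (inverse (sqrt r) / 2)) (at r)"
      by (intro DERIV_chain2[OF DERIV_ramp[OF d(1)]] DERIV_real_sqrt)
    moreover have "?K (sqrt r) * (inverse (sqrt r) / 2) = ?K (sqrt r) / (2 * max s (sqrt r))"
    proof (cases "sqrt r \<le> s")
      case False
      then have m: "max s (sqrt r) = sqrt r" by simp
      have "k * (inverse q / 2) = k / (2 * q)" for k q :: real by (cases "q = 0") (simp_all add: field_simps)
      then show ?thesis unfolding m .
    next
      case True
      then show ?thesis unfolding rp(3)[OF True] by simp
    qed
    ultimately show ?thesis by (simp only:)
  next
    case False
    have "((\<lambda>r. ?F (sqrt r)) has_real_derivative 0) (at r)"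
    proof (rule has_field_derivative_transform_within_open[of "\<lambda>_. 0" _ _ "{..<s\<^sup>2}"])
      show "r \<in> {..<s\<^sup>2}" using False s by (simp add: not_less le_less_trans)
      fix y assume "y \<in> {..<s\<^sup>2}"
      then have "sqrt y \<le> s" using s by (intro real_le_lsqrt) auto
      then show "0 = ?F (sqrt y)" by (simp add: rp(5))
    qed auto
    moreover have "sqrt r \<le> s" using False s real_sqrt_le_0_iff[of r] by linarith
    ultimately show ?thesis by (simp add: rp(3))
  qed
  define V where "V x = ?F (u x)" for x
  define D where "D i x = ?K (u x) / (2 * max s (u x)) * Dr i x" for i x
  have hV: "has_partial i V (D i)" for i
    unfolding V_def[abs_def] D_def[abs_def] u_def by (rule has_partial_compose[OF hr dh])
  have cF: "continuous_on UNIV ?F"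
    by (intro continuous_at_imp_continuous_on ballI DERIV_isCont[OF DERIV_ramp[OF d(1)]])
  have cV: "continuous_on UNIV V" unfolding V_def[abs_def] by (rule continuous_on_compose2[OF cF cu]) auto
  have cD: "continuous_on UNIV (D i)" for i
    unfolding D_def[abs_def] ramp'_def using s d by (intro continuous_intros cu cDr) auto
  have n2: "(norm (\<chi> i. D i x))\<^sup>2 \<le> gr x * indicator ?S x" for x
  proof -
    let ?k = "?K (u x)" let ?m = "max s (u x)"
    have m: "?m > 0" "u x \<le> ?m" using s by auto
    have "(norm (\<chi> i. D i x))\<^sup>2 = (D 1 x)\<^sup>2 + (D 2 x)\<^sup>2"
      unfolding power2_norm_eq_inner by (simp add: inner_vec_def sum_2 power2_eq_square)
    also have "\<dots> = (?k / (2 * ?m))\<^sup>2 * ((Dr 1 x)\<^sup>2 + (Dr 2 x)\<^sup>2)"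
      unfolding D_def power_mult_distrib by (simp add: distrib_left)
    also have "\<dots> \<le> (?k / (2 * ?m))\<^sup>2 * (4 * (rho x * gr x))" by (intro mult_left_mono Dr_le) simp
    also have "\<dots> = ?k\<^sup>2 * (u x / ?m)\<^sup>2 * gr x" by (simp add: power_divide power_mult_distrib u_sq)
    also have "\<dots> \<le> indicator ?S x * 1 * gr x"
    proof (intro mult_right_mono mult_mono g0)
      show "?k\<^sup>2 \<le> indicator ?S x"
      proof (cases "x \<in> ?S")
        case False
        then have "u x \<le> s \<or> s' \<le> u x" by auto
        then show ?thesis using rp(3,4) by auto
      qed (use rp(1,2) in \<open>simp add: power_le_one_iff\<close>)
      show "(u x / ?m)\<^sup>2 \<le> 1" using m u0[of x] by (simp add: power_le_one_iff)
    qed auto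
    finally show ?thesis by (simp add: mult.commute)
  qed
  have nb: "norm (\<chi> i. D i x) \<le> (\<tau> * indicator ?S x + gr x * indicator ?S x / \<tau>) / 2" if t: "\<tau> > 0" for \<tau> x
  proof (cases "x \<in> ?S")
    case True
    let ?n = "norm (\<chi> i. D i x)"
    have "2 * ?n * \<tau> \<le> ?n\<^sup>2 + \<tau>\<^sup>2" by (rule sum_squares_bound)
    also have "\<dots> \<le> gr x + \<tau>\<^sup>2" using n2[of x] True by simp
    finally show ?thesis using t True by (simp add: field_simps power2_eq_square)
  next
    case False
    then have "(norm (\<chi> i. D i x))\<^sup>2 \<le> 0" using n2[of x] by simp
    then show ?thesis using False by simp
  qed
  have iB: "integrable lborel (\<lambda>x. (\<tau> * indicator ?S x + gr x * indicator ?S x / \<tau>) / 2)" for \<tau> :: real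
    using iS iE by auto
  have cn: "continuous_on UNIV (\<lambda>x. norm (\<chi> i. D i x))" by (intro continuous_intros cD)
  have iN: "integrable lborel (\<lambda>x. norm (\<chi> i. D i x))"
    by (rule Bochner_Integration.integrable_bound[OF iB[of 1]])
      (use cont_borel[OF cn] nb[of 1] in \<open>auto intro!: AE_I2 order_trans[OF _ abs_ge_self]\<close>)
  have iD: "integrable lborel (D i)" for i
  proof (rule Bochner_Integration.integrable_bound[OF iN])
    show "AE x in lborel. norm (D i x) \<le> norm (norm (\<chi> i. D i x))"
      using component_le_norm_cart[of "\<chi> i. D i _" i] by (intro AE_I2) simp
  qed (use cont_borel[OF cD] in simp)
  have V0: "0 \<le> V x" for x unfolding V_def by (rule rp(7))
  have iV: "integrable lborel V"
  proof (rule Bochner_Integration.integrable_bound)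
    show "integrable lborel (\<lambda>x. (s' - s - \<delta>) * indicator {x. s < u x} x)" using level_integrable[OF s] by auto
    have "V x \<le> (s' - s - \<delta>) * indicator {x. s < u x} x" for x
      unfolding V_def using rp(5,8)[of "u x"] by (cases "s < u x") auto
    then show "AE x in lborel. norm (V x) \<le> norm ((s' - s - \<delta>) * indicator {x. s < u x} x)"
      using V0 by (intro AE_I2) (auto intro: order_trans[OF _ abs_ge_self])
  qed (use cont_borel[OF cV] in simp)
  let ?A = "{x. s' \<le> u x}" let ?N = "LINT x|lborel. norm (\<chi> i. D i x)"
  have sets: "?A \<in> sets borel" by measurable
  have "emeasure lborel ?A \<le> emeasure lborel {x. s < u x}" using d by (intro emeasure_mono) auto
  then have fin: "emeasure lborel ?A < \<infinity>" using level_finite[OF s] by (rule le_less_trans)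
  have iso: "4 * pi * (s' - s - \<delta>)\<^sup>2 * measure lborel ?A \<le> ?N\<^sup>2"
    by (rule sharp_sobolev_level[OF cV V0 hV cD iV iD sets fin]) (use d in \<open>auto simp: V_def rp(6)\<close>)
  have Nb: "2 * ?N \<le> \<tau> * a + ?E / \<tau>" if t: "\<tau> > 0" for \<tau>
  proof -
    have "?N \<le> (LINT x|lborel. (\<tau> * indicator ?S x + gr x * indicator ?S x / \<tau>) / 2)"
      by (intro integral_mono iN iB nb t)
    also have "\<dots> = (\<tau> * (LINT x|lborel. indicator ?S x) + ?E / \<tau>) / 2"
      using iS iE by simp
    also have "(LINT x|lborel. indicator ?S x) = measure lborel ?S" by simp
    finally have "?N \<le> (\<tau> * measure lborel ?S + ?E / \<tau>) / 2" .
    moreover have "\<tau> * measure lborel ?S \<le> \<tau> * a" using a t by (intro mult_left_mono) auto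
    ultimately show ?thesis by argo
  qed
  have "?N\<^sup>2 \<le> a * ?E"
  proof (cases "?N > 0")
    case True
    \<comment> \<open>The choice \<open>\<tau> = ?N / a\<close> turns the bound into the Cauchy-Schwarz inequality.\<close>
    have "2 * ?N \<le> (?N / a) * a + ?E / (?N / a)" by (rule Nb) (use True a in simp)
    then have "?N \<le> ?E * a / ?N" using a by simp
    then show ?thesis using True by (simp add: pos_le_divide_eq power2_eq_square mult.commute)
  next
    case False
    moreover have "0 \<le> ?N" by (rule integral_nonneg_AE) simp
    ultimately have "?N = 0" by simp
    moreover have "0 \<le> ?E" using g0 by (intro integral_nonneg_AE) simp
    ultimately show ?thesis using a by simp
  qed
  with iso show ?thesis by linarith
qed


text \<open>
  The decreasing rearrangement in the variable \<open>t = ln r\<close>: the value \<open>v t\<close> is determined by the disc of radius \<open>exp t\<close>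
  having the area of the set where \<open>u\<close> exceeds \<open>v t\<close>. The measure is kept in \<open>ennreal\<close> because at height \<open>0\<close> it may be
  infinite.
\<close>
definition levels :: "real \<Rightarrow> real set" where
  "levels t = {s. 0 \<le> s \<and> emeasure lborel {x. s < u x} \<le> ennreal (pi * exp (2 * t))}"
definition v :: "real \<Rightarrow> real" where "v t = Inf (levels t)"

lemma level_mono: "s \<le> s' \<Longrightarrow> emeasure lborel {x. s' < u x} \<le> emeasure lborel {x. s < u x}"
  by (intro emeasure_mono) auto

lemma levels_nonempty: "levels t \<noteq> {}"
proof -
  let ?I = "LINT x|lborel. rho x"
  have I0: "0 \<le> ?I" using r0 by (intro integral_nonneg_AE) simp
  define s where "s = sqrt ((?I + 1) / (pi * exp (2 * t)))"
  have s: "s > 0" "s\<^sup>2 = (?I + 1) / (pi * exp (2 * t))" using I0 by (auto simp: s_def divide_nonneg_pos)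
  have "s\<^sup>2 * indicator {x. s < u x} x \<le> rho x" for x
  proof (cases "s < u x")
    case True
    then have "s\<^sup>2 \<le> (u x)\<^sup>2" using s(1) by (intro power_mono) auto
    then show ?thesis using True by (simp add: u_sq)
  qed (simp add: r0)
  then have "(LINT x|lborel. s\<^sup>2 * indicator {x. s < u x} x) \<le> ?I"
    using level_integrable[OF s(1)] by (intro integral_mono ir) auto
  then have "s\<^sup>2 * measure lborel {x. s < u x} \<le> ?I" by simp
  then have "measure lborel {x. s < u x} \<le> ?I / s\<^sup>2" using s(1) by (simp add: pos_le_divide_eq mult.commute)
  also have "\<dots> = pi * exp (2 * t) * (?I / (?I + 1))" unfolding s(2) by simp
  also have "\<dots> \<le> pi * exp (2 * t) * 1" using I0 by (intro mult_left_mono) auto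
  finally have "emeasure lborel {x. s < u x} \<le> ennreal (pi * exp (2 * t))"
    using level_finite[OF s(1)] by (simp add: emeasure_eq_ennreal_measure)
  then have "s \<in> levels t" using s(1) by (simp add: levels_def)
  then show ?thesis by blast
qed

lemma v_le: "0 \<le> s \<Longrightarrow> emeasure lborel {x. s < u x} \<le> ennreal (pi * exp (2 * t)) \<Longrightarrow> v t \<le> s"
  unfolding v_def by (intro cInf_lower) (auto simp: levels_def intro!: bdd_belowI)

lemma less_v:
  assumes s: "0 \<le> s" and m: "ennreal (pi * exp (2 * t)) < emeasure lborel {x. s < u x}"
  shows "s < v t"
proof -
  let ?X = "\<lambda>n. {x. s + 1 / real (Suc n) < u x}"
  have U: "(\<Union>n. ?X n) = {x. s < u x}"
  proof (intro equalityI subsetI)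
    fix x assume "x \<in> {x. s < u x}"
    then obtain n where "inverse (real (Suc n)) < u x - s" using reals_Archimedean[of "u x - s"] by auto
    then show "x \<in> (\<Union>n. ?X n)" by (auto simp: inverse_eq_divide algebra_simps)
  next
    fix x assume "x \<in> (\<Union>n. ?X n)"
    then obtain n where "s + 1 / real (Suc n) < u x" by blast
    then have "s < u x" by (rule less_trans[rotated]) simp
    then show "x \<in> {x. s < u x}" by simp
  qed
  have inc: "incseq ?X"
  proof (rule incseq_SucI, rule subsetI)
    fix n x assume "x \<in> ?X n"
    moreover have "1 / real (Suc (Suc n)) \<le> 1 / real (Suc n)" by (intro divide_left_mono) auto
    ultimately show "x \<in> ?X (Suc n)" by simp
  qed
  have "(SUP n. emeasure lborel (?X n)) = emeasure lborel {x. s < u x}"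
    unfolding U[symmetric] by (rule SUP_emeasure_incseq[OF _ inc]) auto
  then have "ennreal (pi * exp (2 * t)) < (SUP n. emeasure lborel (?X n))" using m by simp
  then obtain n where n: "ennreal (pi * exp (2 * t)) < emeasure lborel (?X n)" by (auto simp: less_SUP_iff)
  have "s + 1 / real (Suc n) \<le> v t" unfolding v_def
  proof (rule cInf_greatest[OF levels_nonempty])
    fix y assume y: "y \<in> levels t"
    show "s + 1 / real (Suc n) \<le> y"
    proof (rule ccontr)
      assume "\<not> ?thesis"
      then have "emeasure lborel (?X n) \<le> emeasure lborel {x. y < u x}" by (intro level_mono) simp
      also have "\<dots> \<le> ennreal (pi * exp (2 * t))" using y by (simp add: levels_def)
      finally show False using n by simp
    qed
  qed
  then show ?thesis by (rule less_le_trans[rotated]) simp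
qed

lemma less_v_iff: "0 \<le> s \<Longrightarrow> s < v t \<longleftrightarrow> ennreal (pi * exp (2 * t)) < emeasure lborel {x. s < u x}"
  using v_le[of s t] less_v[of s t] by (auto simp: not_less[symmetric])

lemma v0: "0 \<le> v t"
  unfolding v_def by (rule cInf_greatest[OF levels_nonempty]) (simp add: levels_def)

lemma v_antimono: "s \<le> t \<Longrightarrow> v t \<le> v s"
proof -
  assume st: "s \<le> t"
  have e: "ennreal (pi * exp (2 * s)) \<le> ennreal (pi * exp (2 * t))" using st by (intro ennreal_leI) simp
  show ?thesis
    unfolding v_def by (rule cInf_superset_mono[OF levels_nonempty]) (auto simp: levels_def intro!: bdd_belowI intro: order_trans[OF _ e])
qed

text \<open>
  Between the heights \<open>v t\<close> and \<open>v s\<close> the function \<open>u\<close> occupies at most the area of the annulus, and the set above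
  \<open>v s\<close> has the area of the inner disc. Hence \<open>level_gap\<close> applies, with heights slightly inside the interval so that
  the strict inequalities of \<open>less_v_iff\<close> can be used.
\<close>
lemma v_increment:
  assumes st: "s < t"
  shows "(v s - v t)\<^sup>2 \<le> (exp (2 * (t - s)) - 1) / (4 * pi) * (LINT x|lborel. gr x * indicator {x. v t < u x \<and> u x \<le> v s} x)"
proof (cases "v t < v s")
  case False
  then have "v s - v t = 0" using v_antimono[of s t] st by simp
  moreover have "0 \<le> (LINT x|lborel. gr x * indicator {x. v t < u x \<and> u x \<le> v s} x)"
    using g0 by (intro integral_nonneg_AE) simp
  ultimately show ?thesis using st by simp
next
  case True
  let ?S = "{x. v t < u x \<and> u x \<le> v s}" let ?E = "LINT x|lborel. gr x * indicator ?S x"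
  have step: "(v s - v t - 3 * h)\<^sup>2 \<le> (exp (2 * (t - s)) - 1) / (4 * pi) * ?E" if h: "0 < h" "4 * h \<le> v s - v t" for h
  proof -
    let ?a = "v t + h" let ?b = "v s - h"
    let ?c = "pi * (exp (2 * t) - exp (2 * s))"
    have a: "0 < ?a" "?a < ?b" "0 < ?b" "?b < v s" using h v0[of t] by auto
    have ma: "measure lborel {x. ?a < u x} \<le> pi * exp (2 * t)"
    proof -
      have "emeasure lborel {x. ?a < u x} \<le> ennreal (pi * exp (2 * t))" using less_v_iff[of ?a t] a h by (simp add: not_less[symmetric])
      then show ?thesis using level_finite[OF a(1)] by (simp add: emeasure_eq_ennreal_measure)
    qed
    have mb: "pi * exp (2 * s) < measure lborel {x. ?b < u x}"
    proof -
      have "ennreal (pi * exp (2 * s)) < emeasure lborel {x. ?b < u x}" using less_v_iff[of ?b s] a by simp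
      then show ?thesis using level_finite[OF a(3)] by (simp add: emeasure_eq_ennreal_measure ennreal_less_iff)
    qed
    have "measure lborel {x. ?a < u x \<and> u x < ?b} \<le> measure lborel ({x. ?a < u x} - {x. ?b < u x})"
      using level_finite[OF a(1)] by (intro measure_mono_fmeasurable) (auto simp: fmeasurable_def intro: le_less_trans[OF emeasure_mono])
    also have "\<dots> = measure lborel {x. ?a < u x} - measure lborel {x. ?b < u x}"
      using level_finite[OF a(1)] a(2) by (intro measure_Diff) auto
    also have "\<dots> \<le> ?c" using ma mb by (simp add: right_diff_distrib)
    finally have mc: "measure lborel {x. ?a < u x \<and> u x < ?b} \<le> ?c" .
    have c: "0 < ?c" using st by simp
    have i1: "integrable lborel (\<lambda>x. gr x * indicator A x)" if "A \<in> sets borel" for A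
      using that ig by (intro integrable_real_mult_indicator) auto
    have E: "(LINT x|lborel. gr x * indicator {x. ?a < u x \<and> u x < ?b} x) \<le> ?E"
    proof (rule integral_mono[OF i1 i1])
      show "gr x * indicator {x. ?a < u x \<and> u x < ?b} x \<le> gr x * indicator ?S x" for x
        using g0[of x] h by (auto simp: indicator_def)
    qed measurable
    have mb': "pi * exp (2 * s) \<le> measure lborel {x. ?b \<le> u x}"
    proof -
      have "emeasure lborel {x. ?b \<le> u x} \<le> emeasure lborel {x. ?a < u x}" using a(2) by (intro emeasure_mono) auto
      then have "emeasure lborel {x. ?b \<le> u x} < \<infinity>" using level_finite[OF a(1)] by (rule le_less_trans)
      then have "measure lborel {x. ?b < u x} \<le> measure lborel {x. ?b \<le> u x}"
        by (intro measure_mono_fmeasurable) (auto simp: fmeasurable_def)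
      then show ?thesis using mb by simp
    qed
    have "4 * pi * (?b - ?a - h)\<^sup>2 * (pi * exp (2 * s)) \<le> 4 * pi * (?b - ?a - h)\<^sup>2 * measure lborel {x. ?b \<le> u x}"
      by (rule mult_left_mono[OF mb']) simp
    also have "\<dots> \<le> ?c * (LINT x|lborel. gr x * indicator {x. ?a < u x \<and> u x < ?b} x)"
      by (rule level_gap[OF a(1) h(1) _ c mc]) (use h in simp)
    also have "\<dots> \<le> ?c * ?E" by (rule mult_left_mono[OF E]) (use c in simp)
    finally have f: "4 * pi * (?b - ?a - h)\<^sup>2 * (pi * exp (2 * s)) \<le> ?c * ?E" .
    have eb: "?b - ?a - h = v s - v t - 3 * h" by simp
    have ec: "?c = (pi * exp (2 * s)) * (exp (2 * (t - s)) - 1)"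
      by (simp add: algebra_simps exp_add[symmetric])
    have "(pi * exp (2 * s)) * (4 * pi * (v s - v t - 3 * h)\<^sup>2) \<le> (pi * exp (2 * s)) * ((exp (2 * (t - s)) - 1) * ?E)"
      using f unfolding eb ec by (simp only: mult_ac)
    then have "4 * pi * (v s - v t - 3 * h)\<^sup>2 \<le> (exp (2 * (t - s)) - 1) * ?E" by simp
    then show ?thesis by (simp add: field_simps)
  qed
  have "((\<lambda>h. (v s - v t - 3 * h)\<^sup>2) \<longlongrightarrow> (v s - v t - 3 * 0)\<^sup>2) (at_right 0)" by (intro tendsto_intros)
  moreover have "\<forall>\<^sub>F h in at_right 0. (v s - v t - 3 * h)\<^sup>2 \<le> (exp (2 * (t - s)) - 1) / (4 * pi) * ?E"
  proof (rule eventually_at_rightI[of 0 "(v s - v t) / 4"])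
    fix h assume "h \<in> {0<..<(v s - v t) / 4}"
    then have "0 < h" "4 * h \<le> v s - v t" by auto
    then show "(v s - v t - 3 * h)\<^sup>2 \<le> (exp (2 * (t - s)) - 1) / (4 * pi) * ?E" by (rule step)
  qed (use True in simp)
  ultimately show ?thesis using tendsto_upperbound[of _ "(v s - v t - 3 * 0)\<^sup>2" "at_right (0::real)"] by simp
qed

text \<open>
  The factor \<open>(exp (2 * (t - s)) - 1) / 2\<close> from \<open>v_increment\<close> exceeds \<open>t - s\<close> only to second order, so summing over a
  subdivision of \<open>[s, t]\<close> into \<open>n\<close> parts and letting \<open>n\<close> grow replaces it by \<open>t - s\<close>.
\<close>
theorem fin_en_v: "fin_en v ((LINT x|lborel. gr x) / (2 * pi))"
proof -
  define A where "A t = (LINT x|lborel. gr x * indicator {x. v t < u x} x) / (2 * pi)" for t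
  have i1: "integrable lborel (\<lambda>x. gr x * indicator B x)" if "B \<in> sets borel" for B
    using that ig by (intro integrable_real_mult_indicator) auto
  have A0: "0 \<le> A t" for t unfolding A_def using g0 by (intro divide_nonneg_pos integral_nonneg_AE) auto
  have A1: "A t \<le> (LINT x|lborel. gr x) / (2 * pi)" for t
  proof -
    have "(LINT x|lborel. gr x * indicator {x. v t < u x} x) \<le> (LINT x|lborel. gr x)"
      using g0 by (intro integral_mono i1 ig) (auto simp: indicator_def)
    then show ?thesis unfolding A_def by (intro divide_right_mono) auto
  qed
  have inc: "(v s - v t)\<^sup>2 \<le> (exp (2 * (t - s)) - 1) / 2 * (A t - A s)" if "s < t" for s t
  proof -
    have "(LINT x|lborel. gr x * indicator {x. v t < u x \<and> u x \<le> v s} x)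
       = (LINT x|lborel. gr x * indicator {x. v t < u x} x - gr x * indicator {x. v s < u x} x)"
      using v_antimono[of s t] that by (intro Bochner_Integration.integral_cong) (auto simp: indicator_def)
    also have "\<dots> = 2 * pi * (A t - A s)"
      unfolding A_def by (subst Bochner_Integration.integral_diff) (auto intro!: i1 simp: field_simps)
    finally have e: "(LINT x|lborel. gr x * indicator {x. v t < u x \<and> u x \<le> v s} x) = 2 * pi * (A t - A s)" .
    have q: "c / (4 * pi) * (2 * pi * d) = c / 2 * d" for c d :: real by simp
    show ?thesis using v_increment[OF that] unfolding e q .
  qed
  have main: "(v t - v s)\<^sup>2 \<le> (t - s) * (A t - A s)" if st: "s < t" for s t
  proof -
    have sub: "(v t - v s)\<^sup>2 \<le> real n * ((exp (2 * ((t - s) / real n)) - 1) / 2) * (A t - A s)" if n: "n > 0" for n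
    proof -
      define p where "p i = s + real i * ((t - s) / real n)" for i
      have p: "p 0 = s" "p n = t" "p (Suc i) - p i = (t - s) / real n" "p i < p (Suc i)" for i
        using n st by (simp_all add: p_def algebra_simps add_divide_distrib diff_divide_distrib)
          (simp add: divide_strict_right_mono)
      have tel: "(\<Sum>i<n. F (p (Suc i)) - F (p i)) = F t - F s" for F :: "real \<Rightarrow> real"
        using sum_lessThan_telescope[of "\<lambda>i. F (p i)" n] by (simp add: p(1,2))
      have "(v t - v s)\<^sup>2 = (\<Sum>i<n. v (p (Suc i)) - v (p i))\<^sup>2" unfolding tel ..
      also have "\<dots> \<le> (\<Sum>i<n. (v (p (Suc i)) - v (p i))\<^sup>2) * real (card {..<n})"
        by (rule sum_squared_le_sum_of_squares)
      also have "\<dots> \<le> (\<Sum>i<n. (exp (2 * ((t - s) / real n)) - 1) / 2 * (A (p (Suc i)) - A (p i))) * real (card {..<n})"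
      proof (intro mult_right_mono sum_mono)
        fix i show "(v (p (Suc i)) - v (p i))\<^sup>2 \<le> (exp (2 * ((t - s) / real n)) - 1) / 2 * (A (p (Suc i)) - A (p i))"
          using inc[OF p(4)[of i]] unfolding p(3) by (subst power2_commute)
      qed simp
      also have "\<dots> = real n * ((exp (2 * ((t - s) / real n)) - 1) / 2) * (A t - A s)"
        unfolding sum_distrib_left[symmetric] tel by simp
      finally show ?thesis .
    qed
    have "(\<lambda>n. real n * ((exp (2 * ((t - s) / real n)) - 1) / 2)) \<longlonglongrightarrow> t - s"
      using st by real_asymp
    then have "(\<lambda>n. real n * ((exp (2 * ((t - s) / real n)) - 1) / 2) * (A t - A s)) \<longlonglongrightarrow> (t - s) * (A t - A s)"
      by (intro tendsto_intros)
    then show ?thesis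
      by (rule tendsto_lowerbound) (use sub in \<open>auto simp: eventually_sequentially intro!: exI[of _ 1]\<close>)
  qed
  have "(v t - v s)\<^sup>2 \<le> (t - s) * (A t - A s)" if "s \<le> t" for s t
    using main[of s t] that by (cases "s = t") auto
  then show ?thesis unfolding fin_en_def using A0 A1 by blast
qed

lemma vm [measurable]: "v \<in> borel_measurable borel" by (rule fin_en_measurable[OF fin_en_v])

lemma v_tendsto: "(v \<longlongrightarrow> 0) at_top"
proof (rule order_tendstoI)
  fix a :: real assume a: "0 < a"
  let ?m = "measure lborel {x. a / 2 < u x}"
  have "filterlim (\<lambda>t. pi * exp (2 * t)) at_top (at_top :: real filter)" by real_asymp
  then have "\<forall>\<^sub>F t in at_top. ?m \<le> pi * exp (2 * t)" by (simp add: filterlim_at_top)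
  then show "\<forall>\<^sub>F t in at_top. v t < a"
  proof eventually_elim
    case (elim t)
    then have "emeasure lborel {x. a / 2 < u x} \<le> ennreal (pi * exp (2 * t))"
      using level_finite[of "a / 2"] a by (simp add: emeasure_eq_ennreal_measure)
    then have "v t \<le> a / 2" using a by (intro v_le) auto
    then show ?case using a by simp
  qed
next
  fix a :: real assume "a < 0"
  then have "a < v t" for t using v0[of t] by (rule less_le_trans)
  then show "\<forall>\<^sub>F t in at_top. a < v t" by (intro always_eventually allI)
qed

text \<open>
  The set where \<open>u\<close> exceeds \<open>b\<close> is open and has measure zero.
\<close>
lemma v_bounded_imp_u_bounded:
  assumes b: "0 < b" and vb: "\<And>t. v t \<le> b" shows "u x \<le> b"
proof -
  let ?m = "measure lborel {x. b < u x}"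
  have le: "?m \<le> pi * exp (2 * t)" for t
  proof -
    have "\<not> b < v t" using vb[of t] by simp
    then have "emeasure lborel {x. b < u x} \<le> ennreal (pi * exp (2 * t))" using less_v_iff[of b t] b by (simp add: not_less)
    then show ?thesis using level_finite[OF b] by (simp add: emeasure_eq_ennreal_measure)
  qed
  have "((\<lambda>t :: real. pi * exp (2 * t)) \<longlongrightarrow> 0) at_bot" by real_asymp
  then have "?m \<le> 0" by (rule tendsto_lowerbound) (auto intro!: always_eventually le)
  then have "?m = 0" using measure_nonneg[of lborel "{x. b < u x}"] by simp
  then have "{x. b < u x} \<in> null_sets lborel" using level_finite[OF b] by (simp add: null_sets_def emeasure_eq_ennreal_measure)
  then have n: "negligible {x. b < u x}" unfolding negligible_iff_null_sets by (rule null_sets_completionI)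
  have "open {x. b < u x}" using cu by (intro open_Collect_less continuous_intros)
  then have "{x. b < u x} = {}" using n open_not_negligible by blast
  then show ?thesis by (auto simp: not_less[symmetric])
qed

text \<open>
  The measures of the sets where \<open>u > s\<close> and \<open>v > s\<close> agree for all \<open>s > 0\<close>, the second one with respect to
  \<open>2 * pi * exp (2 * t)\<close>. Passing to \<open>ln u\<close> and \<open>ln v\<close> turns the heights into all of the line, on which a measure is
  determined by its finite values on half-lines; the set where the functions vanish contributes nothing.
\<close>
theorem equimeasurable:
  fixes g :: "real \<Rightarrow> real"
  assumes [measurable]: "g \<in> borel_measurable borel" and g00: "g 0 = 0" and i: "integrable lborel (\<lambda>x. g (u x))"
  shows "integrable lborel (\<lambda>t. exp (2 * t) * g (v t))" "(LINT x|lborel. g (u x)) = 2 * pi * (LINT t|lborel. exp (2 * t) * g (v t))"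
proof -
  let ?wu = "\<lambda>x. indicator {x. 0 < u x} x :: real" let ?wv = "\<lambda>t. 2 * pi * exp (2 * t) * indicator {t. 0 < v t} t :: real"
  let ?M = "distr (density lborel (\<lambda>x. ennreal (?wu x))) borel (\<lambda>x. ln (u x))"
  let ?N = "distr (density lborel (\<lambda>t. ennreal (?wv t))) borel (\<lambda>t. ln (v t))"
  have lnl: "0 < y \<and> s < ln y \<longleftrightarrow> exp s < y" for s y :: real
    using ln_less_cancel_iff[of "exp s" y] less_trans[OF exp_gt_zero[of s], of y] by auto
  have M: "emeasure ?M {s<..} = emeasure lborel {x. exp s < u x}" for s
  proof -
    have "emeasure ?M {s<..} = (\<integral>\<^sup>+y. indicator {s<..} y \<partial>?M)" by simp
    also have "\<dots> = (\<integral>\<^sup>+x. ennreal (?wu x) * indicator {s<..} (ln (u x)) \<partial>lborel)"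
      by (subst nn_integral_distr) (auto simp: nn_integral_density)
    also have "\<dots> = (\<integral>\<^sup>+x. indicator {x. exp s < u x} x \<partial>lborel)"
      using lnl by (intro nn_integral_cong) (auto simp: indicator_def)
    finally show ?thesis by simp
  qed
  have N: "emeasure ?N {s<..} = emeasure lborel {x. exp s < u x}" for s
  proof -
    let ?m = "measure lborel {x. exp s < u x}"
    have e: "emeasure lborel {x. exp s < u x} = ennreal ?m" using level_finite[of "exp s"] by (simp add: emeasure_eq_ennreal_measure)
    have lv: "exp s < v t \<longleftrightarrow> pi * exp (2 * t) < ?m" for t
      using less_v_iff[of "exp s" t] unfolding e by (simp add: ennreal_less_iff)
    have "emeasure ?N {s<..} = (\<integral>\<^sup>+y. indicator {s<..} y \<partial>?N)" by simp
    also have "\<dots> = (\<integral>\<^sup>+t. ennreal (?wv t) * indicator {s<..} (ln (v t)) \<partial>lborel)"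
      by (subst nn_integral_distr) (auto simp: nn_integral_density)
    also have "\<dots> = (\<integral>\<^sup>+t. ennreal (2 * pi * exp (2 * t)) * indicator {t. pi * exp (2 * t) < ?m} t \<partial>lborel)"
      using lnl unfolding lv[symmetric] by (intro nn_integral_cong) (auto simp: indicator_def)
    also have "\<dots> = ennreal ?m"
    proof (cases "?m = 0")
      case True
      have "{t. pi * exp (2 * t) < ?m} = {}" unfolding True by (auto simp: not_less)
      then show ?thesis using True by simp
    next
      case False
      then have m: "?m > 0" by (simp add: less_le)
      have L: "pi * exp (2 * t) < ?m \<longleftrightarrow> t < ln (?m / pi) / 2" for t
      proof -
        have "pi * exp (2 * t) < ?m \<longleftrightarrow> exp (2 * t) < ?m / pi" by (simp add: field_simps)
        also have "\<dots> \<longleftrightarrow> 2 * t < ln (?m / pi)" using m by (subst ln_less_cancel_iff[symmetric]) auto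
        finally show ?thesis by (simp add: field_simps)
      qed
      have S: "{t. pi * exp (2 * t) < ?m} = {..< ln (?m / pi) / 2}" unfolding lessThan_def L ..
      have h2: "2 * (a / 2) = a" for a :: real by simp
      have "pi * exp (2 * (ln (k / pi) / 2)) = k" if "0 < k" for k
        unfolding h2 exp_ln[OF divide_pos_pos[OF that pi_gt_zero]] by simp
      from this[OF m] show ?thesis unfolding S nn_exp2_half_line by (simp only:)
    qed
    finally show ?thesis unfolding e .
  qed
  have eq: "?M = ?N"
    by (rule measure_eqI_lessThan) (simp_all only: M N sets_distr level_finite[OF exp_gt_zero])
  let ?h = "\<lambda>y. g (exp y)"
  have fu: "?wu x *\<^sub>R ?h (ln (u x)) = g (u x)" for x using u0[of x] g00 by (cases "u x = 0") auto
  have fv: "?wv t *\<^sub>R ?h (ln (v t)) = 2 * pi * (exp (2 * t) * g (v t))" for t using v0[of t] g00 by (cases "v t = 0") auto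
  have tr: "integrable (distr (density lborel (\<lambda>x. ennreal (k x))) borel (\<lambda>x. ln (z x))) ?h \<longleftrightarrow> integrable lborel (\<lambda>x. k x *\<^sub>R ?h (ln (z x)))"
      "(LINT y|distr (density lborel (\<lambda>x. ennreal (k x))) borel (\<lambda>x. ln (z x)). ?h y) = (LINT x|lborel. k x *\<^sub>R ?h (ln (z x)))"
    if [measurable]: "k \<in> borel_measurable borel" "z \<in> borel_measurable borel" and k0: "\<And>x. 0 \<le> k x"
    for k z :: "'x::euclidean_space \<Rightarrow> real"
  proof -
    have m: "(\<lambda>x. ln (z x)) \<in> measurable (density lborel (\<lambda>x. ennreal (k x))) borel" "?h \<in> borel_measurable borel"
      by measurable
    have m2: "(\<lambda>x. ?h (ln (z x))) \<in> borel_measurable lborel" "k \<in> borel_measurable lborel" by measurable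
    show "integrable (distr (density lborel (\<lambda>x. ennreal (k x))) borel (\<lambda>x. ln (z x))) ?h \<longleftrightarrow> integrable lborel (\<lambda>x. k x *\<^sub>R ?h (ln (z x)))"
      unfolding integrable_distr_eq[OF m] by (rule integrable_density[OF m2 AE_I2[OF k0]])
    show "(LINT y|distr (density lborel (\<lambda>x. ennreal (k x))) borel (\<lambda>x. ln (z x)). ?h y) = (LINT x|lborel. k x *\<^sub>R ?h (ln (z x)))"
      unfolding integral_distr[OF m] by (rule integral_density[OF m2 AE_I2[OF k0]])
  qed
  have wm: "?wu \<in> borel_measurable borel" "?wv \<in> borel_measurable borel" by measurable
  have w0: "0 \<le> ?wu x" "0 \<le> ?wv t" for x t by auto
  note 1 = tr[OF wm(1) um w0(1)] and 2 = tr[OF wm(2) vm w0(2)]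
  have "integrable lborel (\<lambda>t. 2 * pi * (exp (2 * t) * g (v t)))"
    using 1(1) 2(1) i unfolding eq fu fv by simp
  then show "integrable lborel (\<lambda>t. exp (2 * t) * g (v t))" by simp
  show "(LINT x|lborel. g (u x)) = 2 * pi * (LINT t|lborel. exp (2 * t) * g (v t))"
    using 1(2) 2(2) unfolding eq fu fv by simp
qed

end

section \<open>Profiles and positive radial solutions\<close>

lemma DERIV_ident_mult_at_0:
  fixes k :: "real \<Rightarrow> real" assumes "isCont k 0"
  shows "((\<lambda>t. t * k t) has_real_derivative k 0) (at 0)"
proof -
  have "((\<lambda>h. ((0 + h) * k (0 + h) - 0 * k 0) / h) \<longlongrightarrow> k 0) (at 0)"
    by (rule Lim_transform_eventually[OF assms[unfolded isCont_def]]) (auto simp: eventually_at_filter)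
  then show ?thesis unfolding DERIV_def by simp
qed

lemma has_partial_of_real: "has_partial i F D \<Longrightarrow> has_partial i (\<lambda>x. complex_of_real (F x)) (\<lambda>x. complex_of_real (D x))"
  unfolding has_partial_def by (auto intro: bounded_linear.has_vector_derivative[OF bounded_linear_of_real])

context
  fixes F :: "real ^ 2 \<Rightarrow> real" assumes F: "C2 F"
begin

lemma partial_of_real:
  "partial_deriv i (\<lambda>x. complex_of_real (F x)) = (\<lambda>x. complex_of_real (partial_deriv i F x))"
  "partial_deriv j (\<lambda>x. complex_of_real (partial_deriv i F x)) = (\<lambda>x. complex_of_real (partial_deriv j (partial_deriv i F) x))"
  using F unfolding C2_def by (blast intro: has_partial_eq has_partial_of_real C1_has_partial)+

lemma C1_of_real: "C1 H \<Longrightarrow> C1 (\<lambda>x. complex_of_real (H x))" for H :: "real ^ 2 \<Rightarrow> real"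
  by (rule C1I[where D = "\<lambda>i x. complex_of_real (partial_deriv i H x)"])
    (auto intro!: has_partial_of_real C1_has_partial continuous_on_of_real C1_cont)

lemma stationary_of_real:
  assumes "stationary_solution lam om F" shows "stationary_solution lam om (\<lambda>x. complex_of_real (F x))"
proof -
  have C: "C2 (\<lambda>x. complex_of_real (F x))"
    using F unfolding C2_def partial_of_real by (auto intro: C1_of_real)
  have "- (1 / 2) *\<^sub>R laplacian (\<lambda>x. complex_of_real (F x)) x + (lam * (norm (complex_of_real (F x)))\<^sup>2 * ln ((norm (complex_of_real (F x)))\<^sup>2)) *\<^sub>R complex_of_real (F x)
      + om *\<^sub>R complex_of_real (F x) = 0" for x
  proof -
    have "complex_of_real (- (1 / 2) *\<^sub>R laplacian F x + (lam * (norm (F x))\<^sup>2 * ln ((norm (F x))\<^sup>2)) *\<^sub>R F x + om *\<^sub>R F x) = 0"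
      using assms unfolding stationary_solution_def by (simp only: of_real_0)
    then show ?thesis unfolding laplacian_def partial_of_real by (simp add: scaleR_conv_of_real)
  qed
  with C show ?thesis unfolding stationary_solution_def by blast
qed

lemma grad_norm_sq_of_real: "grad_norm_sq (\<lambda>x. complex_of_real (F x)) = grad_norm_sq F"
  unfolding grad_norm_sq_def partial_of_real by simp

end

context nls_signs
begin

context
  fixes w p a assumes prof: "profile w p" and lim: "(w \<longlongrightarrow> a) at_bot"
begin

text \<open>
  The profile as a function of \<open>r = norm x ^ 2\<close>, in which the solution is differentiable at the origin. For \<open>r \<le> 0\<close> it
  is continued by its tangent, so that the derivative at \<open>0\<close> is two-sided. \<open>Y1\<close> is the derivative of \<open>Y\<close>, and
  \<open>Z r = r * Y'' r\<close> in terms of the equation.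
\<close>
definition Y :: "real \<Rightarrow> real" where "Y r = (if 0 < r then w (ln r / 2) else a + (- f a / 4) * r)"
definition Y1 :: "real \<Rightarrow> real" where "Y1 r = (if 0 < r then p (ln r / 2) / (2 * r) else - f a / 4)"
definition Z :: "real \<Rightarrow> real" where "Z r = - f (Y r) / 4 - Y1 r"

lemma DERIV_half_ln: "0 < r \<Longrightarrow> ((\<lambda>r. ln r / 2) has_real_derivative 1 / (2 * r)) (at r)"
  by (auto intro!: derivative_eq_intros)

lemma at_right_half_ln: "filterlim (\<lambda>r. ln r / 2) at_bot (at_right (0::real))"
  by real_asymp

lemma w_half_ln: "((\<lambda>r. w (ln r / 2)) \<longlongrightarrow> a) (at_right 0)"
  by (rule filterlim_compose[OF lim at_right_half_ln])

lemma DERIV_p_half_ln: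
  assumes r: "0 < r" shows "((\<lambda>r. p (ln r / 2)) has_real_derivative - f (w (ln r / 2)) / 2) (at r)"
proof -
  have "((\<lambda>r. p (ln r / 2)) has_real_derivative (- exp (2 * (ln r / 2)) * f (w (ln r / 2))) * (1 / (2 * r))) (at r)"
    by (rule DERIV_chain2[OF DERIV_p[OF prof] DERIV_half_ln[OF r]])
  then show ?thesis using r by simp
qed

text \<open>
  By the rule of de l'Hospital, as the derivative of \<open>p (ln r / 2)\<close> is \<open>- f (Y r) / 2\<close>.
\<close>
lemma Y1_right: "((\<lambda>r. p (ln r / 2) / (2 * r)) \<longlongrightarrow> - f a / 4) (at_right 0)"
proof (rule lhopital_right_0[where f' = "\<lambda>r. - f (w (ln r / 2)) / 2" and g' = "\<lambda>r. 2"])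
  have "(p \<longlongrightarrow> 0) at_bot" using prof unfolding profile_def by blast
  then show "((\<lambda>r. p (ln r / 2)) \<longlongrightarrow> 0) (at_right 0)" by (rule filterlim_compose[OF _ at_right_half_ln])
  show "((\<lambda>r::real. 2 * r) \<longlongrightarrow> 0) (at_right 0)" by real_asymp
  show "\<forall>\<^sub>F r in at_right 0. ((\<lambda>r. p (ln r / 2)) has_real_derivative - f (w (ln r / 2)) / 2) (at r)"
  proof (rule eventually_at_rightI[of 0 1])
    fix r :: real assume "r \<in> {0<..<1}"
    then show "((\<lambda>r. p (ln r / 2)) has_real_derivative - f (w (ln r / 2)) / 2) (at r)" by (intro DERIV_p_half_ln) simp
  qed simp
  have "((\<lambda>r. f (w (ln r / 2))) \<longlongrightarrow> f a) (at_right 0)"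
    by (rule isCont_tendsto_compose[OF DERIV_isCont[OF DERIV_f] w_half_ln])
  then have "((\<lambda>r. - f (w (ln r / 2)) / 2 / 2) \<longlongrightarrow> - f a / 2 / 2) (at_right 0)" by (intro tendsto_intros) auto
  then show "((\<lambda>r. - f (w (ln r / 2)) / 2 / 2) \<longlongrightarrow> - f a / 4) (at_right 0)" by simp
qed (auto simp: eventually_at_right_less intro!: derivative_eq_intros eventually_at_rightI[of 0 1])

lemma DERIV_Y_pos: assumes r: "0 < r" shows "(Y has_real_derivative Y1 r) (at r)"
proof -
  have "((\<lambda>r. w (ln r / 2)) has_real_derivative p (ln r / 2) * (1 / (2 * r))) (at r)"
    by (rule DERIV_chain2[OF DERIV_w[OF prof] DERIV_half_ln[OF r]])
  then have "(Y has_real_derivative p (ln r / 2) * (1 / (2 * r))) (at r)"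
    by (rule has_field_derivative_transform_within_open[of _ _ _ "{0<..}"]) (use r in \<open>auto simp: Y_def\<close>)
  then show ?thesis using r by (simp add: Y1_def)
qed

lemma DERIV_Y_0: "(Y has_real_derivative Y1 0) (at 0)"
proof -
  have R: "((\<lambda>h. (w (ln h / 2) - a) / h) \<longlongrightarrow> - f a / 4) (at_right 0)"
  proof (rule lhopital_right_0[where f' = "\<lambda>r. p (ln r / 2) / (2 * r)" and g' = "\<lambda>r. 1"])
    show "((\<lambda>h. w (ln h / 2) - a) \<longlongrightarrow> 0) (at_right 0)" using tendsto_diff[OF w_half_ln tendsto_const[of a]] by simp
    show "\<forall>\<^sub>F r in at_right 0. ((\<lambda>h. w (ln h / 2) - a) has_real_derivative p (ln r / 2) / (2 * r)) (at r)"
    proof (rule eventually_at_rightI[of 0 1])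
      fix r :: real assume "r \<in> {0<..<1}"
      then have r: "0 < r" by simp
      from DERIV_diff[OF DERIV_chain2[OF DERIV_w[OF prof] DERIV_half_ln[OF r]] DERIV_const[of a]]
      show "((\<lambda>h. w (ln h / 2) - a) has_real_derivative p (ln r / 2) / (2 * r)) (at r)" by simp
    qed simp
    show "((\<lambda>r. p (ln r / 2) / (2 * r) / 1) \<longlongrightarrow> - f a / 4) (at_right 0)" using Y1_right by simp
  qed (auto simp: eventually_at_right_less intro!: derivative_eq_intros eventually_at_rightI[of 0 1])
  have "((\<lambda>h. (Y (0 + h) - Y 0) / h) \<longlongrightarrow> - f a / 4) (at 0)"
  proof (rule filterlim_split_at)
    show "((\<lambda>h. (Y (0 + h) - Y 0) / h) \<longlongrightarrow> - f a / 4) (at_left 0)"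
      by (rule Lim_transform_eventually[OF tendsto_const], rule eventually_at_leftI[of "-1" 0]) (auto simp: Y_def)
    show "((\<lambda>h. (Y (0 + h) - Y 0) / h) \<longlongrightarrow> - f a / 4) (at_right 0)"
      by (rule Lim_transform_eventually[OF R], rule eventually_at_rightI[of 0 1]) (auto simp: Y_def)
  qed
  then show ?thesis unfolding DERIV_def Y1_def by simp
qed

lemma DERIV_Y: "0 \<le> r \<Longrightarrow> (Y has_real_derivative Y1 r) (at r)"
  using DERIV_Y_0 DERIV_Y_pos by (cases "r = 0") auto

lemma DERIV_Y1: assumes r: "0 < r" shows "(Y1 has_real_derivative Z r / r) (at r)"
proof -
  have "((\<lambda>r. p (ln r / 2) / (2 * r)) has_real_derivative
      (- f (w (ln r / 2)) / 2 * (2 * r) - p (ln r / 2) * 2) / ((2 * r) * (2 * r))) (at r)"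
    using r by (intro DERIV_divide DERIV_p_half_ln) (auto intro!: derivative_eq_intros)
  then have "(Y1 has_real_derivative (- f (w (ln r / 2)) / 2 * (2 * r) - p (ln r / 2) * 2) / ((2 * r) * (2 * r))) (at r)"
    by (rule has_field_derivative_transform_within_open[of _ _ _ "{0<..}"]) (use r in \<open>auto simp: Y1_def\<close>)
  moreover have "(- f (w (ln r / 2)) / 2 * (2 * r) - p (ln r / 2) * 2) / ((2 * r) * (2 * r)) = Z r / r"
    using r by (simp add: Z_def Y_def Y1_def field_simps)
  ultimately show ?thesis by simp
qed

lemma isCont_Y1: assumes "0 \<le> r" shows "isCont Y1 r"
proof (cases "r = 0")
  case True
  have "(Y1 \<longlongrightarrow> - f a / 4) (at 0)"
  proof (rule filterlim_split_at)
    show "(Y1 \<longlongrightarrow> - f a / 4) (at_left 0)"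
      by (rule Lim_transform_eventually[OF tendsto_const], rule eventually_at_leftI[of "-1" 0]) (auto simp: Y1_def)
    show "(Y1 \<longlongrightarrow> - f a / 4) (at_right 0)"
      by (rule Lim_transform_eventually[OF Y1_right], rule eventually_at_rightI[of 0 1]) (auto simp: Y1_def)
  qed
  then show ?thesis using True by (simp add: isCont_def Y1_def)
next
  case False
  then show ?thesis using DERIV_isCont[OF DERIV_Y1, of r] assms by simp
qed

lemma isCont_Y: "0 \<le> r \<Longrightarrow> isCont Y r" by (rule DERIV_isCont[OF DERIV_Y])
lemma isCont_Z: "0 \<le> r \<Longrightarrow> isCont Z r"
  unfolding Z_def[abs_def] by (intro continuous_intros isCont_o2[OF isCont_Y DERIV_isCont[OF DERIV_f]] isCont_Y1) auto
lemma Z_0: "Z 0 = 0" by (simp add: Z_def Y_def Y1_def)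

definition phi :: "real ^ 2 \<Rightarrow> real" where "phi x = Y (x \<bullet> x)"
definition d1 :: "2 \<Rightarrow> real ^ 2 \<Rightarrow> real" where "d1 i x = Y1 (x \<bullet> x) * (2 * x $ i)"
definition d2 :: "2 \<Rightarrow> 2 \<Rightarrow> real ^ 2 \<Rightarrow> real" where
  "d2 j i x = Z (x \<bullet> x) * (4 * (x $ i) * (x $ j) / (x \<bullet> x)) + Y1 (x \<bullet> x) * (2 * (if j = i then 1 else 0))"

lemma isCont_sq: "isCont (\<lambda>x :: real ^ 2. x \<bullet> x) x" by (intro continuous_intros)

lemma hp_phi: "has_partial i phi (d1 i)"
  unfolding phi_def[abs_def] d1_def[abs_def] by (rule has_partial_compose[OF has_partial_sq_norm DERIV_Y]) simp

text \<open>
  At the origin this uses only that \<open>Y1\<close> is continuous: on the axes \<open>d1\<close> is \<open>2 * t * Y1 (t\<^sup>2)\<close> or zero.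
\<close>
lemma hp_d1: "has_partial j (d1 i) (d2 j i)"
  unfolding has_partial_def
proof
  fix x
  show "((\<lambda>t. d1 i (x + t *\<^sub>R axis j 1)) has_vector_derivative d2 j i x) (at 0)"
  proof (cases "x = 0")
    case True
    have c: "isCont (\<lambda>t :: real. Y1 (t * t) * (2 * (if j = i then 1 else 0))) 0"
      by (intro continuous_intros isCont_o2[of 0 "\<lambda>t::real. t * t" Y1] isCont_Y1) auto
    have e: "d1 i (x + t *\<^sub>R axis j 1) = t * (Y1 (t * t) * (2 * (if j = i then 1 else 0)))" for t
    proof -
      have "(t *\<^sub>R axis j 1) \<bullet> (t *\<^sub>R axis j (1 :: real)) = t * t" by (simp add: inner_axis_axis)
      moreover have "(t *\<^sub>R axis j (1 :: real)) $ i = t * (if j = i then 1 else 0)" by (simp add: axis_def)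
      ultimately show ?thesis unfolding d1_def True add_0 by simp
    qed
    show ?thesis unfolding e has_real_derivative_iff_has_vector_derivative[symmetric]
      using DERIV_ident_mult_at_0[OF c] True by (simp add: d2_def)
  next
    case False
    have q: "((\<lambda>t. (x + t *\<^sub>R axis j 1) \<bullet> (x + t *\<^sub>R axis j 1)) has_real_derivative 2 * (x $ j)) (at 0)"
      using has_partialD[OF has_partial_sq_norm, of x j] by (simp add: has_real_derivative_iff_has_vector_derivative)
    have c: "((\<lambda>t. 2 * (x + t *\<^sub>R axis j 1) $ i) has_real_derivative 2 * (if j = i then 1 else 0)) (at 0)"
      using has_partialD[OF has_partial_coord, of x j i]
      by (intro DERIV_cmult) (simp add: has_real_derivative_iff_has_vector_derivative)
    have xx: "0 < (x + 0 *\<^sub>R axis j 1) \<bullet> (x + 0 *\<^sub>R axis j 1)" using False by simp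
    from DERIV_mult[OF DERIV_chain2[OF DERIV_Y1[OF xx] q] c]
    show ?thesis unfolding d1_def has_real_derivative_iff_has_vector_derivative[symmetric]
      by (rule DERIV_cong) (simp add: d2_def)
  qed
qed

lemma cont_phi: "continuous_on UNIV phi" "continuous_on UNIV (d1 i)" "continuous_on UNIV (d2 j i)"
proof -
  show "continuous_on UNIV phi" unfolding phi_def[abs_def]
    by (intro continuous_at_imp_continuous_on ballI isCont_o2[OF isCont_sq isCont_Y]) simp
  show "continuous_on UNIV (d1 i)" unfolding d1_def[abs_def]
    by (intro continuous_at_imp_continuous_on ballI continuous_intros isCont_o2[OF isCont_sq isCont_Y1]) simp
  have b: "\<bar>4 * (x $ i) * (x $ j) / (x \<bullet> x)\<bar> \<le> 4" for x :: "real ^ 2"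
  proof (cases "x = 0")
    case False
    have "\<bar>x $ i\<bar> * \<bar>x $ j\<bar> \<le> norm x * norm x" by (intro mult_mono component_le_norm_cart) auto
    then show ?thesis using False by (simp add: abs_mult power2_norm_eq_inner[symmetric] power2_eq_square divide_le_eq)
  qed simp
  have T: "isCont (\<lambda>x. Z (x \<bullet> x) * (4 * (x $ i) * (x $ j) / (x \<bullet> x))) x" for x :: "real ^ 2"
  proof (cases "x = 0")
    case True
    have z: "isCont (\<lambda>x :: real ^ 2. Z (x \<bullet> x)) 0" by (rule isCont_o2[OF isCont_sq isCont_Z]) simp
    have "((\<lambda>x :: real ^ 2. 4 * \<bar>Z (x \<bullet> x)\<bar>) \<longlongrightarrow> 4 * \<bar>Z (0 \<bullet> (0 :: real ^ 2))\<bar>) (at 0)"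
      using z unfolding isCont_def by (intro tendsto_intros)
    then have l: "((\<lambda>x :: real ^ 2. 4 * \<bar>Z (x \<bullet> x)\<bar>) \<longlongrightarrow> 0) (at 0)" by (simp add: Z_0)
    have "((\<lambda>x :: real ^ 2. Z (x \<bullet> x) * (4 * (x $ i) * (x $ j) / (x \<bullet> x))) \<longlongrightarrow> 0) (at 0)"
    proof (rule Lim_null_comparison[OF _ l], intro always_eventually allI)
      fix x :: "real ^ 2"
      have "\<bar>Z (x \<bullet> x)\<bar> * \<bar>4 * (x $ i) * (x $ j) / (x \<bullet> x)\<bar> \<le> \<bar>Z (x \<bullet> x)\<bar> * 4" by (rule mult_left_mono[OF b]) simp
      then show "norm (Z (x \<bullet> x) * (4 * (x $ i) * (x $ j) / (x \<bullet> x))) \<le> 4 * \<bar>Z (x \<bullet> x)\<bar>"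
        unfolding real_norm_def abs_mult[of "Z (x \<bullet> x)"] by (simp only: mult.commute)
    qed
    then show ?thesis using True by (simp add: isCont_def)
  next
    case False
    have z: "isCont (\<lambda>x :: real ^ 2. Z (x \<bullet> x)) x" by (rule isCont_o2[OF isCont_sq isCont_Z]) simp
    show ?thesis using False by (intro continuous_intros z) auto
  qed
  show "continuous_on UNIV (d2 j i)" unfolding d2_def[abs_def]
    by (intro continuous_at_imp_continuous_on ballI continuous_add T continuous_mult continuous_const isCont_o2[OF isCont_sq isCont_Y1]) simp
qed

lemma partial_phi: "partial_deriv i phi = d1 i" "partial_deriv j (d1 i) = d2 j i"
  by (rule has_partial_eq[OF hp_phi] has_partial_eq[OF hp_d1])+

lemma C2_phi: "C2 phi"
  unfolding C2_def partial_phi by (auto intro!: C1I hp_phi hp_d1 cont_phi)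

lemma phi_norm: "x \<noteq> 0 \<Longrightarrow> phi x = w (ln (norm x))" "phi 0 = a"
proof -
  show "x \<noteq> 0 \<Longrightarrow> phi x = w (ln (norm x))"
    by (simp add: phi_def Y_def power2_norm_eq_inner[symmetric] ln_realpow)
qed (simp add: phi_def Y_def)

lemma a_bounds: "0 < a" "a < ze"
  using profile_lim_bounds[OF prof lim] al_pos al_be by auto

lemma phi_bounds: "0 < phi x" "phi x < ze"
  using a_bounds profile_pos[OF prof] profile_lt_ze[OF prof] by (cases "x = 0"; simp add: phi_norm)+

lemma laplacian_phi: "laplacian phi x = - f (phi x)"
proof -
  have "laplacian phi x = Z (x \<bullet> x) * (4 * ((x $ 1 * x $ 1 + x $ 2 * x $ 2) / (x \<bullet> x))) + 4 * Y1 (x \<bullet> x)"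
    unfolding laplacian_def partial_phi by (simp add: sum_2 d2_def add_divide_distrib algebra_simps)
  also have "x $ 1 * x $ 1 + x $ 2 * x $ 2 = x \<bullet> x" by (simp add: inner_vec_def sum_2)
  also have "Z (x \<bullet> x) * (4 * (x \<bullet> x / (x \<bullet> x))) = 4 * Z (x \<bullet> x)" by (cases "x = 0") (simp_all add: Z_0)
  finally show ?thesis by (simp add: Z_def phi_def[of x])
qed

lemma phi_solution: "positive_radial_solution lam om phi"
proof -
  have "- (1 / 2) *\<^sub>R laplacian phi x + (lam * (norm (phi x))\<^sup>2 * ln ((norm (phi x))\<^sup>2)) *\<^sub>R phi x + om *\<^sub>R phi x = 0" for x
  proof -
    have l: "ln ((phi x)\<^sup>2) = 2 * ln (phi x)" using phi_bounds(1)[of x] by (simp add: ln_realpow)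
    show ?thesis unfolding laplacian_phi real_norm_def power2_abs l f_def
      by (simp add: power2_eq_square power3_eq_cube algebra_simps)
  qed
  then have s: "stationary_solution lam om phi" unfolding stationary_solution_def using C2_phi by blast
  have r: "radially_symmetric phi"
    unfolding radially_symmetric_def phi_def by (simp add: power2_norm_eq_inner[symmetric])
  obtain C \<delta> where C: "0 < \<delta>" "\<And>t. w t \<le> C * exp (- \<delta> * exp t)" using prof unfolding profile_def by blast
  have "norm (phi x) \<le> max C a * exp (- \<delta> * norm x)" for x
  proof (cases "x = 0")
    case True
    then show ?thesis using a_bounds by (simp add: phi_norm)
  next
    case False
    then have "norm (phi x) = w (ln (norm x))" using profile_pos[OF prof, of "ln (norm x)"] by (simp add: phi_norm)
    also have "\<dots> \<le> C * exp (- \<delta> * exp (ln (norm x)))" by (rule C(2))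
    also have "\<dots> \<le> max C a * exp (- \<delta> * exp (ln (norm x)))" by (intro mult_right_mono) auto
    finally show ?thesis using False by simp
  qed
  then have "exponentially_decaying phi" unfolding exponentially_decaying_def using C(1) by blast
  with s r phi_bounds(1) show ?thesis unfolding positive_radial_solution_def by blast
qed

lemma grad_phi: assumes "x \<noteq> 0" shows "grad_norm_sq phi x = (p (ln (norm x)))\<^sup>2 / (norm x)\<^sup>2"
proof -
  have n: "0 < norm x" using assms by simp
  have "grad_norm_sq phi x = (Y1 (x \<bullet> x))\<^sup>2 * (4 * (x $ 1 * x $ 1 + x $ 2 * x $ 2))"
    unfolding grad_norm_sq_def partial_phi by (simp add: sum_2 d1_def power2_eq_square algebra_simps)
  also have "x $ 1 * x $ 1 + x $ 2 * x $ 2 = (norm x)\<^sup>2" by (simp add: power2_norm_eq_inner inner_vec_def sum_2)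
  also have "Y1 (x \<bullet> x) = p (ln (norm x)) / (2 * (norm x)\<^sup>2)"
    using n unfolding power2_norm_eq_inner[symmetric] by (simp add: Y1_def ln_realpow)
  also have "(p (ln (norm x)) / (2 * (norm x)\<^sup>2))\<^sup>2 * (4 * (norm x)\<^sup>2) = (p (ln (norm x)))\<^sup>2 / (norm x)\<^sup>2"
    using n by (simp add: field_simps power2_eq_square)
  finally show ?thesis .
qed

lemma integral_grad_phi:
  assumes i: "integrable lborel (\<lambda>t. (p t)\<^sup>2)"
  shows "integrable lborel (grad_norm_sq phi)" "(LINT x|lborel. grad_norm_sq phi x) = 2 * pi * (LINT t|lborel. (p t)\<^sup>2)"
proof -
  have pc: "p \<in> borel_measurable borel"
    by (intro borel_measurable_continuous_onI continuous_at_imp_continuous_on ballI DERIV_isCont[OF DERIV_p[OF prof]])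
  note [measurable] = pc
  have g0: "0 \<le> grad_norm_sq phi x" for x unfolding grad_norm_sq_def by (intro sum_nonneg) auto
  have cg: "continuous_on UNIV (grad_norm_sq phi)" unfolding grad_norm_sq_def[abs_def] partial_phi by (intro continuous_intros cont_phi)
  note [measurable] = cont_borel[OF cg]
  have "(\<integral>\<^sup>+x. ennreal (grad_norm_sq phi x) \<partial>lborel) = (\<integral>\<^sup>+x. ennreal ((p (ln (norm (x :: real ^ 2))))\<^sup>2 / (norm x)\<^sup>2) \<partial>lborel)"
    using AE_lborel_singleton[of "0 :: real ^ 2"] by (intro nn_integral_cong_AE) (auto elim!: eventually_mono simp: grad_phi)
  also have "\<dots> = (\<integral>\<^sup>+t. ennreal ((p (ln (exp t)))\<^sup>2 / (exp t)\<^sup>2) * ennreal (2 * pi * exp (2 * t)) \<partial>lborel)"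
    by (rule nn_integral_radial) measurable
  also have "\<dots> = (\<integral>\<^sup>+t. ennreal (2 * pi * (p t)\<^sup>2) \<partial>lborel)"
    by (intro nn_integral_cong) (simp add: ennreal_mult[symmetric] exp_double)
  also have "\<dots> = ennreal (LINT t|lborel. 2 * pi * (p t)\<^sup>2)"
    using i by (intro nn_integral_eq_integral) auto
  also have "(LINT t|lborel. 2 * pi * (p t)\<^sup>2) = 2 * pi * (LINT t|lborel. (p t)\<^sup>2)" by simp
  finally have e: "(\<integral>\<^sup>+x. ennreal (grad_norm_sq phi x) \<partial>lborel) = ennreal (2 * pi * (LINT t|lborel. (p t)\<^sup>2))" .
  have "integrable lborel (grad_norm_sq phi) \<and> (LINT x|lborel. grad_norm_sq phi x) = 2 * pi * (LINT t|lborel. (p t)\<^sup>2)"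
    using g0 by (intro nn_integral_eq_integrable[THEN iffD1, OF _ _ _ e]) auto
  then show "integrable lborel (grad_norm_sq phi)" "(LINT x|lborel. grad_norm_sq phi x) = 2 * pi * (LINT t|lborel. (p t)\<^sup>2)" by auto
qed

text \<open>
  The exponential decay is compared with the integrable function \<open>1 / (norm x ^ 2 + 1)\<^sup>2\<close>.
\<close>
lemma finite_H1_phi:
  assumes i: "integrable lborel (\<lambda>t. (p t)\<^sup>2)" shows "finite_H1 (\<lambda>x. complex_of_real (phi x))"
proof -
  obtain C \<delta> where C: "0 < \<delta>" "\<And>x. norm (phi x) \<le> C * exp (- \<delta> * norm x)"
    using phi_solution unfolding positive_radial_solution_def exponentially_decaying_def by blast
  \<comment> \<open>Then \<open>k * (1 + r) \<le> exp (\<delta> / 2 * r)\<close>, whose fourth power gives the comparison.\<close>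
  define k where "k = min 1 (\<delta> / 2)"
  have k: "0 < k" "k \<le> 1" "k \<le> \<delta> / 2" using C(1) by (auto simp: k_def)
  have dec: "exp (- \<delta> * r) ^ 2 \<le> (1 / k ^ 4) * (1 / (r\<^sup>2 + 1)\<^sup>2)" if r: "0 \<le> r" for r
  proof -
    have "k * (1 + r) \<le> 1 + \<delta> / 2 * r" using k r mult_right_mono[OF k(3) r] by (simp add: distrib_left)
    also have "\<dots> \<le> exp (\<delta> / 2 * r)" by (rule exp_ge_add_one_self)
    finally have "(k * (1 + r)) ^ 4 \<le> exp (\<delta> / 2 * r) ^ 4" using k r by (intro power_mono) auto
    also have "exp (\<delta> / 2 * r) ^ 4 = exp (2 * (\<delta> * r))" by (simp add: exp_of_nat_mult[symmetric])
    finally have 1: "k ^ 4 * (1 + r) ^ 4 \<le> exp (2 * (\<delta> * r))" by (simp add: power_mult_distrib)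
    have "(r\<^sup>2 + 1)\<^sup>2 \<le> ((1 + r)\<^sup>2)\<^sup>2" using r by (intro power_mono) (auto simp: power2_eq_square algebra_simps)
    also have "\<dots> = (1 + r) ^ 4" by (simp add: power_mult[symmetric])
    finally have "k ^ 4 * (r\<^sup>2 + 1)\<^sup>2 \<le> k ^ 4 * (1 + r) ^ 4" by (intro mult_left_mono) (use k in auto)
    with 1 have le: "k ^ 4 * (r\<^sup>2 + 1)\<^sup>2 \<le> exp (2 * (\<delta> * r))" by linarith
    have pos: "0 < k ^ 4 * (r\<^sup>2 + 1)\<^sup>2" using k by (intro mult_pos_pos zero_less_power) (auto simp: add_nonneg_pos)
    have "exp (- \<delta> * r) ^ 2 = 1 / exp (2 * (\<delta> * r))" by (simp add: exp_double power_divide exp_minus inverse_eq_divide)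
    also have "\<dots> \<le> 1 / (k ^ 4 * (r\<^sup>2 + 1)\<^sup>2)" using le pos by (intro divide_left_mono mult_pos_pos) auto
    finally show ?thesis by simp
  qed
  have im: "integrable lborel (\<lambda>z :: real ^ 2. 2 / ((norm z)\<^sup>2 + 1)\<^sup>2)"
  proof (rule integrableI_bounded)
    have "(\<integral>\<^sup>+z. ennreal (norm (2 / ((norm (z :: real ^ 2))\<^sup>2 + 1)\<^sup>2)) \<partial>lborel) = ennreal (2 * pi)" using nn_mass_kernel by simp
    then show "(\<integral>\<^sup>+z. ennreal (norm (2 / ((norm (z :: real ^ 2))\<^sup>2 + 1)\<^sup>2)) \<partial>lborel) < \<infinity>" by simp
  qed measurable
  have "integrable lborel (\<lambda>x. (phi x)\<^sup>2)"
  proof (rule Bochner_Integration.integrable_bound)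
    show "integrable lborel (\<lambda>z :: real ^ 2. (C\<^sup>2 / (2 * k ^ 4)) * (2 / ((norm z)\<^sup>2 + 1)\<^sup>2))" using im by (rule integrable_mult_right)
    show "(\<lambda>x. (phi x)\<^sup>2) \<in> borel_measurable lborel" using cont_borel[OF cont_phi(1)] by simp
    show "AE x in lborel. norm ((phi x)\<^sup>2) \<le> norm ((C\<^sup>2 / (2 * k ^ 4)) * (2 / ((norm x)\<^sup>2 + 1)\<^sup>2))"
    proof (rule AE_I2)
      fix x :: "real ^ 2"
      have "norm (phi x) ^ 2 \<le> (C * exp (- \<delta> * norm x)) ^ 2" using C(2)[of x] by (intro power_mono) auto
      also have "\<dots> = C\<^sup>2 * exp (- \<delta> * norm x) ^ 2" by (rule power_mult_distrib)
      also have "\<dots> \<le> C\<^sup>2 * ((1 / k ^ 4) * (1 / ((norm x)\<^sup>2 + 1)\<^sup>2))" by (intro mult_left_mono dec) auto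
      also have "\<dots> = (C\<^sup>2 / (2 * k ^ 4)) * (2 / ((norm x)\<^sup>2 + 1)\<^sup>2)" by simp
      finally show "norm ((phi x)\<^sup>2) \<le> norm ((C\<^sup>2 / (2 * k ^ 4)) * (2 / ((norm x)\<^sup>2 + 1)\<^sup>2))" by simp
    qed
  qed
  then show ?thesis unfolding finite_H1_def grad_norm_sq_of_real[OF C2_phi] using integral_grad_phi(1)[OF i] by simp
qed

end

text \<open>
  Along the first axis the second partial derivative in the orthogonal direction is \<open>V' r / r\<close> by symmetry, so the
  equation reads \<open>V'' + V' / r + f V = 0\<close>; regularity at the origin and the decay are inherited.
\<close>
lemma radial_solution_profile:
  assumes "positive_radial_solution lam om \<psi>"
  shows "\<exists>p. profile (\<lambda>t. \<psi> (exp t *\<^sub>R axis 1 1)) p"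
proof -
  have st: "stationary_solution lam om \<psi>" and pos: "\<And>x. 0 < \<psi> x" and rad: "\<And>x y. norm x = norm y \<Longrightarrow> \<psi> x = \<psi> y"
    and dec: "exponentially_decaying \<psi>"
    using assms unfolding positive_radial_solution_def radially_symmetric_def by blast+
  let ?e = "\<lambda>r :: real. r *\<^sub>R axis (1 :: 2) 1 :: real ^ 2"
  let ?d = "\<lambda>i. partial_deriv i \<psi>" let ?dd = "\<lambda>i. partial_deriv i (partial_deriv i \<psi>)"
  have C: "C1 \<psi>" "\<And>i. C1 (?d i)" using st unfolding stationary_solution_def C2_def by auto
  have hp: "has_partial i \<psi> (?d i)" "has_partial i (?d i) (?dd i)" for i by (rule C1_has_partial C)+
  define V where "V r = \<psi> (?e r)" for r
  define V1 where "V1 r = ?d 1 (?e r)" for r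
  have dV: "(V has_real_derivative V1 r) (at r)" for r
    using has_partial_line[OF hp(1)[of 1], of 0 r] unfolding V_def[abs_def] V1_def by (simp add: has_real_derivative_iff_has_vector_derivative)
  have dV1: "(V1 has_real_derivative ?dd 1 (?e r)) (at r)" for r
    using has_partial_line[OF hp(2)[of 1], of 0 r] unfolding V1_def[abs_def] by (simp add: has_real_derivative_iff_has_vector_derivative)
  have d22: "?dd 2 (?e r) = V1 r / r" if r: "r > 0" for r
  proof -
    let ?q = "\<lambda>t :: real. sqrt (r\<^sup>2 + t\<^sup>2)"
    have q0: "0 < r\<^sup>2 + t\<^sup>2" for t :: real using r by (simp add: add_pos_nonneg)
    have dq: "(?q has_real_derivative t / ?q t) (at t)" for t
    proof -
      have "((\<lambda>t. r\<^sup>2 + t\<^sup>2) has_real_derivative 2 * t) (at t)" by (auto intro!: derivative_eq_intros)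
      from DERIV_chain2[OF DERIV_real_sqrt[OF q0] this] show ?thesis by (rule DERIV_cong) (simp add: inverse_eq_divide)
    qed
    have eq: "\<psi> (?e r + t *\<^sub>R axis 2 1) = V (?q t)" for t
    proof -
      have "(norm (?e r + t *\<^sub>R axis 2 1))\<^sup>2 = r\<^sup>2 + t\<^sup>2"
        unfolding power2_norm_eq_inner by (simp add: inner_vec_def sum_2 axis_def power2_eq_square)
      then have "norm (?e r + t *\<^sub>R axis 2 1) = ?q t" using real_sqrt_unique[of "norm (?e r + t *\<^sub>R axis 2 1)"] by simp
      moreover have "norm (?e (?q t)) = ?q t" using q0[of t] by (simp add: norm_axis_1)
      ultimately show ?thesis unfolding V_def by (intro rad) simp
    qed
    have d2: "?d 2 (?e r + t *\<^sub>R axis 2 1) = t * (V1 (?q t) / ?q t)" for t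
    proof -
      have "((\<lambda>t. \<psi> (?e r + t *\<^sub>R axis 2 1)) has_real_derivative ?d 2 (?e r + t *\<^sub>R axis 2 1)) (at t)"
        using has_partial_line[OF hp(1)[of 2], of "?e r" t] by (simp add: has_real_derivative_iff_has_vector_derivative)
      then have "((\<lambda>t. V (?q t)) has_real_derivative ?d 2 (?e r + t *\<^sub>R axis 2 1)) (at t)" unfolding eq .
      from DERIV_unique[OF this DERIV_chain2[OF dV dq]] show ?thesis by simp
    qed
    have "((\<lambda>t. t * (V1 (?q t) / ?q t)) has_real_derivative V1 (?q 0) / ?q 0) (at 0)"
    proof (rule DERIV_ident_mult_at_0)
      have "isCont (\<lambda>t. V1 (?q t)) 0" by (rule isCont_o2[OF DERIV_isCont[OF dq] DERIV_isCont[OF dV1]])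
      then show "isCont (\<lambda>t. V1 (?q t) / ?q t) 0" using r by (intro continuous_divide DERIV_isCont[OF dq]) auto
    qed
    moreover have "((\<lambda>t. t * (V1 (?q t) / ?q t)) has_real_derivative ?dd 2 (?e r)) (at 0)"
      using has_partialD[OF hp(2)[of 2], of "?e r"] unfolding d2 by (simp add: has_real_derivative_iff_has_vector_derivative)
    ultimately have "?dd 2 (?e r) = V1 (?q 0) / ?q 0" by (rule DERIV_unique[rotated])
    then show ?thesis using r by simp
  qed
  have ode: "?dd 1 (?e r) = - f (V r) - V1 r / r" if r: "r > 0" for r
  proof -
    have "- (1 / 2) *\<^sub>R laplacian \<psi> (?e r) + (lam * (norm (V r))\<^sup>2 * ln ((norm (V r))\<^sup>2)) *\<^sub>R V r + om *\<^sub>R V r = 0"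
      using st unfolding stationary_solution_def V_def by blast
    moreover have "laplacian \<psi> (?e r) = ?dd 1 (?e r) + V1 r / r" unfolding laplacian_def by (simp add: sum_2 d22[OF r])
    moreover have "ln ((V r)\<^sup>2) = 2 * ln (V r)" using pos[of "?e r"] by (simp add: V_def ln_realpow)
    ultimately show ?thesis by (simp add: f_def power2_eq_square power3_eq_cube algebra_simps)
  qed
  define p where "p t = exp t * V1 (exp t)" for t
  have "profile (\<lambda>t. V (exp t)) p"
    unfolding profile_def radial_ode_def
  proof (intro conjI allI)
    fix t
    show "((\<lambda>t. V (exp t)) has_real_derivative p t) (at t)"
      using DERIV_chain2[OF dV DERIV_exp, of t] by (simp add: p_def mult.commute)
    have "((\<lambda>t. exp t * V1 (exp t)) has_real_derivative exp t * V1 (exp t) + (?dd 1 (?e (exp t)) * exp t) * exp t) (at t)"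
      by (intro DERIV_mult DERIV_exp DERIV_chain2[OF dV1 DERIV_exp])
    moreover have "exp t * V1 (exp t) + (?dd 1 (?e (exp t)) * exp t) * exp t = - exp (2 * t) * f (V (exp t))"
      unfolding ode[OF exp_gt_zero] exp_double by (simp add: power2_eq_square algebra_simps)
    ultimately show "(p has_real_derivative - exp (2 * t) * f (V (exp t))) (at t)" unfolding p_def[abs_def] by (simp only:)
    show "0 < V (exp t)" unfolding V_def by (rule pos)
  next
    have e: "((\<lambda>t::real. exp t) \<longlongrightarrow> 0) at_bot" by (rule exp_at_bot)
    show "\<exists>a. ((\<lambda>t. V (exp t)) \<longlongrightarrow> a) at_bot" using isCont_tendsto_compose[OF DERIV_isCont[OF dV] e] by blast
    have "((\<lambda>t. exp t * V1 (exp t)) \<longlongrightarrow> 0 * V1 0) at_bot"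
      by (intro tendsto_mult e isCont_tendsto_compose[OF DERIV_isCont[OF dV1] e])
    then show "(p \<longlongrightarrow> 0) at_bot" unfolding p_def[abs_def] by simp
    obtain C \<delta> where C: "0 < \<delta>" "\<And>x. norm (\<psi> x) \<le> C * exp (- \<delta> * norm x)" using dec unfolding exponentially_decaying_def by blast
    have "V (exp t) \<le> C * exp (- \<delta> * exp t)" for t
      using C(2)[of "?e (exp t)"] by (simp add: V_def norm_axis_1)
    then show "\<exists>C \<delta>. 0 < \<delta> \<and> (\<forall>t. V (exp t) \<le> C * exp (- \<delta> * exp t))" using C(1) by blast
  qed
  then show ?thesis unfolding V_def by blast
qed

theorem positive_radial_solution_unique:
  assumes 1: "positive_radial_solution lam om \<psi>1" and 2: "positive_radial_solution lam om \<psi>2"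
  shows "\<psi>1 = \<psi>2"
proof
  fix x :: "real ^ 2"
  obtain p1 p2 where "profile (\<lambda>t. \<psi>1 (exp t *\<^sub>R axis 1 1)) p1" "profile (\<lambda>t. \<psi>2 (exp t *\<^sub>R axis 1 1)) p2"
    using radial_solution_profile[OF 1] radial_solution_profile[OF 2] by blast
  then have "(\<lambda>t. \<psi>1 (exp t *\<^sub>R axis 1 1)) = (\<lambda>t. \<psi>2 (exp t *\<^sub>R axis 1 1))" by (rule profile_unique)
  from fun_cong[OF this] have eq: "\<psi>1 (exp t *\<^sub>R axis 1 1) = \<psi>2 (exp t *\<^sub>R axis 1 1)" for t .
  show "\<psi>1 x = \<psi>2 x"
  proof (cases "x = 0")
    case False
    then have n: "norm x = norm (exp (ln (norm x)) *\<^sub>R axis (1 :: 2) 1 :: real ^ 2)" by (simp add: norm_axis_1)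
    have "\<psi>1 x = \<psi>1 (exp (ln (norm x)) *\<^sub>R axis 1 1)" "\<psi>2 x = \<psi>2 (exp (ln (norm x)) *\<^sub>R axis 1 1)"
      using 1 2 n unfolding positive_radial_solution_def radially_symmetric_def by blast+
    then show ?thesis unfolding eq by simp
  next
    case True
    have lim: "((\<lambda>t. \<psi> (exp t *\<^sub>R axis 1 1)) \<longlongrightarrow> \<psi> (0 *\<^sub>R axis 1 1)) at_bot" if "positive_radial_solution lam om \<psi>" for \<psi>
    proof (rule isCont_tendsto_compose[of _ \<psi>])
      have "continuous_on UNIV \<psi>" using that unfolding positive_radial_solution_def stationary_solution_def C2_def C1_def by blast
      then show "isCont \<psi> (0 *\<^sub>R axis 1 1)" by (simp add: continuous_on_eq_continuous_at)
      show "((\<lambda>t. exp t *\<^sub>R axis 1 1 :: real ^ 2) \<longlongrightarrow> 0 *\<^sub>R axis 1 1) at_bot"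
        by (intro tendsto_scaleR exp_at_bot tendsto_const)
    qed
    have "\<psi>1 (0 *\<^sub>R axis 1 1) = \<psi>2 (0 *\<^sub>R axis 1 1)"
      using tendsto_unique[OF _ lim[OF 1, unfolded eq] lim[OF 2]] by simp
    then show ?thesis using True by simp
  qed
qed

end

section \<open>Ground states\<close>

context nls
begin

context
  fixes \<psi> :: "real ^ 2 \<Rightarrow> complex"
  assumes sol: "stationary_solution lam om \<psi>" and H1: "finite_H1 \<psi>"
begin

text \<open>
  The potential part of the action is minus the integral of \<open>G (norm \<psi>)\<close> by \<open>G_eq_ln_sqrt\<close>, which vanishes by
  \<open>pohozaev\<close>.
\<close>
lemma action_eq: "action lam om \<psi> = (LINT x|lborel. grad_norm_sq \<psi> x) / 2"
proof -
  let ?q = "\<lambda>x. (norm (\<psi> x)) ^ 4 * ln ((norm (\<psi> x))\<^sup>2 / sqrt (exp 1))"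
  have q: "?q x = (rho \<psi> x)\<^sup>2 * ln (rho \<psi> x) - (rho \<psi> x)\<^sup>2 / 2" for x
  proof (cases "\<psi> x = 0")
    case False
    have "ln (sqrt (exp 1)) = (1/2::real)" by (simp add: ln_sqrt)
    then have L: "ln ((norm (\<psi> x))\<^sup>2 / sqrt (exp 1)) = ln ((norm (\<psi> x))\<^sup>2) - 1/2" using False by (simp add: ln_div)
    show ?thesis unfolding rho_norm[OF sol H1] L by (simp add: right_diff_distrib flip: power_mult)
  qed (simp add: rho_norm[OF sol H1])
  have iq: "integrable lborel ?q" unfolding q using nehari_integrable[OF sol H1] by auto
  have im: "integrable lborel (\<lambda>x. (norm (\<psi> x))\<^sup>2)" using H1 unfolding finite_H1_def by blast
  have "0 = (LINT x|lborel. G (norm (\<psi> x)))" using pohozaev[OF sol H1] by simp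
  also have "\<dots> = (LINT x|lborel. - (lam / 2) * ?q x - om * (norm (\<psi> x))\<^sup>2)" unfolding G_eq_ln_sqrt ..
  also have "\<dots> = (LINT x|lborel. - (lam / 2) * ?q x) - (LINT x|lborel. om * (norm (\<psi> x))\<^sup>2)"
    using iq im by (intro Bochner_Integration.integral_diff integrable_mult_right)
  also have "\<dots> = - (lam / 2) * (LINT x|lborel. ?q x) - om * mass \<psi>" unfolding mass_def by simp
  finally show ?thesis unfolding action_def energy_def by simp
qed

text \<open>
  If the rearrangement did not exceed \<open>b\<close>, then \<open>norm \<psi> \<le> b\<close> everywhere, so \<open>G (norm \<psi>) \<le> - (om / 2) * norm \<psi> ^ 2\<close>;
  as the integral of \<open>G (norm \<psi>)\<close> is zero, \<open>\<psi>\<close> would vanish.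
\<close>
lemma rearranged_energy:
  assumes nz: "\<exists>x. \<psi> x \<noteq> 0" and b: "0 < b" "\<And>s. 0 \<le> s \<Longrightarrow> s \<le> b \<Longrightarrow> G s \<le> - (om / 2) * s\<^sup>2"
  obtains v where "\<And>t. 0 \<le> v t" "(v \<longlongrightarrow> 0) at_top" "\<exists>t. b < v t" "integrable lborel (\<lambda>t. exp (2 * t) * G (v t))"
    "(LINT t|lborel. exp (2 * t) * G (v t)) = 0" "fin_en v ((LINT x|lborel. grad_norm_sq \<psi> x) / (2 * pi))"
proof -
  note hp_rho = hp_rho[OF sol H1] and cont_rho = cont_rho[OF sol H1] and cont_psi = cont_psi[OF sol H1]
    and rho_norm = rho_norm[OF sol H1] and rho_nonneg = rho_nonneg[OF sol H1]
  let ?d = "\<lambda>i. partial_deriv i \<psi>"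
  have le: "(2 * (\<psi> x \<bullet> ?d 1 x))\<^sup>2 + (2 * (\<psi> x \<bullet> ?d 2 x))\<^sup>2 \<le> 4 * (rho \<psi> x * grad_norm_sq \<psi> x)" for x
  proof -
    have cs: "(\<psi> x \<bullet> y)\<^sup>2 \<le> rho \<psi> x * (norm y)\<^sup>2" for y
      unfolding rho_norm power2_norm_eq_inner by (rule Cauchy_Schwarz_ineq)
    have "(2 * (\<psi> x \<bullet> ?d 1 x))\<^sup>2 + (2 * (\<psi> x \<bullet> ?d 2 x))\<^sup>2 = 4 * ((\<psi> x \<bullet> ?d 1 x)\<^sup>2 + (\<psi> x \<bullet> ?d 2 x)\<^sup>2)"
      by (simp add: power_mult_distrib)
    also have "\<dots> \<le> 4 * (rho \<psi> x * (norm (?d 1 x))\<^sup>2 + rho \<psi> x * (norm (?d 2 x))\<^sup>2)"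
      using cs[of "?d 1 x"] cs[of "?d 2 x"] by simp
    also have "\<dots> = 4 * (rho \<psi> x * grad_norm_sq \<psi> x)" unfolding grad_norm_sq_def by (simp add: sum_2 distrib_left)
    finally show ?thesis .
  qed
  interpret R: finite_energy_density "rho \<psi>" "\<lambda>i x. 2 * (\<psi> x \<bullet> ?d i x)" "grad_norm_sq \<psi>"
  proof
    show "0 \<le> grad_norm_sq \<psi> x" for x unfolding grad_norm_sq_def by (intro sum_nonneg) simp
    show "continuous_on UNIV (\<lambda>x. 2 * (\<psi> x \<bullet> ?d i x))" for i by (intro continuous_intros cont_psi)
  qed (rule cont_rho rho_nonneg hp_rho int_rho[OF sol H1] int_grad[OF sol H1] le)+
  have u: "R.u x = norm (\<psi> x)" for x unfolding R.u_def rho_norm by simp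
  have Gm: "G \<in> borel_measurable borel" by (rule cont_borel[OF continuous_on_G])
  have iG: "integrable lborel (\<lambda>x. G (R.u x))" unfolding u using int_G[OF sol H1] unfolding G_rho[OF sol H1] .
  have zero: "(LINT x|lborel. G (R.u x)) = 0" unfolding u by (rule pohozaev[OF sol H1])
  have "\<exists>t. b < R.v t"
  proof (rule ccontr)
    assume "\<not> ?thesis"
    then have "R.v t \<le> b" for t by (simp add: not_less)
    then have ub: "R.u x \<le> b" for x by (rule R.v_bounded_imp_u_bounded[OF b(1)])
    have Gle: "G (R.u x) \<le> - (om / 2) * rho \<psi> x" for x
      using b(2)[OF R.u0 ub, of x] unfolding R.u_sq .
    have "(LINT x|lborel. G (R.u x)) \<le> (LINT x|lborel. - (om / 2) * rho \<psi> x)"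
      by (intro integral_mono iG integrable_mult_right int_rho[OF sol H1] Gle)
    then have "(om / 2) * (LINT x|lborel. rho \<psi> x) \<le> 0" unfolding zero by simp
    then have "(LINT x|lborel. rho \<psi> x) \<le> 0" using om_pos by (simp add: mult_le_0_iff)
    moreover have "0 \<le> (LINT x|lborel. rho \<psi> x)" using rho_nonneg by (intro integral_nonneg_AE) simp
    ultimately have "(LINT x|lborel. rho \<psi> x) = 0" by simp
    then have ae: "AE x in lborel. rho \<psi> x = 0"
      using integral_nonneg_eq_0_iff_AE[OF int_rho[OF sol H1]] rho_nonneg by simp
    note [measurable] = cont_borel[OF cont_rho]
    have "{x \<in> space lborel. \<not> rho \<psi> x = 0} \<in> sets lborel" by measurable
    from AE_iff_null[OF this] have "{x. rho \<psi> x \<noteq> 0} \<in> null_sets lborel" using ae by simp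
    then have "negligible {x. rho \<psi> x \<noteq> 0}" unfolding negligible_iff_null_sets by (rule null_sets_completionI)
    moreover have "open {x. rho \<psi> x \<noteq> 0}" using cont_rho by (intro open_Collect_neq continuous_intros)
    ultimately have "{x. rho \<psi> x \<noteq> 0} = {}" using open_not_negligible by blast
    then show False using nz unfolding rho_norm by auto
  qed
  moreover have "integrable lborel (\<lambda>t. exp (2 * t) * G (R.v t))" by (rule R.equimeasurable(1)[OF Gm G_0 iG])
  moreover have "(LINT t|lborel. exp (2 * t) * G (R.v t)) = 0" using R.equimeasurable(2)[OF Gm G_0 iG] zero by simp
  ultimately show thesis using that[OF R.v0 R.v_tendsto] R.fin_en_v by blast
qed

end

end

context nls_signs
begin

text \<open>
  The action of the solution built from the minimal profile is at most \<open>pi * m\<close>, and that of any competitor is at least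
  \<open>pi * m\<close>.
\<close>
theorem ground_state_exists:
  obtains \<phi> :: "real ^ 2 \<Rightarrow> real" where "positive_radial_solution lam om \<phi>" "\<And>x. 0 < \<phi> x" "\<And>x. \<phi> x < ze"
    "ground_state lam om (\<lambda>x. complex_of_real (\<phi> x))"
proof -
  obtain W P m b where prof: "profile W P" and iP: "integrable lborel (\<lambda>t. (P t)\<^sup>2)" and Pm: "(LINT t|lborel. (P t)\<^sup>2) \<le> m"
    and b: "0 < b" "\<And>s. 0 \<le> s \<Longrightarrow> s \<le> b \<Longrightarrow> G s \<le> - (om / 2) * s\<^sup>2"
    and min: "\<And>v M. (\<And>t. 0 \<le> v t) \<Longrightarrow> (v \<longlongrightarrow> 0) at_top \<Longrightarrow> (\<exists>t. b < v t) \<Longrightarrow>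
      integrable lborel (\<lambda>t. exp (2 * t) * G (v t)) \<Longrightarrow> 0 \<le> (LINT t|lborel. exp (2 * t) * G (v t)) \<Longrightarrow>
      fin_en v M \<Longrightarrow> m \<le> M"
    by (rule profile_exists) blast
  obtain a where lim: "(W \<longlongrightarrow> a) at_bot" using prof unfolding profile_def by blast
  define \<phi> where "\<phi> = phi W a"
  let ?\<Phi> = "\<lambda>x. complex_of_real (\<phi> x)"
  have phi: "positive_radial_solution lam om \<phi>" unfolding \<phi>_def by (rule phi_solution[OF prof lim])
  have bounds: "0 < \<phi> x" "\<phi> x < ze" for x unfolding \<phi>_def by (rule phi_bounds[OF prof lim])+
  have st: "stationary_solution lam om \<phi>" and C2: "C2 \<phi>"
    using phi unfolding positive_radial_solution_def stationary_solution_def by auto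
  have st': "stationary_solution lam om ?\<Phi>" by (rule stationary_of_real[OF C2 st])
  have H1: "finite_H1 ?\<Phi>" unfolding \<phi>_def by (rule finite_H1_phi[OF prof lim iP])
  have nt: "nontrivial_solution lam om ?\<Phi>"
    unfolding nontrivial_solution_def using st' H1 bounds(1)[of 0] by (auto intro!: exI[of _ 0])
  have act: "action lam om ?\<Phi> \<le> pi * m"
  proof -
    have "action lam om ?\<Phi> = (LINT x|lborel. grad_norm_sq \<phi> x) / 2"
      unfolding action_eq[OF st' H1] grad_norm_sq_of_real[OF C2] ..
    also have "\<dots> = pi * (LINT t|lborel. (P t)\<^sup>2)" unfolding \<phi>_def integral_grad_phi(2)[OF prof lim iP] by simp
    also have "\<dots> \<le> pi * m" using Pm by (intro mult_left_mono) auto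
    finally show ?thesis .
  qed
  have "action lam om ?\<Phi> \<le> action lam om \<psi>" if "nontrivial_solution lam om \<psi>" for \<psi>
  proof -
    have s: "stationary_solution lam om \<psi>" and h: "finite_H1 \<psi>" and nz: "\<exists>x. \<psi> x \<noteq> 0"
      using that unfolding nontrivial_solution_def by auto
    obtain v where v: "\<And>t. 0 \<le> v t" "(v \<longlongrightarrow> 0) at_top" "\<exists>t. b < v t" "integrable lborel (\<lambda>t. exp (2 * t) * G (v t))"
      "(LINT t|lborel. exp (2 * t) * G (v t)) = 0" "fin_en v ((LINT x|lborel. grad_norm_sq \<psi> x) / (2 * pi))"
      by (rule rearranged_energy[OF s h nz b]) blast+
    have "m \<le> (LINT x|lborel. grad_norm_sq \<psi> x) / (2 * pi)"
      by (rule min[OF v(1-4) _ v(6)]) (simp add: v(5))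
    then have "pi * m \<le> (LINT x|lborel. grad_norm_sq \<psi> x) / 2" by (simp add: field_simps)
    then show ?thesis using act unfolding action_eq[OF s h] by linarith
  qed
  then have "ground_state lam om ?\<Phi>" unfolding ground_state_def using nt by blast
  then show thesis using that[OF phi bounds] by blast
qed

end

theorem theorem1p3:
  fixes lam :: real
  assumes "0 < lam"
  shows "\<exists>z :: real \<Rightarrow> real.
    (\<forall>\<omega>. 0 < \<omega> \<and> \<omega> < lam / (2 * sqrt (exp 1)) \<longrightarrow>
       is_z_param lam \<omega> (z \<omega>) \<and> (\<forall>s. is_z_param lam \<omega> s \<longrightarrow> s = z \<omega>) \<and>
       (\<exists>\<phi> :: real ^ 2 \<Rightarrow> real.
          positive_radial_solution lam \<omega> \<phi> \<and>
          (\<forall>\<psi>. positive_radial_solution lam \<omega> \<psi> \<longrightarrow> \<psi> = \<phi>) \<and>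
          ground_state lam \<omega> (\<lambda>x. complex_of_real (\<phi> x)) \<and>
          (\<forall>x. 0 < \<phi> x \<and> \<phi> x < sqrt (z \<omega>)))) \<and>
    (z \<longlongrightarrow> 1) (at_right 0)"
proof -
  define z where "z \<omega> = (SOME s. is_z_param lam \<omega> s)" for \<omega>
  have z: "is_z_param lam \<omega> (z \<omega>)" if "0 < \<omega>" "\<omega> < lam / (2 * sqrt (exp 1))" for \<omega>
    unfolding z_def by (rule someI_ex[OF z_param_exists[OF assms that]])
  show ?thesis
  proof (intro exI[of _ z] conjI allI impI; (elim conjE)?)
    show "(z \<longlongrightarrow> 1) (at_right 0)" by (rule z_param_tendsto_1[OF assms z])
  next
    fix \<omega> assume om: "0 < \<omega>" "\<omega> < lam / (2 * sqrt (exp 1))"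
    show "is_z_param lam \<omega> (z \<omega>)" by (rule z[OF om])
    show "s = z \<omega>" if "is_z_param lam \<omega> s" for s by (rule z_param_unique[OF assms that z[OF om]])
    interpret nls lam \<omega> by unfold_locales (use assms om in auto)
    obtain al be ze where s: "0 < al" "al < be" "be < ze" "is_z_param lam \<omega> (ze\<^sup>2)"
      "\<And>s. 0 < s \<Longrightarrow> s < al \<Longrightarrow> f s < 0" "f al = 0" "\<And>s. al < s \<Longrightarrow> s < ze \<Longrightarrow> 0 < f s" "f ze = 0"
      "\<And>s. ze < s \<Longrightarrow> f s < 0" "\<And>s. 0 < s \<Longrightarrow> s < be \<Longrightarrow> G s < 0" "G be = 0"
      "\<And>s. be < s \<Longrightarrow> s \<le> ze \<Longrightarrow> 0 < G s"
      by (rule sign_structure) blast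
    interpret nls_signs lam \<omega> al be ze by unfold_locales (fact s)+
    have "ze\<^sup>2 = z \<omega>" by (rule z_param_unique[OF assms s(4) z[OF om]])
    then have ze: "sqrt (z \<omega>) = ze" using s(1-3) by (simp add: real_sqrt_unique)
    obtain \<phi> :: "real ^ 2 \<Rightarrow> real" where phi: "positive_radial_solution lam \<omega> \<phi>" "\<And>x. 0 < \<phi> x" "\<And>x. \<phi> x < ze"
      "ground_state lam \<omega> (\<lambda>x. complex_of_real (\<phi> x))"
      by (rule ground_state_exists) blast
    show "\<exists>\<phi> :: real ^ 2 \<Rightarrow> real. positive_radial_solution lam \<omega> \<phi> \<and>
          (\<forall>\<psi>. positive_radial_solution lam \<omega> \<psi> \<longrightarrow> \<psi> = \<phi>) \<and>
          ground_state lam \<omega> (\<lambda>x. complex_of_real (\<phi> x)) \<and> (\<forall>x. 0 < \<phi> x \<and> \<phi> x < sqrt (z \<omega>))"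
      unfolding ze using phi positive_radial_solution_unique[OF _ phi(1)] by blast
  qed
qed

end
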